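(* For each $n\ge1$ let $\beta=\beta_n>0$, $p_1=p_1(n)\ge n$, $p_2=p_2(n)\ge n$, put $\beta'=\beta/2$, and let $\mu_n$ be the (random) spectral measure of the rescaled tridiagonal random matrix $\widetilde{\mathcal J}_n$ of the $\beta$-Jacobi ensemble (defined in the context). Suppose that $$\lim_{n\to\infty}\frac{n}{p_1}=\gamma\in[0,1],\qquad \lim_{n\to\infty}\frac{p_1}{p_2}=\sigma\in[0,\gamma^{-1}),\qquad \lim_{n\to\infty}\beta n=+\infty$$ (with $\gamma^{-1}=+\infty$ when $\gamma=0$). Then $\mu_n$ satisfies in $\mathcal M^1_{m,d}\big(\big[-\frac{1}{\sqrt\gamma},\frac{1}{\sqrt\gamma\,\sigma}\big]\big)$ a large deviation principle with speed $\beta' n$ and good rate function $I_{\gamma,\sigma}$ (defined in the context). The unique minimizer of $I_{\gamma,\sigma}$ is the probability measure $\tilde\nu_{\gamma,\sigma}$ with density $\tilde h_{\gamma,\sigma}$ (defined in the context).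
   Context: Matrix model: let $c_1,\dots,c_n,s_1,\dots,s_{n-1}$ be independent with $$c_k\sim\operatorname{Beta}\big(\beta'(p_1-k+1),\beta'(p_2-k+1)\big)\ (1\le k\le n),\quad s_k\sim\operatorname{Beta}\big(\beta'(n-k),\beta'(p_1+p_2-n-k+1)\big)\ (1\le k\le n-1),$$ and $c_0=s_0=0$. Let $\mathcal J_n$ be the symmetric tridiagonal $n\times n$ matrix with diagonal entries $s_{k-1}(1-c_{k-1})+c_k(1-s_{k-1})$ ($1\le k\le n$) and off-diagonal entries $\sqrt{c_k(1-c_k)s_k(1-s_{k-1})}$ ($1\le k\le n-1$), and $\widetilde{\mathcal J}_n=\frac{(p_1+p_2)\mathcal J_n-p_1\mathbf I_n}{\sqrt{np_1}}$. Spectral measure: the spectral measure of a finite symmetric tridiagonal real matrix $J$ with positive off-diagonal entries is the unique probability measure $\mu$ on $\mathbb R$ with $\langle\mu,x^k\rangle:=\int x^k\,d\mu=J^k(1,1)$ for all $k\in\mathbb N$. Space: for $I\subset\mathbb R$, $\mathcal M^1_{m,d}(I)$ is the set of probability measures on $I$ with all moments finite and which are uniquely determined by their moments, with the distance of convergence of moments $$d(\mu,\nu)=\sum_{k\ge1}2^{-k}\frac{|\langle\mu,x^k\rangle-\langle\nu,x^k\rangle|}{1+|\langle\mu,x^k\rangle-\langle\nu,x^k\rangle|}.$$ If $\gamma=0$ or $\gamma\sigma=0$, the quantity $\frac1{\sqrt\gamma}$, respectively $\frac1{\sqrt\gamma\sigma}$, is replaced by $+\infty$ (so the interval is $\mathbb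 R$ when $\gamma=0$ and $[-1/\sqrt\gamma,\infty)$ when $\sigma=0<\gamma$). Large deviation principle (LDP) with speed $a_n$ and rate function $\mathcal I$ (lower semicontinuous, values in $[0,\infty]$) for the laws $P_n$: $\limsup \frac1{a_n}\log P_n(F)\le-\inf_F\mathcal I$ for closed $F$ and $\liminf\frac1{a_n}\log P_n(O)\ge-\inf_O\mathcal I$ for open $O$; "good" means compact level sets $\{\mathcal I\le M\}$. Jacobi coefficients of $\mu$ (with infinite support): the numbers $a_k\in\mathbb R$, $b_k>0$, $k\ge1$, in the recursion $xP_k=b_kP_{k+1}+a_kP_k+b_{k-1}P_{k-1}$ ($k\ge1$, $P_0=0$, $P_1=1$) of the orthonormal polynomials $P_1,P_2,\dots$ obtained by Gram-Schmidt from $1,x,x^2,\dots$ in $L^2(\mu)$. Decomposition: for $\mu\in\mathcal M^1_{m,d}\big(\big[-\frac1{\sqrt\gamma},\frac1{\sqrt\gamma\sigma}\big]\big)$, the coefficients are written uniquely as $$a_k=\sqrt\gamma\,\tfrac{1-\sigma}{1+\sigma}v_{k-1}-\tfrac{\gamma\sigma}{1+\sigma}v_{k-1}(u_{k-1}+u_k)+u_k,$$ $$b_k^2=\tfrac1{1+\sigma}v_k(1-\sigma\sqrt\gamma u_k)(1+\sqrt\gamma u_k)\Big(1-\tfrac{\gamma\sigma}{1+\sigma}v_{k-1}\Big),\qquad k\ge1,$$ with $u_0=v_0=0$, $v_k\in\big(0,\frac{1+\sigma}{\gamma\sigma}\big)$, $u_k\in\big(-\frac1{\sqrt\gamma},\frac1{\sqrt\gamma\sigma}\big)$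 for $k\ge1$ (same convention on infinite endpoints). Rate function: let $g(x)=x-\log x-1$ for $x>0$ and $g(x)=+\infty$ otherwise, $c_{\gamma,\sigma}=\frac{\gamma\sigma}{1+\sigma}$. With $(u_k,v_k)$ from the decomposition above, $$I_{\gamma,\sigma}(\mu)=\begin{cases}\sum_{k\ge1}\Big[\frac1\gamma g(1+\sqrt\gamma u_k)+\frac1{\gamma\sigma}g(1-\sqrt\gamma\sigma u_k)+g(v_k)+\frac{1-c_{\gamma,\sigma}}{c_{\gamma,\sigma}}g\Big(\frac{1-c_{\gamma,\sigma}v_k}{1-c_{\gamma,\sigma}}\Big)\Big],&0<\sigma\gamma\le1,\\ \sum_{k\ge1}\big[\frac1\gamma g(1+\sqrt\gamma u_k)+g(v_k)\big],&\sigma=0,\ 0<\gamma\le1,\\ \sum_{k\ge1}\big[\frac{1+\sigma}{2}u_k^2+g(v_k)\big],&\gamma=0,\ \sigma\ge0,\end{cases}$$ and $I_{\gamma,\sigma}(\mu)=+\infty$ otherwise (i.e. when there is no such infinite sequence $(u_k,v_k)_{k\ge1}$). Limit law density: $$\tilde h_{\gamma,\sigma}(x)=\begin{cases}\frac{\sigma\sqrt\gamma}{1+\sigma}\,h_{\gamma,\sigma}\!\left(\frac{\sigma}{1+\sigma}(\sqrt\gamma x+1)\right), & 0<\sigma\gamma\le1,\\ \sqrt\gamma\,h_\gamma(1+\sqrt\gamma x), & \sigma=0,\ 0<\gamma\le1,\\ \frac{1+\sigma}{2\pi}\sqrt{\frac{4}{1+\sigma}-x^2}\ \text{ for } x^2\le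 \frac{4}{1+\sigma}\ (0\text{ otherwise}), & \gamma=0,\ \sigma\ge0,\end{cases}$$ where $h_\gamma(x)=\frac{1}{2\pi\gamma x}\sqrt{(x-\gamma_1)(\gamma_2-x)}\,\mathbf 1_{[\gamma_1,\gamma_2]}(x)$ with $\gamma_1=(\sqrt\gamma-1)^2$, $\gamma_2=(\sqrt\gamma+1)^2$, and $h_{\gamma,\sigma}(x)=\frac{1+\sigma}{2\pi\sigma\gamma}\frac{\sqrt{(x-u_-)(u_+-x)}}{x(1-x)}\mathbf 1_{[u_-,u_+]}(x)$ with $u_\pm=\frac{\sigma}{1+\sigma}\left(\sqrt{1-\frac{\sigma\gamma}{1+\sigma}}\pm\sqrt{\frac{\gamma}{1+\sigma}}\right)^2$.
   Formalization: For finite n the support of μ_n may exceed the limit interval, so the LDP is proved in the space over all of R, with rate +∞ off the measures on the interval; in the space over the interval itself it is proved when μ_n lies there almost surely for all large n. *)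

theory Defs
  imports
    "HOL-Probability.Probability"
    "HOL-Computational_Algebra.Polynomial"
    "Jordan_Normal_Form.Matrix"
begin

section \<open>Large deviation principles\<close>

definition log_prob :: "real \<Rightarrow> ereal" where
  "log_prob p = (if 0 < p then ereal (ln p) else -\<infinity>)"

definition good_rate_function :: "'b topology \<Rightarrow> ('b \<Rightarrow> ereal) \<Rightarrow> bool" where
  "good_rate_function X \<I> \<longleftrightarrow>
     (\<forall>x\<in>topspace X. 0 \<le> \<I> x) \<and>
     (\<forall>r::real. closedin X {x \<in> topspace X. \<I> x \<le> ereal r}) \<and>
     (\<forall>r::real. compactin X {x \<in> topspace X. \<I> x \<le> ereal r})"

text \<open>\<open>P n A\<close> is the probability that the \<open>n\<close>-th random element lies in \<open>A\<close>.\<close>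

definition ldp_bounds ::
  "'b topology \<Rightarrow> (nat \<Rightarrow> 'b set \<Rightarrow> real) \<Rightarrow> (nat \<Rightarrow> real) \<Rightarrow> ('b \<Rightarrow> ereal) \<Rightarrow> bool" where
  "ldp_bounds X P speed \<I> \<longleftrightarrow>
     (\<forall>F. closedin X F \<longrightarrow>
        limsup (\<lambda>n. ereal (1 / speed n) * log_prob (P n F)) \<le> - (INF x\<in>F. \<I> x)) \<and>
     (\<forall>U. openin X U \<longrightarrow>
        liminf (\<lambda>n. ereal (1 / speed n) * log_prob (P n U)) \<ge> - (INF x\<in>U. \<I> x))"

definition good_ldp ::
  "'b topology \<Rightarrow> (nat \<Rightarrow> 'b set \<Rightarrow> real) \<Rightarrow> (nat \<Rightarrow> real) \<Rightarrow> ('b \<Rightarrow> ereal) \<Rightarrow> bool" where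
  "good_ldp X P speed \<I> \<longleftrightarrow> good_rate_function X \<I> \<and> ldp_bounds X P speed \<I>"


section \<open>Probability measures with the topology of convergence of moments\<close>

definition moment :: "real measure \<Rightarrow> nat \<Rightarrow> real" where
  "moment \<mu> k = (\<integral>x. x ^ k \<partial>\<mu>)"

definition borel_prob_finite_moments :: "real measure \<Rightarrow> bool" where
  "borel_prob_finite_moments \<mu> \<longleftrightarrow>
     prob_space \<mu> \<and> sets \<mu> = sets borel \<and> (\<forall>k. integrable \<mu> (\<lambda>x. x ^ k))"

text \<open>Determinacy is meant among all probability measures on the real line.\<close>

definition moment_space :: "real set \<Rightarrow> real measure set" where
  "moment_space S = {\<mu>. borel_prob_finite_moments \<mu> \<and> (AE x in \<mu>. x \<in> S) \<and>
     (\<forall>\<nu>. borel_prob_finite_moments \<nu> \<and> (\<forall>k. moment \<nu> k = moment \<mu> k) \<longrightarrow> \<nu> = \<mu>)}"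

definition moment_dist :: "real measure \<Rightarrow> real measure \<Rightarrow> real" where
  "moment_dist \<mu> \<nu> =
     (\<Sum>j. let k = Suc j; t = \<bar>moment \<mu> k - moment \<nu> k\<bar> in (1 / 2) ^ k * (t / (1 + t)))"

definition moment_topology :: "real set \<Rightarrow> real measure topology" where
  "moment_topology S = Metric_space.mtopology (moment_space S) moment_dist"


section \<open>The tridiagonal model of the Jacobi ensemble\<close>

definition beta_density :: "real \<Rightarrow> real \<Rightarrow> real \<Rightarrow> real" where
  "beta_density a b x =
     (if 0 < x \<and> x < 1 then x powr (a - 1) * (1 - x) powr (b - 1) / Beta a b else 0)"

definition jacobi_model ::
  "'a measure \<Rightarrow> nat \<Rightarrow> real \<Rightarrow> real \<Rightarrow> real \<Rightarrow> (nat \<Rightarrow> 'a \<Rightarrow> real) \<Rightarrow> (nat \<Rightarrow> 'a \<Rightarrow> real) \<Rightarrow> bool"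
where
  "jacobi_model M n \<beta>' p1 p2 c s \<longleftrightarrow>
     prob_space M \<and>
     prob_space.indep_vars M (\<lambda>_. borel) (case_sum c s) (Inl ` {1..n} \<union> Inr ` {1..<n}) \<and>
     (\<forall>k\<in>{1..n}. distributed M lborel (c k)
        (\<lambda>x. ennreal (beta_density (\<beta>' * (p1 - real k + 1)) (\<beta>' * (p2 - real k + 1)) x))) \<and>
     (\<forall>k\<in>{1..<n}. distributed M lborel (s k)
        (\<lambda>x. ennreal (beta_density (\<beta>' * (real n - real k))
                                   (\<beta>' * (p1 + p2 - real n - real k + 1)) x))) \<and>
     (\<forall>\<omega>. c 0 \<omega> = 0 \<and> s 0 \<omega> = 0)"

text \<open>Matrix indices start at 0: the entry \<open>(i, i)\<close> below is the diagonal entry number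
  \<open>k = i + 1\<close>, and the entries \<open>(i, i + 1)\<close>, \<open>(i + 1, i)\<close> are the off-diagonal entry
  number \<open>k = i + 1\<close>.\<close>

definition jacobi_offdiag :: "(nat \<Rightarrow> real) \<Rightarrow> (nat \<Rightarrow> real) \<Rightarrow> nat \<Rightarrow> real" where
  "jacobi_offdiag c s k = sqrt (c k * (1 - c k) * s k * (1 - s (k - 1)))"

definition jacobi_matrix :: "nat \<Rightarrow> (nat \<Rightarrow> real) \<Rightarrow> (nat \<Rightarrow> real) \<Rightarrow> real mat" where
  "jacobi_matrix n c s = mat n n (\<lambda>(i, j).
     if i = j then s i * (1 - c i) + c (Suc i) * (1 - s i)
     else if j = Suc i then jacobi_offdiag c s (Suc i)
     else if i = Suc j then jacobi_offdiag c s (Suc j)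
     else 0)"

definition rescaled_jacobi_matrix ::
  "nat \<Rightarrow> real \<Rightarrow> real \<Rightarrow> (nat \<Rightarrow> real) \<Rightarrow> (nat \<Rightarrow> real) \<Rightarrow> real mat" where
  "rescaled_jacobi_matrix n p1 p2 c s =
     (1 / sqrt (real n * p1)) \<cdot>\<^sub>m ((p1 + p2) \<cdot>\<^sub>m jacobi_matrix n c s - p1 \<cdot>\<^sub>m 1\<^sub>m n)"

definition spectral_measure :: "real mat \<Rightarrow> real measure" where
  "spectral_measure J = (THE \<mu>. borel_prob_finite_moments \<mu> \<and>
     (\<forall>k. moment \<mu> k = (J ^\<^sub>m k) $$ (0, 0)))"


section \<open>Jacobi coefficients of a measure\<close>

definition measure_support :: "real measure \<Rightarrow> real set" where
  "measure_support \<mu> = {x. \<forall>U. open U \<and> x \<in> U \<longrightarrow> 0 < emeasure \<mu> U}"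

definition poly_inner :: "real measure \<Rightarrow> real poly \<Rightarrow> real poly \<Rightarrow> real" where
  "poly_inner \<mu> p q = (\<integral>x. poly p x * poly q x \<partial>\<mu>)"

fun gram_schmidt_poly :: "real measure \<Rightarrow> nat \<Rightarrow> real poly" where
  "gram_schmidt_poly \<mu> m = Polynomial.monom 1 m -
     (\<Sum>j\<in>{..<m}. Polynomial.smult (poly_inner \<mu> (Polynomial.monom 1 m) (gram_schmidt_poly \<mu> j) /
                          poly_inner \<mu> (gram_schmidt_poly \<mu> j) (gram_schmidt_poly \<mu> j))
                         (gram_schmidt_poly \<mu> j))"

declare gram_schmidt_poly.simps [simp del]

text \<open>Numbered so that the polynomial with index \<open>k \<ge> 1\<close> has degree \<open>k - 1\<close>.\<close>

definition orthonormal_poly :: "real measure \<Rightarrow> nat \<Rightarrow> real poly" where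
  "orthonormal_poly \<mu> k = (if k = 0 then 0 else
     (let p = gram_schmidt_poly \<mu> (k - 1) in Polynomial.smult (1 / sqrt (poly_inner \<mu> p p)) p))"

definition jacobi_coefficients :: "real measure \<Rightarrow> (nat \<Rightarrow> real) \<Rightarrow> (nat \<Rightarrow> real) \<Rightarrow> bool" where
  "jacobi_coefficients \<mu> a b \<longleftrightarrow> infinite (measure_support \<mu>) \<and>
     (\<forall>k\<ge>1. b k > 0 \<and>
        Polynomial.monom 1 1 * orthonormal_poly \<mu> k =
          Polynomial.smult (b k) (orthonormal_poly \<mu> (k + 1)) + Polynomial.smult (a k) (orthonormal_poly \<mu> k)
          + Polynomial.smult (b (k - 1)) (orthonormal_poly \<mu> (k - 1)))"


section \<open>The rate function\<close>

text \<open>In the following sets an endpoint with denominator 0 is read as infinite.\<close>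

definition limit_interval :: "real \<Rightarrow> real \<Rightarrow> real set" where
  "limit_interval \<gamma> \<sigma> = {x. (\<gamma> \<noteq> 0 \<longrightarrow> - 1 / sqrt \<gamma> \<le> x) \<and>
                            (\<gamma> * \<sigma> \<noteq> 0 \<longrightarrow> x \<le> 1 / (sqrt \<gamma> * \<sigma>))}"

definition u_range :: "real \<Rightarrow> real \<Rightarrow> real set" where
  "u_range \<gamma> \<sigma> = {x. (\<gamma> \<noteq> 0 \<longrightarrow> - 1 / sqrt \<gamma> < x) \<and>
                      (\<gamma> * \<sigma> \<noteq> 0 \<longrightarrow> x < 1 / (sqrt \<gamma> * \<sigma>))}"

definition v_range :: "real \<Rightarrow> real \<Rightarrow> real set" where
  "v_range \<gamma> \<sigma> = {x. 0 < x \<and> (\<gamma> * \<sigma> \<noteq> 0 \<longrightarrow> x < (1 + \<sigma>) / (\<gamma> * \<sigma>))}"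

definition decomposition ::
  "real \<Rightarrow> real \<Rightarrow> real measure \<Rightarrow> (nat \<Rightarrow> real) \<Rightarrow> (nat \<Rightarrow> real) \<Rightarrow> bool" where
  "decomposition \<gamma> \<sigma> \<mu> u v \<longleftrightarrow> u 0 = 0 \<and> v 0 = 0 \<and>
     (\<forall>k\<ge>1. u k \<in> u_range \<gamma> \<sigma> \<and> v k \<in> v_range \<gamma> \<sigma>) \<and>
     (\<exists>a b. jacobi_coefficients \<mu> a b \<and>
       (\<forall>k\<ge>1.
          a k = sqrt \<gamma> * ((1 - \<sigma>) / (1 + \<sigma>)) * v (k - 1)
                - \<gamma> * \<sigma> / (1 + \<sigma>) * v (k - 1) * (u (k - 1) + u k) + u k \<and>
          (b k)\<^sup>2 = 1 / (1 + \<sigma>) * v k * (1 - \<sigma> * sqrt \<gamma> * u k) * (1 + sqrt \<gamma> * u k)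
                    * (1 - \<gamma> * \<sigma> / (1 + \<sigma>) * v (k - 1))))"

definition rate_g :: "real \<Rightarrow> ereal" where
  "rate_g x = (if 0 < x then ereal (x - ln x - 1) else \<infinity>)"

definition rate_sum :: "real \<Rightarrow> real \<Rightarrow> (nat \<Rightarrow> real) \<Rightarrow> (nat \<Rightarrow> real) \<Rightarrow> ereal" where
  "rate_sum \<gamma> \<sigma> u v = (let c = \<gamma> * \<sigma> / (1 + \<sigma>) in
     if 0 < \<sigma> * \<gamma> \<and> \<sigma> * \<gamma> \<le> 1 then
       (\<Sum>j. let k = Suc j in
          ereal (1 / \<gamma>) * rate_g (1 + sqrt \<gamma> * u k)
          + ereal (1 / (\<gamma> * \<sigma>)) * rate_g (1 - sqrt \<gamma> * \<sigma> * u k)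
          + rate_g (v k)
          + ereal ((1 - c) / c) * rate_g ((1 - c * v k) / (1 - c)))
     else if \<sigma> = 0 \<and> 0 < \<gamma> \<and> \<gamma> \<le> 1 then
       (\<Sum>j. let k = Suc j in ereal (1 / \<gamma>) * rate_g (1 + sqrt \<gamma> * u k) + rate_g (v k))
     else if \<gamma> = 0 \<and> 0 \<le> \<sigma> then
       (\<Sum>j. let k = Suc j in ereal ((1 + \<sigma>) / 2 * (u k)\<^sup>2) + rate_g (v k))
     else \<infinity>)"

definition rate_function :: "real \<Rightarrow> real \<Rightarrow> real measure \<Rightarrow> ereal" where
  "rate_function \<gamma> \<sigma> \<mu> =
     (if \<mu> \<in> moment_space (limit_interval \<gamma> \<sigma>) \<and> (\<exists>u v. decomposition \<gamma> \<sigma> \<mu> u v)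
      then (case (THE (u, v). decomposition \<gamma> \<sigma> \<mu> u v) of (u, v) \<Rightarrow> rate_sum \<gamma> \<sigma> u v)
      else \<infinity>)"


text \<open>The definition makes the rate function infinite off \<open>moment_space (limit_interval \<gamma> \<sigma>)\<close>.
  This matters because for finite \<open>n\<close> the spectral measures live on the interval with
  \<open>\<gamma>\<close>, \<open>\<sigma>\<close> replaced by \<open>n / p1\<close>, \<open>p1 / p2\<close>, which may exceed the limit interval; hence their laws
  are considered on \<open>moment_space UNIV\<close>.\<close>


section \<open>The limit law\<close>

definition h_laguerre :: "real \<Rightarrow> real \<Rightarrow> real" where
  "h_laguerre \<gamma> x = (let \<gamma>1 = (sqrt \<gamma> - 1)\<^sup>2; \<gamma>2 = (sqrt \<gamma> + 1)\<^sup>2 in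
     1 / (2 * pi * \<gamma> * x) * sqrt ((x - \<gamma>1) * (\<gamma>2 - x)) * indicator {\<gamma>1..\<gamma>2} x)"

definition h_jacobi :: "real \<Rightarrow> real \<Rightarrow> real \<Rightarrow> real" where
  "h_jacobi \<gamma> \<sigma> x =
     (let um = \<sigma> / (1 + \<sigma>) * (sqrt (1 - \<sigma> * \<gamma> / (1 + \<sigma>)) - sqrt (\<gamma> / (1 + \<sigma>)))\<^sup>2;
          up = \<sigma> / (1 + \<sigma>) * (sqrt (1 - \<sigma> * \<gamma> / (1 + \<sigma>)) + sqrt (\<gamma> / (1 + \<sigma>)))\<^sup>2
      in (1 + \<sigma>) / (2 * pi * \<sigma> * \<gamma>) * (sqrt ((x - um) * (up - x)) / (x * (1 - x)))
         * indicator {um..up} x)"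

definition limit_density :: "real \<Rightarrow> real \<Rightarrow> real \<Rightarrow> real" where
  "limit_density \<gamma> \<sigma> x =
     (if 0 < \<sigma> * \<gamma> \<and> \<sigma> * \<gamma> \<le> 1 then
        \<sigma> * sqrt \<gamma> / (1 + \<sigma>) * h_jacobi \<gamma> \<sigma> (\<sigma> / (1 + \<sigma>) * (sqrt \<gamma> * x + 1))
      else if \<sigma> = 0 \<and> 0 < \<gamma> \<and> \<gamma> \<le> 1 then sqrt \<gamma> * h_laguerre \<gamma> (1 + sqrt \<gamma> * x)
      else if \<gamma> = 0 \<and> 0 \<le> \<sigma> \<and> x\<^sup>2 \<le> 4 / (1 + \<sigma>) then
        (1 + \<sigma>) / (2 * pi) * sqrt (4 / (1 + \<sigma>) - x\<^sup>2)
      else 0)"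

definition limit_law :: "real \<Rightarrow> real \<Rightarrow> real measure" where
  "limit_law \<gamma> \<sigma> = density lborel (\<lambda>x. ennreal (limit_density \<gamma> \<sigma> x))"

end

theory Submission
  imports Defs "HOL-Real_Asymp.Real_Asymp"
begin

text \<open>The rescaled variables \<open>u\<^sub>k = ((p\<^sub>1 + p\<^sub>2) c\<^sub>k - p\<^sub>1) / sqrt (n p\<^sub>1)\<close> and \<open>v\<^sub>k = (p\<^sub>1 + p\<^sub>2) s\<^sub>k / n\<close>
  are independent, with log-concave densities \<open>exp (- \<lambda>\<^sub>n h\<^sub>n)\<close> whose exponents \<open>h\<^sub>n\<close> are convex and
  converge pointwise to the summands of the rate function; convexity turns this into exponential
  bounds for each variable. The moments of the spectral measure are continuous in
  finitely many of these variables, and the level sets of the rate sum are compact in the product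
  topology, so the large deviation bounds pass from the variables to the moments. That every
  coefficient sequence of finite rate belongs to a measure on the limit interval follows from
  Hausdorff's moment theorem, as \<open>J - lo\<close> and \<open>hi - J\<close> are positive semidefinite by an explicit
  factorization.

  The rate vanishes only at \<open>u = 0\<close>, \<open>v = 1\<close>. Multiplying the corresponding measure \<open>\<mu>\<close> by
  \<open>q x = (1 + sqrt \<gamma> x) (1 - \<sigma> sqrt \<gamma> x)\<close> makes the recursion coefficients constant, so that
  \<open>q d\<mu>\<close> is a multiple of a semicircle law; as \<open>\<mu>\<close> has no atoms at the zeros of \<open>q\<close>, division by
  \<open>q\<close> gives the limit density.\<close>

section \<open>Moment problems for bounded measures\<close>

text \<open>An arbitrary admissible sequence need not give a measure in the space: unbounded
  coefficients may lead to an indeterminate moment problem. Moments, however, are polynomials in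
  finitely many \<open>a\<close> and \<open>b\<close>, hence continuous functions of any real
  sequence. So measures are attached to coefficients only on level sets, where the sequences are
  bounded, and all other steps are phrased by moments. This takes the place of a contraction
  principle and copes with a further obstacle: at size \<open>n\<close> the map from coefficients to
  moments contains \<open>n / p1\<close> and \<open>p1 / p2\<close> instead of their limits. In
  place of a projective limit, a box that is compact in the infinite product is covered by finitely
  many cylinders, and only the coordinates met by the cover enter the estimates. The normalizing
  constants of the densities are bounded from both sides by total mass one instead of through the
  Beta function. Hausdorff's theorem serves finite and infinite matrices alike and controls the
  support at the same time.\<close>

lemma sum_binomial_Suc:
  fixes f :: "nat \<Rightarrow> real"
  shows "(\<Sum>i\<le>Suc N. real (Suc N choose i) * f i)
       = (\<Sum>i\<le>N. real (N choose i) * f (Suc i)) + (\<Sum>i\<le>N. real (N choose i) * f i)"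
proof -
  have "(\<Sum>i\<le>Suc N. real (Suc N choose i) * f i)
      = f 0 + (\<Sum>i\<le>N. real (Suc N choose Suc i) * f (Suc i))"
    by (subst sum.atMost_Suc_shift) simp
  also have "\<dots> = (\<Sum>i\<le>N. real (N choose i) * f (Suc i))
      + (f 0 + (\<Sum>i\<le>N. real (N choose Suc i) * f (Suc i)))"
    by (simp add: algebra_simps sum.distrib)
  also have "f 0 + (\<Sum>i\<le>N. real (N choose Suc i) * f (Suc i)) = (\<Sum>i\<le>Suc N. real (N choose i) * f i)"
    by (subst sum.atMost_Suc_shift) simp
  also have "\<dots> = (\<Sum>i\<le>N. real (N choose i) * f i)" by simp
  finally show ?thesis .
qed

text \<open>\<open>D i j\<close> plays the role of the integral of x^i (1 - x)^j. Splitting 1 = x +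
  (1 - x) \<open>N\<close> times, as \<open>rec\<close> does, gives one term per choice of the steps
  that raise the first index; \<open>N choose i\<close> counts these choices.\<close>

lemma hausdorff_sum:
  fixes D :: "nat \<Rightarrow> nat \<Rightarrow> real"
  assumes rec: "\<And>i j. D i j = D (Suc i) j + D i (Suc j)"
  shows "(\<Sum>i\<le>N. real (N choose i) * D (k + i) (j + (N - i))) = D k j"
proof (induction N arbitrary: k j)
  case (Suc N)
  have "(\<Sum>i\<le>Suc N. real (Suc N choose i) * D (k + i) (j + (Suc N - i)))
     = (\<Sum>i\<le>N. real (N choose i) * D (Suc k + i) (j + (N - i)))
       + (\<Sum>i\<le>N. real (N choose i) * D (k + i) (j + (Suc N - i)))"
    using sum_binomial_Suc[of N "\<lambda>i. D (k + i) (j + (Suc N - i))"] by simp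
  also have "(\<Sum>i\<le>N. real (N choose i) * D (k + i) (j + (Suc N - i)))
     = (\<Sum>i\<le>N. real (N choose i) * D (k + i) (Suc j + (N - i)))"
    by (intro sum.cong) (auto simp: Suc_diff_le)
  finally show ?case unfolding Suc.IH[of "Suc k" j] Suc.IH[of k "Suc j"] rec[of k j, symmetric] .
qed simp

text \<open>For the weights \<open>(N choose i) * D i (N - i)\<close>, formally a mixture of
  binomial laws, the left side is the factorial moment of order \<open>k\<close> divided by
  \<open>fact k\<close>. The product of \<open>N choose i\<close> and \<open>i choose k\<close>
  factors as \<open>N choose k\<close> times \<open>(N - k) choose (i - k)\<close>, which leaves a
  sum of the previous form.\<close>

lemma hausdorff_factorial_sum:
  fixes D :: "nat \<Rightarrow> nat \<Rightarrow> real"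
  assumes rec: "\<And>i j. D i j = D (Suc i) j + D i (Suc j)"
  shows "(\<Sum>i\<le>N. real (i choose k) * (real (N choose i) * D i (N - i))) = real (N choose k) * D k 0"
proof (cases "k \<le> N")
  case True
  have "(\<Sum>i\<le>N. real (i choose k) * (real (N choose i) * D i (N - i)))
      = (\<Sum>i\<in>{k..N}. real (i choose k) * (real (N choose i) * D i (N - i)))"
    by (rule sum.mono_neutral_right) auto
  also have "\<dots> = (\<Sum>i\<in>{k..N}. real (N choose k) * (real ((N - k) choose (i - k)) * D i (N - i)))"
  proof (intro sum.cong refl)
    fix i assume "i \<in> {k..N}"
    then have "real (N choose i) * real (i choose k) = real (N choose k) * real ((N - k) choose (i - k))"
      using choose_mult[of k i N] by (metis atLeastAtMost_iff of_nat_mult)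
    then have "(real (N choose i) * real (i choose k)) * D i (N - i)
        = (real (N choose k) * real ((N - k) choose (i - k))) * D i (N - i)" by simp
    then show "real (i choose k) * (real (N choose i) * D i (N - i))
        = real (N choose k) * (real ((N - k) choose (i - k)) * D i (N - i))"
      by (simp only: mult_ac)
  qed
  also have "\<dots> = real (N choose k) * (\<Sum>i\<in>{k..N}. real ((N - k) choose (i - k)) * D i (N - i))"
    by (simp add: sum_distrib_left)
  also have "(\<Sum>i\<in>{k..N}. real ((N - k) choose (i - k)) * D i (N - i))
     = (\<Sum>i\<le>N-k. real ((N - k) choose i) * D (k + i) (0 + ((N - k) - i)))"
    by (rule sum.reindex_bij_witness[of _ "\<lambda>i. k + i" "\<lambda>i. i - k"]) (use True in auto)
  also have "\<dots> = D k 0" by (rule hausdorff_sum[of D, OF rec])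
  finally show ?thesis .
qed (simp add: binomial_eq_0)

lemma binomial_over_power_tendsto:
  "(\<lambda>N. real (N choose m) / real N ^ m) \<longlonglongrightarrow> 1 / fact m"
proof (induction m)
  case (Suc m)
  have "(\<lambda>N. real (N choose m) / real N ^ m * ((1 - real m / real N) / real (Suc m)))
      \<longlonglongrightarrow> 1 / fact m * ((1 - 0) / real (Suc m))"
    by (intro tendsto_intros Suc.IH lim_const_over_n) auto
  moreover have "\<forall>\<^sub>F N in sequentially. real (N choose m) / real N ^ m * ((1 - real m / real N) / real (Suc m))
      = real (N choose Suc m) / real N ^ Suc m"
    using eventually_ge_at_top[of "Suc m"]
  proof eventually_elim
    case (elim N)
    have "Suc m * (N choose Suc m) = (N - m) * (N choose m)"
      using Suc_times_binomial_add[of m "N - Suc m"] binomial_symmetric[of m N]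
        Suc_times_binomial_add[of "N - Suc m" m] binomial_symmetric[of "Suc m" N] elim
      by (simp add: Suc_diff_Suc)
    then have "real (Suc m) * real (N choose Suc m) = real (N - m) * real (N choose m)"
      by (metis of_nat_mult)
    moreover have "real (N - m) = real N - real m" using elim by simp
    ultimately have "real (N choose Suc m) = (real N - real m) * real (N choose m) / real (Suc m)"
      by (simp add: field_simps)
    moreover have "1 - real m / real N = (real N - real m) / real N" using elim by (simp add: field_simps)
    ultimately show ?case by (simp add: mult.commute)
  qed
  ultimately have "(\<lambda>N. real (N choose Suc m) / real N ^ Suc m) \<longlonglongrightarrow> 1 / fact m * ((1 - 0) / real (Suc m))"
    by (rule Lim_transform_eventually)
  then show ?case by (simp add: field_simps)
qed simp

text \<open>Hausdorff's approximation: mass \<open>(N choose i) * D i (N - i)\<close> at the point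
  \<open>i / N\<close>, the weights of Bernstein polynomials. The factorial moments are exact by
  \<open>hausdorff_factorial_sum\<close>; ordinary moments differ from them by terms of lower order
  in \<open>N\<close>.\<close>

lemma hausdorff_discrete:
  fixes D :: "nat \<Rightarrow> nat \<Rightarrow> real"
  assumes pos: "\<And>i j. 0 \<le> D i j" and rec: "\<And>i j. D i j = D (Suc i) j + D i (Suc j)"
    and D00: "D 0 0 = 1"
  obtains \<mu> :: "nat \<Rightarrow> real measure" where
    "\<And>N. real_distribution (\<mu> N)" "\<And>N. measure (\<mu> N) {0..1} = 1"
    "\<And>k. (\<lambda>N. \<integral>x. x ^ k \<partial>\<mu> N) \<longlonglongrightarrow> D k 0"
proof -
  define w where "w N i = real (N choose i) * D i (N - i)" for N i
  have w_nonneg: "0 \<le> w N i" for N i by (simp add: w_def pos)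
  have w_sum: "(\<Sum>i\<le>N. w N i) = 1" for N
    using hausdorff_sum[of D, OF rec, of N 0 0] D00 by (simp add: w_def)
  have w_0: "w N i = 0" if "N < i" for N i using that by (simp add: w_def binomial_eq_0)
  define p where "p N = embed_pmf (w N)" for N
  have pmf_p: "pmf (p N) i = w N i" for N i
    unfolding p_def
  proof (rule pmf_embed_pmf)
    have "(\<integral>\<^sup>+ x. ennreal (w N x) \<partial>count_space UNIV) = (\<Sum>i\<le>N. ennreal (w N i))"
      by (rule nn_integral_count_space'[OF _ _]) (auto simp: w_0 not_le)
    also have "\<dots> = 1" by (simp add: sum_ennreal w_nonneg w_sum)
    finally show "(\<integral>\<^sup>+ x. ennreal (w N x) \<partial>count_space UNIV) = 1" .
  qed (simp add: w_nonneg)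
  have set_p: "set_pmf (p N) \<subseteq> {..N}" for N
  proof
    fix i assume "i \<in> set_pmf (p N)"
    then have "w N i \<noteq> 0" by (simp add: set_pmf_iff pmf_p)
    then show "i \<in> {..N}" using w_0[of N i] by (cases "N < i") auto
  qed
  define \<mu> where "\<mu> N = distr (measure_pmf (p N)) borel (\<lambda>i. real i / real N)" for N
  have rd: "real_distribution (\<mu> N)" for N unfolding \<mu>_def by (rule prob_space.real_distribution_distr[OF measure_pmf.prob_space_axioms]) simp
  have supp: "measure (\<mu> N) {0..1} = 1" for N
  proof -
    have "measure (\<mu> N) {0..1} = measure (measure_pmf (p N)) ((\<lambda>i. real i / real N) -` {0..1})"
      unfolding \<mu>_def by (subst measure_distr) auto
    also have "\<dots> = 1"
      by (rule measure_pmf.prob_eq_1[THEN iffD2])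
        (use set_p[of N] in \<open>auto simp: AE_measure_pmf_iff divide_le_eq_1\<close>)
    finally show ?thesis .
  qed
  have int: "(\<integral>x. x ^ k \<partial>\<mu> N) = (\<Sum>i\<le>N. (real i / real N) ^ k * w N i)" for k N
    unfolding \<mu>_def
    by (subst integral_distr, simp, simp, subst integral_measure_pmf_real[where A="{..N}"])
      (use set_p[of N] in \<open>auto simp: pmf_p\<close>)
  \<comment> \<open>Mixed power and factorial moments. The identity i C(i,m) = (m+1) C(i,m+1) + m
    C(i,m) trades a factor \<open>i\<close> for a higher binomial coefficient; after scaling, the
    last term carries a factor \<open>1 / N\<close>.\<close>
  define F where "F N k m = (\<Sum>i\<le>N. real i ^ k * real (i choose m) * w N i)" for N k m
  have F_Suc: "F N (Suc k) m = real (Suc m) * F N k (Suc m) + real m * F N k m" for N k m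
  proof -
    have "real i * real (i choose m) = real (Suc m) * real (i choose Suc m) + real m * real (i choose m)" for i
    proof (cases "i < m")
      case False
      have "Suc m * (i choose Suc m) = (i - m) * (i choose m)"
      proof (cases "i = m")
        case neq: False
        with False show ?thesis
          using Suc_times_binomial_add[of m "i - Suc m"] binomial_symmetric[of m i]
            Suc_times_binomial_add[of "i - Suc m" m] binomial_symmetric[of "Suc m" i]
          by (simp add: Suc_diff_Suc)
      qed simp
      then have "real (Suc m) * real (i choose Suc m) = (real i - real m) * real (i choose m)"
        using False by (metis of_nat_mult of_nat_diff not_less)
      then show ?thesis by (simp add: algebra_simps)
    qed (simp add: binomial_eq_0)
    note rec = this
    have "real i ^ Suc k * real (i choose m) * w N i = real (Suc m) * (real i ^ k * real (i choose Suc m) * w N i)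
       + real m * (real i ^ k * real (i choose m) * w N i)" for i
    proof -
      have "real i ^ Suc k * real (i choose m) * w N i = (real i * real (i choose m)) * (real i ^ k * w N i)" by simp
      also have "\<dots> = real (Suc m) * (real i ^ k * real (i choose Suc m) * w N i)
         + real m * (real i ^ k * real (i choose m) * w N i)"
        unfolding rec by (simp add: algebra_simps)
      finally show ?thesis .
    qed
    then show ?thesis by (simp only: F_def sum.distrib sum_distrib_left)
  qed
  have F_lim: "(\<lambda>N. F N k m / real N ^ (k + m)) \<longlonglongrightarrow> D (k + m) 0 / fact m" for k m
  proof (induction k arbitrary: m)
    case 0
    have "F N 0 m = real (N choose m) * D m 0" for N
      using hausdorff_factorial_sum[of D m N, OF rec] by (simp add: F_def w_def)
    then have "(\<lambda>N. F N 0 m / real N ^ (0 + m)) = (\<lambda>N. real (N choose m) / real N ^ m * D m 0)" by simp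
    moreover have "\<dots> \<longlonglongrightarrow> 1 / fact m * D m 0" by (intro tendsto_intros binomial_over_power_tendsto)
    ultimately show ?case by simp
  next
    case (Suc k)
    have "(\<lambda>N. real (Suc m) * (F N k (Suc m) / real N ^ (k + Suc m))
        + real m * (F N k m / real N ^ (k + m)) * (1 / real N))
      \<longlonglongrightarrow> real (Suc m) * (D (k + Suc m) 0 / fact (Suc m)) + real m * (D (k + m) 0 / fact m) * 0"
      by (intro tendsto_intros Suc.IH lim_const_over_n)
    moreover have "(\<lambda>N. real (Suc m) * (F N k (Suc m) / real N ^ (k + Suc m))
        + real m * (F N k m / real N ^ (k + m)) * (1 / real N)) = (\<lambda>N. F N (Suc k) m / real N ^ (Suc k + m))"
    proof (rule ext)
      fix N
      show "real (Suc m) * (F N k (Suc m) / real N ^ (k + Suc m))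
        + real m * (F N k m / real N ^ (k + m)) * (1 / real N) = F N (Suc k) m / real N ^ (Suc k + m)"
        unfolding F_Suc add_divide_distrib by (simp del: of_nat_Suc)
    qed
    moreover have "real (Suc m) * (D (k + Suc m) 0 / fact (Suc m)) + real m * (D (k + m) 0 / fact m) * 0 = D (Suc k + m) 0 / fact m"
      by (simp add: field_simps del: of_nat_Suc)
    ultimately show ?case by metis
  qed
  have "(\<lambda>N. \<integral>x. x ^ k \<partial>\<mu> N) \<longlonglongrightarrow> D k 0" for k
    using F_lim[of k 0] by (simp add: F_def int power_divide sum_divide_distrib)
  with rd supp show thesis by (rule that)
qed

text \<open>The measure is a weak limit of the discrete laws. Weak convergence tests bounded
  continuous functions only, so the support and the moments are read off from clipped test
  functions.\<close>

lemma hausdorff_moment_unit: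
  fixes D :: "nat \<Rightarrow> nat \<Rightarrow> real"
  assumes "\<And>i j. 0 \<le> D i j" and "\<And>i j. D i j = D (Suc i) j + D i (Suc j)" and "D 0 0 = 1"
  obtains \<mu> :: "real measure" where
    "real_distribution \<mu>" "AE x in \<mu>. 0 \<le> x \<and> x \<le> 1" "\<And>k. (\<integral>x. x ^ k \<partial>\<mu>) = D k 0"
proof -
  obtain \<mu> :: "nat \<Rightarrow> real measure" where
    rd: "\<And>N. real_distribution (\<mu> N)" and supp: "\<And>N. measure (\<mu> N) {0..1} = 1"
    and lim: "\<And>k. (\<lambda>N. \<integral>x. x ^ k \<partial>\<mu> N) \<longlonglongrightarrow> D k 0"
    using hausdorff_discrete[of D, OF assms] by blast
  interpret R: real_distribution "\<mu> N" for N by (rule rd)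
  have tight: "tight \<mu>"
    unfolding tight_def
  proof (intro conjI allI impI rd)
    fix \<epsilon> :: real assume "\<epsilon> > 0"
    have "measure (\<mu> n) {-1<..1} \<ge> measure (\<mu> n) {0..1}" for n
      by (rule R.finite_measure_mono) auto
    then have "measure (\<mu> n) {-1<..1} > 1 - \<epsilon>" for n using supp[of n] \<open>\<epsilon> > 0\<close> by (smt (verit))
    then show "\<exists>a b::real. a < b \<and> (\<forall>n. measure (\<mu> n) {a<..b} > 1 - \<epsilon>)"
      by (intro exI[of _ "-1"] exI[of _ 1]) auto
  qed
  obtain r M where r: "strict_mono (r :: nat \<Rightarrow> nat)" and M: "real_distribution M"
    and wc: "weak_conv_m (\<mu> \<circ> r) M"
    using tight_imp_convergent_subsubsequence[OF tight strict_mono_id] by auto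
  interpret M: real_distribution M by (rule M)
  have AE_n: "AE x in \<mu> n. 0 \<le> x \<and> x \<le> 1" for n
    using R.prob_eq_1[of "{0..1}" n] supp[of n] by simp
  have conv: "(\<lambda>n. \<integral>x. f x \<partial>\<mu> (r n)) \<longlonglongrightarrow> (\<integral>x. f x \<partial>M)"
    if "\<And>x. isCont f x" "\<And>x. norm (f x) \<le> B" for f :: "real \<Rightarrow> real" and B
    by (rule weak_conv_imp_integral_bdd_continuous_conv[of "\<mu> \<circ> r" M f B, unfolded comp_def])
      (use rd M wc that in \<open>auto simp: comp_def\<close>)
  \<comment> \<open>Bounded, continuous, and zero exactly on the unit interval: its integral
    vanishes along the sequence, hence also in the limit.\<close>
  let ?h = "\<lambda>x::real. min 1 (max 0 (- x) + max 0 (x - 1))"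
  have h_meas: "?h \<in> borel_measurable borel" by (intro borel_measurable_continuous_onI continuous_intros)
  have h_n: "(\<integral>x. ?h x \<partial>\<mu> n) = 0" for n
  proof -
    have "(\<integral>x. ?h x \<partial>\<mu> n) = (\<integral>x. 0 \<partial>\<mu> n)"
      by (rule integral_cong_AE) (use AE_n[of n] h_meas in auto)
    then show ?thesis by simp
  qed
  have "(\<lambda>n. \<integral>x. ?h x \<partial>\<mu> (r n)) \<longlonglongrightarrow> (\<integral>x. ?h x \<partial>M)"
    by (rule conv[of _ 1]) (auto intro!: continuous_intros)
  then have "(\<integral>x. ?h x \<partial>M) = 0"
    unfolding h_n by (simp add: LIMSEQ_const_iff)
  then have "AE x in M. min 1 (max 0 (- x) + max 0 (x - 1)) = 0"
    by (subst (asm) integral_nonneg_eq_0_iff_AE)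
      (use h_meas in \<open>auto intro!: M.integrable_const_bound[where B=1]\<close>)
  then have AE_M: "AE x in M. 0 \<le> x \<and> x \<le> 1"
    by eventually_elim (auto simp: min_def max_def split: if_splits)
  have "(\<integral>x. x ^ k \<partial>M) = D k 0" for k
  proof -
    \<comment> \<open>Clipping makes the power bounded on the line and changes it only on a null
      set.\<close>
    have eq: "(\<integral>x. (max 0 (min 1 x)) ^ k \<partial>N) = (\<integral>x. x ^ k \<partial>N)"
      if "real_distribution N" "AE x in N. 0 \<le> x \<and> x \<le> 1" for N
    proof -
      interpret N: real_distribution N by (rule that)
      show ?thesis
        by (intro integral_cong_AE) (use that(2) in \<open>auto intro!: borel_measurable_continuous_onI continuous_intros\<close>)
    qed
    have "(\<lambda>n. \<integral>x. (max 0 (min 1 x)) ^ k \<partial>\<mu> (r n)) \<longlonglongrightarrow> (\<integral>x. (max 0 (min 1 x)) ^ k \<partial>M)"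
      by (rule conv[of _ 1]) (auto intro!: continuous_intros power_le_one)
    then have "(\<lambda>n. \<integral>x. x ^ k \<partial>\<mu> (r n)) \<longlonglongrightarrow> (\<integral>x. x ^ k \<partial>M)"
      using eq[OF rd AE_n] eq[OF M AE_M] by simp
    moreover have "(\<lambda>n. \<integral>x. x ^ k \<partial>\<mu> (r n)) \<longlonglongrightarrow> D k 0"
      using LIMSEQ_subseq_LIMSEQ[OF lim r] by (simp add: comp_def)
    ultimately show ?thesis by (rule LIMSEQ_unique)
  qed
  with M AE_M show thesis by (rule that)
qed

text \<open>Affine transport from the unit interval: \<open>D i j\<close> stands for the integral of
  (x - lo)^i (hi - x)^j, which is homogeneous of degree i + j in the length of the interval.\<close>

lemma hausdorff_moment:
  fixes D :: "nat \<Rightarrow> nat \<Rightarrow> real"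
  assumes lt: "lo < hi" and pos: "\<And>i j. 0 \<le> D i j"
    and rec: "\<And>i j. (hi - lo) * D i j = D (Suc i) j + D i (Suc j)" and D00: "D 0 0 = 1"
  obtains \<mu> :: "real measure" where
    "real_distribution \<mu>" "AE x in \<mu>. lo \<le> x \<and> x \<le> hi" "\<And>k. (\<integral>x. (x - lo) ^ k \<partial>\<mu>) = D k 0"
proof -
  define E where "E i j = D i j / (hi - lo) ^ (i + j)" for i j
  have h: "hi - lo > 0" using lt by simp
  have E: "0 \<le> E i j" "E i j = E (Suc i) j + E i (Suc j)" "E 0 0 = 1" for i j
  proof -
    have "E (Suc i) j + E i (Suc j) = (hi - lo) * D i j / ((hi - lo) * (hi - lo) ^ (i + j))"
      by (simp add: E_def rec add_divide_distrib)
    then show "E i j = E (Suc i) j + E i (Suc j)" using h by (simp add: E_def)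
  qed (use pos D00 h in \<open>auto simp: E_def\<close>)
  obtain \<mu> :: "real measure" where \<mu>: "real_distribution \<mu>" "AE x in \<mu>. 0 \<le> x \<and> x \<le> 1"
    "\<And>k. (\<integral>x. x ^ k \<partial>\<mu>) = E k 0"
    using hausdorff_moment_unit[of E, OF E] by blast
  interpret \<mu>: real_distribution \<mu> by (rule \<mu>)
  let ?\<nu> = "distr \<mu> borel (\<lambda>x. lo + (hi - lo) * x)"
  have "real_distribution ?\<nu>" by simp
  moreover have "AE x in ?\<nu>. lo \<le> x \<and> x \<le> hi"
  proof (subst AE_distr_iff)
    show "AE x in \<mu>. lo \<le> lo + (hi - lo) * x \<and> lo + (hi - lo) * x \<le> hi"
      using \<mu>(2)
    proof eventually_elim
      case (elim x)
      then have "(hi - lo) * x \<le> (hi - lo) * 1" "0 \<le> (hi - lo) * x" using h by (auto intro: mult_left_mono)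
      then show ?case by simp
    qed
  qed auto
  moreover have "(\<integral>x. (x - lo) ^ k \<partial>?\<nu>) = D k 0" for k
    using h by (subst integral_distr) (auto simp: power_mult_distrib \<mu>(3) E_def)
  ultimately show thesis by (rule that)
qed

section \<open>Bounded support, determinacy, and detection of the support by even moments\<close>

lemma integrable_power_bounded:
  fixes \<mu> :: "real measure"
  assumes "real_distribution \<mu>" "AE x in \<mu>. \<bar>x\<bar> \<le> R"
  shows "integrable \<mu> (\<lambda>x. x ^ k)"
proof -
  interpret real_distribution \<mu> by fact
  have "AE x in \<mu>. norm (x ^ k) \<le> R ^ k"
    using assms(2) by eventually_elim (auto simp: power_abs intro: power_mono)
  then show ?thesis by (intro integrable_const_bound) auto
qed

lemma borel_prob_finite_moments_iff:
  "borel_prob_finite_moments \<mu> \<longleftrightarrow> real_distribution \<mu> \<and> (\<forall>k. integrable \<mu> (\<lambda>x. x ^ k))"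
  by (auto simp: borel_prob_finite_moments_def real_distribution_def real_distribution_axioms_def)

lemma borel_prob_finite_moments_bounded:
  fixes \<mu> :: "real measure"
  assumes "real_distribution \<mu>" "AE x in \<mu>. \<bar>x\<bar> \<le> R"
  shows "borel_prob_finite_moments \<mu>"
  using integrable_power_bounded[OF assms] assms(1) by (simp add: borel_prob_finite_moments_iff)

text \<open>Under a geometric bound on the even moments, the Taylor polynomials of the characteristic
  function, which only depend on the moments, converge.\<close>

lemma moment_determinate:
  assumes \<mu>: "borel_prob_finite_moments \<mu>" and \<nu>: "borel_prob_finite_moments \<nu>"
    and eq: "\<And>k. moment \<nu> k = moment \<mu> k" and R: "\<And>k. moment \<mu> (2 * k) \<le> R ^ (2 * k)"
  shows "\<nu> = \<mu>"
proof -
  interpret M: real_distribution \<mu> using \<mu> by (simp add: borel_prob_finite_moments_iff)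
  interpret N: real_distribution \<nu> using \<nu> by (simp add: borel_prob_finite_moments_iff)
  have int: "integrable \<mu> (\<lambda>x. x ^ k)" "integrable \<nu> (\<lambda>x. x ^ k)" for k
    using \<mu> \<nu> by (auto simp: borel_prob_finite_moments_def)
  have "char \<nu> t = char \<mu> t" for t
  proof -
    define T where "T n = (\<Sum>k\<le>n. ((\<i> * t)^k / fact k) * complex_of_real (moment \<mu> k))" for n
    \<comment> \<open>At even order the absolute moment in the Taylor remainder is an ordinary
      moment, hence common to both measures; the constant 4 comes from two remainders with constant
      2.\<close>
    have bd: "cmod (char \<nu> t - char \<mu> t) \<le> 4 * ((\<bar>t\<bar> * R) ^ (2 * m) / fact (2 * m))" for m
    proof -
      have a: "cmod (char \<mu> t - T (2 * m)) \<le> (2*\<bar>t\<bar>^(2 * m) / fact (2 * m)) * moment \<mu> (2 * m)"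
        using M.char_approx1[of "2 * m" t] int by (simp add: T_def moment_def power_even_abs)
      have b: "cmod (char \<nu> t - T (2 * m)) \<le> (2*\<bar>t\<bar>^(2 * m) / fact (2 * m)) * moment \<mu> (2 * m)"
        using N.char_approx1[of "2 * m" t] int eq by (simp add: T_def moment_def power_even_abs)
      have "cmod (char \<nu> t - char \<mu> t) \<le> cmod (char \<nu> t - T (2 * m)) + cmod (char \<mu> t - T (2 * m))"
        using norm_triangle_ineq4[of "char \<nu> t - T (2 * m)" "char \<mu> t - T (2 * m)"] by simp
      also have "\<dots> \<le> 2 * ((2*\<bar>t\<bar>^(2 * m) / fact (2 * m)) * moment \<mu> (2 * m))" using a b by simp
      also have "\<dots> \<le> 2 * ((2*\<bar>t\<bar>^(2 * m) / fact (2 * m)) * R ^ (2 * m))"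
        by (intro mult_left_mono R) auto
      finally show ?thesis by (simp add: power_mult_distrib)
    qed
    have "(\<lambda>m. 4 * ((\<bar>t\<bar> * R) ^ (2 * m) / fact (2 * m))) \<longlonglongrightarrow> 4 * 0"
    proof (intro tendsto_intros)
      have "(\<lambda>n. (\<bar>t\<bar> * R) ^ n / fact n) \<longlonglongrightarrow> 0"
        using summable_LIMSEQ_zero[OF summable_exp[of "\<bar>t\<bar> * R"]] by (simp add: field_simps)
      then have "((\<lambda>n. (\<bar>t\<bar> * R) ^ n / fact n) \<circ> (\<lambda>m. 2 * m)) \<longlonglongrightarrow> 0"
        by (rule LIMSEQ_subseq_LIMSEQ) (simp add: strict_mono_def)
      then show "(\<lambda>m. (\<bar>t\<bar> * R) ^ (2 * m) / fact (2 * m)) \<longlonglongrightarrow> 0" by (simp add: comp_def)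
    qed
    then have "cmod (char \<nu> t - char \<mu> t) \<le> 4 * 0"
      by (rule tendsto_lowerbound[OF _ always_eventually]) (use bd in auto)
    then show ?thesis by simp
  qed
  then show ?thesis
    by (intro Levy_uniqueness) (auto intro: M.real_distribution_axioms N.real_distribution_axioms)
qed

lemma even_moment_le:
  fixes \<mu> :: "real measure"
  assumes "real_distribution \<mu>" "AE x in \<mu>. \<bar>x - a\<bar> \<le> R"
  shows "(\<integral>x. (x - a) ^ (2 * k) \<partial>\<mu>) \<le> R ^ (2 * k)"
proof -
  interpret real_distribution \<mu> by fact
  have AE: "AE x in \<mu>. (x - a) ^ (2 * k) \<le> R ^ (2 * k)"
    using assms(2)
  proof eventually_elim
    case (elim x)
    then show ?case using power_mono[of "\<bar>x - a\<bar>" R "2 * k"] by (simp add: power_even_abs)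
  qed
  have "(\<integral>x. (x - a) ^ (2 * k) \<partial>\<mu>) \<le> (\<integral>x. R ^ (2 * k) \<partial>\<mu>)"
  proof (rule integral_mono_AE)
    have "AE x in \<mu>. norm ((x - a) ^ (2 * k)) \<le> R ^ (2 * k)" using AE by eventually_elim simp
    then show "integrable \<mu> (\<lambda>x. (x - a) ^ (2 * k))"
      by (intro integrable_const_bound) auto
  qed (use AE in auto)
  also have "\<dots> = R ^ (2 * k)" using prob_space by simp
  finally show ?thesis .
qed

text \<open>Markov's inequality for the power \<open>2 * k\<close>: the mass outside distance
  \<open>S > R\<close> is at most (R / S)^(2 k) for every \<open>k\<close>, hence zero.\<close>

lemma AE_bounded_of_even_moments:
  fixes \<mu> :: "real measure"
  assumes "real_distribution \<mu>" "0 \<le> R" and int: "\<And>k. integrable \<mu> (\<lambda>x. (x - a) ^ (2 * k))"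
    and le: "\<And>k. (\<integral>x. (x - a) ^ (2 * k) \<partial>\<mu>) \<le> R ^ (2 * k)"
  shows "AE x in \<mu>. \<bar>x - a\<bar> \<le> R"
proof -
  interpret real_distribution \<mu> by fact
  have null: "AE x in \<mu>. \<not> (\<bar>x - a\<bar> \<ge> R + 1 / real (Suc m))" for m
  proof -
    define S where "S = R + 1 / real (Suc m)"
    have S: "S > R" "S > 0" using \<open>0 \<le> R\<close> by (auto simp: S_def add_nonneg_pos)
    let ?A = "{x. \<bar>x - a\<bar> \<ge> S}"
    have A: "?A \<in> sets borel" by measurable
    have p: "prob ?A \<le> (R / S) ^ (2 * k)" for k
    proof -
      have "S ^ (2 * k) * prob ?A = (\<integral>x. S ^ (2 * k) * indicator ?A x \<partial>\<mu>)" using A by simp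
      also have "\<dots> \<le> (\<integral>x. (x - a) ^ (2 * k) \<partial>\<mu>)"
      proof (rule integral_mono)
        show "integrable \<mu> (\<lambda>x. S ^ (2 * k) * indicator ?A x)" using A by (intro integrable_mult_right integrable_real_indicator) (auto simp: emeasure_eq_measure)
        show "S ^ (2 * k) * indicator ?A x \<le> (x - a) ^ (2 * k)" for x
          using power_mono[of S "\<bar>x - a\<bar>" "2 * k"] S by (auto simp: indicator_def power_even_abs)
      qed (rule int)
      also have "\<dots> \<le> R ^ (2 * k)" by (rule le)
      finally show ?thesis using S by (simp add: power_divide field_simps)
    qed
    have "(\<lambda>n. (R / S) ^ n) \<longlonglongrightarrow> 0"
      using S \<open>0 \<le> R\<close> by (intro LIMSEQ_power_zero) auto
    then have "((\<lambda>n. (R / S) ^ n) \<circ> (\<lambda>m. 2 * m)) \<longlonglongrightarrow> 0"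
      by (rule LIMSEQ_subseq_LIMSEQ) (simp add: strict_mono_def)
    then have "prob ?A \<le> 0"
      by (rule tendsto_lowerbound[OF _ always_eventually]) (use p in auto)
    then have "prob ?A = 0" by (simp add: measure_le_0_iff)
    then show ?thesis unfolding S_def[symmetric]
      using A by (subst AE_iff_measurable[where N="?A"]) (auto simp: emeasure_eq_measure)
  qed
  then have "AE x in \<mu>. \<forall>m. \<not> (\<bar>x - a\<bar> \<ge> R + 1 / real (Suc m))" by (simp add: AE_all_countable)
  then show ?thesis
  proof eventually_elim
    case (elim x)
    show ?case
    proof (rule ccontr)
      assume "\<not> ?thesis"
      then obtain m where "inverse (real (Suc m)) < \<bar>x - a\<bar> - R"
        using reals_Archimedean[of "\<bar>x - a\<bar> - R"] by auto
      then show False using elim[rule_format, of m] by (simp add: inverse_eq_divide)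
    qed
  qed
qed

lemma moment_space_bounded:
  fixes \<mu> :: "real measure"
  assumes rd: "real_distribution \<mu>" and R: "AE x in \<mu>. \<bar>x\<bar> \<le> R" and S: "AE x in \<mu>. x \<in> S"
  shows "\<mu> \<in> moment_space S"
  unfolding moment_space_def
proof (intro CollectI conjI allI impI)
  show m: "borel_prob_finite_moments \<mu>" by (rule borel_prob_finite_moments_bounded[OF rd R])
  fix \<nu> assume "borel_prob_finite_moments \<nu> \<and> (\<forall>k. moment \<nu> k = moment \<mu> k)"
  then show "\<nu> = \<mu>"
    using even_moment_le[OF rd, of 0 R] R by (intro moment_determinate[OF m, of \<nu> R]) (auto simp: moment_def)
qed (rule S)

section \<open>Jacobi operators\<close>

text \<open>Sequences are indexed from \<open>1\<close>; position \<open>0\<close> is kept at \<open>0\<close>.\<close>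

definition jacobi_op :: "(nat \<Rightarrow> real) \<Rightarrow> (nat \<Rightarrow> real) \<Rightarrow> (nat \<Rightarrow> real) \<Rightarrow> nat \<Rightarrow> real" where
  "jacobi_op a b f i = (if i = 0 then 0 else b (i - 1) * f (i - 1) + a i * f i + b i * f (Suc i))"

definition unit_seq :: "nat \<Rightarrow> nat \<Rightarrow> real" where
  "unit_seq j i = (if i = j then 1 else 0)"

definition jacobi_pow :: "(nat \<Rightarrow> real) \<Rightarrow> (nat \<Rightarrow> real) \<Rightarrow> nat \<Rightarrow> nat \<Rightarrow> nat \<Rightarrow> real" where
  "jacobi_pow a b k j = (jacobi_op a b ^^ k) (unit_seq j)"

lemma jacobi_pow_0 [simp]: "jacobi_pow a b 0 j = unit_seq j"
  by (simp add: jacobi_pow_def)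

lemma jacobi_pow_Suc: "jacobi_pow a b (Suc k) j = jacobi_op a b (jacobi_pow a b k j)"
  by (simp add: jacobi_pow_def)

lemma jacobi_op_0 [simp]: "jacobi_op a b f 0 = 0"
  by (simp add: jacobi_op_def)

lemma jacobi_op_linear:
  "jacobi_op a b (\<lambda>i. c * f i + d * g i) = (\<lambda>i. c * jacobi_op a b f i + d * jacobi_op a b g i)"
  by (auto simp: jacobi_op_def fun_eq_iff algebra_simps)

lemma jacobi_op_funpow_linear:
  "(jacobi_op a b ^^ k) (\<lambda>i. c * f i + d * g i)
     = (\<lambda>i. c * (jacobi_op a b ^^ k) f i + d * (jacobi_op a b ^^ k) g i)"
  by (induction k) (simp_all add: jacobi_op_linear)

lemma jacobi_pow_zero:
  assumes "1 \<le> j" shows "jacobi_pow a b k j 0 = 0"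
  using assms by (cases k) (auto simp: jacobi_pow_Suc unit_seq_def)

lemma jacobi_pow_support: "i > k + j \<Longrightarrow> jacobi_pow a b k j i = 0"
  by (induction k arbitrary: i) (auto simp: jacobi_pow_Suc jacobi_op_def unit_seq_def)

lemma jacobi_pow_diag_pos:
  assumes "\<And>i. 1 \<le> i \<Longrightarrow> 0 < b i"
  shows "0 < jacobi_pow a b k 1 (Suc k)"
proof (induction k)
  case (Suc k)
  have "jacobi_pow a b (Suc k) 1 (Suc (Suc k)) = b (Suc k) * jacobi_pow a b k 1 (Suc k)"
    using jacobi_pow_support[of k 1 "Suc (Suc k)" a b] jacobi_pow_support[of k 1 "Suc (Suc (Suc k))" a b]
    by (simp add: jacobi_pow_Suc jacobi_op_def)
  then show ?case using Suc assms[of "Suc k"] by simp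
qed (simp add: unit_seq_def)

text \<open>Started at position 1, \<open>k\<close> applications meet only \<open>a i\<close> and
  \<open>b i\<close> with 1 \<le> i \<le> k, and \<open>b 0\<close> always multiplies the value 0 at
  position 0. Thus a matrix of size larger than \<open>k\<close> and its infinite model share the
  moment of order \<open>k\<close>.\<close>

lemma jacobi_pow_cong:
  assumes "\<And>i. 1 \<le> i \<Longrightarrow> i \<le> K \<Longrightarrow> a i = a' i \<and> b i = b' i" and "k \<le> K"
  shows "jacobi_pow a b k 1 = jacobi_pow a' b' k 1"
  using \<open>k \<le> K\<close>
proof (induction k)
  case (Suc k)
  then have IH: "jacobi_pow a' b' k 1 = jacobi_pow a b k 1" by simp
  show ?case
  proof (rule ext)
    fix i
    let ?f = "jacobi_pow a b k 1"
    have s: "?f i = 0" if "i > k + 1" for i using jacobi_pow_support that by simp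
    have z: "?f 0 = 0" by (rule jacobi_pow_zero) simp
    have e: "i \<ge> 1 \<Longrightarrow> a i * ?f i = a' i * ?f i" "i \<ge> 1 \<Longrightarrow> b i * ?f (Suc i) = b' i * ?f (Suc i)"
      "b i * ?f i = b' i * ?f i" for i
      using assms(1)[of i] s[of i] s[of "Suc i"] z Suc.prems by (cases "i = 0"; cases "i \<le> k + 1"; force)+
    show "jacobi_pow a b (Suc k) 1 i = jacobi_pow a' b' (Suc k) 1 i"
      using e(1)[of i] e(2)[of i] e(3)[of "i - 1"]
      by (auto simp: jacobi_pow_Suc IH[simplified] jacobi_op_def)
  qed
qed simp

lemma tendsto_jacobi_pow:
  assumes "\<And>i. 1 \<le> i \<Longrightarrow> ((\<lambda>x. a x i) \<longlongrightarrow> a' i) F" "\<And>i. 1 \<le> i \<Longrightarrow> ((\<lambda>x. b x i) \<longlongrightarrow> b' i) F"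
  shows "((\<lambda>x. jacobi_pow (a x) (b x) k 1 i) \<longlongrightarrow> jacobi_pow a' b' k 1 i) F"
proof (induction k arbitrary: i)
  case (Suc k)
  show ?case
  proof (cases "i = 0")
    case False
    have z: "jacobi_pow u v k 1 0 = 0" for u v by (rule jacobi_pow_zero) simp
    have "((\<lambda>x. b x (i - 1) * jacobi_pow (a x) (b x) k 1 (i - 1)) \<longlongrightarrow> b' (i - 1) * jacobi_pow a' b' k 1 (i - 1)) F"
    proof (cases "i = 1")
      case False
      with \<open>i \<noteq> 0\<close> show ?thesis by (intro tendsto_intros Suc.IH assms) auto
    qed (simp add: z[simplified])
    moreover have "((\<lambda>x. a x i * jacobi_pow (a x) (b x) k 1 i + b x i * jacobi_pow (a x) (b x) k 1 (Suc i))
       \<longlongrightarrow> a' i * jacobi_pow a' b' k 1 i + b' i * jacobi_pow a' b' k 1 (Suc i)) F"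
      using False by (intro tendsto_intros Suc.IH assms) auto
    ultimately show ?thesis
      using False by (simp add: jacobi_pow_Suc jacobi_op_def add.assoc tendsto_add)
  qed (simp add: jacobi_pow_Suc)
qed simp

section \<open>Positivity of Jacobi operators and the measures they define\<close>

lemma jacobi_op_symmetric:
  assumes "f 0 = 0" "g 0 = 0" and f: "\<And>i. i \<ge> N \<Longrightarrow> f i = 0"
  shows "(\<Sum>i=1..N. jacobi_op a b f i * g i) = (\<Sum>i=1..N. f i * jacobi_op a b g i)"
proof -
  have A: "(\<Sum>i=1..N. b (i - 1) * f (i - 1) * g i) = (\<Sum>i=1..N. b i * f i * g (Suc i))"
  proof -
    have "(\<Sum>i=1..N. b (i - 1) * f (i - 1) * g i) = (\<Sum>i<N. b i * f i * g (Suc i))"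
      by (rule sum.reindex_bij_witness[of _ Suc "\<lambda>i. i - 1"]) auto
    \<comment> \<open>\<open>f N = 0\<close> removes the boundary term
      \<open>b N * f N * g (Suc N)\<close>, and \<open>f 0 = 0\<close> the one at the other
      end.\<close>
    also have "\<dots> = (\<Sum>i=1..N. b i * f i * g (Suc i))"
      by (rule sum.mono_neutral_cong) (use assms in \<open>auto simp: not_less not_le less_Suc_eq_0_disj\<close>)
    finally show ?thesis .
  qed
  have B: "(\<Sum>i=1..N. b i * f (Suc i) * g i) = (\<Sum>i=1..N. b (i - 1) * f i * g (i - 1))"
  proof -
    have "(\<Sum>i=1..N. b i * f (Suc i) * g i) = (\<Sum>i=2..Suc N. b (i - 1) * f i * g (i - 1))"
      by (rule sum.reindex_bij_witness[of _ "\<lambda>i. i - 1" Suc]) auto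
    also have "\<dots> = (\<Sum>i=1..N. b (i - 1) * f i * g (i - 1))"
    proof (rule sum.mono_neutral_cong)
      show "b (i - 1) * f i * g (i - 1) = 0" if "i \<in> {2..Suc N} - {1..N}" for i
        using that f[of i] by auto
      show "b (i - 1) * f i * g (i - 1) = 0" if "i \<in> {1..N} - {2..Suc N}" for i
      proof -
        have "i = 1" using that by auto
        then show ?thesis using assms by simp
      qed
    qed auto
    finally show ?thesis .
  qed
  have "(\<Sum>i=1..N. jacobi_op a b f i * g i) = (\<Sum>i=1..N. b (i - 1) * f (i - 1) * g i)
    + (\<Sum>i=1..N. a i * f i * g i) + (\<Sum>i=1..N. b i * f (Suc i) * g i)"
    unfolding sum.distrib[symmetric] by (intro sum.cong) (auto simp: jacobi_op_def algebra_simps)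
  also have "\<dots> = (\<Sum>i=1..N. f i * jacobi_op a b g i)"
    unfolding A B unfolding sum.distrib[symmetric] by (intro sum.cong) (auto simp: jacobi_op_def algebra_simps)
  finally show ?thesis .
qed

lemma quadratic_form_nonneg:
  fixes x y b p q :: real
  assumes "0 \<le> x" "0 \<le> y" "b\<^sup>2 \<le> x * y"
  shows "0 \<le> x * p\<^sup>2 + y * q\<^sup>2 + 2 * b * p * q"
proof -
  have "(2 * b * p * q)\<^sup>2 = 4 * b\<^sup>2 * (p * q)\<^sup>2" by (simp add: power2_eq_square)
  also have "\<dots> \<le> 4 * (x * y) * (p * q)\<^sup>2"
    using assms by (intro mult_right_mono mult_left_mono) auto
  also have "\<dots> \<le> (x * p\<^sup>2 + y * q\<^sup>2)\<^sup>2"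
    using zero_le_power2[of "x * p\<^sup>2 - y * q\<^sup>2"] by (simp add: power2_eq_square algebra_simps)
  finally have "\<bar>2 * b * p * q\<bar> \<le> x * p\<^sup>2 + y * q\<^sup>2"
    using assms by (intro power2_le_imp_le[of "\<bar>2 * b * p * q\<bar>"]) auto
  then show ?thesis by linarith
qed

text \<open>Splitting the diagonal entry \<open>a i\<close> into \<open>x i\<close> and
  \<open>y (i - 1)\<close> turns the form into a sum over \<open>i\<close> of 2 x 2 forms in
  \<open>f i\<close> and \<open>f (Suc i)\<close>, with diagonal \<open>x i\<close>,
  \<open>y i\<close> and off-diagonal entry \<open>b i\<close>, each nonnegative. Stated with
  inequalities, it accepts crude bounds as well as exact factorizations.\<close>

lemma jacobi_op_psd:
  assumes xy: "\<And>i. 0 \<le> x i" "\<And>i. 0 \<le> y i" and a: "\<And>i. 1 \<le> i \<Longrightarrow> y (i - 1) + x i \<le> a i"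
    and b: "\<And>i. 1 \<le> i \<Longrightarrow> (b i)\<^sup>2 \<le> x i * y i"
    and f0: "f 0 = 0" and f: "\<And>i. i \<ge> N \<Longrightarrow> f i = 0"
  shows "0 \<le> (\<Sum>i=1..N. f i * jacobi_op a b f i)"
proof -
  have "(\<Sum>i=1..N. f i * jacobi_op a b f i)
     = (\<Sum>i=1..N. a i * (f i)\<^sup>2) + (\<Sum>i=1..N. b (i - 1) * f (i - 1) * f i) + (\<Sum>i=1..N. b i * f i * f (Suc i))"
    unfolding sum.distrib[symmetric]
    by (intro sum.cong) (auto simp: jacobi_op_def algebra_simps power2_eq_square)
  also have "(\<Sum>i=1..N. b (i - 1) * f (i - 1) * f i) = (\<Sum>i<N. b i * f i * f (Suc i))"
    by (rule sum.reindex_bij_witness[of _ Suc "\<lambda>i. i - 1"]) auto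
  also have "\<dots> = (\<Sum>i=1..N. b i * f i * f (Suc i))"
    by (rule sum.mono_neutral_cong) (use f0 f in \<open>auto simp: not_less not_le less_Suc_eq_0_disj\<close>)
  finally have e: "(\<Sum>i=1..N. f i * jacobi_op a b f i)
     = (\<Sum>i=1..N. a i * (f i)\<^sup>2) + 2 * (\<Sum>i=1..N. b i * f i * f (Suc i))" by simp
  have "(\<Sum>i=1..N. y i * (f (Suc i))\<^sup>2) \<le> (\<Sum>i<Suc N. y i * (f (Suc i))\<^sup>2)"
    using xy by (intro sum_mono2) auto
  also have "\<dots> = (\<Sum>i<N. y i * (f (Suc i))\<^sup>2)" using f[of "Suc N"] by simp
  also have "\<dots> = (\<Sum>i=1..N. y (i - 1) * (f i)\<^sup>2)"
    by (rule sum.reindex_bij_witness[of _ "\<lambda>i. i - 1" Suc]) auto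
  finally have y: "(\<Sum>i=1..N. y i * (f (Suc i))\<^sup>2) \<le> (\<Sum>i=1..N. y (i - 1) * (f i)\<^sup>2)" .
  have "0 \<le> (\<Sum>i=1..N. x i * (f i)\<^sup>2 + y i * (f (Suc i))\<^sup>2 + 2 * b i * f i * f (Suc i))"
    using xy b by (intro sum_nonneg quadratic_form_nonneg) auto
  also have "\<dots> \<le> (\<Sum>i=1..N. (y (i - 1) + x i) * (f i)\<^sup>2) + 2 * (\<Sum>i=1..N. b i * f i * f (Suc i))"
    using y by (simp add: sum.distrib sum_distrib_left algebra_simps)
  also have "\<dots> \<le> (\<Sum>i=1..N. a i * (f i)\<^sup>2) + 2 * (\<Sum>i=1..N. b i * f i * f (Suc i))"
    using a by (intro add_right_mono sum_mono mult_right_mono) auto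
  finally show ?thesis using e by simp
qed

text \<open>The numbers \<open>D i j = \<langle>(J - lo)\<^sup>i (hi - J)\<^sup>j e\<^sub>1, e\<^sub>1\<rangle>\<close> satisfy Hausdorff's condition:
  they are values of the quadratic forms of \<open>1\<close>, \<open>J - lo\<close>, \<open>hi - J\<close>, and the case of two odd
  exponents follows from the additive relation.\<close>

lemma jacobi_moment_measure:
  assumes lt: "lo < hi"
    and xy: "\<And>i. 0 \<le> x i" "\<And>i. 0 \<le> y i" and a: "\<And>i. 1 \<le> i \<Longrightarrow> y (i - 1) + x i \<le> a i - lo"
    and b: "\<And>i. 1 \<le> i \<Longrightarrow> (b i)\<^sup>2 \<le> x i * y i"
    and xy': "\<And>i. 0 \<le> x' i" "\<And>i. 0 \<le> y' i" and a': "\<And>i. 1 \<le> i \<Longrightarrow> y' (i - 1) + x' i \<le> hi - a i"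
    and b': "\<And>i. 1 \<le> i \<Longrightarrow> (b i)\<^sup>2 \<le> x' i * y' i"
  obtains \<mu> :: "real measure" where
    "real_distribution \<mu>" "AE x in \<mu>. lo \<le> x \<and> x \<le> hi" "\<And>k. moment \<mu> k = jacobi_pow a b k 1 1"
proof -
  let ?A = "jacobi_op (\<lambda>i. a i - lo) b" and ?B = "jacobi_op (\<lambda>i. hi - a i) (\<lambda>i. - b i)"
  let ?T = "jacobi_op a b"
  define W where "W i j = (?A ^^ i) ((?B ^^ j) (unit_seq 1))" for i j
  \<comment> \<open>Restricted to \<open>f 0 = 0\<close> because every operator resets position 0;
    \<open>W0\<close> maintains this condition.\<close>
  have B_eq: "?B f = (\<lambda>i. (hi - lo) * f i + (-1) * ?A f i)" if "f 0 = 0" for f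
    using that by (auto simp: jacobi_op_def fun_eq_iff algebra_simps)
  have comm: "?A (?B f) = ?B (?A f)" if "f 0 = 0" for f
    unfolding B_eq[of f, OF that] using B_eq[of "?A f"] jacobi_op_linear[of "\<lambda>i. a i - lo" b "hi - lo" f "-1" "?A f"] by simp
  have B0: "(?B ^^ j) (unit_seq 1) 0 = 0" for j by (cases j) (auto simp: unit_seq_def)
  have W0: "W i j 0 = 0" for i j using B0 by (cases i) (auto simp: W_def)
  have W_Suc1: "W (Suc i) j = ?A (W i j)" for i j by (simp add: W_def)
  have W_Suc2: "W i (Suc j) = ?B (W i j)" for i j
  proof (induction i)
    case (Suc i)
    then show ?case using comm[of "W i j", OF W0[of i j]] by (simp add: W_Suc1)
  qed (simp add: W_def)
  have supp_op: "jacobi_op u v f l = 0" if "\<And>l. l > m \<Longrightarrow> f l = 0" "l > Suc m" for u v f and l m :: nat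
    using that by (auto simp: jacobi_op_def)
  have B_supp: "(?B ^^ j) (unit_seq 1) l = 0" if "l > j + 1" for j l
    using that
  proof (induction j arbitrary: l)
    case (Suc j)
    have "?B ((?B ^^ j) (unit_seq 1)) l = 0"
    proof (rule supp_op[of "j + 1"])
      show "(?B ^^ j) (unit_seq 1) m = 0" if "m > j + 1" for m using Suc.IH[OF that] .
      show "l > Suc (j + 1)" using Suc.prems by simp
    qed
    then show ?case by simp
  qed (simp add: unit_seq_def)
  have W_supp: "W i j l = 0" if "l > i + j + 1" for i j l
    using that
  proof (induction i arbitrary: l)
    case (Suc i)
    show ?case unfolding W_Suc1
    proof (rule supp_op[of "i + j + 1"])
      show "W i j m = 0" if "m > i + j + 1" for m using Suc.IH[OF that] .
      show "l > Suc (i + j + 1)" using Suc.prems by simp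
    qed
  qed (simp add: W_def B_supp[simplified])
  define D where "D i j = W i j 1" for i j
  define ip :: "nat \<Rightarrow> (nat \<Rightarrow> real) \<Rightarrow> (nat \<Rightarrow> real) \<Rightarrow> real"
    where "ip N f g = (\<Sum>i=1..N. f i * g i)" for N f g
  \<comment> \<open>The range \<open>N\<close> exceeds the support of \<open>W i j\<close>, as
    \<open>jacobi_op_symmetric\<close> requires of its first argument.\<close>
  have move1: "ip N (W (Suc i) j) g = ip N (W i j) (?A g)" if "N \<ge> i + j + 2" "g 0 = 0" for N i j g
    unfolding ip_def W_Suc1 by (rule jacobi_op_symmetric) (use that W0 W_supp in auto)
  have move2: "ip N (W i (Suc j)) g = ip N (W i j) (?B g)" if "N \<ge> i + j + 2" "g 0 = 0" for N i j g
    unfolding ip_def W_Suc2 by (rule jacobi_op_symmetric) (use that W0 W_supp in auto)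
  have ip1: "ip N (W i j) (W i' j') = ip N (W 0 j) (W (i + i') j')" if "N \<ge> i + j + 2" for N i j i' j'
    using that
  proof (induction i arbitrary: i')
    case (Suc i)
    have "ip N (W (Suc i) j) (W i' j') = ip N (W i j) (W (Suc i') j')"
      using move1[of i j N "W i' j'"] Suc.prems W0 by (simp add: W_Suc1)
    then show ?case using Suc by simp
  qed simp
  have ip2: "ip N (W 0 j) (W i' j') = ip N (W 0 0) (W i' (j + j'))" if "N \<ge> j + 2" for N j i' j'
    using that
  proof (induction j arbitrary: j')
    case (Suc j)
    have "ip N (W 0 (Suc j)) (W i' j') = ip N (W 0 j) (W i' (Suc j'))"
      using move2[of 0 j N "W i' j'"] Suc.prems W0 by (simp add: W_Suc2)
    then show ?case using Suc by simp
  qed simp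
  have ip: "ip (i + j + 2) (W i j) (W i' j') = D (i + i') (j + j')" for i j i' j'
  proof -
    have "ip (i + j + 2) (W i j) (W i' j') = ip (i + j + 2) (W 0 0) (W (i + i') (j + j'))"
      using ip1[of i j "i + j + 2" i' j'] ip2[of j "i + j + 2" "i + i'" j'] by simp
    also have "\<dots> = (\<Sum>l=1..i+j+2. if l = 1 then W (i + i') (j + j') l else 0)"
      unfolding ip_def by (intro sum.cong) (auto simp: W_def[of 0 0] unit_seq_def)
    also have "\<dots> = W (i + i') (j + j') 1" by (subst sum.delta) auto
    finally show ?thesis by (simp add: D_def)
  qed
  have rec: "(hi - lo) * D i j = D (Suc i) j + D i (Suc j)" for i j
    unfolding D_def W_Suc2 W_Suc1 using B_eq[of "W i j", OF W0] by simp
  have ee: "0 \<le> D (2 * p) (2 * q)" for p q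
  proof -
    have "D (2 * p) (2 * q) = ip (p + q + 2) (W p q) (W p q)" using ip[of p q p q] by (simp add: mult_2)
    also have "\<dots> \<ge> 0" unfolding ip_def by (intro sum_nonneg) simp
    finally show ?thesis .
  qed
  have oe: "0 \<le> D (2 * p + 1) (2 * q)" for p q
  proof -
    have "D (2 * p + 1) (2 * q) = ip (p + q + 2) (W p q) (?A (W p q))"
      using ip[of p q "Suc p" q] by (simp add: mult_2 W_Suc1)
    also have "\<dots> \<ge> 0" unfolding ip_def
      by (rule jacobi_op_psd[of x y]) (use xy a b W0 W_supp in auto)
    finally show ?thesis .
  qed
  have eo: "0 \<le> D (2 * p) (2 * q + 1)" for p q
  proof -
    have "D (2 * p) (2 * q + 1) = ip (p + q + 2) (W p q) (?B (W p q))"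
      using ip[of p q p "Suc q"] by (simp add: mult_2 W_Suc2)
    also have "\<dots> \<ge> 0" unfolding ip_def
      by (rule jacobi_op_psd[of x' y']) (use xy' a' b' W0 W_supp in auto)
    finally show ?thesis .
  qed
  have oo: "0 \<le> D (2 * p + 1) (2 * q + 1)" for p q
  proof -
    have "(hi - lo) * D (2 * p + 1) (2 * q + 1) = D (2 * (p + 1)) (2 * q + 1) + D (2 * p + 1) (2 * (q + 1))"
      using rec[of "2 * p + 1" "2 * q + 1"] by simp
    then have "0 \<le> (hi - lo) * D (2 * p + 1) (2 * q + 1)" using eo[of "p + 1" q] oe[of p "q + 1"] by linarith
    then show ?thesis using lt by (simp add: zero_le_mult_iff)
  qed
  have D_nonneg: "0 \<le> D i j" for i j
  proof -
    have "i = 2 * (i div 2) \<or> i = 2 * (i div 2) + 1" "j = 2 * (j div 2) \<or> j = 2 * (j div 2) + 1" by presburger+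
    then show ?thesis using ee[of "i div 2" "j div 2"] oe[of "i div 2" "j div 2"]
      eo[of "i div 2" "j div 2"] oo[of "i div 2" "j div 2"] by metis
  qed
  have D00: "D 0 0 = 1" by (simp add: D_def W_def unit_seq_def)
  obtain \<mu> :: "real measure" where \<mu>: "real_distribution \<mu>" "AE x in \<mu>. lo \<le> x \<and> x \<le> hi"
    "\<And>k. (\<integral>x. (x - lo) ^ k \<partial>\<mu>) = D k 0"
    using hausdorff_moment[of lo hi D, OF lt D_nonneg rec D00] by blast
  interpret \<mu>: real_distribution \<mu> by (rule \<mu>)
  have int: "integrable \<mu> (\<lambda>x. x ^ k * (x - lo) ^ i)" for k i
  proof (rule \<mu>.integrable_const_bound)
    show "AE x in \<mu>. norm (x ^ k * (x - lo) ^ i) \<le> (\<bar>lo\<bar> + \<bar>hi\<bar>) ^ k * (hi - lo) ^ i"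
      using \<mu>(2)
    proof eventually_elim
      case (elim x)
      then have "\<bar>x\<bar> ^ k * \<bar>x - lo\<bar> ^ i \<le> (\<bar>lo\<bar> + \<bar>hi\<bar>) ^ k * (hi - lo) ^ i"
        by (intro mult_mono power_mono) auto
      then show ?case by (simp add: abs_mult power_abs)
    qed
  qed simp
  \<comment> \<open>Peeling off x = (x - lo) + lo, which mirrors J = (J - lo) + lo acting on
    \<open>W i 0\<close>, converts shifted moments into moments. The exponent \<open>i\<close> stays
    general because each step raises it.\<close>
  have "(\<integral>x. x ^ k * (x - lo) ^ i \<partial>\<mu>) = (?T ^^ k) (W i 0) 1" for k i
  proof (induction k arbitrary: i)
    case (Suc k)
    have "(\<integral>x. x ^ Suc k * (x - lo) ^ i \<partial>\<mu>) = (\<integral>x. x ^ k * (x - lo) ^ Suc i + lo * (x ^ k * (x - lo) ^ i) \<partial>\<mu>)"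
      by (simp add: algebra_simps)
    also have "\<dots> = (?T ^^ k) (W (Suc i) 0) 1 + lo * (?T ^^ k) (W i 0) 1"
      using int by (subst Bochner_Integration.integral_add) (simp_all add: Suc.IH del: power_Suc)
    also have "\<dots> = (?T ^^ k) (\<lambda>l. 1 * W (Suc i) 0 l + lo * W i 0 l) 1"
      unfolding jacobi_op_funpow_linear by simp
    also have "(\<lambda>l. 1 * W (Suc i) 0 l + lo * W i 0 l) = ?T (W i 0)"
      using W0[of i 0] by (auto simp: W_Suc1 jacobi_op_def fun_eq_iff algebra_simps)
    finally show ?case by (simp add: funpow_swap1)
  qed (simp add: \<mu>(3) D_def)
  from this[of _ 0] have "moment \<mu> k = jacobi_pow a b k 1 1" for k
    by (simp add: moment_def jacobi_pow_def W_def)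
  with \<mu>(1,2) show thesis by (rule that)
qed

text \<open>Constant sequences \<open>x = y = R\<close> meet the conditions at distance 3 R from 0:
  2 R for the two parts and R for the size of \<open>a i\<close>. The extra 1 keeps the interval
  nondegenerate when R = 0.\<close>

lemma jacobi_moment_measure_bounded:
  assumes "\<And>i. 1 \<le> i \<Longrightarrow> \<bar>a i\<bar> \<le> R" "\<And>i. 1 \<le> i \<Longrightarrow> \<bar>b i\<bar> \<le> R" "0 \<le> R"
  obtains \<mu> :: "real measure" where
    "real_distribution \<mu>" "AE x in \<mu>. \<bar>x\<bar> \<le> 3 * R + 1" "\<And>k. moment \<mu> k = jacobi_pow a b k 1 1"
proof -
  have b: "(b i)\<^sup>2 \<le> R * R" if "1 \<le> i" for i
    using assms(2)[OF that] power_mono[of "\<bar>b i\<bar>" R 2] by (simp add: power2_eq_square)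
  have a: "R + R \<le> a i - (- (3 * R + 1))" "R + R \<le> 3 * R + 1 - a i" if "1 \<le> i" for i
    using assms(1)[OF that] by auto
  obtain \<mu> :: "real measure" where \<mu>: "real_distribution \<mu>" "AE x in \<mu>. - (3 * R + 1) \<le> x \<and> x \<le> 3 * R + 1"
      "\<And>k. moment \<mu> k = jacobi_pow a b k 1 1"
    using jacobi_moment_measure[of "- (3 * R + 1)" "3 * R + 1" "\<lambda>_. R" "\<lambda>_. R" a b "\<lambda>_. R" "\<lambda>_. R"] a b assms(3)
    by auto
  show thesis by (rule that[OF \<mu>(1) _ \<mu>(3)]) (use \<mu>(2) in \<open>eventually_elim, auto\<close>)
qed

section \<open>Spectral measures of finite tridiagonal matrices\<close>

lemma tridiagonal_pow_entry:
  fixes J :: "real mat"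
  assumes J: "J = mat n n (\<lambda>(i, j). if i = j then a (Suc i) else if j = Suc i then b (Suc i)
                 else if i = Suc j then b (Suc j) else 0)"
    and bn: "b n = 0" and "j < n"
  shows "(J ^\<^sub>m k) $$ (0, j) = jacobi_pow a b k 1 (Suc j)"
  using \<open>j < n\<close>
proof (induction k arbitrary: j)
  case 0
  have "dim_row J = n" by (simp add: J)
  with 0 show ?case by (cases "j = 0") (simp_all add: unit_seq_def)
next
  case (Suc k)
  have carr: "J \<in> carrier_mat n n" by (simp add: J)
  have "(J ^\<^sub>m Suc k) $$ (0, j) = (\<Sum>l\<in>{0..<n}. (J ^\<^sub>m k) $$ (0, l) * J $$ (l, j))"
    using Suc.prems carr pow_carrier_mat[OF carr, of k] by (simp add: scalar_prod_def)
  also have "\<dots> = (\<Sum>l\<in>{0..<n}. jacobi_pow a b k 1 (Suc l) * J $$ (l, j))"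
    by (intro sum.cong) (auto simp: Suc.IH)
  also have "\<dots> = (\<Sum>l\<in>{0..<n}. (if l = j then a (Suc j) * jacobi_pow a b k 1 (Suc j) else 0)
      + (if l = j - 1 then (if j = 0 then 0 else b j * jacobi_pow a b k 1 j) else 0)
      + (if l = Suc j then b (Suc j) * jacobi_pow a b k 1 (Suc (Suc j)) else 0))"
    using Suc.prems by (intro sum.cong) (auto simp: J)
  also have "\<dots> = a (Suc j) * jacobi_pow a b k 1 (Suc j)
      + (if j = 0 then 0 else b j * jacobi_pow a b k 1 j)
      + (if Suc j < n then b (Suc j) * jacobi_pow a b k 1 (Suc (Suc j)) else 0)"
    using Suc.prems by (simp add: sum.distrib sum.delta)
  \<comment> \<open>In the last column, \<open>Suc j = n\<close>, the missing neighbour is supplied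
    with the coefficient \<open>b n = 0\<close>.\<close>
  also have "(if Suc j < n then b (Suc j) * jacobi_pow a b k 1 (Suc (Suc j)) else 0)
      = b (Suc j) * jacobi_pow a b k 1 (Suc (Suc j))"
    using Suc.prems bn by (cases "Suc j < n") (auto simp: not_less le_Suc_eq)
  also have "(if j = 0 then 0 else b j * jacobi_pow a b k 1 j) = b j * jacobi_pow a b k 1 j"
    using jacobi_pow_zero[of 1 a b k] by auto
  finally show ?case by (simp add: jacobi_pow_Suc jacobi_op_def)
qed

text \<open>Extended by zeros, the matrix is a bounded Jacobi operator, so its measure comes from
  Hausdorff's theorem instead of a diagonalization. The sign of \<open>b\<close> is left open; hence
  the description holds for every outcome of the random matrix, also where an off-diagonal entry
  vanishes.\<close>

lemma spectral_measure_tridiagonal: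
  fixes J :: "real mat"
  assumes J: "J = mat n n (\<lambda>(i, j). if i = j then a (Suc i) else if j = Suc i then b (Suc i)
                 else if i = Suc j then b (Suc j) else 0)"
    and b0: "\<And>i. i \<ge> n \<Longrightarrow> b i = 0" and a0: "\<And>i. i > n \<Longrightarrow> a i = 0" and n: "n \<ge> 1"
  shows "\<exists>R. real_distribution (spectral_measure J) \<and> (AE x in spectral_measure J. \<bar>x\<bar> \<le> R)
           \<and> (\<forall>k. moment (spectral_measure J) k = jacobi_pow a b k 1 1)"
proof -
  define R where "R = (\<Sum>i\<le>n. \<bar>a i\<bar> + \<bar>b i\<bar>)"
  have le: "\<bar>a i\<bar> + \<bar>b i\<bar> \<le> R" for i
  proof (cases "i \<le> n")
    case True
    then show ?thesis unfolding R_def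
      by (intro member_le_sum[of i "{..n}" "\<lambda>i. \<bar>a i\<bar> + \<bar>b i\<bar>"]) auto
  qed (simp add: a0 b0 R_def sum_nonneg)
  have R: "\<bar>a i\<bar> \<le> R" "\<bar>b i\<bar> \<le> R" "0 \<le> R" for i
    using le[of i] abs_ge_zero[of "a i"] abs_ge_zero[of "b i"] by linarith+
  obtain \<mu> :: "real measure" where \<mu>: "real_distribution \<mu>" "AE x in \<mu>. \<bar>x\<bar> \<le> 3 * R + 1"
    "\<And>k. moment \<mu> k = jacobi_pow a b k 1 1"
    using jacobi_moment_measure_bounded[of a R b] R by blast
  have entry: "(J ^\<^sub>m k) $$ (0, 0) = jacobi_pow a b k 1 1" for k
    using tridiagonal_pow_entry[OF J b0[OF order_refl], of 0 k] n by simp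
  have "spectral_measure J = \<mu>"
    unfolding spectral_measure_def entry
  proof (rule the_equality)
    show m: "borel_prob_finite_moments \<mu> \<and> (\<forall>k. moment \<mu> k = jacobi_pow a b k 1 1)"
      using borel_prob_finite_moments_bounded[OF \<mu>(1,2)] \<mu>(3) by simp
    fix \<nu> assume \<nu>: "borel_prob_finite_moments \<nu> \<and> (\<forall>k. moment \<nu> k = jacobi_pow a b k 1 1)"
    show "\<nu> = \<mu>"
      by (rule moment_determinate[where R="3 * R + 1"])
        (use m \<nu> even_moment_le[OF \<mu>(1), of 0 "3 * R + 1"] \<mu>(2) in \<open>auto simp: moment_def\<close>)
  qed
  then show ?thesis using \<mu> by blast
qed

section \<open>Jacobi coefficients\<close>

lemma integrable_poly:
  assumes "borel_prob_finite_moments \<mu>"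
  shows "integrable \<mu> (\<lambda>x. poly p x)"
  using assms by (simp add: borel_prob_finite_moments_def poly_altdef)

lemma poly_inner_sum_smult:
  assumes "borel_prob_finite_moments \<mu>" "finite A"
  shows "poly_inner \<mu> (p - (\<Sum>j\<in>A. Polynomial.smult (w j) (q j))) r
     = poly_inner \<mu> p r - (\<Sum>j\<in>A. w j * poly_inner \<mu> (q j) r)"
proof -
  have int: "integrable \<mu> (\<lambda>x. poly u x * poly v x)" for u v
    using integrable_poly[OF assms(1), of "u * v"] by simp
  show ?thesis
    by (simp add: poly_inner_def left_diff_distrib poly_sum sum_distrib_right mult.assoc
        Bochner_Integration.integral_diff Bochner_Integration.integral_sum int)
qed

lemma poly_inner_commute: "poly_inner \<mu> p q = poly_inner \<mu> q p"
  by (simp add: poly_inner_def mult.commute)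

lemma poly_inner_smult:
  "poly_inner \<mu> (Polynomial.smult c p) (Polynomial.smult d q) = c * d * poly_inner \<mu> p q"
proof -
  have "poly_inner \<mu> (Polynomial.smult c p) (Polynomial.smult d q) = (\<integral>x. (c * d) * (poly p x * poly q x) \<partial>\<mu>)"
    unfolding poly_inner_def by (intro Bochner_Integration.integral_cong) (auto simp: algebra_simps)
  then show ?thesis by (simp add: poly_inner_def)
qed

text \<open>For a finitely supported measure some Gram-Schmidt polynomials have norm 0 and the
  projection coefficient becomes a division by 0. Such a polynomial vanishes almost everywhere, so
  that orthogonality survives.\<close>

lemma poly_inner_self_zero:
  assumes m: "borel_prob_finite_moments \<mu>" and "poly_inner \<mu> p p = 0"
  shows "poly_inner \<mu> q p = 0"
proof -
  have "AE x in \<mu>. poly p x * poly p x = 0"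
    using assms(2) integrable_poly[OF m, of "p * p"] unfolding poly_inner_def
    by (subst (asm) integral_nonneg_eq_0_iff_AE) auto
  then have "AE x in \<mu>. poly q x * poly p x = 0" by eventually_elim auto
  then show ?thesis unfolding poly_inner_def by (rule integral_eq_zero_AE)
qed

lemma gram_schmidt_orthogonal:
  assumes m: "borel_prob_finite_moments \<mu>"
  shows "i < k \<Longrightarrow> poly_inner \<mu> (gram_schmidt_poly \<mu> k) (gram_schmidt_poly \<mu> i) = 0"
proof (induction k arbitrary: i rule: less_induct)
  case (less k)
  let ?p = "gram_schmidt_poly \<mu>"
  have orth: "poly_inner \<mu> (?p j) (?p i) = 0" if "j < k" "j \<noteq> i" for j
    using less.IH[of j i] less.IH[of i j] less.prems that
    by (cases "i < j") (auto simp: poly_inner_commute[of \<mu> "?p i" "?p j"])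
  have "poly_inner \<mu> (?p k) (?p i) = poly_inner \<mu> (Polynomial.monom 1 k) (?p i)
     - (\<Sum>j\<in>{..<k}. poly_inner \<mu> (Polynomial.monom 1 k) (?p j) / poly_inner \<mu> (?p j) (?p j) * poly_inner \<mu> (?p j) (?p i))"
    by (subst gram_schmidt_poly.simps) (rule poly_inner_sum_smult[OF m finite_lessThan])
  also have "(\<Sum>j\<in>{..<k}. poly_inner \<mu> (Polynomial.monom 1 k) (?p j) / poly_inner \<mu> (?p j) (?p j) * poly_inner \<mu> (?p j) (?p i))
     = (\<Sum>j\<in>{..<k}. if j = i then poly_inner \<mu> (Polynomial.monom 1 k) (?p i) / poly_inner \<mu> (?p i) (?p i) * poly_inner \<mu> (?p i) (?p i) else 0)"
    by (intro sum.cong) (auto simp: orth)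
  also have "\<dots> = poly_inner \<mu> (Polynomial.monom 1 k) (?p i) / poly_inner \<mu> (?p i) (?p i) * poly_inner \<mu> (?p i) (?p i)"
    using less.prems by (subst sum.delta) auto
  \<comment> \<open>If the norm is 0, the left side is 0 by the convention for division and the
    right side by \<open>poly_inner_self_zero\<close>.\<close>
  also have "\<dots> = poly_inner \<mu> (Polynomial.monom 1 k) (?p i)"
    using poly_inner_self_zero[OF m, of "?p i"] by (cases "poly_inner \<mu> (?p i) (?p i) = 0") auto
  finally show ?case by simp
qed

text \<open>\<open>g\<close> is a formal eigenvector, J g = x g with \<open>g 1 = 1\<close>, so x^m
  is the first entry of J^m g; symmetry moves J^m to the first unit vector. Applied below to
  orthonormal polynomials and to Chebyshev polynomials.\<close>

lemma power_eq_jacobi_sum: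
  fixes g :: "nat \<Rightarrow> real"
  assumes g0: "g 0 = 0" "g 1 = 1"
    and rec: "\<And>i. 1 \<le> i \<Longrightarrow> x * g i = b i * g (Suc i) + a i * g i + b (i - 1) * g (i - 1)"
    and "N \<ge> m + 1"
  shows "x ^ m = (\<Sum>i=1..N. jacobi_pow a b m 1 i * g i)"
  using \<open>N \<ge> m + 1\<close>
proof (induction m)
  case 0
  have "(\<Sum>i=1..N. jacobi_pow a b 0 1 i * g i) = (\<Sum>i=1..N. if i = 1 then g 1 else 0)"
    by (intro sum.cong) (auto simp: unit_seq_def)
  then show ?case using 0 g0 by (simp add: sum.delta)
next
  case (Suc m)
  have "x ^ Suc m = (\<Sum>i=1..N. jacobi_pow a b m 1 i * (x * g i))"
    using Suc by (simp add: sum_distrib_left mult_ac)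
  also have "\<dots> = (\<Sum>i=1..N. jacobi_pow a b m 1 i * jacobi_op a b g i)"
    by (intro sum.cong) (auto simp: rec jacobi_op_def algebra_simps)
  also have "\<dots> = (\<Sum>i=1..N. jacobi_pow a b (Suc m) 1 i * g i)"
    unfolding jacobi_pow_Suc
    by (rule jacobi_op_symmetric[symmetric]) (use g0 Suc.prems in \<open>auto simp: jacobi_pow_support jacobi_pow_zero[of 1, simplified]\<close>)
  finally show ?case .
qed

lemma orthonormal_poly_1:
  assumes "borel_prob_finite_moments \<mu>"
  shows "orthonormal_poly \<mu> 1 = 1"
proof -
  interpret prob_space \<mu> using assms by (simp add: borel_prob_finite_moments_def)
  have "gram_schmidt_poly \<mu> 0 = 1" by (subst gram_schmidt_poly.simps) (simp add: monom_0)
  then show ?thesis by (simp add: orthonormal_poly_def poly_inner_def prob_space)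
qed

text \<open>Integrate the expansion of x^k in the orthonormal polynomials: all but the first are
  orthogonal to the constant 1.\<close>

lemma jacobi_coefficients_moment:
  assumes m: "borel_prob_finite_moments \<mu>" and J: "jacobi_coefficients \<mu> a b"
  shows "moment \<mu> k = jacobi_pow a b k 1 1"
proof -
  interpret prob_space \<mu> using m by (simp add: borel_prob_finite_moments_def)
  let ?P = "orthonormal_poly \<mu>"
  have zero: "(\<integral>x. poly (?P i) x \<partial>\<mu>) = (if i = 1 then 1 else 0)" for i
  proof (cases "i \<le> 1")
    case True
    then consider "i = 0" | "i = 1" by linarith
    then show ?thesis
      using orthonormal_poly_1[OF m] by cases (auto simp: orthonormal_poly_def prob_space)
  next
    case False
    have "gram_schmidt_poly \<mu> 0 = 1" by (subst gram_schmidt_poly.simps) (simp add: monom_0)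
    then have "(\<integral>x. poly (gram_schmidt_poly \<mu> (i - 1)) x \<partial>\<mu>) = 0"
      using gram_schmidt_orthogonal[OF m, of 0 "i - 1"] False by (simp add: poly_inner_def)
    then show ?thesis using False by (simp add: orthonormal_poly_def Let_def)
  qed
  have "x ^ k = (\<Sum>i=1..k+1. jacobi_pow a b k 1 i * poly (?P i) x)" for x
  proof (rule power_eq_jacobi_sum)
    show "poly (?P 0) x = 0" by (simp add: orthonormal_poly_def)
    show "poly (?P 1) x = 1" by (simp only: orthonormal_poly_1[OF m] poly_1)
    fix i :: nat assume "1 \<le> i"
    then have e: "Polynomial.monom 1 1 * ?P i = Polynomial.smult (b i) (?P (i + 1)) + Polynomial.smult (a i) (?P i)
          + Polynomial.smult (b (i - 1)) (?P (i - 1))"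
      using J by (simp add: jacobi_coefficients_def)
    show "x * poly (?P i) x = b i * poly (?P (Suc i)) x + a i * poly (?P i) x + b (i - 1) * poly (?P (i - 1)) x"
      using arg_cong[OF e, of "\<lambda>p. poly p x"] by (simp add: poly_monom)
  qed simp
  then have "moment \<mu> k = (\<integral>x. (\<Sum>i=1..k+1. jacobi_pow a b k 1 i * poly (?P i) x) \<partial>\<mu>)"
    by (simp add: moment_def)
  also have "\<dots> = (\<Sum>i=1..k+1. jacobi_pow a b k 1 i * (if i = 1 then 1 else 0))"
    by (subst Bochner_Integration.integral_sum) (auto simp: integrable_poly[OF m] zero)
  also have "\<dots> = (\<Sum>i=1..k+1. if i = 1 then jacobi_pow a b k 1 1 else 0)" by (intro sum.cong) auto
  finally show ?thesis by (simp add: sum.delta)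
qed

section \<open>Orthonormality recovered from a three-term recursion\<close>

fun jacobi_poly :: "(nat \<Rightarrow> real) \<Rightarrow> (nat \<Rightarrow> real) \<Rightarrow> nat \<Rightarrow> real poly" where
  "jacobi_poly a b 0 = 0"
| "jacobi_poly a b (Suc 0) = 1"
| "jacobi_poly a b (Suc (Suc k)) = Polynomial.smult (1 / b (Suc k))
     (Polynomial.monom 1 1 * jacobi_poly a b (Suc k) - Polynomial.smult (a (Suc k)) (jacobi_poly a b (Suc k))
      - Polynomial.smult (b k) (jacobi_poly a b k))"

lemma jacobi_poly_rec:
  assumes "1 \<le> k" "b k \<noteq> 0"
  shows "Polynomial.monom 1 1 * jacobi_poly a b k = Polynomial.smult (b k) (jacobi_poly a b (Suc k))
     + Polynomial.smult (a k) (jacobi_poly a b k) + Polynomial.smult (b (k - 1)) (jacobi_poly a b (k - 1))"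
  using assms by (cases k) auto

lemma poly_jacobi_poly_rec:
  assumes "1 \<le> k" "b k \<noteq> 0"
  shows "x * poly (jacobi_poly a b k) x = b k * poly (jacobi_poly a b (Suc k)) x
     + a k * poly (jacobi_poly a b k) x + b (k - 1) * poly (jacobi_poly a b (k - 1)) x"
  using arg_cong[OF jacobi_poly_rec[where b=b and a=a, OF assms], of "\<lambda>p. poly p x"] by (simp add: poly_monom)

text \<open>Matrix elements of x^k and entries of J^k satisfy the same recursions in both indices
  and agree for \<open>i = j = 1\<close> by \<open>mom\<close>. The power \<open>k\<close> stays
  general because raising an index multiplies by x; orthonormality is the case k = 0.\<close>

lemma jacobi_poly_orthonormal:
  assumes m: "borel_prob_finite_moments \<mu>" and b: "\<And>i. 1 \<le> i \<Longrightarrow> 0 < b i"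
    and mom: "\<And>k. moment \<mu> k = jacobi_pow a b k 1 1" and "1 \<le> i" "1 \<le> j"
  shows "(\<integral>x. x ^ k * poly (jacobi_poly a b i) x * poly (jacobi_poly a b j) x \<partial>\<mu>) = jacobi_pow a b k j i"
proof -
  let ?Q = "jacobi_poly a b"
  have int: "integrable \<mu> (\<lambda>x. x ^ k * poly u x * poly v x)" for k u v
    using integrable_poly[OF m, of "Polynomial.monom 1 k * u * v"] by (simp add: poly_monom)
  have int1: "integrable \<mu> (\<lambda>x. x ^ k * poly u x)" for k u
    using int[of k u 1] by simp
  have step: "b (Suc j) * poly (?Q (Suc (Suc j))) x
      = x * poly (?Q (Suc j)) x - a (Suc j) * poly (?Q (Suc j)) x - b j * poly (?Q j) x" for j x
    using poly_jacobi_poly_rec[of "Suc j" b x a] b[of "Suc j"] by (simp del: jacobi_poly.simps(3))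
  have first: "(\<integral>x. x ^ k * poly (?Q i) x \<partial>\<mu>) = jacobi_pow a b k 1 i" for i k
  proof (induction i arbitrary: k rule: induct_nat_012)
    case 0
    then show ?case using jacobi_pow_zero[of 1 a b k] by simp
  next
    case 1
    then show ?case using mom[of k] by (simp add: moment_def)
  next
    case (ge2 i)
    have "b (Suc i) * (\<integral>x. x ^ k * poly (?Q (Suc (Suc i))) x \<partial>\<mu>)
        = (\<integral>x. x ^ k * (b (Suc i) * poly (?Q (Suc (Suc i))) x) \<partial>\<mu>)"
      by (simp add: mult.left_commute)
    also have "\<dots> = (\<integral>x. x ^ Suc k * poly (?Q (Suc i)) x - a (Suc i) * (x ^ k * poly (?Q (Suc i)) x) - b i * (x ^ k * poly (?Q i) x) \<partial>\<mu>)"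
      unfolding step by (simp add: algebra_simps)
    also have "\<dots> = (\<integral>x. x ^ Suc k * poly (?Q (Suc i)) x \<partial>\<mu>) - a (Suc i) * (\<integral>x. x ^ k * poly (?Q (Suc i)) x \<partial>\<mu>)
          - b i * (\<integral>x. x ^ k * poly (?Q i) x \<partial>\<mu>)"
      by (simp del: power_Suc add: int1)
    also have "\<dots> = jacobi_pow a b (Suc k) 1 (Suc i) - a (Suc i) * jacobi_pow a b k 1 (Suc i) - b i * jacobi_pow a b k 1 i"
      unfolding ge2(1) ge2(2) ..
    also have "\<dots> = b (Suc i) * jacobi_pow a b k 1 (Suc (Suc i))"
      by (simp add: jacobi_pow_Suc jacobi_op_def)
    finally show ?case using b[of "Suc i"] by simp
  qed
  have "(\<integral>x. x ^ k * poly (?Q i) x * poly (?Q j) x \<partial>\<mu>) = (if j = 0 then 0 else jacobi_pow a b k j i)" for j k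
  proof (induction j arbitrary: k rule: induct_nat_012)
    case 1
    then show ?case using first[of k i] by simp
  next
    case (ge2 j)
    have "b (Suc j) * (\<integral>x. x ^ k * poly (?Q i) x * poly (?Q (Suc (Suc j))) x \<partial>\<mu>)
        = (\<integral>x. x ^ k * poly (?Q i) x * (b (Suc j) * poly (?Q (Suc (Suc j))) x) \<partial>\<mu>)"
      by (simp add: mult.left_commute)
    also have "\<dots> = (\<integral>x. x ^ Suc k * poly (?Q i) x * poly (?Q (Suc j)) x - a (Suc j) * (x ^ k * poly (?Q i) x * poly (?Q (Suc j)) x)
         - b j * (x ^ k * poly (?Q i) x * poly (?Q j) x) \<partial>\<mu>)"
      unfolding step by (simp add: algebra_simps)
    also have "\<dots> = (\<integral>x. x ^ Suc k * poly (?Q i) x * poly (?Q (Suc j)) x \<partial>\<mu>)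
       - a (Suc j) * (\<integral>x. x ^ k * poly (?Q i) x * poly (?Q (Suc j)) x \<partial>\<mu>)
       - b j * (\<integral>x. x ^ k * poly (?Q i) x * poly (?Q j) x \<partial>\<mu>)"
      by (simp del: power_Suc add: int)
    also have "\<dots> = jacobi_pow a b (Suc k) (Suc j) i - a (Suc j) * jacobi_pow a b k (Suc j) i
        - (if j = 0 then 0 else b j * jacobi_pow a b k j i)"
      unfolding ge2 by simp
    also have "\<dots> = b (Suc j) * jacobi_pow a b k (Suc (Suc j)) i"
    proof -
      \<comment> \<open>A column of the operator. The guard drops the entry at position 0, where the
        operator always returns 0.\<close>
      have "jacobi_op a b (unit_seq (Suc j)) = (\<lambda>l. 1 * (b (Suc j) * unit_seq (Suc (Suc j)) l + a (Suc j) * unit_seq (Suc j) l)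
          + (if j = 0 then 0 else b j) * unit_seq j l)"
        by (auto simp: jacobi_op_def unit_seq_def fun_eq_iff)
      then have "jacobi_pow a b (Suc k) (Suc j) = (\<lambda>l. 1 * (b (Suc j) * jacobi_pow a b k (Suc (Suc j)) l + a (Suc j) * jacobi_pow a b k (Suc j) l)
          + (if j = 0 then 0 else b j) * jacobi_pow a b k j l)"
        unfolding jacobi_pow_def funpow_Suc_right comp_def by (simp only: jacobi_op_funpow_linear)
      then show ?thesis by simp
    qed
    finally show ?case using b[of "Suc j"] by simp
  qed simp
  then show ?thesis using \<open>1 \<le> j\<close> by simp
qed

lemma monom_eq_jacobi_poly_sum:
  assumes b: "\<And>i. 1 \<le> i \<Longrightarrow> 0 < b i"
  shows "Polynomial.monom 1 m = (\<Sum>i=1..m+1. Polynomial.smult (jacobi_pow a b m 1 i) (jacobi_poly a b i))"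
proof -
  have "poly (Polynomial.monom 1 m) x = poly (\<Sum>i=1..m+1. Polynomial.smult (jacobi_pow a b m 1 i) (jacobi_poly a b i)) x" for x
    unfolding poly_monom poly_sum poly_smult
    using power_eq_jacobi_sum[of "\<lambda>i. poly (jacobi_poly a b i) x" x b a m "m + 1"]
      poly_jacobi_poly_rec[of _ b x a] b by (auto simp: less_imp_neq[symmetric])
  then show ?thesis by (simp add: poly_eq_poly_eq_iff[symmetric] fun_eq_iff)
qed

text \<open>The factor is the product b 1 ... b k, the norm of the monic orthogonal polynomial. The
  coordinates of x^k in the \<open>jacobi_poly\<close> basis are its projections, so subtracting
  those below \<open>k\<close> leaves the top term.\<close>

lemma gram_schmidt_eq_jacobi_poly:
  assumes m: "borel_prob_finite_moments \<mu>" and b: "\<And>i. 1 \<le> i \<Longrightarrow> 0 < b i"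
    and mom: "\<And>k. moment \<mu> k = jacobi_pow a b k 1 1"
  shows "gram_schmidt_poly \<mu> k = Polynomial.smult (jacobi_pow a b k 1 (Suc k)) (jacobi_poly a b (Suc k))"
proof (induction k rule: less_induct)
  case (less k)
  let ?Q = "jacobi_poly a b" and ?p = "gram_schmidt_poly \<mu>" and ?w = "\<lambda>k. jacobi_pow a b k 1 (Suc k)"
  have w: "?w k > 0" for k by (rule jacobi_pow_diag_pos[OF b])
  have orth: "poly_inner \<mu> (?Q i) (?Q j) = (if i = j then 1 else 0)" if "1 \<le> i" "1 \<le> j" for i j
    using jacobi_poly_orthonormal[OF m b mom that, of 0] by (simp add: poly_inner_def unit_seq_def)
  note smult = poly_inner_smult[of \<mu>]
  have monom: "poly_inner \<mu> (Polynomial.monom 1 k) (?Q (Suc j)) = jacobi_pow a b k 1 (Suc j)" for j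
    using jacobi_poly_orthonormal[OF m b mom, of "Suc j" 1 k] by (simp add: poly_inner_def poly_monom)
  have "Polynomial.smult (poly_inner \<mu> (Polynomial.monom 1 k) (?p j) / poly_inner \<mu> (?p j) (?p j)) (?p j)
      = Polynomial.smult (jacobi_pow a b k 1 (Suc j)) (?Q (Suc j))" if "j < k" for j
  proof -
    have "poly_inner \<mu> (?p j) (?p j) = ?w j * ?w j" using less[OF that] smult orth[of "Suc j" "Suc j"] by simp
    moreover have "poly_inner \<mu> (Polynomial.monom 1 k) (?p j) = ?w j * jacobi_pow a b k 1 (Suc j)"
      using less[OF that] smult[of 1 "Polynomial.monom 1 k" "?w j" "?Q (Suc j)"] monom[of j] by (simp add: mult.commute)
    ultimately show ?thesis using less[OF that] w[of j] by simp
  qed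
  then have "?p k = Polynomial.monom 1 k - (\<Sum>j<k. Polynomial.smult (jacobi_pow a b k 1 (Suc j)) (?Q (Suc j)))"
    by (subst gram_schmidt_poly.simps) simp
  also have "(\<Sum>j<k. Polynomial.smult (jacobi_pow a b k 1 (Suc j)) (?Q (Suc j)))
      = (\<Sum>i=1..k. Polynomial.smult (jacobi_pow a b k 1 i) (?Q i))"
    by (rule sum.reindex_bij_witness[of _ "\<lambda>i. i - 1" Suc]) auto
  also have "Polynomial.monom 1 k = (\<Sum>i=1..k+1. Polynomial.smult (jacobi_pow a b k 1 i) (?Q i))"
    by (rule monom_eq_jacobi_poly_sum[OF b])
  finally show ?case by simp
qed

text \<open>By Lindelof's theorem countably many open null sets cover the complement of the
  support.\<close>

lemma measure_support_compl_null:
  fixes \<mu> :: "real measure"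
  assumes "real_distribution \<mu>"
  shows "AE x in \<mu>. x \<in> measure_support \<mu>"
proof -
  interpret real_distribution \<mu> by fact
  define F where "F = {U :: real set. open U \<and> emeasure \<mu> U = 0}"
  obtain F' where F': "F' \<subseteq> F" "countable F'" "\<Union>F' = \<Union>F"
    using Lindelof[of F] by (auto simp: F_def)
  have "AE x in \<mu>. \<forall>U\<in>F'. x \<notin> U"
    using F' by (subst AE_ball_countable)
      (auto simp: F_def intro!: AE_not_in simp: null_sets_def subset_eq)
  then show ?thesis
  proof eventually_elim
    case (elim x)
    then have "x \<notin> \<Union>F" using F'(3) by auto
    then show ?case by (auto simp: measure_support_def F_def zero_less_iff_neq_zero)
  qed
qed

text \<open>A finite support would be the zero set of some nonzero polynomial \<open>p\<close>, but
  the pairing of \<open>p\<close> with the orthonormal polynomial of the same degree is its leading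
  coefficient times a positive number.\<close>

lemma infinite_support_of_jacobi:
  assumes m: "borel_prob_finite_moments \<mu>" and b: "\<And>i. 1 \<le> i \<Longrightarrow> 0 < b i"
    and mom: "\<And>k. moment \<mu> k = jacobi_pow a b k 1 1"
  shows "infinite (measure_support \<mu>)"
proof
  assume fin: "finite (measure_support \<mu>)"
  have rd: "real_distribution \<mu>" using m by (simp add: borel_prob_finite_moments_iff)
  define p where "p = (\<Prod>s\<in>measure_support \<mu>. [:-s, 1:])"
  have p: "p \<noteq> 0" "\<And>x. x \<in> measure_support \<mu> \<Longrightarrow> poly p x = 0"
    using fin by (auto simp: p_def poly_prod prod_zero_iff)
  let ?N = "degree p" and ?q = "jacobi_poly a b (Suc (degree p))"
  have int: "integrable \<mu> (\<lambda>x. x ^ k * poly u x)" for k u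
    using integrable_poly[OF m, of "Polynomial.monom 1 k * u"] by (simp add: poly_monom)
  have "AE x in \<mu>. poly p x * poly ?q x = 0"
    using measure_support_compl_null[OF rd] by eventually_elim (simp add: p)
  then have "0 = (\<integral>x. poly p x * poly ?q x \<partial>\<mu>)" by (rule integral_eq_zero_AE[symmetric])
  also have "\<dots> = (\<integral>x. (\<Sum>i\<le>?N. coeff p i * (x ^ i * poly ?q x)) \<partial>\<mu>)"
    by (simp add: poly_altdef[of p] sum_distrib_right mult.assoc)
  also have "\<dots> = (\<Sum>i\<le>?N. coeff p i * jacobi_pow a b i 1 (Suc ?N))"
    using jacobi_poly_orthonormal[OF m b mom, of "Suc ?N" 1] by (subst Bochner_Integration.integral_sum) (auto simp: int)
  also have "\<dots> = (\<Sum>i\<le>?N. if i = ?N then coeff p ?N * jacobi_pow a b ?N 1 (Suc ?N) else 0)"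
  proof (intro sum.cong refl)
    fix i assume "i \<in> {..?N}"
    then show "coeff p i * jacobi_pow a b i 1 (Suc ?N) = (if i = ?N then coeff p ?N * jacobi_pow a b ?N 1 (Suc ?N) else 0)"
      using jacobi_pow_support[of i 1 "Suc ?N" a b] by auto
  qed
  also have "\<dots> = coeff p ?N * jacobi_pow a b ?N 1 (Suc ?N)" by (subst sum.delta) auto
  finally show False using p(1) jacobi_pow_diag_pos[of b a "?N", OF b] by simp
qed

lemma jacobi_coefficients_of_moments:
  assumes m: "borel_prob_finite_moments \<mu>" and b: "\<And>i. 1 \<le> i \<Longrightarrow> 0 < b i"
    and mom: "\<And>k. moment \<mu> k = jacobi_pow a b k 1 1"
  shows "jacobi_coefficients \<mu> a b"
proof -
  let ?Q = "jacobi_poly a b"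
  have "orthonormal_poly \<mu> k = ?Q k" for k
  proof (cases k)
    case (Suc j)
    let ?w = "jacobi_pow a b j 1 (Suc j)"
    have w: "?w > 0" by (rule jacobi_pow_diag_pos[OF b])
    have "poly_inner \<mu> (?Q (Suc j)) (?Q (Suc j)) = 1"
      using jacobi_poly_orthonormal[OF m b mom, of "Suc j" "Suc j" 0] by (simp add: poly_inner_def unit_seq_def)
    then have "poly_inner \<mu> (Polynomial.smult ?w (?Q (Suc j))) (Polynomial.smult ?w (?Q (Suc j))) = ?w ^ 2"
      by (simp only: poly_inner_smult) (simp add: power2_eq_square)
    then show ?thesis
      using w Suc by (simp add: orthonormal_poly_def Let_def gram_schmidt_eq_jacobi_poly[OF m b mom])
  qed (simp add: orthonormal_poly_def)
  then show ?thesis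
    unfolding jacobi_coefficients_def
    using infinite_support_of_jacobi[OF m b mom] jacobi_poly_rec[of _ b a] b
    by (simp add: less_imp_neq[symmetric])
qed

section \<open>The topology of convergence of moments\<close>

definition squash :: "real \<Rightarrow> real" where
  "squash t = t / (1 + t)"

lemma squash_simps [simp]: "squash 0 = 0" "0 \<le> t \<Longrightarrow> 0 \<le> squash t" "0 \<le> t \<Longrightarrow> squash t \<le> 1"
  "0 \<le> t \<Longrightarrow> squash t \<le> t"
proof -
  assume t: "0 \<le> t"
  then have "t * 1 \<le> t * (1 + t)" by (intro mult_left_mono) auto
  with t show "0 \<le> squash t" "squash t \<le> 1" "squash t \<le> t"
    by (auto simp: squash_def divide_le_eq_1 pos_divide_le_eq)
qed (simp add: squash_def)

lemma squash_mono: "0 \<le> s \<Longrightarrow> s \<le> t \<Longrightarrow> squash s \<le> squash t"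
  by (simp add: squash_def frac_le_eq divide_le_cancel field_simps)

lemma squash_less_iff: "0 \<le> s \<Longrightarrow> 0 \<le> t \<Longrightarrow> squash s < squash t \<longleftrightarrow> s < t"
  by (simp add: squash_def field_simps)

lemma squash_add: "0 \<le> s \<Longrightarrow> 0 \<le> t \<Longrightarrow> squash (s + t) \<le> squash s + squash t"
proof -
  assume st: "0 \<le> s" "0 \<le> t"
  have "squash (s + t) = s / (1 + (s + t)) + t / (1 + (s + t))" by (simp add: squash_def add_divide_distrib)
  also have "\<dots> \<le> s / (1 + s) + t / (1 + t)" using st by (intro add_mono divide_left_mono) auto
  finally show ?thesis by (simp add: squash_def)
qed

lemma moment_dist_eq:
  "moment_dist \<mu> \<nu> = (\<Sum>j. (1/2) ^ Suc j * squash \<bar>moment \<mu> (Suc j) - moment \<nu> (Suc j)\<bar>)"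
  by (simp add: moment_dist_def Let_def squash_def)

lemma moment_dist_summable:
  "summable (\<lambda>j. (1/2) ^ Suc j * squash \<bar>moment \<mu> (Suc j) - moment \<nu> (Suc j)\<bar>)"
proof (rule summable_comparison_test')
  show "summable (\<lambda>j. (1/2 :: real) ^ Suc j)" by (subst summable_Suc_iff) (simp add: summable_geometric)
  show "norm ((1/2) ^ Suc n * squash \<bar>moment \<mu> (Suc n) - moment \<nu> (Suc n)\<bar>) \<le> (1/2) ^ Suc n" if "n \<ge> 0" for n
    by (simp add: abs_mult mult_left_le)
qed

lemma moment_dist_large:
  assumes "0 < \<epsilon>" "1 \<le> k" "moment_dist \<mu> \<nu> < (1/2) ^ k * squash \<epsilon>"
  shows "\<bar>moment \<mu> k - moment \<nu> k\<bar> < \<epsilon>"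
proof -
  obtain j where k: "k = Suc j" using assms(2) by (cases k) auto
  have "(1/2) ^ k * squash \<bar>moment \<mu> k - moment \<nu> k\<bar> \<le> moment_dist \<mu> \<nu>"
    unfolding moment_dist_eq k
    using sum_le_suminf[OF moment_dist_summable[of \<mu> \<nu>], of "{j}"] by simp
  then have "(1/2) ^ k * squash \<bar>moment \<mu> k - moment \<nu> k\<bar> < (1/2) ^ k * squash \<epsilon>" using assms by linarith
  then have "squash \<bar>moment \<mu> k - moment \<nu> k\<bar> < squash \<epsilon>" by simp
  then show ?thesis using assms by (simp add: squash_less_iff)
qed

text \<open>Cutting the series after \<open>J\<close> terms costs at most (1/2)^J, since each
  summand is at most its weight; the remaining terms are controlled by the differences of the
  moments.\<close>

lemma moment_dist_small:
  assumes "0 < \<epsilon>"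
  obtains J :: nat and \<delta> :: real where "0 < \<delta>"
    "\<And>\<mu> \<nu>. (\<And>k. k \<le> J \<Longrightarrow> \<bar>moment \<mu> k - moment \<nu> k\<bar> < \<delta>) \<Longrightarrow> moment_dist \<mu> \<nu> < \<epsilon>"
proof -
  obtain J where J: "(1/2 :: real) ^ J < \<epsilon> / 2"
    using real_arch_pow_inv[of "\<epsilon> / 2" "1/2"] assms by auto
  have geo: "(\<lambda>j. (1/2 :: real) ^ Suc j) sums 1" using power_half_series by simp
  show thesis
  proof (rule that[of "\<epsilon> / 2" J])
    show "0 < \<epsilon> / 2" using assms by simp
    fix \<mu> \<nu> assume d: "\<And>k. k \<le> J \<Longrightarrow> \<bar>moment \<mu> k - moment \<nu> k\<bar> < \<epsilon> / 2"
    let ?f = "\<lambda>j. (1/2) ^ Suc j * squash \<bar>moment \<mu> (Suc j) - moment \<nu> (Suc j)\<bar>"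
    have split: "moment_dist \<mu> \<nu> = (\<Sum>j. ?f (j + J)) + (\<Sum>j<J. ?f j)"
      unfolding moment_dist_eq by (rule suminf_split_initial_segment[OF moment_dist_summable])
    have "(\<Sum>j. ?f (j + J)) \<le> (\<Sum>j. (1/2) ^ J * (1/2) ^ Suc j)"
    proof (rule suminf_le)
      show "summable (\<lambda>j. ?f (j + J))" using summable_ignore_initial_segment[OF moment_dist_summable] .
      show "summable (\<lambda>j. (1/2 :: real) ^ J * (1/2) ^ Suc j)" using geo by (intro summable_mult) (rule sums_summable)
      show "?f (j + J) \<le> (1/2) ^ J * (1/2) ^ Suc j" for j
        using mult_left_mono[of "squash \<bar>moment \<mu> (Suc (j + J)) - moment \<nu> (Suc (j + J))\<bar>" 1 "(1/2) ^ Suc (j + J)"]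
        by (simp add: power_add mult_ac)
    qed
    also have "(\<Sum>j. (1/2 :: real) ^ J * (1/2) ^ Suc j) = (1/2) ^ J"
      using sums_unique[OF sums_mult[OF geo, of "(1/2) ^ J"]] by simp
    finally have tail: "(\<Sum>j. ?f (j + J)) \<le> (1/2) ^ J" .
    have "(\<Sum>j<J. ?f j) \<le> (\<Sum>j<J. (1/2) ^ Suc j * (\<epsilon> / 2))"
    proof (intro sum_mono mult_left_mono)
      fix j assume "j \<in> {..<J}"
      then have "\<bar>moment \<mu> (Suc j) - moment \<nu> (Suc j)\<bar> < \<epsilon> / 2" by (intro d) auto
      then show "squash \<bar>moment \<mu> (Suc j) - moment \<nu> (Suc j)\<bar> \<le> \<epsilon> / 2"
        using squash_simps(4)[of "\<bar>moment \<mu> (Suc j) - moment \<nu> (Suc j)\<bar>"] by linarith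
    qed simp
    also have "\<dots> = (\<Sum>j<J. (1/2) ^ Suc j) * (\<epsilon> / 2)" by (rule sum_distrib_right[symmetric])
    also have "\<dots> \<le> 1 * (\<epsilon> / 2)"
      using sum_le_suminf[OF sums_summable[OF geo], of "{..<J}"] sums_unique[OF geo] assms
      by (intro mult_right_mono) auto
    finally show "moment_dist \<mu> \<nu> < \<epsilon>" using split tail J by linarith
  qed
qed

lemma moment_0: "borel_prob_finite_moments \<mu> \<Longrightarrow> moment \<mu> 0 = 1"
proof -
  assume "borel_prob_finite_moments \<mu>"
  then interpret prob_space \<mu> by (simp add: borel_prob_finite_moments_def)
  show ?thesis by (simp add: moment_def prob_space)
qed

lemma moment_space_eqI:
  assumes "\<mu> \<in> moment_space S" "\<nu> \<in> moment_space T" "\<And>k. moment \<mu> k = moment \<nu> k"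
  shows "\<mu> = \<nu>"
  using assms by (auto simp: moment_space_def)

lemma moment_space_UNIV: "\<mu> \<in> moment_space S \<Longrightarrow> \<mu> \<in> moment_space UNIV"
  by (auto simp: moment_space_def)

lemma moment_metric: "Metric_space (moment_space S) moment_dist"
proof
  fix \<mu> \<nu> :: "real measure"
  show "0 \<le> moment_dist \<mu> \<nu>"
    unfolding moment_dist_eq by (intro suminf_nonneg moment_dist_summable) simp
  show "moment_dist \<mu> \<nu> = moment_dist \<nu> \<mu>"
    by (simp add: moment_dist_eq abs_minus_commute)
next
  fix \<mu> \<nu> assume in_space: "\<mu> \<in> moment_space S" "\<nu> \<in> moment_space S"
  show "moment_dist \<mu> \<nu> = 0 \<longleftrightarrow> \<mu> = \<nu>"
  proof
    assume 0: "moment_dist \<mu> \<nu> = 0"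
    have "moment \<mu> k = moment \<nu> k" for k
    proof (cases "k = 0")
      case True
      then show ?thesis using in_space by (simp add: moment_0 moment_space_def)
    next
      case False
      have "\<bar>moment \<mu> k - moment \<nu> k\<bar> < e" if "e > 0" for e
      proof -
        have "0 < squash e" using that by (simp add: squash_def)
        then show ?thesis using moment_dist_large[of e k \<mu> \<nu>] that False 0 by simp
      qed
      then show ?thesis by (metis abs_ge_zero abs_le_zero_iff eq_iff_diff_eq_0 less_irrefl not_less)
    qed
    then show "\<mu> = \<nu>" by (rule moment_space_eqI[OF in_space])
  qed (simp add: moment_dist_eq)
next
  fix \<mu> \<nu> \<kappa> :: "real measure"
  let ?d = "\<lambda>\<mu> \<nu> j. (1/2) ^ Suc j * squash \<bar>moment \<mu> (Suc j) - moment \<nu> (Suc j)\<bar>"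
  have "moment_dist \<mu> \<kappa> \<le> (\<Sum>j. ?d \<mu> \<nu> j + ?d \<nu> \<kappa> j)"
    unfolding moment_dist_eq
  proof (intro suminf_le moment_dist_summable summable_add)
    fix j
    have "squash \<bar>moment \<mu> (Suc j) - moment \<kappa> (Suc j)\<bar>
        \<le> squash (\<bar>moment \<mu> (Suc j) - moment \<nu> (Suc j)\<bar> + \<bar>moment \<nu> (Suc j) - moment \<kappa> (Suc j)\<bar>)"
      by (intro squash_mono) auto
    also have "\<dots> \<le> squash \<bar>moment \<mu> (Suc j) - moment \<nu> (Suc j)\<bar> + squash \<bar>moment \<nu> (Suc j) - moment \<kappa> (Suc j)\<bar>"
      by (intro squash_add) auto
    finally show "?d \<mu> \<kappa> j \<le> ?d \<mu> \<nu> j + ?d \<nu> \<kappa> j"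
      by (simp add: distrib_left[symmetric])
  qed
  also have "\<dots> = moment_dist \<mu> \<nu> + moment_dist \<nu> \<kappa>"
    unfolding moment_dist_eq by (rule suminf_add[symmetric, OF moment_dist_summable moment_dist_summable])
  finally show "moment_dist \<mu> \<kappa> \<le> moment_dist \<mu> \<nu> + moment_dist \<nu> \<kappa>" .
qed

lemma topspace_moment_topology [simp]: "topspace (moment_topology S) = moment_space S"
  by (simp add: moment_topology_def Metric_space.topspace_mtopology[OF moment_metric])

lemma Hausdorff_moment_topology: "Hausdorff_space (moment_topology S)"
  by (simp add: moment_topology_def Metric_space.Hausdorff_space_mtopology[OF moment_metric])

lemma moment_topology_subtopology:
  "moment_topology S = subtopology (moment_topology UNIV) (moment_space S)"
proof -
  have "Submetric (moment_space UNIV) moment_dist (moment_space S)"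
    by (simp add: Submetric_def Submetric_axioms_def moment_metric subset_iff moment_space_UNIV)
  from Submetric.mtopology_submetric[OF this] show ?thesis by (simp add: moment_topology_def)
qed

text \<open>Balls of the metric are traded for conditions on finitely many moments, the form suited
  to continuity and measurability.\<close>

lemma openin_moment_topology:
  "openin (moment_topology S) U \<longleftrightarrow> U \<subseteq> moment_space S \<and>
     (\<forall>\<mu>\<in>U. \<exists>J. \<exists>\<delta>>0. \<forall>\<nu>\<in>moment_space S. (\<forall>k\<le>J. \<bar>moment \<nu> k - moment \<mu> k\<bar> < \<delta>) \<longrightarrow> \<nu> \<in> U)"
proof -
  interpret Metric_space "moment_space S" moment_dist by (rule moment_metric)
  show ?thesis
    unfolding moment_topology_def openin_mtopology
  proof (intro conj_cong refl iffI ballI allI impI)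
    fix \<mu> assume sub: "U \<subseteq> moment_space S" and op: "\<forall>x. x \<in> U \<longrightarrow> (\<exists>r>0. mball x r \<subseteq> U)" and \<mu>: "\<mu> \<in> U"
    then obtain r where r: "r > 0" "mball \<mu> r \<subseteq> U" by blast
    obtain J \<delta> where J: "0 < \<delta>"
      "\<And>\<mu> \<nu>. (\<And>k. k \<le> J \<Longrightarrow> \<bar>moment \<mu> k - moment \<nu> k\<bar> < \<delta>) \<Longrightarrow> moment_dist \<mu> \<nu> < r"
      using moment_dist_small[OF r(1)] by metis
    show "\<exists>J. \<exists>\<delta>>0. \<forall>\<nu>\<in>moment_space S. (\<forall>k\<le>J. \<bar>moment \<nu> k - moment \<mu> k\<bar> < \<delta>) \<longrightarrow> \<nu> \<in> U"
    proof (intro exI[of _ J] exI[of _ \<delta>] conjI ballI impI)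
      fix \<nu> assume \<nu>: "\<nu> \<in> moment_space S" "\<forall>k\<le>J. \<bar>moment \<nu> k - moment \<mu> k\<bar> < \<delta>"
      then have "moment_dist \<mu> \<nu> < r" by (intro J) (simp add: abs_minus_commute)
      then have "\<nu> \<in> mball \<mu> r" using \<nu> \<mu> sub by (auto simp: in_mball)
      then show "\<nu> \<in> U" using r by blast
    qed (rule J)
  next
    fix \<mu> assume sub: "U \<subseteq> moment_space S"
      and op: "\<forall>\<mu>\<in>U. \<exists>J. \<exists>\<delta>>0. \<forall>\<nu>\<in>moment_space S. (\<forall>k\<le>J. \<bar>moment \<nu> k - moment \<mu> k\<bar> < \<delta>) \<longrightarrow> \<nu> \<in> U"
      and \<mu>: "\<mu> \<in> U"
    then obtain J \<delta> where J: "\<delta> > 0"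
      "\<And>\<nu>. \<nu> \<in> moment_space S \<Longrightarrow> (\<forall>k\<le>J. \<bar>moment \<nu> k - moment \<mu> k\<bar> < \<delta>) \<Longrightarrow> \<nu> \<in> U" by metis
    let ?r = "(1/2) ^ J * squash \<delta>"
    have sq: "0 < squash \<delta>" using J(1) by (simp add: squash_def)
    have "mball \<mu> ?r \<subseteq> U"
    proof
      fix \<nu> assume "\<nu> \<in> mball \<mu> ?r"
      then have \<nu>: "\<nu> \<in> moment_space S" "moment_dist \<mu> \<nu> < ?r" by (auto simp: in_mball)
      have "\<bar>moment \<nu> k - moment \<mu> k\<bar> < \<delta>" if "k \<le> J" for k
      proof (cases "k = 0")
        \<comment> \<open>The distance starts with the first moment; the zeroth is 1 for every
          probability measure.\<close>
        case True
        then show ?thesis using \<nu> \<mu> sub J(1) by (auto simp: moment_0 moment_space_def)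
      next
        case False
        have "?r \<le> (1/2) ^ k * squash \<delta>"
          using that sq by (intro mult_right_mono power_decreasing) auto
        then show ?thesis using moment_dist_large[OF J(1), of k \<mu> \<nu>] \<nu> False
          by (simp add: abs_minus_commute)
      qed
      then show "\<nu> \<in> U" by (intro J \<nu>) auto
    qed
    then show "\<exists>r>0. mball \<mu> r \<subseteq> U" using sq by (intro exI[of _ ?r]) auto
  qed
qed

text \<open>Covering \<open>U\<close> by cylinders in moment space makes it a preimage under the
  moment sequence. Events thereby become Borel, and continuity can be checked in the product
  topology.\<close>

lemma openin_moment_vimage:
  assumes "openin (moment_topology S) U"
  obtains W :: "(nat \<Rightarrow> real) set" where "open W" "U = {\<nu> \<in> moment_space S. moment \<nu> \<in> W}"
proof -
  from assms have sub: "U \<subseteq> moment_space S" and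
    "\<forall>\<mu>\<in>U. \<exists>J. \<exists>\<delta>>0. \<forall>\<nu>\<in>moment_space S. (\<forall>k\<le>J. \<bar>moment \<nu> k - moment \<mu> k\<bar> < \<delta>) \<longrightarrow> \<nu> \<in> U"
    by (auto simp: openin_moment_topology)
  then obtain J \<delta> where J: "\<And>\<mu>. \<mu> \<in> U \<Longrightarrow> \<delta> \<mu> > 0"
    "\<And>\<mu> \<nu>. \<mu> \<in> U \<Longrightarrow> \<nu> \<in> moment_space S \<Longrightarrow> (\<forall>k\<le>J \<mu>. \<bar>moment \<nu> k - moment \<mu> k\<bar> < \<delta> \<mu>) \<Longrightarrow> \<nu> \<in> U"
    by metis
  define B where "B \<mu> = (\<Inter>k\<in>{..J \<mu>}. {m :: nat \<Rightarrow> real. \<bar>m k - moment \<mu> k\<bar> < \<delta> \<mu>})" for \<mu>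
  have "open (B \<mu>)" for \<mu>
    unfolding B_def by (intro open_INT finite_atMost ballI open_Collect_less continuous_intros continuous_on_product_coordinates)
  moreover have "U = {\<nu> \<in> moment_space S. moment \<nu> \<in> (\<Union>\<mu>\<in>U. B \<mu>)}"
  proof (intro subset_antisym subsetI)
    fix \<mu> assume \<mu>: "\<mu> \<in> U"
    then have "moment \<mu> \<in> B \<mu>" using J(1) by (auto simp: B_def)
    with \<mu> sub show "\<mu> \<in> {\<nu> \<in> moment_space S. moment \<nu> \<in> (\<Union>\<mu>\<in>U. B \<mu>)}" by blast
  qed (use J(2) in \<open>auto simp: B_def\<close>)
  ultimately show thesis by (intro that[of "\<Union>\<mu>\<in>U. B \<mu>"]) auto
qed

lemma open_fun_basis:
  fixes W :: "('i \<Rightarrow> real) set"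
  assumes "open W" "m \<in> W"
  obtains K \<delta> where "finite K" "0 < \<delta>" "\<And>m'. (\<And>k. k \<in> K \<Longrightarrow> \<bar>m' k - m k\<bar> < \<delta>) \<Longrightarrow> m' \<in> W"
proof -
  have "openin (product_topology (\<lambda>i. euclidean) UNIV) W" using assms by (simp add: open_fun_def)
  from product_topology_open_contains_basis[OF this assms(2)] obtain X where
    X: "m \<in> Pi\<^sub>E UNIV X" "\<And>i. open (X i)" "finite {i. X i \<noteq> UNIV}" "Pi\<^sub>E UNIV X \<subseteq> W"
    by auto
  let ?K = "{i. X i \<noteq> UNIV}"
  have "\<exists>e>0. \<forall>y. \<bar>y - m i\<bar> < e \<longrightarrow> y \<in> X i" for i
  proof -
    have "m i \<in> X i" using X(1) by auto
    with X(2)[of i] show ?thesis by (auto simp: open_dist dist_real_def)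
  qed
  then obtain e where e: "\<And>i. e i > 0" "\<And>i y. \<bar>y - m i\<bar> < e i \<Longrightarrow> y \<in> X i" by metis
  define \<delta> where "\<delta> = Min (insert 1 (e ` ?K))"
  show thesis
  proof (rule that[OF X(3), of \<delta>])
    show "0 < \<delta>" using X(3) e(1) by (simp add: \<delta>_def)
    fix m' assume m': "\<And>k. k \<in> ?K \<Longrightarrow> \<bar>m' k - m k\<bar> < \<delta>"
    have "m' i \<in> X i" for i
    proof (cases "X i = UNIV")
      case False
      then have "\<delta> \<le> e i" unfolding \<delta>_def using X(3) by (intro Min_le) auto
      then show ?thesis using m'[of i] False e(2)[of "m' i" i] by auto
    qed simp
    then show "m' \<in> W" using X(4) by auto
  qed
qed

lemma measurable_moment_vimage:
  fixes W :: "(nat \<Rightarrow> real) set" and \<mu> :: "'a \<Rightarrow> real measure"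
  assumes "\<And>k. (\<lambda>\<omega>. moment (\<mu> \<omega>) k) \<in> borel_measurable M" "open W"
  shows "{\<omega> \<in> space M. moment (\<mu> \<omega>) \<in> W} \<in> sets M"
proof -
  have "(\<lambda>\<omega>. moment (\<mu> \<omega>)) \<in> borel_measurable M"
    by (rule measurable_coordinatewise_then_product) (rule assms(1))
  from measurable_sets[OF this borel_open[OF assms(2)]] show ?thesis
    by (simp add: vimage_def Int_def conj_commute)
qed

section \<open>Laplace asymptotics for log-concave densities\<close>

text \<open>The sign condition places \<open>z\<close> between \<open>p\<close> and
  \<open>y\<close>, on whichever side. Written with distances and without division, one inequality
  serves both tails.\<close>

lemma convex_on_three_points:
  fixes h :: "real \<Rightarrow> real"
  assumes h: "convex_on S h" and S: "p \<in> S" "y \<in> S" and between: "0 \<le> (y - z) * (z - p)" "z \<noteq> p"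
  shows "(\<bar>z - p\<bar> + \<bar>y - z\<bar>) * h z \<le> \<bar>y - z\<bar> * h p + \<bar>z - p\<bar> * h y"
proof -
  define d e where "d = \<bar>z - p\<bar>" and "e = \<bar>y - z\<bar>"
  define t where "t = d / (d + e)"
  have d: "d > 0" "e \<ge> 0" using between by (auto simp: d_def e_def)
  have t: "0 \<le> t" "t \<le> 1" "1 - t = e / (d + e)" using d by (auto simp: t_def field_simps)
  have comb: "(1 - t) * p + t * y = (e * p + d * y) / (d + e)"
    unfolding t by (simp add: t_def add_divide_distrib)
  have z: "(1 - t) * p + t * y = z"
  proof (cases "z > p")
    case True
    then have "y \<ge> z" using between by (simp add: zero_le_mult_iff)
    with True have "p = z - d" "y = z + e" by (auto simp: d_def e_def)
    then have "e * p + d * y = (d + e) * z" by (simp only: ring_distribs) (simp add: mult.commute)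
    then show ?thesis unfolding comb using d by simp
  next
    case False
    then have "y \<le> z" using between by (simp add: zero_le_mult_iff)
    with False have "p = z + d" "y = z - e" by (auto simp: d_def e_def)
    then have "e * p + d * y = (d + e) * z" by (simp only: ring_distribs) (simp add: mult.commute)
    then show ?thesis unfolding comb using d by simp
  qed
  have "h z \<le> (1 - t) * h p + t * h y"
    using convex_onD[OF h t(1,2) S] z by simp
  then have "(d + e) * h z \<le> (d + e) * ((1 - t) * h p + t * h y)" using d by (intro mult_left_mono) auto
  also have "\<dots> = e * h p + d * h y"
  proof -
    have "(d + e) * (1 - t) = e" "(d + e) * t = d" unfolding t unfolding t_def using d by auto
    then show ?thesis by (simp only: distrib_left mult.assoc[symmetric])
  qed
  finally show ?thesis by (simp add: d_def e_def)
qed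

lemma convex_on_le_max_endpoints:
  fixes h :: "real \<Rightarrow> real"
  assumes h: "convex_on S h" and S: "l \<in> S" "u \<in> S" and y: "l \<le> y" "y \<le> u"
  shows "h y \<le> max (h l) (h u)"
proof (cases "y = l")
  case False
  then have lt: "y > l" using y by simp
  have "(\<bar>y - l\<bar> + \<bar>u - y\<bar>) * h y \<le> \<bar>u - y\<bar> * h l + \<bar>y - l\<bar> * h u"
    by (rule convex_on_three_points[OF h S]) (use lt y in auto)
  also have "\<dots> \<le> \<bar>u - y\<bar> * max (h l) (h u) + \<bar>y - l\<bar> * max (h l) (h u)"
    by (intro add_mono mult_left_mono) auto
  also have "\<dots> = (\<bar>y - l\<bar> + \<bar>u - y\<bar>) * max (h l) (h u)" by (simp add: algebra_simps)
  finally show ?thesis using lt by (simp add: mult_le_cancel_left)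
qed simp

lemma nn_integral_exp_abs:
  assumes c: "0 < c"
  shows "(\<integral>\<^sup>+y. ennreal (exp (- c * \<bar>y - z\<bar>)) \<partial>lborel) \<le> ennreal (2 / c)"
proof -
  have half: "(\<integral>\<^sup>+x. ennreal (exp (- c * (x - z))) * indicator {z..} x \<partial>lborel) = ennreal (1 / c)"
  proof -
    have "(\<integral>\<^sup>+x. ennreal (exp (- c * (x - z))) * indicator {z..} x \<partial>lborel) = ennreal (0 - (- exp (- c * (z - z)) / c))"
    proof (rule nn_integral_FTC_atLeast[where F="\<lambda>x. - exp (- c * (x - z)) / c" and T=0])
      show "((\<lambda>x. - exp (- c * (x - z)) / c) has_real_derivative exp (- c * (x - z))) (at x)" for x
        using c by (auto intro!: derivative_eq_intros)
      have "filterlim (\<lambda>x. - c * (x - z)) at_bot at_top"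
        using c by real_asymp
      then have "((\<lambda>x. exp (- c * (x - z))) \<longlongrightarrow> 0) at_top"
        by (rule filterlim_compose[OF exp_at_bot])
      then have "((\<lambda>x. - exp (- c * (x - z)) / c) \<longlongrightarrow> - 0 / c) at_top"
        using c by (intro tendsto_intros) auto
      then show "((\<lambda>x. - exp (- c * (x - z)) / c) \<longlongrightarrow> 0) at_top" by simp
    qed auto
    then show ?thesis by simp
  qed
  have half': "(\<integral>\<^sup>+x. ennreal (exp (- c * \<bar>x - z\<bar>)) * indicator {..z} x \<partial>lborel) = ennreal (1 / c)"
  proof -
    have "(\<integral>\<^sup>+x. ennreal (exp (- c * \<bar>x - z\<bar>)) * indicator {..z} x \<partial>lborel)
      = ennreal \<bar>-1\<bar> * (\<integral>\<^sup>+x. ennreal (exp (- c * \<bar>(2 * z + (-1) * x) - z\<bar>)) * indicator {..z} (2 * z + (-1) * x) \<partial>lborel)"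
      by (rule nn_integral_real_affine) auto
    also have "\<dots> = (\<integral>\<^sup>+x. ennreal (exp (- c * (x - z))) * indicator {z..} x \<partial>lborel)"
      by (simp, intro nn_integral_cong) (auto simp: indicator_def)
    finally show ?thesis using half by simp
  qed
  have "(\<integral>\<^sup>+y. ennreal (exp (- c * \<bar>y - z\<bar>)) \<partial>lborel)
     \<le> (\<integral>\<^sup>+y. ennreal (exp (- c * (y - z))) * indicator {z..} y + ennreal (exp (- c * \<bar>y - z\<bar>)) * indicator {..z} y \<partial>lborel)"
    by (intro nn_integral_mono) (auto simp: indicator_def)
  also have "\<dots> = ennreal (1 / c) + ennreal (1 / c)"
    by (subst nn_integral_add) (simp_all only: half half', auto)
  also have "\<dots> = ennreal (2 / c)" using c by (simp add: ennreal_plus[symmetric] del: ennreal_plus)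
  finally show ?thesis .
qed

text \<open>Laplace's principle for densities with convex exponents. Convergence is required only
  pointwise and only on \<open>D\<close>, which may differ from the domains \<open>S n\<close>;
  convexity supplies the uniformity. The constants \<open>N n\<close> are unspecified because total
  mass 1 fixes their exponential order. \<open>ends\<close> provides points of arbitrarily high rate
  on both sides of \<open>z0\<close>, hence exponential tightness.\<close>

locale laplace_family =
  fixes lam :: "nat \<Rightarrow> real" and S :: "nat \<Rightarrow> real set" and h :: "nat \<Rightarrow> real \<Rightarrow> real" and N :: "nat \<Rightarrow> real"
    and Q :: "nat \<Rightarrow> real measure" and D :: "real set" and r :: "real \<Rightarrow> real" and z0 :: real
  assumes lam: "filterlim lam at_top sequentially"
    and fam: "\<forall>\<^sub>F n in sequentially. prob_space (Q n) \<and> convex_on (S n) (h n) \<and> 0 < N n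
        \<and> S n \<in> sets borel \<and> h n \<in> borel_measurable borel
        \<and> Q n = density lborel (\<lambda>z. ennreal (indicator (S n) z * exp (- lam n * h n z) / N n))"
    and open_D: "open D" and int_D: "is_interval D" and z0: "z0 \<in> D"
    and in_S: "\<And>z. z \<in> D \<Longrightarrow> \<forall>\<^sub>F n in sequentially. z \<in> S n"
    and conv: "\<And>z. z \<in> D \<Longrightarrow> (\<lambda>n. h n z) \<longlonglongrightarrow> r z"
    and r_z0: "r z0 = 0" and r_pos: "\<And>z. z \<in> D \<Longrightarrow> z \<noteq> z0 \<Longrightarrow> 0 < r z"
    and cont_r: "continuous_on D r"
    and ends: "\<And>\<alpha>. \<exists>z1\<in>D. \<exists>z2\<in>D. z1 < z0 \<and> z0 < z2 \<and> \<alpha> < r z1 \<and> \<alpha> < r z2"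
begin

lemma eventually_le_exp:
  assumes "0 < \<eta>" shows "\<forall>\<^sub>F n in sequentially. C \<le> exp (lam n * \<eta>)"
proof -
  have "filterlim (\<lambda>n. lam n * \<eta>) at_top sequentially"
    by (rule filterlim_at_top_mult_tendsto_pos[OF tendsto_const assms lam])
  then have "filterlim (\<lambda>n. exp (lam n * \<eta>)) at_top sequentially"
    by (rule filterlim_compose[OF exp_at_top])
  then show ?thesis by (simp add: filterlim_at_top)
qed

text \<open>Two values control a whole half line: \<open>h n z0 < a / 2\<close> and
  \<open>h n z > a\<close> force, by convexity, at least the slope a / (2 |z - z0|) beyond
  \<open>z\<close>, uniformly over the domain \<open>S n\<close>.\<close>

lemma growth:
  assumes z: "z \<in> D" "z \<noteq> z0" and a: "0 < a" "a < r z"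
  shows "\<forall>\<^sub>F n in sequentially. \<forall>y\<in>S n. 0 \<le> (y - z) * (z - z0) \<longrightarrow> a + a / (2 * \<bar>z - z0\<bar>) * \<bar>y - z\<bar> \<le> h n y"
proof -
  have "\<forall>\<^sub>F n in sequentially. a < h n z" using order_tendstoD(1)[OF conv[OF z(1)] a(2)] .
  moreover have "\<forall>\<^sub>F n in sequentially. h n z0 < a / 2"
    using order_tendstoD(2)[OF conv[OF z0], of "a / 2"] r_z0 a by simp
  ultimately show ?thesis
    using fam in_S[OF z0] in_S[OF z(1)]
  proof eventually_elim
    case (elim n)
    show ?case
    proof (intro ballI impI)
      fix y assume y: "y \<in> S n" "0 \<le> (y - z) * (z - z0)"
      have d: "\<bar>z - z0\<bar> > 0" using z by simp
      have "(\<bar>z - z0\<bar> + \<bar>y - z\<bar>) * a \<le> (\<bar>z - z0\<bar> + \<bar>y - z\<bar>) * h n z"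
        using elim by (intro mult_left_mono) auto
      also have "\<dots> \<le> \<bar>y - z\<bar> * h n z0 + \<bar>z - z0\<bar> * h n y"
        using elim y z by (intro convex_on_three_points) auto
      also have "\<dots> \<le> \<bar>y - z\<bar> * (a / 2) + \<bar>z - z0\<bar> * h n y"
        using elim by (intro add_right_mono mult_left_mono) auto
      finally have "\<bar>z - z0\<bar> * a + \<bar>y - z\<bar> * (a / 2) \<le> \<bar>z - z0\<bar> * h n y" by (simp add: algebra_simps)
      then have "(\<bar>z - z0\<bar> * a + \<bar>y - z\<bar> * (a / 2)) / \<bar>z - z0\<bar> \<le> h n y"
        using d by (simp add: pos_divide_le_eq mult.commute)
      then show "a + a / (2 * \<bar>z - z0\<bar>) * \<bar>y - z\<bar> \<le> h n y"
        using d by (simp add: add_divide_distrib mult.commute)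
    qed
  qed
qed

lemma upper_bound:
  assumes "0 < c" "A \<in> sets borel"
  shows "\<forall>\<^sub>F n in sequentially. (\<forall>y\<in>S n \<inter> A. a + c * \<bar>y - z\<bar> \<le> h n y)
     \<longrightarrow> measure (Q n) A \<le> exp (- lam n * a) * (2 / c) / N n"
proof -
  have "\<forall>\<^sub>F n in sequentially. 1 \<le> lam n" using lam by (simp add: filterlim_at_top)
  then show ?thesis using fam
  proof eventually_elim
    case (elim n)
    interpret prob_space "Q n" using elim by blast
    have Nn: "N n > 0" using elim by simp
    show ?case
    proof
      assume ge: "\<forall>y\<in>S n \<inter> A. a + c * \<bar>y - z\<bar> \<le> h n y"
      have [measurable]: "S n \<in> sets borel" "h n \<in> borel_measurable borel" "A \<in> sets borel" using elim assms by auto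
      have "emeasure (Q n) A = (\<integral>\<^sup>+y. ennreal (indicator (S n) y * exp (- lam n * h n y) / N n) * indicator A y \<partial>lborel)"
        using elim by (simp add: emeasure_density)
      also have "\<dots> \<le> (\<integral>\<^sup>+y. ennreal (exp (- lam n * a) / N n) * ennreal (exp (- c * \<bar>y - z\<bar>)) \<partial>lborel)"
      proof (rule nn_integral_mono)
        fix y
        have "indicator (S n) y * exp (- lam n * h n y) / N n \<le> exp (- lam n * a) / N n * exp (- c * \<bar>y - z\<bar>)" if "y \<in> A"
        proof (cases "y \<in> S n")
          case True
          have "lam n * (a + c * \<bar>y - z\<bar>) \<le> lam n * h n y"
            using ge True that elim by (intro mult_left_mono) auto
          \<comment> \<open>Only one unit of \<open>lam n\<close> is spent on the linear term: this
            makes the tail integrable with a bound independent of \<open>n\<close>.\<close>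
          moreover have "1 * (c * \<bar>y - z\<bar>) \<le> lam n * (c * \<bar>y - z\<bar>)"
            using elim assms by (intro mult_right_mono) auto
          ultimately have "- lam n * h n y \<le> - lam n * a + (- c * \<bar>y - z\<bar>)" by (simp add: algebra_simps)
          then have "exp (- lam n * h n y) \<le> exp (- lam n * a) * exp (- c * \<bar>y - z\<bar>)"
            by (simp add: exp_add[symmetric])
          then show ?thesis using True Nn by (simp add: divide_right_mono)
        qed (use Nn in simp)
        then show "ennreal (indicator (S n) y * exp (- lam n * h n y) / N n) * indicator A y
            \<le> ennreal (exp (- lam n * a) / N n) * ennreal (exp (- c * \<bar>y - z\<bar>))"
          using Nn by (auto simp: indicator_def ennreal_mult[symmetric] intro!: ennreal_leI)
      qed
      also have "\<dots> = ennreal (exp (- lam n * a) / N n) * (\<integral>\<^sup>+y. ennreal (exp (- c * \<bar>y - z\<bar>)) \<partial>lborel)"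
        by (rule nn_integral_cmult) simp
      also have "\<dots> \<le> ennreal (exp (- lam n * a) / N n) * ennreal (2 / c)"
        by (intro mult_left_mono nn_integral_exp_abs assms) simp
      also have "\<dots> = ennreal (exp (- lam n * a) / N n * (2 / c))"
        using Nn assms by (intro ennreal_mult[symmetric]) auto
      finally have "ennreal (measure (Q n) A) \<le> ennreal (exp (- lam n * a) / N n * (2 / c))"
        by (simp add: emeasure_eq_measure)
      then show "measure (Q n) A \<le> exp (- lam n * a) * (2 / c) / N n"
        using Nn assms by (simp add: ennreal_le_iff mult.commute)
    qed
  qed
qed

text \<open>On an interval a convex function stays below its larger endpoint value, so convergence
  at \<open>l\<close> and \<open>u\<close> bounds the whole density from below.\<close>

lemma lower_bound:
  assumes "l < u" "l \<in> D" "u \<in> D" "r l < \<eta>" "r u < \<eta>"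
  shows "\<forall>\<^sub>F n in sequentially. (u - l) * exp (- lam n * \<eta>) / N n \<le> measure (Q n) {l..u}"
proof -
  have "\<forall>\<^sub>F n in sequentially. h n l < \<eta>" "\<forall>\<^sub>F n in sequentially. h n u < \<eta>"
    using order_tendstoD(2)[OF conv] assms by auto
  moreover have "\<forall>\<^sub>F n in sequentially. 1 \<le> lam n" using lam by (simp add: filterlim_at_top)
  ultimately show ?thesis using fam in_S[OF assms(2)] in_S[OF assms(3)]
  proof eventually_elim
    case (elim n)
    interpret prob_space "Q n" using elim by blast
    have Nn: "N n > 0" using elim by simp
    have [measurable]: "S n \<in> sets borel" "h n \<in> borel_measurable borel" using elim by auto
    have conv_S: "convex (S n)" using elim by (auto dest: convex_on_imp_convex)
    have "(u - l) * exp (- lam n * \<eta>) / N n = exp (- lam n * \<eta>) / N n * (u - l)" by simp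
    then have "ennreal ((u - l) * exp (- lam n * \<eta>) / N n) = ennreal (exp (- lam n * \<eta>) / N n) * ennreal (u - l)"
      using assms Nn by (simp only:, intro ennreal_mult) auto
    also have "\<dots> = (\<integral>\<^sup>+y. ennreal (exp (- lam n * \<eta>) / N n) * indicator {l..u} y \<partial>lborel)"
      using assms by (subst nn_integral_cmult) auto
    also have "\<dots> \<le> (\<integral>\<^sup>+y. ennreal (indicator (S n) y * exp (- lam n * h n y) / N n) * indicator {l..u} y \<partial>lborel)"
    proof (rule nn_integral_mono)
      fix y
      have "exp (- lam n * \<eta>) / N n \<le> indicator (S n) y * exp (- lam n * h n y) / N n" if y: "l \<le> y" "y \<le> u"
      proof -
        have "y \<in> S n"
          using conv_S elim y unfolding is_interval_convex_1[symmetric] by (meson mem_is_interval_1_I)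
        moreover have "h n y \<le> \<eta>"
          using convex_on_le_max_endpoints[of "S n" "h n" l u y] elim y by auto
        then have "exp (- lam n * \<eta>) \<le> exp (- lam n * h n y)" using elim by (simp add: mult_left_mono)
        ultimately show ?thesis using Nn by (simp add: divide_right_mono)
      qed
      then show "ennreal (exp (- lam n * \<eta>) / N n) * indicator {l..u} y
          \<le> ennreal (indicator (S n) y * exp (- lam n * h n y) / N n) * indicator {l..u} y"
        by (cases "y \<in> {l..u}") (simp_all add: ennreal_leI)
    qed
    also have "\<dots> = emeasure (Q n) {l..u}" using elim by (simp add: emeasure_density)
    finally show ?case by (simp add: emeasure_eq_measure ennreal_le_iff)
  qed
qed

lemma small_window:
  assumes "z \<in> D" "0 < \<delta>" "0 < \<eta>"
  shows "\<exists>d. 0 < d \<and> d < \<delta> \<and> (\<forall>y. \<bar>y - z\<bar> \<le> d \<longrightarrow> y \<in> D \<and> \<bar>r y - r z\<bar> < \<eta>)"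
proof -
  obtain d1 where d1: "d1 > 0" "\<And>y. \<bar>y - z\<bar> < d1 \<Longrightarrow> y \<in> D"
    using open_D assms(1) by (auto simp: open_dist dist_real_def)
  obtain d2 where d2: "d2 > 0" "\<And>y. y \<in> D \<Longrightarrow> \<bar>y - z\<bar> < d2 \<Longrightarrow> \<bar>r y - r z\<bar> < \<eta>"
    using cont_r assms unfolding continuous_on_iff dist_real_def by metis
  define d where "d = min \<delta> (min d1 d2) / 2"
  have "0 < d" "d < \<delta>" "d < d1" "d < d2" using assms d1(1) d2(1) by (auto simp: d_def min_def)
  with d1(2) d2(2) show ?thesis by (intro exI[of _ d]) auto
qed

text \<open>A window around \<open>z0\<close> has probability at most 1, while its lower bound
  contains the factor 1 / \<open>N n\<close>.\<close>

lemma norm_ge: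
  assumes "0 < \<eta>" shows "\<forall>\<^sub>F n in sequentially. exp (- lam n * \<eta>) \<le> N n"
proof -
  obtain d where d: "0 < d" "\<And>y. \<bar>y - z0\<bar> \<le> d \<Longrightarrow> y \<in> D \<and> \<bar>r y - r z0\<bar> < \<eta> / 2"
    using small_window[of z0 1 "\<eta> / 2"] z0 assms by auto
  have "\<forall>\<^sub>F n in sequentially. ((z0 + d) - (z0 - d)) * exp (- lam n * (\<eta> / 2)) / N n \<le> measure (Q n) {z0 - d..z0 + d}"
    using d(1) d(2)[of "z0 - d"] d(2)[of "z0 + d"] r_z0 by (intro lower_bound) auto
  moreover have "\<forall>\<^sub>F n in sequentially. 1 / (2 * d) \<le> exp (lam n * (\<eta> / 2))"
    using assms by (intro eventually_le_exp) auto
  ultimately show ?thesis using fam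
  proof eventually_elim
    case (elim n)
    interpret prob_space "Q n" using elim by blast
    have "2 * d * exp (- lam n * (\<eta> / 2)) / N n \<le> 1" using order_trans[OF elim(1) prob_le_1] by simp
    then have a: "2 * d * exp (- lam n * (\<eta> / 2)) \<le> N n" using elim by (simp add: pos_divide_le_eq)
    have "exp (- lam n * \<eta>) = 1 * exp (- lam n * \<eta>)" by simp
    also have "\<dots> \<le> (2 * d * exp (lam n * (\<eta> / 2))) * exp (- lam n * \<eta>)"
      using elim(2) d(1) by (intro mult_right_mono) (auto simp: field_simps)
    also have "\<dots> = 2 * d * exp (- lam n * (\<eta> / 2))"
      by (simp add: exp_add[symmetric] mult.assoc field_simps)
    finally show ?case using a by linarith
  qed
qed

text \<open>The line is covered by two tails, where the exponent grows linearly, and a window around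
  \<open>z0\<close>, where it cannot dip far below 0. Total mass 1 then bounds \<open>N n\<close>
  from above.\<close>

lemma norm_le:
  assumes "0 < \<eta>" shows "\<forall>\<^sub>F n in sequentially. N n \<le> exp (lam n * \<eta>)"
proof -
  \<comment> \<open>The exponential loss is at most \<open>6 * e\<close>, and absorbing the constant
    \<open>C\<close> costs another \<open>6 * e\<close>.\<close>
  define e where "e = \<eta> / 12"
  have e: "e > 0" using assms by (simp add: e_def)
  obtain d where d: "0 < d" "\<And>y. \<bar>y - z0\<bar> \<le> d \<Longrightarrow> y \<in> D \<and> \<bar>r y - r z0\<bar> < e"
    using small_window[of z0 1 e] z0 e by auto
  let ?l = "z0 - d" and ?u = "z0 + d"
  have lu: "?l \<in> D" "?u \<in> D" "r ?l < e" "r ?u < e" "0 < r ?l" "0 < r ?u"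
    using d(1) d(2)[of ?l] d(2)[of ?u] r_z0 r_pos[of ?l] r_pos[of ?u] by auto
  define al au where "al = r ?l / 2" and "au = r ?u / 2"
  have alu: "0 < al" "al < r ?l" "0 < au" "au < r ?u" using lu by (auto simp: al_def au_def)
  define cl cu cw where "cl = al / (2 * \<bar>?l - z0\<bar>)" and "cu = au / (2 * \<bar>?u - z0\<bar>)" and "cw = 3 * e / d"
  have c: "cl > 0" "cu > 0" "cw > 0" using alu d(1) e by (auto simp: cl_def cu_def cw_def)
  define C where "C = 2 / cl + 2 / cu + 2 / cw"
  have gl: "\<forall>\<^sub>F n in sequentially. \<forall>y\<in>S n. 0 \<le> (y - ?l) * (?l - z0) \<longrightarrow> al + cl * \<bar>y - ?l\<bar> \<le> h n y"
    unfolding cl_def using d(1) lu alu by (intro growth) auto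
  have gu: "\<forall>\<^sub>F n in sequentially. \<forall>y\<in>S n. 0 \<le> (y - ?u) * (?u - z0) \<longrightarrow> au + cu * \<bar>y - ?u\<bar> \<le> h n y"
    unfolding cu_def using d(1) lu alu by (intro growth) auto
  have ul: "\<forall>\<^sub>F n in sequentially. (\<forall>y\<in>S n \<inter> {..?l}. al + cl * \<bar>y - ?l\<bar> \<le> h n y)
     \<longrightarrow> measure (Q n) {..?l} \<le> exp (- lam n * al) * (2 / cl) / N n" by (rule upper_bound) (use c in auto)
  have uu: "\<forall>\<^sub>F n in sequentially. (\<forall>y\<in>S n \<inter> {?u..}. au + cu * \<bar>y - ?u\<bar> \<le> h n y)
     \<longrightarrow> measure (Q n) {?u..} \<le> exp (- lam n * au) * (2 / cu) / N n" by (rule upper_bound) (use c in auto)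
  have uw: "\<forall>\<^sub>F n in sequentially. (\<forall>y\<in>S n \<inter> {?l..?u}. - (6 * e) + cw * \<bar>y - z0\<bar> \<le> h n y)
     \<longrightarrow> measure (Q n) {?l..?u} \<le> exp (- lam n * (- (6 * e))) * (2 / cw) / N n" by (rule upper_bound) (use c in auto)
  have hl: "\<forall>\<^sub>F n in sequentially. h n ?l < e" "\<forall>\<^sub>F n in sequentially. h n ?u < e" "\<forall>\<^sub>F n in sequentially. - e < h n z0"
    using order_tendstoD(2)[OF conv[OF lu(1)] lu(3)] order_tendstoD(2)[OF conv[OF lu(2)] lu(4)]
      order_tendstoD(1)[OF conv[OF z0], of "-e"] r_z0 e by auto
  \<comment> \<open>Convexity through \<open>z0\<close> and an endpoint gives the lower bound
    \<open>- (3 * e)\<close> on the window; the slope \<open>cw\<close> adds at most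
    \<open>3 * e\<close> there and is inserted only to fit the form of
    \<open>upper_bound\<close>.\<close>
  have ww: "\<forall>\<^sub>F n in sequentially. \<forall>y\<in>S n \<inter> {?l..?u}. - (6 * e) + cw * \<bar>y - z0\<bar> \<le> h n y"
    using hl fam in_S[OF lu(1)] in_S[OF lu(2)]
  proof eventually_elim
    case (elim n)
    show ?case
    proof
      fix y assume y: "y \<in> S n \<inter> {?l..?u}"
      \<comment> \<open>The endpoint on the far side, so that \<open>z0\<close> lies between it and
        \<open>y\<close>.\<close>
      define p where "p = (if y \<ge> z0 then ?l else ?u)"
      have p: "p \<in> S n" "0 \<le> (y - z0) * (z0 - p)" "\<bar>z0 - p\<bar> = d" "z0 \<noteq> p" "h n p < e"
        using elim d(1) by (auto simp: p_def mult_nonpos_nonpos mult_nonpos_nonneg)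
      have ey: "\<bar>y - z0\<bar> \<le> d" using y by auto
      have "(\<bar>z0 - p\<bar> + \<bar>y - z0\<bar>) * h n z0 \<le> \<bar>y - z0\<bar> * h n p + \<bar>z0 - p\<bar> * h n y"
        using elim p y by (intro convex_on_three_points) auto
      then have "(d + \<bar>y - z0\<bar>) * h n z0 \<le> \<bar>y - z0\<bar> * h n p + d * h n y" using p by simp
      moreover have "(d + \<bar>y - z0\<bar>) * (- e) \<le> (d + \<bar>y - z0\<bar>) * h n z0"
        using elim d(1) by (intro mult_left_mono) auto
      moreover have "\<bar>y - z0\<bar> * h n p \<le> \<bar>y - z0\<bar> * e" using p by (intro mult_left_mono) auto
      moreover have "\<bar>y - z0\<bar> * e \<le> d * e" using ey e by (intro mult_right_mono) auto
      ultimately have "d * (- (3 * e)) \<le> d * h n y" by (simp add: algebra_simps)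
      then have "- (3 * e) \<le> h n y" using d(1) by (simp only: mult_le_cancel_left_pos)
      moreover have "cw * \<bar>y - z0\<bar> \<le> cw * d" using ey c by (intro mult_left_mono) auto
      moreover have "cw * d = 3 * e" using d(1) by (simp add: cw_def)
      ultimately show "- (6 * e) + cw * \<bar>y - z0\<bar> \<le> h n y" by linarith
    qed
  qed
  have l1: "\<forall>\<^sub>F n in sequentially. 1 \<le> lam n" using lam by (simp add: filterlim_at_top)
  have l2: "\<forall>\<^sub>F n in sequentially. C \<le> exp (lam n * (6 * e))" using e by (intro eventually_le_exp) auto
  show ?thesis using gl gu ul uu uw ww fam l1 l2
  proof eventually_elim
    case (elim n)
    interpret prob_space "Q n" using elim by blast
    have Nn: "N n > 0" using elim by simp
    have sQ: "sets (Q n) = sets borel" "space (Q n) = UNIV" using elim by auto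
    have E: "exp (- lam n * al) \<le> exp (lam n * (6 * e))" "exp (- lam n * au) \<le> exp (lam n * (6 * e))"
    proof -
      have "1 \<le> lam n" using elim by blast
      then have "0 \<le> lam n * al" "0 \<le> lam n * au" "0 \<le> lam n * (6 * e)" using alu e by auto
      then show "exp (- lam n * al) \<le> exp (lam n * (6 * e))" "exp (- lam n * au) \<le> exp (lam n * (6 * e))"
        unfolding exp_le_cancel_iff minus_mult_left[symmetric] by linarith+
    qed
    have "measure (Q n) {..?l} \<le> exp (- lam n * al) * (2 / cl) / N n"
    proof (rule elim(3)[rule_format])
      fix y assume y: "y \<in> S n \<inter> {..?l}"
      then have "0 \<le> (y - ?l) * (?l - z0)" using d(1) by (intro mult_nonpos_nonpos) auto
      then show "al + cl * \<bar>y - ?l\<bar> \<le> h n y" using elim(1) y by blast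
    qed
    also have "\<dots> \<le> exp (lam n * (6 * e)) * (2 / cl) / N n" using E c Nn by (intro divide_right_mono mult_right_mono) auto
    finally have 1: "measure (Q n) {..?l} \<le> exp (lam n * (6 * e)) * (2 / cl) / N n" .
    have "measure (Q n) {?u..} \<le> exp (- lam n * au) * (2 / cu) / N n"
    proof (rule elim(4)[rule_format])
      fix y assume y: "y \<in> S n \<inter> {?u..}"
      then have "0 \<le> (y - ?u) * (?u - z0)" using d(1) by (intro mult_nonneg_nonneg) auto
      then show "au + cu * \<bar>y - ?u\<bar> \<le> h n y" using elim(2) y by blast
    qed
    also have "\<dots> \<le> exp (lam n * (6 * e)) * (2 / cu) / N n" using E c Nn by (intro divide_right_mono mult_right_mono) auto
    finally have 2: "measure (Q n) {?u..} \<le> exp (lam n * (6 * e)) * (2 / cu) / N n" .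
    have 3: "measure (Q n) {?l..?u} \<le> exp (lam n * (6 * e)) * (2 / cw) / N n"
      using elim(5) elim(6) by simp
    have "UNIV = {..?l} \<union> ({?u..} \<union> {?l..?u})" by auto
    then have "1 = measure (Q n) ({..?l} \<union> ({?u..} \<union> {?l..?u}))" using prob_space sQ by simp
    also have "\<dots> \<le> measure (Q n) {..?l} + (measure (Q n) {?u..} + measure (Q n) {?l..?u})"
      by (rule order_trans[OF measure_Un_le add_left_mono[OF measure_Un_le]]) (auto simp: sQ)
    also have "\<dots> \<le> exp (lam n * (6 * e)) * (2 / cl) / N n + (exp (lam n * (6 * e)) * (2 / cu) / N n + exp (lam n * (6 * e)) * (2 / cw) / N n)"
      using 1 2 3 by linarith
    also have "\<dots> = exp (lam n * (6 * e)) * C / N n" by (simp add: C_def algebra_simps add_divide_distrib)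
    finally have "N n \<le> exp (lam n * (6 * e)) * C" using Nn by (simp add: pos_le_divide_eq)
    also have "\<dots> \<le> exp (lam n * (6 * e)) * exp (lam n * (6 * e))" using elim by (intro mult_left_mono) auto
    also have "\<dots> = exp (lam n * \<eta>)" by (simp add: exp_add[symmetric] e_def)
    finally show ?case .
  qed
qed

lemma half_line_bound:
  assumes z: "z \<in> D" "z \<noteq> z0" and a: "\<alpha> < r z"
  shows "\<forall>\<^sub>F n in sequentially. measure (Q n) {y. 0 \<le> (y - z) * (z - z0)} \<le> exp (- lam n * \<alpha>)"
proof -
  \<comment> \<open>Strictly between \<alpha> and the rate at \<open>z\<close>; the gap
    \<open>a - \<alpha>\<close> is spent in halves on \<open>N n\<close> and on the constant
    \<open>2 / c\<close>. The maximum keeps \<open>a\<close> positive when \<alpha> is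
    negative.\<close>
  define a where "a = (max \<alpha> 0 + r z) / 2"
  have a: "0 < a" "\<alpha> < a" "a < r z" using a r_pos[OF z] by (auto simp: a_def)
  define c where "c = a / (2 * \<bar>z - z0\<bar>)"
  have c: "c > 0" using a z by (simp add: c_def)
  let ?A = "{y. 0 \<le> (y - z) * (z - z0)}"
  have meas: "?A \<in> sets borel" by measurable
  have N: "\<forall>\<^sub>F n in sequentially. exp (- lam n * ((a - \<alpha>) / 2)) \<le> N n" using a by (intro norm_ge) auto
  have C: "\<forall>\<^sub>F n in sequentially. 2 / c \<le> exp (lam n * ((a - \<alpha>) / 2))" using a by (intro eventually_le_exp) auto
  show ?thesis
    using growth[OF z a(1,3)] upper_bound[OF c meas, of a z] N C fam
  proof eventually_elim
    case (elim n)
    have Nn: "N n > 0" using elim by simp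
    have "measure (Q n) ?A \<le> exp (- lam n * a) * (2 / c) / N n"
      by (rule elim(2)[rule_format]) (use elim(1) in \<open>auto simp: c_def\<close>)
    also have "\<dots> \<le> exp (- lam n * a) * exp (lam n * ((a - \<alpha>) / 2)) / exp (- lam n * ((a - \<alpha>) / 2))"
      using elim c Nn by (intro frac_le mult_left_mono) auto
    also have "\<dots> = exp (- lam n * a + lam n * ((a - \<alpha>) / 2) - (- lam n * ((a - \<alpha>) / 2)))"
      by (simp only: exp_add exp_diff)
    also have "- lam n * a + lam n * ((a - \<alpha>) / 2) - (- lam n * ((a - \<alpha>) / 2)) = - lam n * \<alpha>"
      by (simp add: field_simps)
    finally show ?case .
  qed
qed

text \<open>Near a point \<open>z\<close> other than \<open>z0\<close>, a window fits into the half
  line beyond a point \<open>p\<close> slightly closer to \<open>z0\<close> whose rate still exceeds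
  \<alpha>. At \<open>z0\<close> the rate is 0, so \<alpha> is negative and the bound exceeds
  1.\<close>

lemma local_upper:
  assumes z: "z \<in> D" and a: "\<alpha> < r z"
  obtains \<delta> where "0 < \<delta>" "\<forall>\<^sub>F n in sequentially. measure (Q n) {z - \<delta><..<z + \<delta>} \<le> exp (- lam n * \<alpha>)"
proof (cases "z = z0")
  case True
  have "\<forall>\<^sub>F n in sequentially. 1 \<le> lam n" using lam by (simp add: filterlim_at_top)
  then have "\<forall>\<^sub>F n in sequentially. measure (Q n) {z - 1<..<z + 1} \<le> exp (- lam n * \<alpha>)" using fam
  proof eventually_elim
    case (elim n)
    interpret prob_space "Q n" using elim by blast
    have "0 \<le> - lam n * \<alpha>" using a True r_z0 elim by (simp add: mult_nonneg_nonpos)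
    then have "1 \<le> exp (- lam n * \<alpha>)" by simp
    then show ?case using prob_le_1[of "{z - 1<..<z + 1}"] by linarith
  qed
  then show thesis by (rule that[of 1, rotated]) simp
next
  case False
  obtain d where d: "0 < d" "d < \<bar>z - z0\<bar>" "\<And>y. \<bar>y - z\<bar> \<le> d \<Longrightarrow> y \<in> D \<and> \<bar>r y - r z\<bar> < r z - \<alpha>"
    using small_window[OF z, of "\<bar>z - z0\<bar>" "r z - \<alpha>"] False a by auto
  define p where "p = (if z > z0 then z - d else z + d)"
  have p: "p \<in> D" "p \<noteq> z0" "\<alpha> < r p" using d(1,2) d(3)[of p] by (auto simp: p_def abs_if split: if_splits)
  have sub: "{z - d<..<z + d} \<subseteq> {y. 0 \<le> (y - p) * (p - z0)}"
    using d(1,2) False by (auto simp: p_def abs_if mult_nonpos_nonpos split: if_splits)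
  have "\<forall>\<^sub>F n in sequentially. measure (Q n) {z - d<..<z + d} \<le> exp (- lam n * \<alpha>)"
    using half_line_bound[OF p] fam
  proof eventually_elim
    case (elim n)
    interpret prob_space "Q n" using elim by blast
    have "sets (Q n) = sets borel" using elim by auto
    then have "measure (Q n) {z - d<..<z + d} \<le> measure (Q n) {y. 0 \<le> (y - p) * (p - z0)}"
      by (intro finite_measure_mono sub) auto
    then show ?case using elim by linarith
  qed
  with d(1) show thesis by (rule that)
qed

lemma exponential_tightness:
  obtains l u where "l \<in> D" "u \<in> D" "l < z0" "z0 < u"
    "\<forall>\<^sub>F n in sequentially. measure (Q n) (- {l..u}) \<le> 2 * exp (- lam n * \<alpha>)"
proof -
  obtain l u where lu: "l \<in> D" "u \<in> D" "l < z0" "z0 < u" "\<alpha> < r l" "\<alpha> < r u"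
    using ends[of \<alpha>] by auto
  have "\<forall>\<^sub>F n in sequentially. measure (Q n) {y. 0 \<le> (y - l) * (l - z0)} \<le> exp (- lam n * \<alpha>)"
    "\<forall>\<^sub>F n in sequentially. measure (Q n) {y. 0 \<le> (y - u) * (u - z0)} \<le> exp (- lam n * \<alpha>)"
    using half_line_bound[OF lu(1) _ lu(5)] half_line_bound[OF lu(2) _ lu(6)] lu(3,4) by simp_all
  then have "\<forall>\<^sub>F n in sequentially. measure (Q n) (- {l..u}) \<le> 2 * exp (- lam n * \<alpha>)" using fam
  proof eventually_elim
    case (elim n)
    interpret prob_space "Q n" using elim by blast
    let ?L = "{y. 0 \<le> (y - l) * (l - z0)}" and ?U = "{y. 0 \<le> (y - u) * (u - z0)}"
    have s: "sets (Q n) = sets borel" using elim by auto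
    have m: "?L \<in> sets borel" "?U \<in> sets borel" by measurable
    have "- {l..u} \<subseteq> ?L \<union> ?U" using lu by (auto simp: zero_le_mult_iff)
    then have "measure (Q n) (- {l..u}) \<le> measure (Q n) (?L \<union> ?U)"
      using m by (intro finite_measure_mono) (auto simp: s)
    also have "\<dots> \<le> measure (Q n) ?L + measure (Q n) ?U" using m by (intro measure_Un_le) (auto simp: s)
    finally show ?case using elim by linarith
  qed
  with lu show thesis by (intro that) auto
qed

lemma local_lower:
  assumes z: "z \<in> D" and "0 < \<delta>" "0 < \<epsilon>"
  shows "\<forall>\<^sub>F n in sequentially. exp (- lam n * (r z + \<epsilon>)) \<le> measure (Q n) {z - \<delta><..<z + \<delta>}"
proof -
  \<comment> \<open>Three shares of \<epsilon>: the variation of \<open>r\<close> on the window, the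
    normalizing constant, and the width of the window.\<close>
  obtain d where d: "0 < d" "d < \<delta>" "\<And>y. \<bar>y - z\<bar> \<le> d \<Longrightarrow> y \<in> D \<and> \<bar>r y - r z\<bar> < \<epsilon> / 3"
    using small_window[OF z assms(2), of "\<epsilon> / 3"] assms(3) by auto
  have a: "z - d \<in> D \<and> \<bar>r (z - d) - r z\<bar> < \<epsilon> / 3" by (rule d(3)) (use d(1) in simp)
  have b: "z + d \<in> D \<and> \<bar>r (z + d) - r z\<bar> < \<epsilon> / 3" by (rule d(3)) (use d(1) in simp)
  have ab: "r (z - d) < r z + \<epsilon> / 3" "r (z + d) < r z + \<epsilon> / 3" using a b by linarith+
  have low: "\<forall>\<^sub>F n in sequentially. ((z + d) - (z - d)) * exp (- lam n * (r z + \<epsilon> / 3)) / N n \<le> measure (Q n) {z - d..z + d}"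
    by (rule lower_bound) (use d(1) a b ab in auto)
  have N: "\<forall>\<^sub>F n in sequentially. N n \<le> exp (lam n * (\<epsilon> / 3))" using assms by (intro norm_le) auto
  have C: "\<forall>\<^sub>F n in sequentially. 1 / (2 * d) \<le> exp (lam n * (\<epsilon> / 3))" using assms by (intro eventually_le_exp) auto
  show ?thesis using low N C fam
  proof eventually_elim
    case (elim n)
    interpret prob_space "Q n" using elim by blast
    have Nn: "N n > 0" using elim by simp
    have s: "sets (Q n) = sets borel" using elim by auto
    have "exp (- lam n * (r z + \<epsilon>)) = exp (- lam n * (r z + \<epsilon> / 3)) * (exp (- lam n * (\<epsilon> / 3)) * exp (- lam n * (\<epsilon> / 3)))"
      by (simp add: exp_add[symmetric] algebra_simps)
    also have "\<dots> = exp (- lam n * (r z + \<epsilon> / 3)) * (exp (- lam n * (\<epsilon> / 3)) * 1) / exp (lam n * (\<epsilon> / 3))"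
      by (simp add: exp_minus field_simps)
    also have "\<dots> \<le> exp (- lam n * (r z + \<epsilon> / 3)) * (2 * d) / N n"
    proof (intro frac_le mult_left_mono)
      show "exp (- lam n * (\<epsilon> / 3)) * 1 \<le> 2 * d"
        using elim(3) d(1) by (simp add: exp_minus field_simps)
    qed (use elim Nn d(1) in auto)
    also have "\<dots> \<le> measure (Q n) {z - d..z + d}" using elim(1) by (simp add: mult.commute)
    also have "\<dots> \<le> measure (Q n) {z - \<delta><..<z + \<delta>}" using d s by (intro finite_measure_mono) auto
    finally show ?case .
  qed
qed

end

section \<open>The rate functions of single coefficients\<close>

text \<open>\<open>g (1 + t z) / t\<^sup>2 = z\<^sup>2 * log_remainder (t z)\<close> has the limit \<open>z\<^sup>2 / 2\<close> for \<open>t \<rightarrow> 0\<close>; this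
  allows treating the cases \<open>\<gamma> = 0\<close> and \<open>\<sigma> = 0\<close> together with the generic one.\<close>

definition log_remainder :: "real \<Rightarrow> real" where
  "log_remainder x = (if x = 0 then 1 / 2 else (x - ln (1 + x)) / x\<^sup>2)"

lemma log_remainder_mult:
  "t \<noteq> 0 \<Longrightarrow> z\<^sup>2 * log_remainder (t * z) = (t * z - ln (1 + t * z)) / t\<^sup>2"
  by (cases "z = 0") (auto simp: log_remainder_def power_mult_distrib)

lemma log_remainder_pos: "-1 < x \<Longrightarrow> 0 < log_remainder x"
  using ln_add_one_self_less_self[of x] ln_le_minus_one[of "1 + x"] ln_eq_minus_one[of "1 + x"]
  by (cases "x = 0") (auto simp: log_remainder_def intro!: divide_pos_pos, fastforce)

lemma isCont_log_remainder:
  assumes "-1 < x" shows "isCont log_remainder x"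
proof (cases "x = 0")
  case True
  have "((\<lambda>x::real. (x - ln (1 + x)) / x\<^sup>2) \<longlongrightarrow> 1 / 2) (at 0)" by real_asymp
  then have "(log_remainder \<longlongrightarrow> 1 / 2) (at 0)"
    by (rule Lim_transform_eventually) (auto simp: eventually_at_filter log_remainder_def)
  then show ?thesis using True by (simp add: isCont_def log_remainder_def)
next
  case False
  have "isCont (\<lambda>x::real. (x - ln (1 + x)) / x\<^sup>2) x" using False assms by (intro continuous_intros) auto
  moreover have "\<forall>\<^sub>F y in nhds x. log_remainder y = (y - ln (1 + y)) / y\<^sup>2"
    using t1_space_nhds[OF False] by eventually_elim (simp add: log_remainder_def)
  ultimately show ?thesis using isCont_cong by metis
qed

lemma tendsto_log_remainder:
  "(f \<longlongrightarrow> x) F \<Longrightarrow> -1 < x \<Longrightarrow> ((\<lambda>y. log_remainder (f y)) \<longlongrightarrow> log_remainder x) F"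
  using isCont_tendsto_compose[OF isCont_log_remainder] by blast

definition u_rate :: "real \<Rightarrow> real \<Rightarrow> real \<Rightarrow> real" where
  "u_rate \<gamma> \<sigma> z = z\<^sup>2 * log_remainder (sqrt \<gamma> * z) + \<sigma> * (z\<^sup>2 * log_remainder (- \<sigma> * sqrt \<gamma> * z))"

text \<open>This is c / (1 - c) for c = \<gamma>\<sigma> / (1 + \<sigma>), so that (1 - c v) / (1 -
  c) = 1 + \<open>v_ratio \<gamma> \<sigma> * (1 - v)\<close>.\<close>

definition v_ratio :: "real \<Rightarrow> real \<Rightarrow> real" where
  "v_ratio \<gamma> \<sigma> = \<gamma> * \<sigma> / (1 + \<sigma> - \<gamma> * \<sigma>)"

text \<open>For c > 0 the last summand is (1 - c) / c times \<open>g\<close> at (1 - c v) / (1 - c);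
  this form makes it 0 for c = 0.\<close>

definition v_rate :: "real \<Rightarrow> real \<Rightarrow> real \<Rightarrow> real" where
  "v_rate \<gamma> \<sigma> v = (v - ln v - 1) + v_ratio \<gamma> \<sigma> * ((1 - v)\<^sup>2 * log_remainder (v_ratio \<gamma> \<sigma> * (1 - v)))"

locale limit_params =
  fixes \<gamma> \<sigma> :: real
  assumes gamma: "0 \<le> \<gamma>" "\<gamma> \<le> 1" and sigma: "0 \<le> \<sigma>" and gs: "\<gamma> * \<sigma> < 1"
begin

abbreviation \<tau> :: real where "\<tau> \<equiv> v_ratio \<gamma> \<sigma>"

lemma \<tau>_nonneg: "0 \<le> \<tau>" and \<tau>_pos: "\<gamma> * \<sigma> \<noteq> 0 \<Longrightarrow> 0 < \<tau>" and \<tau>_zero: "\<gamma> * \<sigma> = 0 \<Longrightarrow> \<tau> = 0"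
  using gamma sigma gs mult_nonneg_nonneg[OF gamma(1) sigma]
  by (auto simp: v_ratio_def intro!: divide_nonneg_pos divide_pos_pos)

lemma u_range_iff: "z \<in> u_range \<gamma> \<sigma> \<longleftrightarrow> 0 < 1 + sqrt \<gamma> * z \<and> 0 < 1 - \<sigma> * sqrt \<gamma> * z"
proof -
  have "(\<gamma> \<noteq> 0 \<longrightarrow> - 1 / sqrt \<gamma> < z) \<longleftrightarrow> 0 < 1 + sqrt \<gamma> * z"
  proof (cases "\<gamma> = 0")
    case False
    then have "sqrt \<gamma> > 0" using gamma by simp
    then show ?thesis using False by (auto simp: pos_divide_less_eq field_simps)
  qed simp
  moreover have "(\<gamma> * \<sigma> \<noteq> 0 \<longrightarrow> z < 1 / (sqrt \<gamma> * \<sigma>)) \<longleftrightarrow> 0 < 1 - \<sigma> * sqrt \<gamma> * z"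
  proof (cases "\<gamma> * \<sigma> = 0")
    case False
    then have "sqrt \<gamma> * \<sigma> > 0" using gamma sigma by auto
    then show ?thesis using False by (auto simp: pos_less_divide_eq mult_ac)
  qed auto
  ultimately show ?thesis by (simp add: u_range_def)
qed

lemma v_range_iff: "z \<in> v_range \<gamma> \<sigma> \<longleftrightarrow> 0 < z \<and> 0 < 1 + \<tau> * (1 - z)"
proof -
  have "(\<gamma> * \<sigma> \<noteq> 0 \<longrightarrow> z < (1 + \<sigma>) / (\<gamma> * \<sigma>)) \<longleftrightarrow> 0 < 1 + \<tau> * (1 - z)"
  proof (cases "\<gamma> * \<sigma> = 0")
    case False
    then have p: "\<gamma> * \<sigma> > 0" using gamma sigma by (metis less_eq_real_def mult_nonneg_nonneg)
    have q: "1 + \<sigma> - \<gamma> * \<sigma> > 0" using gs sigma by linarith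
    have "1 + \<tau> * (1 - z) = (1 + \<sigma> - \<gamma> * \<sigma> * z) / (1 + \<sigma> - \<gamma> * \<sigma>)"
      using q by (simp add: v_ratio_def field_simps)
    then have "0 < 1 + \<tau> * (1 - z) \<longleftrightarrow> z * (\<gamma> * \<sigma>) < 1 + \<sigma>"
      using q by (simp add: zero_less_divide_iff mult_ac)
    then show ?thesis using p False by (simp only: pos_less_divide_eq) simp
  qed (simp add: \<tau>_zero)
  then show ?thesis by (auto simp: v_range_def)
qed

lemma open_u_range: "open (u_range \<gamma> \<sigma>)" and open_v_range: "open (v_range \<gamma> \<sigma>)"
proof -
  have "u_range \<gamma> \<sigma> = {z. 0 < 1 + sqrt \<gamma> * z} \<inter> {z. 0 < 1 - \<sigma> * sqrt \<gamma> * z}" using u_range_iff by auto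
  then show "open (u_range \<gamma> \<sigma>)" by (simp add: open_Int open_Collect_less continuous_intros)
  have "v_range \<gamma> \<sigma> = {z. 0 < z} \<inter> {z. 0 < 1 + \<tau> * (1 - z)}" using v_range_iff by auto
  then show "open (v_range \<gamma> \<sigma>)" by (simp add: open_Int open_Collect_less continuous_intros)
qed

lemma is_interval_u_range: "is_interval (u_range \<gamma> \<sigma>)"
  unfolding is_interval_1 u_range_iff
proof (intro ballI allI impI)
  fix a b x assume *: "a \<in> u_range \<gamma> \<sigma>" "b \<in> u_range \<gamma> \<sigma>" "a \<le> x \<and> x \<le> b"
  have "sqrt \<gamma> * a \<le> sqrt \<gamma> * x" "\<sigma> * sqrt \<gamma> * x \<le> \<sigma> * sqrt \<gamma> * b"
    using * gamma sigma by (auto intro!: mult_left_mono)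
  with * show "0 < 1 + sqrt \<gamma> * x \<and> 0 < 1 - \<sigma> * sqrt \<gamma> * x" unfolding u_range_iff by linarith
qed

lemma is_interval_v_range: "is_interval (v_range \<gamma> \<sigma>)"
  unfolding is_interval_1 v_range_iff
proof (intro ballI allI impI)
  fix a b x assume *: "a \<in> v_range \<gamma> \<sigma>" "b \<in> v_range \<gamma> \<sigma>" "a \<le> x \<and> x \<le> b"
  have "\<tau> * (1 - b) \<le> \<tau> * (1 - x)" using * \<tau>_nonneg by (auto intro!: mult_left_mono)
  with * show "0 < x \<and> 0 < 1 + \<tau> * (1 - x)" unfolding v_range_iff by linarith
qed

lemma zero_in_u_range: "0 \<in> u_range \<gamma> \<sigma>" and one_in_v_range: "1 \<in> v_range \<gamma> \<sigma>"
  by (simp_all add: u_range_iff v_range_iff)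

lemma u_rate_tendsto:
  assumes "z \<in> u_range \<gamma> \<sigma>" "(t \<longlongrightarrow> sqrt \<gamma>) F" "(s \<longlongrightarrow> \<sigma>) F" "(y \<longlongrightarrow> z) F"
  shows "((\<lambda>n. (y n)\<^sup>2 * log_remainder (t n * y n) + s n * ((y n)\<^sup>2 * log_remainder (- s n * t n * y n)))
     \<longlongrightarrow> u_rate \<gamma> \<sigma> z) F"
  unfolding u_rate_def using assms(1)[unfolded u_range_iff]
  by (intro tendsto_intros tendsto_log_remainder assms) auto

lemma continuous_u_rate: "continuous_on (u_range \<gamma> \<sigma>) (u_rate \<gamma> \<sigma>)"
  unfolding continuous_on_def
proof
  fix z assume "z \<in> u_range \<gamma> \<sigma>"
  from u_rate_tendsto[OF this tendsto_const tendsto_const tendsto_ident_at]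
  show "(u_rate \<gamma> \<sigma> \<longlongrightarrow> u_rate \<gamma> \<sigma> z) (at z within u_range \<gamma> \<sigma>)" by (simp add: u_rate_def[abs_def])
qed

lemma continuous_v_rate: "continuous_on (v_range \<gamma> \<sigma>) (v_rate \<gamma> \<sigma>)"
  unfolding continuous_on_def
proof
  fix z assume "z \<in> v_range \<gamma> \<sigma>"
  then have z: "0 < z" "-1 < \<tau> * (1 - z)" by (auto simp: v_range_iff)
  show "(v_rate \<gamma> \<sigma> \<longlongrightarrow> v_rate \<gamma> \<sigma> z) (at z within v_range \<gamma> \<sigma>)"
    unfolding v_rate_def[abs_def] using z by (intro tendsto_intros tendsto_log_remainder) auto
qed

lemma ln_ge_rate: "0 < v \<Longrightarrow> 0 \<le> v - ln v - (1::real)"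
  using ln_le_minus_one[of v] by simp

lemma u_rate_0: "u_rate \<gamma> \<sigma> 0 = 0" and v_rate_1: "v_rate \<gamma> \<sigma> 1 = 0"
  by (simp_all add: u_rate_def v_rate_def)

lemma u_rate_ge:
  assumes "z \<in> u_range \<gamma> \<sigma>"
  shows "z\<^sup>2 * log_remainder (sqrt \<gamma> * z) \<le> u_rate \<gamma> \<sigma> z" "\<sigma> * (z\<^sup>2 * log_remainder (- \<sigma> * sqrt \<gamma> * z)) \<le> u_rate \<gamma> \<sigma> z"
proof -
  have "0 < log_remainder (sqrt \<gamma> * z)" "0 < log_remainder (- \<sigma> * sqrt \<gamma> * z)"
    using assms by (auto simp: u_range_iff intro!: log_remainder_pos)
  then show "z\<^sup>2 * log_remainder (sqrt \<gamma> * z) \<le> u_rate \<gamma> \<sigma> z" "\<sigma> * (z\<^sup>2 * log_remainder (- \<sigma> * sqrt \<gamma> * z)) \<le> u_rate \<gamma> \<sigma> z"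
    using sigma unfolding u_rate_def by auto
qed

lemma v_rate_ge:
  assumes "z \<in> v_range \<gamma> \<sigma>"
  shows "z - ln z - 1 \<le> v_rate \<gamma> \<sigma> z" "\<tau> * ((1 - z)\<^sup>2 * log_remainder (\<tau> * (1 - z))) \<le> v_rate \<gamma> \<sigma> z"
proof -
  have "0 < log_remainder (\<tau> * (1 - z))" "0 < z"
    using assms by (auto simp: v_range_iff intro!: log_remainder_pos)
  then show "z - ln z - 1 \<le> v_rate \<gamma> \<sigma> z" "\<tau> * ((1 - z)\<^sup>2 * log_remainder (\<tau> * (1 - z))) \<le> v_rate \<gamma> \<sigma> z"
    using \<tau>_nonneg ln_ge_rate[of z] unfolding v_rate_def by auto
qed

lemma u_rate_pos:
  assumes "z \<in> u_range \<gamma> \<sigma>" "z \<noteq> 0" shows "0 < u_rate \<gamma> \<sigma> z"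
proof -
  have "0 < z\<^sup>2 * log_remainder (sqrt \<gamma> * z)"
    using assms by (intro mult_pos_pos log_remainder_pos) (auto simp: u_range_iff)
  then show ?thesis using u_rate_ge(1)[OF assms(1)] by linarith
qed

lemma v_rate_pos:
  assumes "z \<in> v_range \<gamma> \<sigma>" "z \<noteq> 1" shows "0 < v_rate \<gamma> \<sigma> z"
proof -
  have "0 < z" using assms by (simp add: v_range_iff)
  then have "z - ln z - 1 \<noteq> 0" using ln_eq_minus_one[of z] assms(2) by auto
  then show ?thesis using v_rate_ge(1)[OF assms(1)] ln_ge_rate[OF \<open>0 < z\<close>] by linarith
qed

text \<open>At a finite endpoint the logarithm diverges, and points at distance of order exp (- m)
  are taken; towards an infinite endpoint the square or the exponential dominates. Division by
  \<gamma> \<le> 1 or by \<gamma>\<sigma> \<le> 1 only enlarges the rate.\<close>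

lemma u_rate_ends: "\<exists>z1\<in>u_range \<gamma> \<sigma>. \<exists>z2\<in>u_range \<gamma> \<sigma>. z1 < 0 \<and> 0 < z2 \<and> \<alpha> < u_rate \<gamma> \<sigma> z1 \<and> \<alpha> < u_rate \<gamma> \<sigma> z2"
proof -
  \<comment> \<open>Large enough for both \<open>\<alpha> < m - 1\<close> and
    \<open>\<alpha> < m\<^sup>2 / 2\<close>, the two bounds used below.\<close>
  define m where "m = max 1 (2 * \<bar>\<alpha>\<bar> + 3)"
  have m: "m \<ge> 3" "m \<ge> 2 * \<bar>\<alpha>\<bar> + 3" by (auto simp: m_def)
  have e: "exp (-m) < 1" using m by simp
  have lower: "\<exists>z1\<in>u_range \<gamma> \<sigma>. z1 < 0 \<and> \<alpha> < u_rate \<gamma> \<sigma> z1"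
  proof (cases "\<gamma> = 0")
    case True
    have r: "-m \<in> u_range \<gamma> \<sigma>" unfolding u_range_iff using True by simp
    have "u_rate \<gamma> \<sigma> (-m) \<ge> m\<^sup>2 * (1 / 2)"
      using u_rate_ge(1)[OF r] True by (simp add: log_remainder_def)
    moreover have "m * 3 \<le> m\<^sup>2" unfolding power2_eq_square using m by (intro mult_left_mono) auto
    ultimately show ?thesis using m by (intro bexI[OF _ r]) linarith
  next
    case False
    then have t: "sqrt \<gamma> > 0" "sqrt \<gamma> \<le> 1" using gamma by auto
    let ?z = "- (1 - exp (-m)) / sqrt \<gamma>"
    have tz: "1 + sqrt \<gamma> * ?z = exp (-m)" using t by simp
    have z: "?z < 0" using t e by (simp add: divide_neg_pos)
    have "\<sigma> * sqrt \<gamma> * ?z \<le> 0" using z t sigma by (intro mult_nonneg_nonpos) auto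
    then have r: "?z \<in> u_range \<gamma> \<sigma>" unfolding u_range_iff tz by simp
    have "\<alpha> < m - 1" using m by linarith
    also have "\<dots> \<le> sqrt \<gamma> * ?z - ln (1 + sqrt \<gamma> * ?z)"
    proof -
      have "sqrt \<gamma> * ?z = exp (-m) - 1" using tz by linarith
      then show ?thesis unfolding tz using exp_ge_zero[of "-m"] by simp
    qed
    also have "\<dots> \<le> (sqrt \<gamma> * ?z - ln (1 + sqrt \<gamma> * ?z)) / (sqrt \<gamma>)\<^sup>2"
    proof -
      have "0 \<le> sqrt \<gamma> * ?z - ln (1 + sqrt \<gamma> * ?z)" using ln_le_minus_one[of "1 + sqrt \<gamma> * ?z"] tz by simp
      moreover have "0 < \<gamma>" "\<gamma> \<le> 1" using False gamma by auto
      ultimately show ?thesis by (simp add: pos_le_divide_eq mult_left_le)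
    qed
    also have "\<dots> \<le> u_rate \<gamma> \<sigma> ?z"
      using u_rate_ge(1)[OF r] log_remainder_mult[of "sqrt \<gamma>" ?z] t by simp
    finally show ?thesis using r z by blast
  qed
  have upper: "\<exists>z1\<in>u_range \<gamma> \<sigma>. 0 < z1 \<and> \<alpha> < u_rate \<gamma> \<sigma> z1"
  proof (cases "\<gamma> * \<sigma> = 0")
    case True
    then consider "\<gamma> = 0" | "\<gamma> \<noteq> 0" "\<sigma> = 0" by auto
    then show ?thesis
    proof cases
      case 1
      have r: "m \<in> u_range \<gamma> \<sigma>" unfolding u_range_iff using 1 by simp
      have "u_rate \<gamma> \<sigma> m \<ge> m\<^sup>2 * (1 / 2)"
        using u_rate_ge(1)[OF r] 1 by (simp add: log_remainder_def)
      moreover have "m * 3 \<le> m\<^sup>2" unfolding power2_eq_square using m by (intro mult_left_mono) auto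
      ultimately show ?thesis using m by (intro bexI[OF _ r]) linarith
    next
      case 2
      then have t: "sqrt \<gamma> > 0" "sqrt \<gamma> \<le> 1" using gamma by auto
      let ?z = "(exp m - 1) / sqrt \<gamma>"
      have tz: "1 + sqrt \<gamma> * ?z = exp m" using t by simp
      have z: "0 < ?z" using t m by simp
      have r: "?z \<in> u_range \<gamma> \<sigma>" unfolding u_range_iff tz using 2 by simp
      have "m * 3 \<le> m\<^sup>2" unfolding power2_eq_square using m by (intro mult_left_mono) auto
      then have "\<alpha> < m\<^sup>2 / 2" using m by linarith
      also have "\<dots> \<le> sqrt \<gamma> * ?z - ln (1 + sqrt \<gamma> * ?z)"
      proof -
        have "sqrt \<gamma> * ?z = exp m - 1" using tz by linarith
        then show ?thesis unfolding tz using exp_lower_Taylor_quadratic[of m] m by simp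
      qed
      also have "\<dots> \<le> (sqrt \<gamma> * ?z - ln (1 + sqrt \<gamma> * ?z)) / (sqrt \<gamma>)\<^sup>2"
      proof -
        have "0 \<le> sqrt \<gamma> * ?z - ln (1 + sqrt \<gamma> * ?z)" using ln_le_minus_one[of "1 + sqrt \<gamma> * ?z"] tz by simp
        moreover have "0 < \<gamma>" "\<gamma> \<le> 1" using 2 gamma by auto
        ultimately show ?thesis by (simp add: pos_le_divide_eq mult_left_le)
      qed
      also have "\<dots> \<le> u_rate \<gamma> \<sigma> ?z"
        using u_rate_ge(1)[OF r] log_remainder_mult[of "sqrt \<gamma>" ?z] t by simp
      finally show ?thesis using r z by blast
    qed
  next
    case False
    define t where "t = \<sigma> * sqrt \<gamma>"
    have t: "t > 0" "\<sigma> > 0" using gamma sigma False by (auto simp: t_def)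
    let ?z = "(1 - exp (-m)) / t"
    have tz: "1 - t * ?z = exp (-m)" using t by simp
    have z: "0 < ?z" using t e by simp
    have "0 \<le> sqrt \<gamma> * ?z" using z t gamma by (intro mult_nonneg_nonneg) auto
    then have "0 < 1 + sqrt \<gamma> * ?z" by linarith
    moreover have "0 < 1 - \<sigma> * sqrt \<gamma> * ?z" using tz unfolding t_def[symmetric] by simp
    ultimately have r: "?z \<in> u_range \<gamma> \<sigma>" unfolding u_range_iff by blast
    have "\<alpha> < m - 1" using m by linarith
    also have "\<dots> \<le> - t * ?z - ln (1 + - t * ?z)"
    proof -
      have e1: "1 + - t * ?z = exp (-m)" using tz by simp
      then have e2: "- t * ?z = exp (-m) - 1" by linarith
      show ?thesis unfolding e1 e2 using exp_ge_zero[of "-m"] by simp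
    qed
    also have "\<dots> \<le> \<sigma> * ((- t * ?z - ln (1 + - t * ?z)) / (- t)\<^sup>2)"
    proof -
      have nn: "0 \<le> - t * ?z - ln (1 + - t * ?z)" using ln_le_minus_one[of "1 + - t * ?z"] tz by simp
      have "t\<^sup>2 = \<sigma> * (\<gamma> * \<sigma>)" using gamma by (simp add: t_def power2_eq_square mult_ac)
      then have "\<sigma> * ((- t * ?z - ln (1 + - t * ?z)) / (- t)\<^sup>2) = (- t * ?z - ln (1 + - t * ?z)) / (\<gamma> * \<sigma>)" using t by simp
      moreover have "0 < \<gamma> * \<sigma>" "\<gamma> * \<sigma> \<le> 1" using gs gamma sigma False by (auto simp: zero_less_mult_iff)
      ultimately show ?thesis using nn by (simp only: pos_le_divide_eq) (simp add: mult_left_le)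
    qed
    also have "\<dots> \<le> u_rate \<gamma> \<sigma> ?z"
    proof -
      have eqt: "- \<sigma> * sqrt \<gamma> = - t" by (simp add: t_def)
      have "- t \<noteq> 0" using t by simp
      show ?thesis by (rule u_rate_ge(2)[OF r, unfolded eqt log_remainder_mult[OF \<open>- t \<noteq> 0\<close>]])
    qed
    finally show ?thesis using r z by blast
  qed
  from lower upper show ?thesis by blast
qed

lemma v_rate_ends: "\<exists>z1\<in>v_range \<gamma> \<sigma>. \<exists>z2\<in>v_range \<gamma> \<sigma>. z1 < 1 \<and> 1 < z2 \<and> \<alpha> < v_rate \<gamma> \<sigma> z1 \<and> \<alpha> < v_rate \<gamma> \<sigma> z2"
proof -
  define m where "m = max 1 (2 * \<bar>\<alpha>\<bar> + 3)"
  have m: "m \<ge> 3" "m \<ge> 2 * \<bar>\<alpha>\<bar> + 3" by (auto simp: m_def)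
  have e: "exp (-m) < 1" using m by simp
  have lower: "\<exists>z1\<in>v_range \<gamma> \<sigma>. z1 < 1 \<and> \<alpha> < v_rate \<gamma> \<sigma> z1"
  proof (intro bexI[of _ "exp (-m)"] conjI e)
    show r: "exp (-m) \<in> v_range \<gamma> \<sigma>"
      unfolding v_range_iff using e \<tau>_nonneg by (auto intro!: add_pos_nonneg mult_nonneg_nonneg)
    show "\<alpha> < v_rate \<gamma> \<sigma> (exp (-m))"
      using v_rate_ge(1)[OF r] exp_gt_zero[of "-m"] m unfolding ln_exp by linarith
  qed
  have upper: "\<exists>z1\<in>v_range \<gamma> \<sigma>. 1 < z1 \<and> \<alpha> < v_rate \<gamma> \<sigma> z1"
  proof (cases "\<gamma> * \<sigma> = 0")
    case True
    show ?thesis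
    proof (intro bexI[of _ "exp m"] conjI)
      show "1 < exp m" using m by simp
      show r: "exp m \<in> v_range \<gamma> \<sigma>" unfolding v_range_iff using \<tau>_zero[OF True] by simp
      have "m * 3 \<le> m\<^sup>2" unfolding power2_eq_square using m by (intro mult_left_mono) auto
      then show "\<alpha> < v_rate \<gamma> \<sigma> (exp m)"
        using v_rate_ge(1)[OF r] exp_lower_Taylor_quadratic[of m] m unfolding ln_exp by linarith
    qed
  next
    case False
    have t: "\<tau> > 0" by (rule \<tau>_pos[OF False])
    have t1: "\<tau> * (m - 1) \<le> \<tau> * (m - 1)" ..
    \<comment> \<open>The inequality is proved after multiplication by \<tau>; the factor
      \<open>max 1 \<tau>\<close> in the exponent compensates for it.\<close>
    define k where "k = m * max 1 \<tau>"
    have k: "k \<ge> m" "k \<ge> m * \<tau>" using m by (auto simp: k_def mult_le_cancel_left1)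
    have ek: "exp (-k) < 1" using k m by simp
    let ?z = "1 + (1 - exp (-k)) / \<tau>"
    have tz: "\<tau> * (1 - ?z) = exp (-k) - 1" using t by simp
    have z: "1 < ?z" using t ek by simp
    have r: "?z \<in> v_range \<gamma> \<sigma>" unfolding v_range_iff tz using z by simp
    have "\<alpha> * \<tau> < (m - 1) * \<tau>" using t m by (intro mult_strict_right_mono) auto
    also have "\<dots> \<le> k - 1"
    proof -
      have "m - 1 \<ge> 0" using m by simp
      have "(m - 1) * \<tau> \<le> (m - 1) * max 1 \<tau>" using m by (intro mult_left_mono) auto
      also have "\<dots> \<le> k - 1" by (simp add: k_def algebra_simps)
      finally show ?thesis .
    qed
    also have "\<dots> \<le> \<tau> * (1 - ?z) - ln (1 + \<tau> * (1 - ?z))" unfolding tz using exp_ge_zero[of "-k"] by simp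
    also have "\<dots> = \<tau> * (\<tau> * ((1 - ?z)\<^sup>2 * log_remainder (\<tau> * (1 - ?z))))"
      using log_remainder_mult[of \<tau> "1 - ?z"] t by (simp add: power2_eq_square)
    also have "\<dots> \<le> \<tau> * v_rate \<gamma> \<sigma> ?z" using v_rate_ge(2)[OF r] t by (intro mult_left_mono) auto
    finally have "\<alpha> < v_rate \<gamma> \<sigma> ?z" using t by (simp add: mult.commute mult_less_cancel_left)
    then show ?thesis using r z by blast
  qed
  from lower upper show ?thesis by blast
qed

end

section \<open>Densities of rescaled beta variables\<close>

lemma convex_on_neg_ln_affine:
  fixes A B \<alpha>1 \<alpha>2 \<beta>1 \<beta>2 :: real
  assumes AB: "0 \<le> A" "0 \<le> B"
  shows "convex_on {z. 0 < \<alpha>1 + \<alpha>2 * z \<and> 0 < \<beta>1 + \<beta>2 * z} (\<lambda>z. - A * ln (\<alpha>1 + \<alpha>2 * z) - B * ln (\<beta>1 + \<beta>2 * z))"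
    (is "convex_on ?S _")
proof -
  have aff: "p + q * ((1 - t) * x + t * y) = (1 - t) * (p + q * x) + t * (p + q * y)" for p q t x y :: real
    by (simp add: algebra_simps)
  have S: "?S \<subseteq> {z. 0 < \<alpha>1 + \<alpha>2 * z}" "?S \<subseteq> {z. 0 < \<beta>1 + \<beta>2 * z}" by auto
  have convS: "convex ?S"
  proof (rule convexI)
    fix x y u v :: real assume *: "x \<in> ?S" "y \<in> ?S" "0 \<le> u" "0 \<le> v" "u + v = 1"
    have u: "u = 1 - v" using * by simp
    have pos: "0 < (1 - v) * a + v * b" if "0 < a" "0 < b" for a b :: real
      using convex_bound_lt[of "-a" 0 "-b" "1 - v" v] * that u by simp
    show "u *\<^sub>R x + v *\<^sub>R y \<in> ?S"
      using * unfolding u by (auto simp: aff intro!: pos)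
  qed
  have ln: "(1 - t) * ln a + t * ln b \<le> ln ((1 - t) * a + t * b)" if "0 < t" "t < 1" "0 < a" "0 < b" for a b t :: real
    using concave_onD[OF ln_concave, of t a b] that by simp
  show ?thesis
  proof (rule convex_onI[OF _ convS])
    fix t x y :: real assume t: "0 < t" "t < 1" and xy: "x \<in> ?S" "y \<in> ?S"
    have "A * ((1 - t) * ln (\<alpha>1 + \<alpha>2 * x) + t * ln (\<alpha>1 + \<alpha>2 * y)) \<le> A * ln (\<alpha>1 + \<alpha>2 * ((1 - t) * x + t * y))"
      unfolding aff using t xy by (intro mult_left_mono ln AB) auto
    moreover have "B * ((1 - t) * ln (\<beta>1 + \<beta>2 * x) + t * ln (\<beta>1 + \<beta>2 * y)) \<le> B * ln (\<beta>1 + \<beta>2 * ((1 - t) * x + t * y))"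
      unfolding aff using t xy by (intro mult_left_mono ln AB) auto
    ultimately show "- A * ln (\<alpha>1 + \<alpha>2 * ((1 - t) *\<^sub>R x + t *\<^sub>R y)) - B * ln (\<beta>1 + \<beta>2 * ((1 - t) *\<^sub>R x + t *\<^sub>R y))
        \<le> (1 - t) * (- A * ln (\<alpha>1 + \<alpha>2 * x) - B * ln (\<beta>1 + \<beta>2 * x)) + t * (- A * ln (\<alpha>1 + \<alpha>2 * y) - B * ln (\<beta>1 + \<beta>2 * y))"
      by (simp add: algebra_simps)
  qed
qed

lemma Beta_pos: "0 < a \<Longrightarrow> 0 < b \<Longrightarrow> 0 < Beta a (b :: real)"
  by (simp add: Beta_def Gamma_real_pos)

text \<open>With x = x0 + \<kappa> z, both x and 1 - x are constants times affine functions of z;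
  these constants and the Jacobian are collected in \<open>N\<close>. Parameters of at least 1 make
  the exponent \<open>h\<close> convex.\<close>

lemma beta_affine_density:
  fixes X :: "'a \<Rightarrow> real"
  assumes "prob_space M" and X: "distributed M lborel X (\<lambda>x. ennreal (beta_density a b x))"
    and ab: "1 \<le> a" "1 \<le> b" and k: "0 < \<kappa>" and C: "0 < C1" "0 < C2"
    and aff: "C1 * \<alpha>1 = x0" "C1 * \<alpha>2 = \<kappa>" "C2 * \<beta>1 = 1 - x0" "C2 * \<beta>2 = - \<kappa>" and lam: "0 < lam"
  defines "S \<equiv> {z. 0 < \<alpha>1 + \<alpha>2 * z \<and> 0 < \<beta>1 + \<beta>2 * z}"
    and "h \<equiv> \<lambda>z. - ((a - 1) / lam) * ln (\<alpha>1 + \<alpha>2 * z) - ((b - 1) / lam) * ln (\<beta>1 + \<beta>2 * z)"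
    and "N \<equiv> Beta a b / (\<kappa> * C1 powr (a - 1) * C2 powr (b - 1))"
    and "Q \<equiv> distr M borel (\<lambda>\<omega>. (X \<omega> - x0) / \<kappa>)"
  shows "prob_space Q \<and> convex_on S h \<and> 0 < N \<and> S \<in> sets borel \<and> h \<in> borel_measurable borel
        \<and> Q = density lborel (\<lambda>z. ennreal (indicator S z * exp (- lam * h z) / N))"
proof -
  interpret prob_space M by fact
  have B: "Beta a b > 0" using ab by (intro Beta_pos) auto
  have N: "N > 0" using B k C by (simp add: N_def)
  have Xm: "X \<in> borel_measurable M" using X by (simp add: distributed_def)
  have "distributed M lborel (\<lambda>x. - x0 / \<kappa> + (1 / \<kappa>) * X x) (\<lambda>x. ennreal (beta_density a b ((x - (- x0 / \<kappa>)) / (1 / \<kappa>))) / \<bar>1 / \<kappa>\<bar>)"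
    by (rule distributed_affine[OF X]) (use k in auto)
  then have "distr M lborel (\<lambda>x. - x0 / \<kappa> + (1 / \<kappa>) * X x) = density lborel (\<lambda>x. ennreal (beta_density a b ((x - (- x0 / \<kappa>)) / (1 / \<kappa>))) / \<bar>1 / \<kappa>\<bar>)"
    by (simp add: distributed_def)
  moreover have "(\<lambda>x. - x0 / \<kappa> + (1 / \<kappa>) * X x) = (\<lambda>\<omega>. (X \<omega> - x0) / \<kappa>)"
    using k by (auto simp: field_simps)
  moreover have "distr M lborel (\<lambda>\<omega>. (X \<omega> - x0) / \<kappa>) = Q" unfolding Q_def by (rule distr_cong) auto
  ultimately have Q: "Q = density lborel (\<lambda>x. ennreal (beta_density a b ((x - (- x0 / \<kappa>)) / (1 / \<kappa>))) / \<bar>1 / \<kappa>\<bar>)" by simp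
  have eq: "ennreal (beta_density a b ((z - (- x0 / \<kappa>)) / (1 / \<kappa>))) / \<bar>1 / \<kappa>\<bar> = ennreal (indicator S z * exp (- lam * h z) / N)" for z
  proof -
    let ?x = "x0 + \<kappa> * z"
    have x: "(z - (- x0 / \<kappa>)) / (1 / \<kappa>) = ?x" using k by (simp add: field_simps)
    have x1: "?x = C1 * (\<alpha>1 + \<alpha>2 * z)" "1 - ?x = C2 * (\<beta>1 + \<beta>2 * z)"
      using aff by (simp_all add: distrib_left mult.assoc[symmetric])
    have x0: "0 < ?x \<and> ?x < 1 \<longleftrightarrow> z \<in> S"
    proof -
      have "0 < ?x \<longleftrightarrow> 0 < \<alpha>1 + \<alpha>2 * z" unfolding x1 using C by (simp add: zero_less_mult_iff)
      moreover have "0 < 1 - ?x \<longleftrightarrow> 0 < \<beta>1 + \<beta>2 * z" unfolding x1(2) using C by (simp add: zero_less_mult_iff)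
      ultimately show ?thesis by (auto simp: S_def)
    qed
    have bd: "0 \<le> beta_density a b ?x" using B by (simp add: beta_density_def)
    have "ennreal (beta_density a b ?x) / ennreal \<bar>1 / \<kappa>\<bar> = ennreal (beta_density a b ?x / \<bar>1 / \<kappa>\<bar>)"
      using k bd by (intro divide_ennreal) auto
    also have "beta_density a b ?x / \<bar>1 / \<kappa>\<bar> = \<kappa> * beta_density a b ?x" using k by simp
    also have "\<kappa> * beta_density a b ?x = indicator S z * exp (- lam * h z) / N"
    proof (cases "z \<in> S")
      case True
      then have pos: "0 < \<alpha>1 + \<alpha>2 * z" "0 < \<beta>1 + \<beta>2 * z" by (auto simp: S_def)
      have "exp (- lam * h z) = exp ((a - 1) * ln (\<alpha>1 + \<alpha>2 * z)) * exp ((b - 1) * ln (\<beta>1 + \<beta>2 * z))"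
      proof -
        have "- lam * h z = lam * ((a - 1) / lam) * ln (\<alpha>1 + \<alpha>2 * z) + lam * ((b - 1) / lam) * ln (\<beta>1 + \<beta>2 * z)"
          unfolding h_def by (simp only: right_diff_distrib)
        then show ?thesis using lam by (simp add: exp_add[symmetric])
      qed
      also have "\<dots> = (\<alpha>1 + \<alpha>2 * z) powr (a - 1) * (\<beta>1 + \<beta>2 * z) powr (b - 1)"
        using pos by (simp add: powr_def)
      finally have e: "exp (- lam * h z) = (\<alpha>1 + \<alpha>2 * z) powr (a - 1) * (\<beta>1 + \<beta>2 * z) powr (b - 1)" .
      have "\<kappa> * beta_density a b ?x = \<kappa> * (?x powr (a - 1) * (1 - ?x) powr (b - 1) / Beta a b)"
        using True x0 by (simp add: beta_density_def)
      also have "\<dots> = \<kappa> * ((C1 powr (a - 1) * (\<alpha>1 + \<alpha>2 * z) powr (a - 1)) * (C2 powr (b - 1) * (\<beta>1 + \<beta>2 * z) powr (b - 1)) / Beta a b)"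
        unfolding x1(2) unfolding x1(1) using C pos by (simp add: powr_mult)
      also have "\<dots> = exp (- lam * h z) / N" unfolding e N_def by (simp add: mult_ac)
      finally show ?thesis using True by simp
    next
      case False
      then have "beta_density a b ?x = 0" using x0 by (auto simp: beta_density_def)
      then show ?thesis using False by simp
    qed
    finally show ?thesis unfolding x .
  qed
  have "S \<in> sets borel" unfolding S_def by measurable
  moreover have "h \<in> borel_measurable borel" unfolding h_def by measurable
  moreover have "convex_on S h" unfolding S_def h_def
    using ab lam by (intro convex_on_neg_ln_affine) auto
  moreover have "prob_space Q" unfolding Q_def using Xm by (intro prob_space_distr) auto
  ultimately show ?thesis using N unfolding Q eq by simp
qed

section \<open>The coefficients of the random matrix\<close>

text \<open>The index \<open>Inl k\<close> stands for \<open>u\<^sub>k\<close> and \<open>Inr k\<close> for \<open>v\<^sub>k\<close>.\<close>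

definition coef_index :: "(nat + nat) set" where "coef_index = Inl ` {1..} \<union> Inr ` {1..}"

definition coef_lim :: "nat + nat \<Rightarrow> real" where
  "coef_lim i = (case i of Inl k \<Rightarrow> 0 | Inr k \<Rightarrow> 1)"

context limit_params
begin

definition coef_dom :: "nat + nat \<Rightarrow> real set" where
  "coef_dom i = (case i of Inl k \<Rightarrow> u_range \<gamma> \<sigma> | Inr k \<Rightarrow> v_range \<gamma> \<sigma>)"

definition coef_rate :: "nat + nat \<Rightarrow> real \<Rightarrow> real" where
  "coef_rate i = (case i of Inl k \<Rightarrow> u_rate \<gamma> \<sigma> | Inr k \<Rightarrow> v_rate \<gamma> \<sigma>)"

end

locale jacobi_asymptotics = limit_params \<gamma> \<sigma> for \<gamma> \<sigma> +
  fixes M :: "nat \<Rightarrow> 'a measure" and c s :: "nat \<Rightarrow> nat \<Rightarrow> 'a \<Rightarrow> real" and \<beta> p1 p2 :: "nat \<Rightarrow> real"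
  assumes beta: "\<And>n. n \<ge> 1 \<Longrightarrow> \<beta> n > 0"
    and p1: "\<And>n. n \<ge> 1 \<Longrightarrow> p1 n \<ge> real n"
    and p2: "\<And>n. n \<ge> 1 \<Longrightarrow> p2 n \<ge> real n"
    and model: "\<And>n. n \<ge> 1 \<Longrightarrow> jacobi_model (M n) n (\<beta> n / 2) (p1 n) (p2 n) (c n) (s n)"
    and lim_gamma: "(\<lambda>n. real n / p1 n) \<longlonglongrightarrow> \<gamma>"
    and lim_sigma: "(\<lambda>n. p1 n / p2 n) \<longlonglongrightarrow> \<sigma>"
    and lim_beta: "filterlim (\<lambda>n. \<beta> n * real n) at_top sequentially"
begin

definition speed :: "nat \<Rightarrow> real" where "speed n = \<beta> n / 2 * real n"
text \<open>\<open>tn\<close>, \<open>sn\<close> and \<open>rn\<close> are the values of sqrt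
  \<gamma>, \<sigma> and \<tau> at size \<open>n\<close>; in particular \<open>rn\<close> is c / (1
  - c) for c = n / (p1 + p2).\<close>

definition tn :: "nat \<Rightarrow> real" where "tn n = sqrt (real n / p1 n)"
definition sn :: "nat \<Rightarrow> real" where "sn n = p1 n / p2 n"
definition rn :: "nat \<Rightarrow> real" where "rn n = real n / (p1 n + p2 n - real n)"

definition coef :: "nat \<Rightarrow> nat + nat \<Rightarrow> 'a \<Rightarrow> real" where
  "coef n i \<omega> = (case i of Inl k \<Rightarrow> ((p1 n + p2 n) * c n k \<omega> - p1 n) / sqrt (real n * p1 n)
                         | Inr k \<Rightarrow> (p1 n + p2 n) * s n k \<omega> / real n)"

lemma pos: assumes "n \<ge> 1" shows "p1 n > 0" "p2 n > 0" "tn n > 0" "sn n > 0" "rn n > 0" "p1 n + p2 n > real n"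
  "(tn n)\<^sup>2 = real n / p1 n" "sn n * (tn n)\<^sup>2 = real n / p2 n" "speed n > 0"
  using p1[OF assms] p2[OF assms] beta[OF assms] assms by (auto simp: tn_def sn_def rn_def speed_def)

lemma speed_lim: "filterlim speed at_top sequentially"
proof -
  have "filterlim (\<lambda>n. (1/2) * (\<beta> n * real n)) at_top sequentially"
    by (rule filterlim_tendsto_pos_mult_at_top[OF tendsto_const _ lim_beta]) simp
  then show ?thesis by (simp add: speed_def[abs_def] mult_ac)
qed

lemma speed_ge: "\<forall>\<^sub>F n in sequentially. C \<le> speed n"
  using speed_lim by (simp add: filterlim_at_top)

lemma inverse_speed_lim: "(\<lambda>n. 1 / speed n) \<longlonglongrightarrow> 0"
  using tendsto_divide_0[OF tendsto_const filterlim_at_top_imp_at_infinity[OF speed_lim], of 1] .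

lemma tn_lim: "tn \<longlonglongrightarrow> sqrt \<gamma>"
  unfolding tn_def[abs_def] by (intro tendsto_intros lim_gamma)

lemma sn_lim: "sn \<longlonglongrightarrow> \<sigma>"
  unfolding sn_def[abs_def] by (rule lim_sigma)

lemma rn_lim: "rn \<longlonglongrightarrow> \<tau>"
proof -
  have "1 + \<sigma> - \<gamma> * \<sigma> \<noteq> 0" using gs sigma by linarith
  then have "(\<lambda>n. real n / p1 n * (p1 n / p2 n) / (1 + p1 n / p2 n - real n / p1 n * (p1 n / p2 n))) \<longlonglongrightarrow> \<tau>"
    unfolding v_ratio_def by (intro tendsto_intros lim_gamma lim_sigma)
  moreover have "\<forall>\<^sub>F n in sequentially. real n / p1 n * (p1 n / p2 n) / (1 + p1 n / p2 n - real n / p1 n * (p1 n / p2 n)) = rn n"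
    using eventually_ge_at_top[of 1]
  proof eventually_elim
    case (elim n)
    have a: "real n / p1 n * (p1 n / p2 n) = real n / p2 n" using pos[OF elim] by simp
    have b: "1 + p1 n / p2 n - real n / p2 n = (p1 n + p2 n - real n) / p2 n" using pos[OF elim] by (simp add: field_simps)
    show ?case unfolding a b using pos[OF elim] by (simp add: rn_def)
  qed
  ultimately show ?thesis by (rule Lim_transform_eventually)
qed

lemma small_index: "\<forall>\<^sub>F n in sequentially. n \<ge> 1 \<and> 2 * k \<le> n \<and> 2 \<le> speed n"
  using speed_ge[of 2] eventually_ge_at_top[of "max 1 (2 * k)"] by eventually_elim auto

text \<open>Half of \<open>n\<close> absorbs the shift by \<open>k\<close>, so the beta parameter is
  at least \<open>speed n / 2\<close>. This is the source of convexity of the exponents for large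
  \<open>n\<close>.\<close>

lemma param_ge_1:
  assumes "n \<ge> 1" "2 * k \<le> n" "2 \<le> speed n" "real n - real k \<le> p"
  shows "1 \<le> \<beta> n / 2 * p"
proof -
  have "1 \<le> speed n / 2" using assms by simp
  also have "\<dots> = \<beta> n / 2 * (real n / 2)" by (simp add: speed_def)
  also have "\<dots> \<le> \<beta> n / 2 * p" using assms beta[OF assms(1)] by (intro mult_left_mono) auto
  finally show ?thesis .
qed

lemma laplace_u:
  assumes "k \<ge> 1"
  shows "\<exists>S h N. laplace_family speed S h N (\<lambda>n. distr (M n) borel (coef n (Inl k))) (u_range \<gamma> \<sigma>) (u_rate \<gamma> \<sigma>) 0"
proof -
  define a b where "a n = \<beta> n / 2 * (p1 n - real k + 1)" and "b n = \<beta> n / 2 * (p2 n - real k + 1)" for n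
  define \<kappa> where "\<kappa> n = sqrt (real n * p1 n) / (p1 n + p2 n)" for n
  define C1 C2 where "C1 n = p1 n / (p1 n + p2 n)" and "C2 n = p2 n / (p1 n + p2 n)" for n
  define S where "S n = {z. 0 < 1 + tn n * z \<and> 0 < 1 + (- sn n * tn n) * z}" for n
  define h where "h n z = - ((a n - 1) / speed n) * ln (1 + tn n * z) - ((b n - 1) / speed n) * ln (1 + (- sn n * tn n) * z)" for n z
  define N where "N n = Beta (a n) (b n) / (\<kappa> n * C1 n powr (a n - 1) * C2 n powr (b n - 1))" for n
  have "laplace_family speed S h N (\<lambda>n. distr (M n) borel (coef n (Inl k))) (u_range \<gamma> \<sigma>) (u_rate \<gamma> \<sigma>) 0"
  proof (unfold_locales, goal_cases)
    case 1 show ?case by (rule speed_lim)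
  next
    case 2
    show ?case using small_index[of k]
    proof eventually_elim
      case (elim n)
      note P = pos[of n]
      have jm: "jacobi_model (M n) n (\<beta> n / 2) (p1 n) (p2 n) (c n) (s n)" using elim by (intro model) auto
      have kn: "k \<in> {1..n}" using elim assms by auto
      have sq: "p1 n * tn n = sqrt (real n * p1 n)"
      proof -
        have "p1 n * tn n = sqrt (real n) * (p1 n / sqrt (p1 n))" by (simp add: tn_def real_sqrt_divide)
        moreover have "p1 n / sqrt (p1 n) = sqrt (p1 n)" using P elim by (intro real_div_sqrt) auto
        ultimately show ?thesis by (simp only: real_sqrt_mult)
      qed
      have coef: "coef n (Inl k) = (\<lambda>\<omega>. (c n k \<omega> - C1 n) / \<kappa> n)"
      proof
        fix \<omega>
        have "(c n k \<omega> - C1 n) / \<kappa> n = ((p1 n + p2 n) * c n k \<omega> - p1 n) / (p1 n + p2 n) / (sqrt (real n * p1 n) / (p1 n + p2 n))"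
          using P elim by (simp add: C1_def \<kappa>_def diff_divide_distrib)
        then show "coef n (Inl k) \<omega> = (c n k \<omega> - C1 n) / \<kappa> n"
          using P elim by (simp add: coef_def)
      qed
      show ?case unfolding coef S_def h_def[abs_def] N_def
      proof (rule beta_affine_density)
        show "prob_space (M n)" using jm by (simp add: jacobi_model_def)
        show "distributed (M n) lborel (c n k) (\<lambda>x. ennreal (beta_density (a n) (b n) x))"
          using jm kn by (simp add: jacobi_model_def a_def b_def)
        show "1 \<le> a n" unfolding a_def by (rule param_ge_1[of n k]) (use elim p1[of n] p2[of n] in auto)
        show "1 \<le> b n" unfolding b_def by (rule param_ge_1[of n k]) (use elim p1[of n] p2[of n] in auto)
        show "0 < \<kappa> n" "0 < C1 n" "0 < C2 n" "0 < speed n" using P elim by (auto simp: \<kappa>_def C1_def C2_def)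
        show "C1 n * tn n = \<kappa> n" using sq by (simp add: C1_def \<kappa>_def)
        show "C2 n * 1 = 1 - C1 n" using P elim by (simp add: C1_def C2_def field_simps)
        have "p2 n * (- sn n * tn n) = - (p1 n * tn n)" using P elim by (simp add: sn_def)
        then show "C2 n * (- sn n * tn n) = - \<kappa> n" unfolding sq by (simp add: C2_def \<kappa>_def)
      qed simp
    qed
  next
    case 3 show ?case by (rule open_u_range)
  next
    case 4 show ?case by (rule is_interval_u_range)
  next
    case 5 show ?case by (rule zero_in_u_range)
  next
    case (6 z)
    then have z: "0 < 1 + sqrt \<gamma> * z" "0 < 1 + (- \<sigma> * sqrt \<gamma>) * z" by (auto simp: u_range_iff)
    have "(\<lambda>n. 1 + tn n * z) \<longlonglongrightarrow> 1 + sqrt \<gamma> * z" "(\<lambda>n. 1 + (- sn n * tn n) * z) \<longlonglongrightarrow> 1 + (- \<sigma> * sqrt \<gamma>) * z"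
      by (intro tendsto_intros tn_lim sn_lim)+
    from order_tendstoD(1)[OF this(1) z(1)] order_tendstoD(1)[OF this(2) z(2)]
    show ?case unfolding S_def by eventually_elim simp
  next
    case (7 z)
    then have z: "0 < 1 + sqrt \<gamma> * z" "0 < 1 + (- \<sigma> * sqrt \<gamma>) * z" by (auto simp: u_range_iff)
    \<comment> \<open>The shift by \<open>k - 1\<close> and the - 1 in the exponents of the beta
      density, both relative to the speed; they disappear in the limit.\<close>
    define e where "e n = (real k - 1) * (1 / real n) + 1 / speed n" for n
    have e: "e \<longlonglongrightarrow> 0"
      unfolding e_def[abs_def] using tendsto_add[OF tendsto_mult_right[OF lim_const_over_n[of 1], of "real k - 1"] inverse_speed_lim]
      by (simp add: mult.commute)
    have "(\<lambda>n. (z\<^sup>2 * log_remainder (tn n * z) + sn n * (z\<^sup>2 * log_remainder (- sn n * tn n * z)))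
        + e n * (ln (1 + tn n * z) + ln (1 + (- sn n * tn n) * z)))
      \<longlonglongrightarrow> u_rate \<gamma> \<sigma> z + 0 * (ln (1 + sqrt \<gamma> * z) + ln (1 + (- \<sigma> * sqrt \<gamma>) * z))"
      using z by (intro tendsto_intros u_rate_tendsto[OF 7] tn_lim sn_lim e) auto
    then have lim: "(\<lambda>n. (z\<^sup>2 * log_remainder (tn n * z) + sn n * (z\<^sup>2 * log_remainder (- sn n * tn n * z)))
        + e n * (ln (1 + tn n * z) + ln (1 + (- sn n * tn n) * z))) \<longlonglongrightarrow> u_rate \<gamma> \<sigma> z" by simp
    \<comment> \<open>The weights 1 / t^2 = p1 / n and 1 / (s t^2) = p2 / n diverge when \<gamma> =
      0. Completing each logarithm to a remainder introduces the linear terms z / t and - z / t,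
      which cancel because the variable is centred at p1 / (p1 + p2).\<close>
    have ident: "- (1 / t\<^sup>2 - e) * L1 - (1 / (s * t\<^sup>2) - e) * L2
        = (t * z - L1) / t\<^sup>2 + s * ((- s * t * z - L2) / (- s * t)\<^sup>2) + e * (L1 + L2)"
      if "t > 0" "s > 0" for t s e L1 L2 :: real
    proof -
      have "s * ((- s * t * z - L2) / (- s * t)\<^sup>2) = - z / t - L2 / (s * t\<^sup>2)"
        using that by (simp add: power2_eq_square field_simps)
      moreover have "(t * z - L1) / t\<^sup>2 = z / t - L1 / t\<^sup>2"
        using that by (simp add: power2_eq_square field_simps)
      ultimately show ?thesis by (simp add: algebra_simps)
    qed
    have ev: "\<forall>\<^sub>F n in sequentially. (z\<^sup>2 * log_remainder (tn n * z) + sn n * (z\<^sup>2 * log_remainder (- sn n * tn n * z)))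
        + e n * (ln (1 + tn n * z) + ln (1 + (- sn n * tn n) * z)) = h n z"
      using small_index[of k]
    proof eventually_elim
      case (elim n)
      then have n: "n \<ge> 1" by simp
      note P = pos[OF n]
      have b0: "\<beta> n > 0" using beta n by simp
      have A: "(a n - 1) / speed n = 1 / (tn n)\<^sup>2 - e n"
      proof -
        have "(a n - 1) / speed n = (p1 n - real k + 1) / real n - 1 / speed n"
          using b0 n by (simp add: a_def speed_def diff_divide_distrib)
        then show ?thesis unfolding P(7) e_def using P n by (simp add: field_simps)
      qed
      have B: "(b n - 1) / speed n = 1 / (sn n * (tn n)\<^sup>2) - e n"
      proof -
        have "(b n - 1) / speed n = (p2 n - real k + 1) / real n - 1 / speed n"
          using b0 n by (simp add: b_def speed_def diff_divide_distrib)
        then show ?thesis unfolding P(8) e_def using P n by (simp add: field_simps)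
      qed
      have t0: "tn n \<noteq> 0" "- sn n * tn n \<noteq> 0" using P by auto
      show ?case unfolding h_def A B ident[OF P(3,4)] log_remainder_mult[OF t0(1)] log_remainder_mult[OF t0(2)] by simp
    qed
    show ?case by (rule Lim_transform_eventually[OF lim ev])
  next
    case 8 show ?case by (rule u_rate_0)
  next
    case (9 z) then show ?case by (rule u_rate_pos)
  next
    case 10 show ?case by (rule continuous_u_rate)
  next
    case (11 \<alpha>) show ?case by (rule u_rate_ends)
  qed
  then show ?thesis by blast
qed

lemma laplace_v:
  assumes "k \<ge> 1"
  shows "\<exists>S h N. laplace_family speed S h N (\<lambda>n. distr (M n) borel (coef n (Inr k))) (v_range \<gamma> \<sigma>) (v_rate \<gamma> \<sigma>) 1"
proof -
  define a b where "a n = \<beta> n / 2 * (real n - real k)" and "b n = \<beta> n / 2 * (p1 n + p2 n - real n - real k + 1)" for n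
  define C where "C n = real n / (p1 n + p2 n)" for n
  define S where "S n = {z. 0 < 0 + 1 * z \<and> 0 < (1 + rn n) + (- rn n) * z}" for n
  define h where "h n z = - ((a n - 1) / speed n) * ln (0 + 1 * z) - ((b n - 1) / speed n) * ln ((1 + rn n) + (- rn n) * z)" for n z
  define N where "N n = Beta (a n) (b n) / (C n * C n powr (a n - 1) * (1 - C n) powr (b n - 1))" for n
  have "laplace_family speed S h N (\<lambda>n. distr (M n) borel (coef n (Inr k))) (v_range \<gamma> \<sigma>) (v_rate \<gamma> \<sigma>) 1"
  proof (unfold_locales, goal_cases)
    case 1 show ?case by (rule speed_lim)
  next
    case 2
    show ?case using small_index[of k]
    proof eventually_elim
      case (elim n)
      note P = pos[of n]
      have jm: "jacobi_model (M n) n (\<beta> n / 2) (p1 n) (p2 n) (c n) (s n)" using elim by (intro model) auto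
      have kn: "k \<in> {1..<n}" using elim assms by auto
      have C: "0 < C n" "C n < 1" using P elim by (auto simp: C_def)
      have one_C: "1 - C n = (p1 n + p2 n - real n) / (p1 n + p2 n)" using P elim by (simp add: C_def field_simps)
      have one_r: "1 + rn n = (p1 n + p2 n) / (p1 n + p2 n - real n)" using P elim by (simp add: rn_def field_simps)
      have coef: "coef n (Inr k) = (\<lambda>\<omega>. (s n k \<omega> - 0) / C n)"
        using P elim by (simp add: coef_def C_def fun_eq_iff mult.commute)
      show ?case unfolding coef S_def h_def[abs_def] N_def
      proof (rule beta_affine_density)
        show "prob_space (M n)" using jm by (simp add: jacobi_model_def)
        show "distributed (M n) lborel (s n k) (\<lambda>x. ennreal (beta_density (a n) (b n) x))"
          using jm kn by (simp add: jacobi_model_def a_def b_def)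
        show "1 \<le> a n" unfolding a_def by (rule param_ge_1[of n k]) (use elim p1[of n] p2[of n] in auto)
        show "1 \<le> b n" unfolding b_def by (rule param_ge_1[of n k]) (use elim p1[of n] p2[of n] in auto)
        show "0 < C n" "0 < C n" "0 < 1 - C n" "0 < speed n" using P elim C by auto
        show "(1 - C n) * (1 + rn n) = 1 - 0" unfolding one_C one_r using P elim by simp
        show "(1 - C n) * - rn n = - C n" unfolding one_C using P elim by (simp add: rn_def C_def)
      qed simp_all
    qed
  next
    case 3 show ?case by (rule open_v_range)
  next
    case 4 show ?case by (rule is_interval_v_range)
  next
    case 5 show ?case by (rule one_in_v_range)
  next
    case (6 z)
    then have z: "0 < z" "0 < 1 + \<tau> * (1 - z)" by (auto simp: v_range_iff)
    have "(\<lambda>n. 1 + rn n * (1 - z)) \<longlonglongrightarrow> 1 + \<tau> * (1 - z)"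
      by (intro tendsto_intros rn_lim)
    from order_tendstoD(1)[OF this z(2)]
    show ?case unfolding S_def by eventually_elim (use z(1) in \<open>simp add: algebra_simps\<close>)
  next
    case (7 z)
    then have z: "0 < z" "0 < 1 + \<tau> * (1 - z)" by (auto simp: v_range_iff)
    \<comment> \<open>The first parameter of \<open>s k\<close> is n - k without the + 1 found in
      the second, hence \<open>k\<close> in \<open>e1\<close> and \<open>k - 1\<close> in
      \<open>e2\<close>.\<close>
    define e1 e2 where "e1 n = real k * (1 / real n) + 1 / speed n" and "e2 n = (real k - 1) * (1 / real n) + 1 / speed n" for n
    have e: "e1 \<longlonglongrightarrow> 0" "e2 \<longlonglongrightarrow> 0"
      unfolding e1_def[abs_def] e2_def[abs_def]
      using tendsto_add[OF tendsto_mult_right[OF lim_const_over_n[of 1], of "real k"] inverse_speed_lim]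
        tendsto_add[OF tendsto_mult_right[OF lim_const_over_n[of 1], of "real k - 1"] inverse_speed_lim]
      by (simp_all add: mult.commute)
    have "(\<lambda>n. ((z - ln z - 1) + rn n * ((1 - z)\<^sup>2 * log_remainder (rn n * (1 - z)))) + (e1 n * ln z + e2 n * ln (1 + rn n * (1 - z))))
      \<longlonglongrightarrow> v_rate \<gamma> \<sigma> z + (0 * ln z + 0 * ln (1 + \<tau> * (1 - z)))"
      unfolding v_rate_def using z by (intro tendsto_intros tendsto_log_remainder rn_lim e) auto
    then have lim: "(\<lambda>n. ((z - ln z - 1) + rn n * ((1 - z)\<^sup>2 * log_remainder (rn n * (1 - z)))) + (e1 n * ln z + e2 n * ln (1 + rn n * (1 - z))))
      \<longlonglongrightarrow> v_rate \<gamma> \<sigma> z" by simp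
    have ev: "\<forall>\<^sub>F n in sequentially. ((z - ln z - 1) + rn n * ((1 - z)\<^sup>2 * log_remainder (rn n * (1 - z)))) + (e1 n * ln z + e2 n * ln (1 + rn n * (1 - z))) = h n z"
      using small_index[of k]
    proof eventually_elim
      case (elim n)
      then have n: "n \<ge> 1" by simp
      note P = pos[OF n]
      have b0: "\<beta> n > 0" using beta n by simp
      have A: "(a n - 1) / speed n = 1 - e1 n"
      proof -
        have "(a n - 1) / speed n = (real n - real k) / real n - 1 / speed n"
          using b0 n by (simp add: a_def speed_def diff_divide_distrib)
        then show ?thesis unfolding e1_def using n by (simp add: field_simps)
      qed
      have B: "(b n - 1) / speed n = 1 / rn n - e2 n"
      proof -
        have "(b n - 1) / speed n = (p1 n + p2 n - real n - real k + 1) / real n - 1 / speed n"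
          using b0 n by (simp add: b_def speed_def diff_divide_distrib)
        moreover have "1 / rn n = (p1 n + p2 n - real n) / real n" by (simp add: rn_def)
        ultimately show ?thesis unfolding e2_def by (simp add: diff_divide_distrib add_divide_distrib)
      qed
      have r0: "rn n \<noteq> 0" using P by simp
      have L: "(1 + rn n) + (- rn n) * z = 1 + rn n * (1 - z)" by (simp add: algebra_simps)
      \<comment> \<open>The linear part 1 - z of this remainder cancels z - 1 from the first
        logarithm.\<close>
      have "rn n * ((rn n * (1 - z) - ln (1 + rn n * (1 - z))) / (rn n)\<^sup>2) = (1 - z) - ln (1 + rn n * (1 - z)) / rn n"
        using r0 by (simp add: power2_eq_square field_simps)
      then show ?case unfolding h_def A B L log_remainder_mult[OF r0] by (simp add: algebra_simps)
    qed
    show ?case by (rule Lim_transform_eventually[OF lim ev])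
  next
    case 8 show ?case by (rule v_rate_1)
  next
    case (9 z) then show ?case by (rule v_rate_pos)
  next
    case 10 show ?case by (rule continuous_v_rate)
  next
    case (11 \<alpha>) show ?case by (rule v_rate_ends)
  qed
  then show ?thesis by blast
qed

lemma laplace_coef:
  assumes "i \<in> coef_index"
  obtains S h N where "laplace_family speed S h N (\<lambda>n. distr (M n) borel (coef n i)) (coef_dom i) (coef_rate i) (coef_lim i)"
  using assms laplace_u laplace_v
  by (force simp: coef_index_def coef_dom_def coef_rate_def coef_lim_def)

definition model_index :: "nat \<Rightarrow> (nat + nat) set" where "model_index n = Inl ` {1..n} \<union> Inr ` {1..<n}"

lemma prob_space_M: "n \<ge> 1 \<Longrightarrow> prob_space (M n)"
  using model by (simp add: jacobi_model_def)

lemma indep_coef: "n \<ge> 1 \<Longrightarrow> prob_space.indep_vars (M n) (\<lambda>_. borel) (coef n) (model_index n)"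
proof -
  assume n: "n \<ge> 1"
  then interpret prob_space "M n" by (rule prob_space_M)
  have "indep_vars (\<lambda>_. borel) (case_sum (c n) (s n)) (model_index n)"
    using model[OF n] by (simp add: jacobi_model_def model_index_def)
  then have "indep_vars (\<lambda>_. borel) (\<lambda>i \<omega>. (case i of Inl k \<Rightarrow> (\<lambda>x. ((p1 n + p2 n) * x - p1 n) / sqrt (real n * p1 n))
      | Inr k \<Rightarrow> (\<lambda>x. (p1 n + p2 n) * x / real n)) (case_sum (c n) (s n) i \<omega>)) (model_index n)"
    by (rule indep_vars_compose2) (auto split: sum.split)
  moreover have "(\<lambda>i \<omega>. (case i of Inl k \<Rightarrow> (\<lambda>x. ((p1 n + p2 n) * x - p1 n) / sqrt (real n * p1 n))
      | Inr k \<Rightarrow> (\<lambda>x. (p1 n + p2 n) * x / real n)) (case_sum (c n) (s n) i \<omega>)) = coef n"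
    by (auto simp: fun_eq_iff coef_def split: sum.split)
  ultimately show ?thesis by simp
qed

lemma coef_measurable: "n \<ge> 1 \<Longrightarrow> i \<in> model_index n \<Longrightarrow> coef n i \<in> borel_measurable (M n)"
proof -
  assume "n \<ge> 1" "i \<in> model_index n"
  then show ?thesis
    using indep_coef[OF \<open>n \<ge> 1\<close>] unfolding prob_space.indep_vars_def[OF prob_space_M[OF \<open>n \<ge> 1\<close>]] by blast
qed

lemma finite_coef_index_in_model_index:
  assumes "finite J" "J \<subseteq> coef_index"
  shows "\<forall>\<^sub>F n in sequentially. n \<ge> 1 \<and> J \<subseteq> model_index n"
proof -
  have "\<forall>\<^sub>F n in sequentially. i \<in> model_index n" if "i \<in> coef_index" for i
  proof -
    from that obtain k where k: "k \<ge> 1" "i = Inl k \<or> i = Inr k" by (auto simp: coef_index_def)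
    show ?thesis using eventually_gt_at_top[of k]
      by eventually_elim (use k in \<open>auto simp: model_index_def\<close>)
  qed
  then have "\<forall>\<^sub>F n in sequentially. \<forall>i\<in>J. i \<in> model_index n"
    using assms by (intro eventually_ball_finite) auto
  with eventually_ge_at_top[of 1] show ?thesis by eventually_elim auto
qed

lemma prob_box:
  assumes "n \<ge> 1" "finite J" "J \<subseteq> model_index n" "\<And>i. i \<in> J \<Longrightarrow> A i \<in> sets borel"
  shows "{\<omega> \<in> space (M n). \<forall>i\<in>J. coef n i \<omega> \<in> A i} \<in> sets (M n)"
    "measure (M n) {\<omega> \<in> space (M n). \<forall>i\<in>J. coef n i \<omega> \<in> A i} = (\<Prod>i\<in>J. measure (distr (M n) borel (coef n i)) (A i))"
proof -
  interpret prob_space "M n" by (rule prob_space_M) fact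
  have m: "coef n i \<in> borel_measurable (M n)" if "i \<in> J" for i using coef_measurable[OF assms(1)] that assms by auto
  have s: "coef n i -` A i \<inter> space (M n) \<in> sets (M n)" if "i \<in> J" for i
    using measurable_sets[OF m[OF that] assms(4)[OF that]] .
  have "{\<omega> \<in> space (M n). \<forall>i\<in>J. coef n i \<omega> \<in> A i} \<in> sets (M n) \<and>
    prob {\<omega> \<in> space (M n). \<forall>i\<in>J. coef n i \<omega> \<in> A i} = (\<Prod>i\<in>J. prob (coef n i -` A i \<inter> space (M n)))"
  \<comment> \<open>For empty \<open>J\<close> the intersection used below would be the whole type
    rather than the sample space.\<close>
  proof (cases "J = {}")
    case False
    have eq: "{\<omega> \<in> space (M n). \<forall>i\<in>J. coef n i \<omega> \<in> A i} = (\<Inter>i\<in>J. coef n i -` A i \<inter> space (M n))"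
      using False by auto
    have "(\<Inter>i\<in>J. coef n i -` A i \<inter> space (M n)) \<in> sets (M n)"
      using False assms s by (intro sets.finite_INT) auto
    moreover have "prob (\<Inter>i\<in>J. coef n i -` A i \<inter> space (M n)) = (\<Prod>i\<in>J. prob (coef n i -` A i \<inter> space (M n)))"
      using indep_varsD[OF indep_coef[OF assms(1)] False assms(2,3), of A] assms(4) by simp
    ultimately show ?thesis unfolding eq by simp
  qed (simp add: prob_space)
  moreover have "(\<Prod>i\<in>J. prob (coef n i -` A i \<inter> space (M n))) = (\<Prod>i\<in>J. measure (distr (M n) borel (coef n i)) (A i))"
    using m assms(4) by (intro prod.cong refl) (simp add: measure_distr)
  ultimately show "{\<omega> \<in> space (M n). \<forall>i\<in>J. coef n i \<omega> \<in> A i} \<in> sets (M n)"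
    "prob {\<omega> \<in> space (M n). \<forall>i\<in>J. coef n i \<omega> \<in> A i} = (\<Prod>i\<in>J. measure (distr (M n) borel (coef n i)) (A i))"
    by auto
qed

end

section \<open>Structure of the rate function\<close>

definition acoef :: "real \<Rightarrow> real \<Rightarrow> (nat \<Rightarrow> real) \<Rightarrow> (nat \<Rightarrow> real) \<Rightarrow> nat \<Rightarrow> real" where
  "acoef \<gamma> \<sigma> u v k = sqrt \<gamma> * ((1 - \<sigma>) / (1 + \<sigma>)) * v (k - 1)
     - \<gamma> * \<sigma> / (1 + \<sigma>) * v (k - 1) * (u (k - 1) + u k) + u k"

definition b2coef :: "real \<Rightarrow> real \<Rightarrow> (nat \<Rightarrow> real) \<Rightarrow> (nat \<Rightarrow> real) \<Rightarrow> nat \<Rightarrow> real" where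
  "b2coef \<gamma> \<sigma> u v k = 1 / (1 + \<sigma>) * v k * (1 - \<sigma> * sqrt \<gamma> * u k) * (1 + sqrt \<gamma> * u k)
     * (1 - \<gamma> * \<sigma> / (1 + \<sigma>) * v (k - 1))"

definition useq :: "(nat + nat \<Rightarrow> real) \<Rightarrow> nat \<Rightarrow> real" where
  "useq z k = (if k = 0 then 0 else z (Inl k))"

definition vseq :: "(nat + nat \<Rightarrow> real) \<Rightarrow> nat \<Rightarrow> real" where
  "vseq z k = (if k = 0 then 0 else z (Inr k))"

text \<open>Defined for every real sequence: outside the admissible ranges the argument of the root
  may be negative, where \<open>sqrt\<close> is still continuous. Hence these moments are continuous
  on the full product space.\<close>

definition coef_moment :: "real \<Rightarrow> real \<Rightarrow> (nat + nat \<Rightarrow> real) \<Rightarrow> nat \<Rightarrow> real" where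
  "coef_moment \<gamma> \<sigma> z k = jacobi_pow (acoef \<gamma> \<sigma> (useq z) (vseq z)) (\<lambda>i. sqrt (b2coef \<gamma> \<sigma> (useq z) (vseq z) i)) k 1 1"

lemma tendsto_useq: "(\<And>i. ((\<lambda>x. z x i) \<longlongrightarrow> z' i) F) \<Longrightarrow> ((\<lambda>x. useq (z x) k) \<longlongrightarrow> useq z' k) F"
  and tendsto_vseq: "(\<And>i. ((\<lambda>x. z x i) \<longlongrightarrow> z' i) F) \<Longrightarrow> ((\<lambda>x. vseq (z x) k) \<longlongrightarrow> vseq z' k) F"
  by (auto simp: useq_def vseq_def)

text \<open>The parameters move together with the coefficients, since size \<open>n\<close> has
  \<open>n / p1\<close> and \<open>p1 / p2\<close> in place of \<gamma> and \<sigma>.\<close>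

lemma tendsto_coef_moment:
  assumes "(g \<longlongrightarrow> \<gamma>) F" "(s \<longlongrightarrow> \<sigma>) F" "1 + \<sigma> \<noteq> 0" "\<And>i. ((\<lambda>x. z x i) \<longlongrightarrow> z' i) F"
  shows "((\<lambda>x. coef_moment (g x) (s x) (z x) k) \<longlongrightarrow> coef_moment \<gamma> \<sigma> z' k) F"
  unfolding coef_moment_def
proof (rule tendsto_jacobi_pow)
  fix i
  show "((\<lambda>x. acoef (g x) (s x) (useq (z x)) (vseq (z x)) i) \<longlongrightarrow> acoef \<gamma> \<sigma> (useq z') (vseq z') i) F"
    unfolding acoef_def by (intro tendsto_intros tendsto_useq tendsto_vseq assms)
  show "((\<lambda>x. sqrt (b2coef (g x) (s x) (useq (z x)) (vseq (z x)) i)) \<longlongrightarrow> sqrt (b2coef \<gamma> \<sigma> (useq z') (vseq z') i)) F"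
    unfolding b2coef_def by (intro tendsto_intros tendsto_useq tendsto_vseq assms)
qed

lemma decomposition_iff:
  "decomposition \<gamma> \<sigma> \<mu> u v \<longleftrightarrow> u 0 = 0 \<and> v 0 = 0 \<and> (\<forall>k\<ge>1. u k \<in> u_range \<gamma> \<sigma> \<and> v k \<in> v_range \<gamma> \<sigma>) \<and>
     (\<exists>a b. jacobi_coefficients \<mu> a b \<and> (\<forall>k\<ge>1. a k = acoef \<gamma> \<sigma> u v k \<and> (b k)\<^sup>2 = b2coef \<gamma> \<sigma> u v k))"
  by (simp add: decomposition_def acoef_def b2coef_def)

text \<open>Inner products with the orthonormal polynomials express both coefficients through \<mu>
  alone; two families of coefficients of one measure therefore agree.\<close>

lemma jacobi_coefficients_unique:
  assumes m: "borel_prob_finite_moments \<mu>" and J: "jacobi_coefficients \<mu> a b" and k: "1 \<le> k"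
  shows "a k = poly_inner \<mu> (Polynomial.monom 1 1 * orthonormal_poly \<mu> k) (orthonormal_poly \<mu> k)"
    "b k = poly_inner \<mu> (Polynomial.monom 1 1 * orthonormal_poly \<mu> k) (orthonormal_poly \<mu> (Suc k))"
proof -
  have b: "0 < b i" if "1 \<le> i" for i using J that by (simp add: jacobi_coefficients_def)
  have P: "orthonormal_poly \<mu> i = jacobi_poly a b i" for i
  proof (induction i rule: induct_nat_012)
    case 0 show ?case by (simp add: orthonormal_poly_def)
  next
    case 1 show ?case using orthonormal_poly_1[OF m] by simp
  next
    case (ge2 i)
    have "Polynomial.monom 1 1 * orthonormal_poly \<mu> (Suc i) = Polynomial.smult (b (Suc i)) (orthonormal_poly \<mu> (Suc (Suc i)))
        + Polynomial.smult (a (Suc i)) (orthonormal_poly \<mu> (Suc i)) + Polynomial.smult (b i) (orthonormal_poly \<mu> i)"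
      using J by (simp add: jacobi_coefficients_def)
    then have "Polynomial.smult (b (Suc i)) (orthonormal_poly \<mu> (Suc (Suc i)))
       = Polynomial.monom 1 1 * jacobi_poly a b (Suc i) - Polynomial.smult (a (Suc i)) (jacobi_poly a b (Suc i))
         - Polynomial.smult (b i) (jacobi_poly a b i)"
      unfolding ge2[symmetric] by (simp add: algebra_simps)
    then have "Polynomial.smult (1 / b (Suc i)) (Polynomial.smult (b (Suc i)) (orthonormal_poly \<mu> (Suc (Suc i)))) = jacobi_poly a b (Suc (Suc i))"
      by simp
    then show ?case using b[of "Suc i"] by simp
  qed
  note orth = jacobi_poly_orthonormal[OF m b jacobi_coefficients_moment[OF m J]]
  have "(\<integral>x. x ^ 1 * poly (jacobi_poly a b k) x * poly (jacobi_poly a b j) x \<partial>\<mu>) = jacobi_op a b (unit_seq j) k" if "1 \<le> j" for j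
    using orth[of k j 1] k that by (simp add: jacobi_pow_def)
  then have e: "poly_inner \<mu> (Polynomial.monom 1 1 * orthonormal_poly \<mu> k) (orthonormal_poly \<mu> j) = jacobi_op a b (unit_seq j) k" if "1 \<le> j" for j
    using that by (simp add: P poly_inner_def poly_monom)
  show "a k = poly_inner \<mu> (Polynomial.monom 1 1 * orthonormal_poly \<mu> k) (orthonormal_poly \<mu> k)"
    using k by (subst e) (auto simp: jacobi_op_def unit_seq_def)
  show "b k = poly_inner \<mu> (Polynomial.monom 1 1 * orthonormal_poly \<mu> k) (orthonormal_poly \<mu> (Suc k))"
    using k by (subst e) (auto simp: jacobi_op_def unit_seq_def)
qed

section \<open>Convexity and sublevel sets of the single rates\<close>

lemma convex_on_square_affine: "convex_on UNIV (\<lambda>z::real. (p + q * z)\<^sup>2)"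
proof (rule convex_onI)
  fix t x y :: real assume t: "0 < t" "t < 1"
  have "(1 - t) * (p + q * x)\<^sup>2 + t * (p + q * y)\<^sup>2 - (p + q * ((1 - t) * x + t * y))\<^sup>2
      = t * (1 - t) * (q * (x - y))\<^sup>2"
    by (simp add: power2_eq_square algebra_simps)
  also have "\<dots> \<ge> 0" using t by simp
  finally show "(p + q * ((1 - t) *\<^sub>R x + t *\<^sub>R y))\<^sup>2 \<le> (1 - t) * (p + q * x)\<^sup>2 + t * (p + q * y)\<^sup>2" by simp
qed simp

lemma convex_on_affine_real: "convex S \<Longrightarrow> convex_on S (\<lambda>z::real. p + q * z)"
  by (rule convex_onI) (auto simp: algebra_simps)

lemma convex_on_log_remainder_affine:
  assumes S: "convex S" "\<And>z. z \<in> S \<Longrightarrow> 0 < 1 + t * (p + q * z)"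
  shows "convex_on S (\<lambda>z. (p + q * z)\<^sup>2 * log_remainder (t * (p + q * z)))"
proof (cases "t = 0")
  case True
  have "convex_on S (\<lambda>z. (1/2) * (p + q * z)\<^sup>2)"
    by (rule convex_on_cmul[OF _ convex_on_subset[OF convex_on_square_affine]]) (use S in auto)
  then show ?thesis using True by (simp add: log_remainder_def mult.commute)
next
  case False
  have "convex_on {z. 0 < (1 + t * p) + (t * q) * z \<and> 0 < 1 + 0 * z} (\<lambda>z. - (1 / t\<^sup>2) * ln ((1 + t * p) + (t * q) * z) - 0 * ln (1 + 0 * z))"
    by (rule convex_on_neg_ln_affine) auto
  then have "convex_on S (\<lambda>z. - (1 / t\<^sup>2) * ln ((1 + t * p) + (t * q) * z) - 0 * ln (1 + 0 * z))"
    by (rule convex_on_subset) (use S in \<open>auto simp: algebra_simps\<close>)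
  then have "convex_on S (\<lambda>z. (- (1 / t\<^sup>2) * ln ((1 + t * p) + (t * q) * z) - 0 * ln (1 + 0 * z)) + (p / t + q / t * z))"
    by (intro convex_on_add convex_on_affine_real S)
  moreover have "(- (1 / t\<^sup>2) * ln ((1 + t * p) + (t * q) * z) - 0 * ln (1 + 0 * z)) + (p / t + q / t * z)
     = (p + q * z)\<^sup>2 * log_remainder (t * (p + q * z))" for z
  proof -
    have e1: "(1 + t * p) + (t * q) * z = 1 + t * (p + q * z)" by (simp add: algebra_simps)
    have e2: "(t * (p + q * z) - L) / t\<^sup>2 = - (1 / t\<^sup>2) * L + (p / t + q / t * z)" for L
      using False by (simp add: power2_eq_square field_simps)
    show ?thesis unfolding e1 log_remainder_mult[OF False] e2 by simp
  qed
  ultimately show ?thesis by simp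
qed

context limit_params
begin

lemma convex_u_rate: "convex_on (u_range \<gamma> \<sigma>) (u_rate \<gamma> \<sigma>)"
proof -
  have c: "convex (u_range \<gamma> \<sigma>)" using is_interval_u_range by (simp add: is_interval_convex)
  have "convex_on (u_range \<gamma> \<sigma>) (\<lambda>z. (0 + 1 * z)\<^sup>2 * log_remainder (sqrt \<gamma> * (0 + 1 * z))
     + \<sigma> * ((0 + 1 * z)\<^sup>2 * log_remainder ((- \<sigma> * sqrt \<gamma>) * (0 + 1 * z))))"
    by (intro convex_on_add convex_on_cmul convex_on_log_remainder_affine c sigma) (auto simp: u_range_iff)
  then show ?thesis by (simp add: u_rate_def[abs_def])
qed

lemma convex_v_rate: "convex_on (v_range \<gamma> \<sigma>) (v_rate \<gamma> \<sigma>)"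
proof -
  have c: "convex (v_range \<gamma> \<sigma>)" using is_interval_v_range by (simp add: is_interval_convex)
  have "convex_on {z::real. 0 < 0 + 1 * z \<and> 0 < 1 + 0 * z} (\<lambda>z. - 1 * ln (0 + 1 * z) - 0 * ln (1 + 0 * z))"
    by (rule convex_on_neg_ln_affine) auto
  then have "convex_on (v_range \<gamma> \<sigma>) (\<lambda>z. - 1 * ln (0 + 1 * z) - 0 * ln (1 + 0 * z))"
    by (rule convex_on_subset) (use c in \<open>auto simp: v_range_iff\<close>)
  then have "convex_on (v_range \<gamma> \<sigma>) (\<lambda>z. ((- 1 * ln (0 + 1 * z) - 0 * ln (1 + 0 * z)) + (-1 + 1 * z))
     + \<tau> * ((1 + (-1) * z)\<^sup>2 * log_remainder (\<tau> * (1 + (-1) * z))))"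
    by (intro convex_on_add convex_on_cmul convex_on_log_remainder_affine convex_on_affine_real c \<tau>_nonneg) (auto simp: v_range_iff)
  moreover have "((- 1 * ln (0 + 1 * z) - 0 * ln (1 + 0 * z)) + (-1 + 1 * z))
     + \<tau> * ((1 + (-1) * z)\<^sup>2 * log_remainder (\<tau> * (1 + (-1) * z))) = v_rate \<gamma> \<sigma> z" for z
    by (simp add: v_rate_def)
  ultimately show ?thesis by simp
qed

text \<open>If \<open>y\<close> were beyond \<open>p\<close>, convexity through \<open>z0\<close>,
  \<open>p\<close> and \<open>y\<close> would give r y \<ge> r p > \<alpha>. Points of high rate on
  both sides therefore enclose every sublevel set.\<close>

lemma level_bound:
  assumes r: "convex_on D r" "r (z0::real) = 0" and z0: "z0 \<in> D" and pos: "\<And>z. z \<in> D \<Longrightarrow> 0 \<le> r z"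
    and p: "p \<in> D" "p \<noteq> z0" "\<alpha> < r p" "0 \<le> \<alpha>" and y: "y \<in> D" "r y \<le> \<alpha>"
  shows "(y - p) * (p - z0) < 0"
proof (rule ccontr)
  assume "\<not> ?thesis"
  then have "(\<bar>p - z0\<bar> + \<bar>y - p\<bar>) * r p \<le> \<bar>y - p\<bar> * r z0 + \<bar>p - z0\<bar> * r y"
    using p y by (intro convex_on_three_points[OF r(1) z0]) auto
  also have "\<dots> \<le> \<bar>p - z0\<bar> * \<alpha>" using r(2) y(2) by (simp add: mult_left_mono)
  finally have "\<bar>p - z0\<bar> * r p + \<bar>y - p\<bar> * r p \<le> \<bar>p - z0\<bar> * \<alpha>" by (simp add: algebra_simps)
  moreover have "0 \<le> \<bar>y - p\<bar> * r p" using pos[OF p(1)] by simp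
  moreover have "\<bar>p - z0\<bar> * \<alpha> < \<bar>p - z0\<bar> * r p" using p by (intro mult_strict_left_mono) auto
  ultimately show False by linarith
qed

lemma coef_rate_basic:
  "open (coef_dom i)" "is_interval (coef_dom i)" "coef_lim i \<in> coef_dom i" "coef_rate i (coef_lim i) = 0"
  "continuous_on (coef_dom i) (coef_rate i)" "convex_on (coef_dom i) (coef_rate i)"
  "\<And>z. z \<in> coef_dom i \<Longrightarrow> z \<noteq> coef_lim i \<Longrightarrow> 0 < coef_rate i z"
  by (auto simp: coef_dom_def coef_rate_def coef_lim_def open_u_range open_v_range is_interval_u_range is_interval_v_range
      zero_in_u_range one_in_v_range u_rate_0 v_rate_1 continuous_u_rate continuous_v_rate convex_u_rate convex_v_rate
      u_rate_pos v_rate_pos split: sum.splits)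

lemma coef_rate_ends:
  "\<exists>l\<in>coef_dom i. \<exists>u\<in>coef_dom i. l < coef_lim i \<and> coef_lim i < u \<and> \<alpha> < coef_rate i l \<and> \<alpha> < coef_rate i u"
proof (cases i)
  case (Inl k)
  show ?thesis unfolding coef_dom_def coef_rate_def coef_lim_def Inl sum.case by (rule u_rate_ends)
next
  case (Inr k)
  show ?thesis unfolding coef_dom_def coef_rate_def coef_lim_def Inr sum.case by (rule v_rate_ends)
qed

lemma coef_rate_nonneg: "z \<in> coef_dom i \<Longrightarrow> 0 \<le> coef_rate i z"
  using coef_rate_basic(4)[of i] coef_rate_basic(7)[of z i] by (cases "z = coef_lim i") auto

lemma coef_level_bound:
  obtains l u where "l \<in> coef_dom i" "u \<in> coef_dom i" "l \<le> coef_lim i" "coef_lim i \<le> u" "{l..u} \<subseteq> coef_dom i"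
    "\<And>z. z \<in> coef_dom i \<Longrightarrow> coef_rate i z \<le> \<alpha> \<Longrightarrow> l \<le> z \<and> z \<le> u"
proof -
  obtain l u where lu: "l \<in> coef_dom i" "u \<in> coef_dom i" "l < coef_lim i" "coef_lim i < u"
    "max 0 \<alpha> < coef_rate i l" "max 0 \<alpha> < coef_rate i u"
    using coef_rate_ends[of i "max 0 \<alpha>"] by blast
  have "l \<le> z \<and> z \<le> u" if z: "z \<in> coef_dom i" "coef_rate i z \<le> \<alpha>" for z
  proof -
    have z': "coef_rate i z \<le> max 0 \<alpha>" using z by simp
    have "(z - l) * (l - coef_lim i) < 0"
      by (rule level_bound[OF coef_rate_basic(6,4,3) coef_rate_nonneg lu(1) _ lu(5) _ z(1) z']) (use lu in auto)
    moreover have "(z - u) * (u - coef_lim i) < 0"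
      by (rule level_bound[OF coef_rate_basic(6,4,3) coef_rate_nonneg lu(2) _ lu(6) _ z(1) z']) (use lu in auto)
    ultimately show ?thesis using lu(3,4) by (simp add: mult_less_0_iff)
  qed
  moreover have "{l..u} \<subseteq> coef_dom i"
    using mem_is_interval_1_I[OF coef_rate_basic(2)[of i] lu(1,2)] by (intro subsetI) simp
  ultimately show thesis using lu by (intro that[of l u]) auto
qed

lemma v_factor_pos: "v = 0 \<or> v \<in> v_range \<gamma> \<sigma> \<Longrightarrow> 0 < 1 - \<gamma> * \<sigma> / (1 + \<sigma>) * v"
proof -
  assume v: "v = 0 \<or> v \<in> v_range \<gamma> \<sigma>"
  show ?thesis
  proof (cases "\<gamma> * \<sigma> = 0 \<or> v = 0")
    case False
    then have p: "0 < \<gamma> * \<sigma>" using gamma sigma by (metis less_eq_real_def mult_nonneg_nonneg)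
    have "v < (1 + \<sigma>) / (\<gamma> * \<sigma>)" using v False by (auto simp: v_range_def)
    then have "v * (\<gamma> * \<sigma>) < 1 + \<sigma>" using p by (simp only: pos_less_divide_eq)
    then have "\<gamma> * \<sigma> * v / (1 + \<sigma>) < 1" using sigma by (subst pos_divide_less_eq) (auto simp: mult.commute)
    then show ?thesis by simp
  qed auto
qed

text \<open>The two positions outside \<open>coef_index\<close> are pinned to 0, so that level sets
  can be compact in the product over all indices.\<close>

definition admissible :: "(nat + nat \<Rightarrow> real) \<Rightarrow> bool" where
  "admissible z \<longleftrightarrow> z (Inl 0) = 0 \<and> z (Inr 0) = 0 \<and> (\<forall>i\<in>coef_index. z i \<in> coef_dom i)"

lemma admissible_seq:
  assumes "admissible z"
  shows "k \<ge> 1 \<Longrightarrow> useq z k \<in> u_range \<gamma> \<sigma>" "k \<ge> 1 \<Longrightarrow> vseq z k \<in> v_range \<gamma> \<sigma>"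
    "0 < 1 + sqrt \<gamma> * useq z k" "0 < 1 - \<sigma> * sqrt \<gamma> * useq z k" "0 \<le> vseq z k" "0 < 1 - \<gamma> * \<sigma> / (1 + \<sigma>) * vseq z k"
proof -
  have I: "useq z k \<in> u_range \<gamma> \<sigma> \<and> vseq z k \<in> v_range \<gamma> \<sigma>" if k: "k \<ge> 1" for k
  proof -
    have "Inl k \<in> coef_index" "Inr k \<in> coef_index" using k by (auto simp: coef_index_def)
    then have "z (Inl k) \<in> coef_dom (Inl k)" "z (Inr k) \<in> coef_dom (Inr k)" using assms by (auto simp: admissible_def)
    then show ?thesis using k by (auto simp: useq_def vseq_def coef_dom_def)
  qed
  have U: "useq z k \<in> u_range \<gamma> \<sigma>" using I[of k] zero_in_u_range by (cases "k \<ge> 1") (auto simp: useq_def)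
  have V: "vseq z k = 0 \<or> vseq z k \<in> v_range \<gamma> \<sigma>" using I[of k] by (cases "k \<ge> 1") (auto simp: vseq_def)
  show "k \<ge> 1 \<Longrightarrow> useq z k \<in> u_range \<gamma> \<sigma>" "k \<ge> 1 \<Longrightarrow> vseq z k \<in> v_range \<gamma> \<sigma>" using I by blast+
  show "0 < 1 + sqrt \<gamma> * useq z k" "0 < 1 - \<sigma> * sqrt \<gamma> * useq z k" using U by (auto simp: u_range_iff)
  show "0 \<le> vseq z k" using V by (auto simp: v_range_iff)
  show "0 < 1 - \<gamma> * \<sigma> / (1 + \<sigma>) * vseq z k" by (rule v_factor_pos[OF V])
qed

lemma b2coef_pos:
  assumes "admissible z" "k \<ge> 1" shows "0 < b2coef \<gamma> \<sigma> (useq z) (vseq z) k"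
proof -
  have "0 < vseq z k" using admissible_seq(2)[OF assms] by (simp add: v_range_iff)
  then show ?thesis unfolding b2coef_def
    using admissible_seq(3,4,6)[OF assms(1)] sigma by (intro mult_pos_pos) auto
qed

text \<open>The equations are triangular: once the values at k - 1 are known, \<open>a k\<close> is
  affine in \<open>u k\<close> with positive slope 1 - c v (k - 1), where c = \<gamma>\<sigma> / (1
  + \<sigma>), and then the square of \<open>b k\<close> is a positive multiple of
  \<open>v k\<close>.\<close>

lemma decomposition_unique:
  assumes m: "borel_prob_finite_moments \<mu>" and d: "decomposition \<gamma> \<sigma> \<mu> u v" "decomposition \<gamma> \<sigma> \<mu> u' v'"
  shows "u = u' \<and> v = v'"
proof -
  obtain a b where ab: "jacobi_coefficients \<mu> a b" "\<And>k. k \<ge> 1 \<Longrightarrow> a k = acoef \<gamma> \<sigma> u v k" "\<And>k. k \<ge> 1 \<Longrightarrow> (b k)\<^sup>2 = b2coef \<gamma> \<sigma> u v k"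
    using d(1) unfolding decomposition_iff by blast
  obtain a' b' where ab': "jacobi_coefficients \<mu> a' b'" "\<And>k. k \<ge> 1 \<Longrightarrow> a' k = acoef \<gamma> \<sigma> u' v' k" "\<And>k. k \<ge> 1 \<Longrightarrow> (b' k)\<^sup>2 = b2coef \<gamma> \<sigma> u' v' k"
    using d(2) unfolding decomposition_iff by blast
  have A: "acoef \<gamma> \<sigma> u v k = acoef \<gamma> \<sigma> u' v' k" "b2coef \<gamma> \<sigma> u v k = b2coef \<gamma> \<sigma> u' v' k" if "k \<ge> 1" for k
    using jacobi_coefficients_unique[OF m ab(1) that] jacobi_coefficients_unique[OF m ab'(1) that] ab(2,3)[OF that] ab'(2,3)[OF that]
    by auto
  have "u k = u' k \<and> v k = v' k" for k
  proof (induction k rule: less_induct)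
    case (less k)
    show ?case
    proof (cases "k = 0")
      case True
      then show ?thesis using d by (simp add: decomposition_iff)
    next
      case False
      then have IH: "u (k - 1) = u' (k - 1)" "v (k - 1) = v' (k - 1)" using less.IH[of "k - 1"] by auto
      have "v (k - 1) = 0 \<or> v (k - 1) \<in> v_range \<gamma> \<sigma>"
      proof (cases "k = 1")
        case True
        then show ?thesis using d(1) by (simp add: decomposition_iff)
      next
        case neq: False
        then have "1 \<le> k - 1" using False by simp
        then show ?thesis using d(1) unfolding decomposition_iff by blast
      qed
      then have f: "0 < 1 - \<gamma> * \<sigma> / (1 + \<sigma>) * v (k - 1)" by (rule v_factor_pos)
      define q where "q = \<gamma> * \<sigma> / (1 + \<sigma>)"
      have "acoef \<gamma> \<sigma> u v k - acoef \<gamma> \<sigma> u' v' k = (u k - u' k) * (1 - \<gamma> * \<sigma> / (1 + \<sigma>) * v (k - 1))"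
        unfolding acoef_def IH q_def[symmetric] by (simp add: algebra_simps)
      moreover have "acoef \<gamma> \<sigma> u v k = acoef \<gamma> \<sigma> u' v' k" using A(1)[of k] False by simp
      ultimately have "(u k - u' k) * (1 - \<gamma> * \<sigma> / (1 + \<sigma>) * v (k - 1)) = 0" by linarith
      then have U: "u k = u' k" using less_imp_neq[OF f] unfolding mult_eq_0_iff by linarith
      have "u k \<in> u_range \<gamma> \<sigma>" using d(1) False unfolding decomposition_iff by simp
      then have g: "0 < (1 - \<sigma> * sqrt \<gamma> * u k) * (1 + sqrt \<gamma> * u k)" by (simp add: u_range_iff)
      define P where "P = 1 / (1 + \<sigma>) * ((1 - \<sigma> * sqrt \<gamma> * u k) * (1 + sqrt \<gamma> * u k)) * (1 - \<gamma> * \<sigma> / (1 + \<sigma>) * v (k - 1))"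
      have "P > 0" unfolding P_def by (rule mult_pos_pos[OF mult_pos_pos[OF _ g] f]) (use sigma in auto)
      moreover have "b2coef \<gamma> \<sigma> u v k = v k * P" "b2coef \<gamma> \<sigma> u' v' k = v' k * P"
        unfolding b2coef_def P_def IH U by (simp_all add: mult_ac)
      ultimately have "v k = v' k" using A(2)[of k] False by simp
      with U show ?thesis by simp
    qed
  qed
  then show ?thesis by auto
qed

definition partial_rate :: "nat \<Rightarrow> (nat + nat \<Rightarrow> real) \<Rightarrow> real" where
  "partial_rate N z = (\<Sum>j<N. coef_rate (Inl (Suc j)) (z (Inl (Suc j))) + coef_rate (Inr (Suc j)) (z (Inr (Suc j))))"

lemma rate_g_ereal: "0 < x \<Longrightarrow> rate_g x = ereal (x - ln x - 1)"
  by (simp add: rate_g_def)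

text \<open>The three cases of the definition merge through \<open>log_remainder\<close>; afterwards
  the rate sum is treated uniformly in \<gamma> and \<sigma>.\<close>

lemma rate_sum_eq:
  assumes u: "\<And>k. k \<ge> 1 \<Longrightarrow> u k \<in> u_range \<gamma> \<sigma>" and v: "\<And>k. k \<ge> 1 \<Longrightarrow> v k \<in> v_range \<gamma> \<sigma>"
  shows "rate_sum \<gamma> \<sigma> u v = (\<Sum>j. ereal (u_rate \<gamma> \<sigma> (u (Suc j)) + v_rate \<gamma> \<sigma> (v (Suc j))))"
proof -
  have U: "0 < 1 + sqrt \<gamma> * u (Suc j)" "0 < 1 - \<sigma> * sqrt \<gamma> * u (Suc j)" for j
    using u[of "Suc j"] by (auto simp: u_range_iff)
  have V: "0 < v (Suc j)" "0 < 1 + \<tau> * (1 - v (Suc j))" for j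
    using v[of "Suc j"] by (auto simp: v_range_iff)
  consider "0 < \<sigma> * \<gamma>" | "\<sigma> = 0" "0 < \<gamma>" | "\<gamma> = 0"
    using gamma sigma by (metis less_eq_real_def mult_pos_pos)
  then show ?thesis
  proof cases
    case 1
    then have gp: "0 < \<gamma>" "0 < \<sigma>" using gamma sigma by (auto simp: zero_less_mult_iff)
    define q where "q = \<gamma> * \<sigma> / (1 + \<sigma>)"
    have q: "0 < q" "q < 1" using gp gs by (auto simp: q_def pos_divide_less_eq)
    have tau: "\<tau> = q / (1 - q)" "(1 - q) / q = 1 / \<tau>"
    proof -
      have "1 - q = (1 + \<sigma> - \<gamma> * \<sigma>) / (1 + \<sigma>)" using gp by (simp add: q_def field_simps)
      then show "\<tau> = q / (1 - q)" using gp by (simp add: v_ratio_def q_def)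
      then show "(1 - q) / q = 1 / \<tau>" by simp
    qed
    have t: "\<tau> > 0" using q by (simp add: tau(1))
    have "ereal (1 / \<gamma>) * rate_g (1 + sqrt \<gamma> * u (Suc j)) + ereal (1 / (\<gamma> * \<sigma>)) * rate_g (1 - sqrt \<gamma> * \<sigma> * u (Suc j))
        + rate_g (v (Suc j)) + ereal ((1 - q) / q) * rate_g ((1 - q * v (Suc j)) / (1 - q))
      = ereal (u_rate \<gamma> \<sigma> (u (Suc j)) + v_rate \<gamma> \<sigma> (v (Suc j)))" for j
    proof -
      let ?u = "u (Suc j)" and ?v = "v (Suc j)"
      have arg: "(1 - q * ?v) / (1 - q) = 1 + \<tau> * (1 - ?v)" using q by (simp add: tau(1) field_simps)
      have s1: "sqrt \<gamma> \<noteq> 0" "- \<sigma> * sqrt \<gamma> \<noteq> 0" using gp by auto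
      have "u_rate \<gamma> \<sigma> ?u = (sqrt \<gamma> * ?u - ln (1 + sqrt \<gamma> * ?u)) / \<gamma>
          + \<sigma> * ((- \<sigma> * sqrt \<gamma> * ?u - ln (1 + - \<sigma> * sqrt \<gamma> * ?u)) / (\<sigma>\<^sup>2 * \<gamma>))"
        unfolding u_rate_def log_remainder_mult[OF s1(1)] log_remainder_mult[OF s1(2)] using gp by (simp add: power_mult_distrib)
      also have "\<sigma> * ((- \<sigma> * sqrt \<gamma> * ?u - ln (1 + - \<sigma> * sqrt \<gamma> * ?u)) / (\<sigma>\<^sup>2 * \<gamma>))
          = (- \<sigma> * sqrt \<gamma> * ?u - ln (1 - \<sigma> * sqrt \<gamma> * ?u)) / (\<gamma> * \<sigma>)"
        using gp by (simp add: power2_eq_square)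
      finally have a: "u_rate \<gamma> \<sigma> ?u = 1 / \<gamma> * ((1 + sqrt \<gamma> * ?u) - ln (1 + sqrt \<gamma> * ?u) - 1)
         + 1 / (\<gamma> * \<sigma>) * ((1 - \<sigma> * sqrt \<gamma> * ?u) - ln (1 - \<sigma> * sqrt \<gamma> * ?u) - 1)" by simp
      have "v_rate \<gamma> \<sigma> ?v = (?v - ln ?v - 1) + \<tau> * ((\<tau> * (1 - ?v) - ln (1 + \<tau> * (1 - ?v))) / \<tau>\<^sup>2)"
        unfolding v_rate_def using t by (subst log_remainder_mult) auto
      also have "\<tau> * ((\<tau> * (1 - ?v) - ln (1 + \<tau> * (1 - ?v))) / \<tau>\<^sup>2) = 1 / \<tau> * ((1 + \<tau> * (1 - ?v)) - ln (1 + \<tau> * (1 - ?v)) - 1)"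
        using t by (simp add: power2_eq_square)
      finally have b: "v_rate \<gamma> \<sigma> ?v = (?v - ln ?v - 1) + 1 / \<tau> * ((1 + \<tau> * (1 - ?v)) - ln (1 + \<tau> * (1 - ?v)) - 1)" .
      have c: "sqrt \<gamma> * \<sigma> * ?u = \<sigma> * sqrt \<gamma> * ?u" by (simp only: mult.commute)
      show ?thesis unfolding a b arg tau(2) c
        by (simp only: rate_g_ereal[OF U(1)] rate_g_ereal[OF U(2)] rate_g_ereal[OF V(1)] rate_g_ereal[OF V(2)] times_ereal.simps plus_ereal.simps)
          (simp add: algebra_simps)
    qed
    moreover have "\<sigma> * \<gamma> \<le> 1" using gs by (simp add: mult.commute)
    ultimately show ?thesis unfolding rate_sum_def Let_def using 1 by (simp add: q_def)
  next
    case 2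
    have "ereal (1 / \<gamma>) * rate_g (1 + sqrt \<gamma> * u (Suc j)) + rate_g (v (Suc j))
      = ereal (u_rate \<gamma> \<sigma> (u (Suc j)) + v_rate \<gamma> \<sigma> (v (Suc j)))" for j
    proof -
      let ?u = "u (Suc j)" and ?v = "v (Suc j)"
      have s1: "sqrt \<gamma> \<noteq> 0" using 2 by auto
      have "u_rate \<gamma> \<sigma> ?u = 1 / \<gamma> * ((1 + sqrt \<gamma> * ?u) - ln (1 + sqrt \<gamma> * ?u) - 1)"
        unfolding u_rate_def log_remainder_mult[OF s1] using 2 by simp
      moreover have "v_rate \<gamma> \<sigma> ?v = ?v - ln ?v - 1" using 2 \<tau>_zero by (simp add: v_rate_def)
      ultimately show ?thesis
        by (simp only: rate_g_ereal[OF U(1)] rate_g_ereal[OF V(1)] times_ereal.simps plus_ereal.simps)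
    qed
    then show ?thesis unfolding rate_sum_def Let_def using 2 gamma by simp
  next
    case 3
    have "ereal ((1 + \<sigma>) / 2 * (u (Suc j))\<^sup>2) + rate_g (v (Suc j))
      = ereal (u_rate \<gamma> \<sigma> (u (Suc j)) + v_rate \<gamma> \<sigma> (v (Suc j)))" for j
    proof -
      let ?u = "u (Suc j)" and ?v = "v (Suc j)"
      have "u_rate \<gamma> \<sigma> ?u = (1 + \<sigma>) / 2 * ?u\<^sup>2" using 3 by (simp add: u_rate_def log_remainder_def field_simps)
      moreover have "v_rate \<gamma> \<sigma> ?v = ?v - ln ?v - 1" using 3 \<tau>_zero by (simp add: v_rate_def)
      ultimately show ?thesis by (simp only: rate_g_ereal[OF V(1)] plus_ereal.simps)
    qed
    then show ?thesis unfolding rate_sum_def Let_def using 3 sigma by simp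
  qed
qed

lemma rate_sum_le_iff:
  assumes "admissible z"
  shows "rate_sum \<gamma> \<sigma> (useq z) (vseq z) \<le> ereal r \<longleftrightarrow> (\<forall>N. partial_rate N z \<le> r)"
proof -
  have nn: "0 \<le> u_rate \<gamma> \<sigma> (useq z (Suc j)) + v_rate \<gamma> \<sigma> (vseq z (Suc j))" for j
    using coef_rate_nonneg[of "useq z (Suc j)" "Inl (Suc j)"] coef_rate_nonneg[of "vseq z (Suc j)" "Inr (Suc j)"]
      admissible_seq(1,2)[OF assms, of "Suc j"] by (simp add: coef_dom_def coef_rate_def)
  have "rate_sum \<gamma> \<sigma> (useq z) (vseq z) = (\<Sum>j. ereal (u_rate \<gamma> \<sigma> (useq z (Suc j)) + v_rate \<gamma> \<sigma> (vseq z (Suc j))))"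
    by (rule rate_sum_eq) (use admissible_seq[OF assms] in auto)
  also have "\<dots> = (SUP N. \<Sum>j<N. ereal (u_rate \<gamma> \<sigma> (useq z (Suc j)) + v_rate \<gamma> \<sigma> (vseq z (Suc j))))"
    by (rule suminf_ereal_eq_SUP) (simp add: nn)
  also have "\<dots> = (SUP N. ereal (partial_rate N z))"
    by (simp add: partial_rate_def coef_rate_def useq_def vseq_def del: plus_ereal.simps)
  finally show ?thesis by (simp add: SUP_le_iff)
qed

text \<open>A sublevel set of the rate in coefficient space, described by real partial sums. Each of
  them involves finitely many coordinates, from which closedness in the product topology is read
  off.\<close>

definition level :: "real \<Rightarrow> (nat + nat \<Rightarrow> real) set" where
  "level r = {z. admissible z \<and> (\<forall>N. partial_rate N z \<le> r)}"

lemma level_coef_le: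
  assumes "z \<in> level r" "i \<in> coef_index" shows "coef_rate i (z i) \<le> r"
proof -
  have adm: "admissible z" using assms by (simp add: level_def)
  obtain k where k: "k \<ge> 1" "i = Inl k \<or> i = Inr k" using assms(2) by (auto simp: coef_index_def)
  then obtain j where j: "k = Suc j" by (cases k) auto
  have nn: "0 \<le> coef_rate i' (z i')" if "i' \<in> coef_index" for i'
    using adm that by (intro coef_rate_nonneg) (auto simp: admissible_def)
  have I: "Inl (Suc j) \<in> coef_index" "Inr (Suc j) \<in> coef_index" for j by (auto simp: coef_index_def)
  let ?f = "\<lambda>j. coef_rate (Inl (Suc j)) (z (Inl (Suc j))) + coef_rate (Inr (Suc j)) (z (Inr (Suc j)))"
  have "coef_rate i (z i) \<le> ?f j" using k(2) j nn[OF I(1)[of j]] nn[OF I(2)[of j]] by auto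
  also have "\<dots> \<le> partial_rate (Suc j) z"
    unfolding partial_rate_def using nn[OF I(1)] nn[OF I(2)] by (intro member_le_sum) auto
  also have "\<dots> \<le> r" using assms by (simp add: level_def)
  finally show ?thesis .
qed

end

text \<open>For infinite endpoints: coefficients bounded by \<open>R\<close> belong to the interval
  from - (3 R + 1) to 3 R + 1, by the splitting into constants x = y = R.\<close>

lemma jacobi_bound_crude:
  fixes a b :: "nat \<Rightarrow> real" and R :: real
  assumes "\<And>i. 1 \<le> i \<Longrightarrow> \<bar>a i\<bar> \<le> R" "\<And>i. 1 \<le> i \<Longrightarrow> (b i)\<^sup>2 \<le> R\<^sup>2" "0 \<le> R"
  shows "\<exists>x y. (\<forall>i. 0 \<le> x i \<and> 0 \<le> y i) \<and> (\<forall>i\<ge>1. y (i - 1) + x i \<le> a i - (- (3 * R + 1)) \<and> (b i)\<^sup>2 \<le> x i * y i)"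
    "\<exists>x y. (\<forall>i. 0 \<le> x i \<and> 0 \<le> y i) \<and> (\<forall>i\<ge>1. y (i - 1) + x i \<le> (3 * R + 1) - a i \<and> (b i)\<^sup>2 \<le> x i * y i)"
proof -
  have "R + R \<le> a i - (- (3 * R + 1))" "R + R \<le> 3 * R + 1 - a i" "(b i)\<^sup>2 \<le> R * R" if "1 \<le> i" for i
    using assms(1,2)[OF that] assms(3) by (auto simp: power2_eq_square abs_le_iff)
  then show "\<exists>x y. (\<forall>i. 0 \<le> x i \<and> 0 \<le> y i) \<and> (\<forall>i\<ge>1. y (i - 1) + x i \<le> a i - (- (3 * R + 1)) \<and> (b i)\<^sup>2 \<le> x i * y i)"
    "\<exists>x y. (\<forall>i. 0 \<le> x i \<and> 0 \<le> y i) \<and> (\<forall>i\<ge>1. y (i - 1) + x i \<le> (3 * R + 1) - a i \<and> (b i)\<^sup>2 \<le> x i * y i)"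
    using assms(3) by (auto intro!: exI[of _ "\<lambda>_. R"])
qed

section \<open>Measures attached to coefficient sequences of finite rate\<close>

context limit_params
begin

text \<open>The factorizations below are the ones of \<open>J - lo\<close> and \<open>hi - J\<close> by canonical moments.\<close>

lemma lower_edge_bound:
  assumes z: "admissible z" and g: "\<gamma> \<noteq> 0"
  defines "a \<equiv> acoef \<gamma> \<sigma> (useq z) (vseq z)" and "b2 \<equiv> b2coef \<gamma> \<sigma> (useq z) (vseq z)"
  shows "\<exists>x y. (\<forall>i. 0 \<le> x i \<and> 0 \<le> y i) \<and> (\<forall>i\<ge>1. y (i - 1) + x i \<le> a i - (- 1 / sqrt \<gamma>) \<and> b2 i \<le> x i * y i)"
proof -
  define t q where "t = sqrt \<gamma>" and "q = \<gamma> * \<sigma> / (1 + \<sigma>)"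
  have t: "t > 0" "t * t = \<gamma>" using g gamma by (auto simp: t_def)
  have q: "q = t * t * \<sigma> / (1 + \<sigma>)" using t by (simp add: q_def)
  have s: "1 + \<sigma> \<noteq> 0" "1 + \<sigma> > 0" using sigma by auto
  define x where "x i = (1 + t * useq z i) * (1 - q * vseq z (i - 1)) / t" for i
  define y where "y i = t / (1 + \<sigma>) * vseq z i * (1 - \<sigma> * t * useq z i)" for i
  note A = admissible_seq[OF z, folded t_def q_def]
  have "0 \<le> x i \<and> 0 \<le> y i" for i
    unfolding x_def y_def using A(3)[of i] A(4)[of i] A(5)[of i] A(6)[of "i - 1"] t s by simp
  moreover have "y (i - 1) + x i = a i - (- 1 / sqrt \<gamma>)" if "i \<ge> 1" for i
  proof -
    define v u u' where "v = vseq z (i - 1)" and "u = useq z i" and "u' = useq z (i - 1)"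
    \<comment> \<open>The coefficient of \<open>v\<close> in \<open>a i\<close> splits into the part
      contributed by \<open>y (i - 1)\<close> and the part contributed by
      \<open>x i\<close>.\<close>
    have sp: "t * (1 - \<sigma>) / (1 + \<sigma>) = t / (1 + \<sigma>) - q / t"
    proof -
      have "q / t = t * \<sigma> / (1 + \<sigma>)" using t(1) unfolding q by simp
      then show ?thesis by (simp add: diff_divide_distrib right_diff_distrib)
    qed
    have "x i = 1 / t + u - q / t * v - q * v * u" using t(1) by (simp add: x_def v_def u_def field_simps)
    moreover have "y (i - 1) = t / (1 + \<sigma>) * v - q * v * u'"
    proof -
      define A where "A = t / (1 + \<sigma>)"
      have "A * (\<sigma> * t) = q" unfolding A_def q by simp
      moreover have "y (i - 1) = A * v - A * (\<sigma> * t) * v * u'"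
        by (simp add: y_def v_def u'_def A_def[symmetric] algebra_simps)
      ultimately show ?thesis by (simp add: A_def)
    qed
    moreover have "a i = (t * (1 - \<sigma>) / (1 + \<sigma>)) * v - q * v * (u' + u) + u"
      by (simp add: a_def acoef_def t_def q_def v_def u_def u'_def)
    ultimately show ?thesis unfolding sp t_def[symmetric] by (simp add: algebra_simps)
  qed
  moreover have "b2 i = x i * y i" for i
    using t s by (simp add: b2_def b2coef_def x_def y_def t_def[symmetric] q_def[symmetric])
  ultimately show ?thesis by (intro exI[of _ x] exI[of _ y]) auto
qed

lemma upper_edge_bound:
  assumes z: "admissible z" and g: "\<gamma> * \<sigma> \<noteq> 0"
  defines "a \<equiv> acoef \<gamma> \<sigma> (useq z) (vseq z)" and "b2 \<equiv> b2coef \<gamma> \<sigma> (useq z) (vseq z)"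
  shows "\<exists>x y. (\<forall>i. 0 \<le> x i \<and> 0 \<le> y i) \<and> (\<forall>i\<ge>1. y (i - 1) + x i \<le> 1 / (sqrt \<gamma> * \<sigma>) - a i \<and> b2 i \<le> x i * y i)"
proof -
  define t q where "t = sqrt \<gamma>" and "q = \<gamma> * \<sigma> / (1 + \<sigma>)"
  have t: "t > 0" "t * t = \<gamma>" "\<sigma> > 0" using g gamma sigma by (auto simp: t_def)
  have q: "q = t * t * \<sigma> / (1 + \<sigma>)" using t by (simp add: q_def)
  have s: "1 + \<sigma> \<noteq> 0" "1 + \<sigma> > 0" using sigma by auto
  have q0: "q > 0" using t(1,3) s unfolding q by simp
  define x where "x i = (1 - \<sigma> * t * useq z i) * (1 - q * vseq z (i - 1)) / (\<sigma> * t)" for i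
  define y where "y i = q * vseq z i * (1 + t * useq z i) / t" for i
  note A = admissible_seq[OF z, folded t_def q_def]
  have "0 \<le> x i \<and> 0 \<le> y i" for i
    unfolding x_def y_def using A(3)[of i] A(4)[of i] A(5)[of i] A(6)[of "i - 1"] t q0 by simp
  moreover have "y (i - 1) + x i = 1 / (sqrt \<gamma> * \<sigma>) - a i" if "i \<ge> 1" for i
  proof -
    define v u u' where "v = vseq z (i - 1)" and "u = useq z i" and "u' = useq z (i - 1)"
    have sp: "t * (1 - \<sigma>) / (1 + \<sigma>) = q / (\<sigma> * t) - q / t"
    proof -
      have "q / t = t * \<sigma> / (1 + \<sigma>)" "q / (\<sigma> * t) = t / (1 + \<sigma>)" using t(1,3) unfolding q by simp_all
      then show ?thesis by (simp add: diff_divide_distrib right_diff_distrib)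
    qed
    have "x i = 1 / (t * \<sigma>) - u - q / (\<sigma> * t) * v + q * v * u" using t(1,3) by (simp add: x_def v_def u_def field_simps)
    moreover have "y (i - 1) = q / t * v + q * v * u'"
      using t(1) by (simp add: y_def v_def u'_def field_simps)
    moreover have "a i = (t * (1 - \<sigma>) / (1 + \<sigma>)) * v - q * v * (u' + u) + u"
      by (simp add: a_def acoef_def t_def q_def v_def u_def u'_def)
    ultimately show ?thesis unfolding sp t_def[symmetric] by (simp add: algebra_simps)
  qed
  moreover have "b2 i = x i * y i" for i
  proof -
    have "q / (\<sigma> * t * t) = 1 / (1 + \<sigma>)" using t(1,3) s unfolding q by simp
    moreover have "x i * y i = q / (\<sigma> * t * t) * (vseq z i * (1 - \<sigma> * t * useq z i) * (1 + t * useq z i) * (1 - q * vseq z (i - 1)))"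
      by (simp add: x_def y_def mult_ac)
    ultimately have "x i * y i = 1 / (1 + \<sigma>) * (vseq z i * (1 - \<sigma> * t * useq z i) * (1 + t * useq z i) * (1 - q * vseq z (i - 1)))" by simp
    then show ?thesis by (simp add: b2_def b2coef_def t_def[symmetric] q_def[symmetric])
  qed
  ultimately show ?thesis by (intro exI[of _ x] exI[of _ y]) auto
qed

text \<open>One constant serves all sequences of the level set and all positions, because a single
  rate depends on the kind of the coefficient but not on its index.\<close>

lemma level_bounded:
  obtains R where "0 \<le> R" "\<And>z i. z \<in> level r \<Longrightarrow> 1 \<le> i \<Longrightarrow> \<bar>acoef \<gamma> \<sigma> (useq z) (vseq z) i\<bar> \<le> R"
    "\<And>z i. z \<in> level r \<Longrightarrow> 1 \<le> i \<Longrightarrow> b2coef \<gamma> \<sigma> (useq z) (vseq z) i \<le> R\<^sup>2"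
proof -
  have lb: "\<exists>l u. \<forall>z\<in>coef_dom i. coef_rate i z \<le> r \<longrightarrow> l \<le> z \<and> z \<le> u" for i
    using coef_level_bound[of i r] by metis
  obtain lu uu where u: "\<And>x. x \<in> u_range \<gamma> \<sigma> \<Longrightarrow> u_rate \<gamma> \<sigma> x \<le> r \<Longrightarrow> lu \<le> x \<and> x \<le> uu"
    using lb[of "Inl 1"] unfolding coef_dom_def coef_rate_def sum.case by metis
  obtain lv uv where v: "\<And>x. x \<in> v_range \<gamma> \<sigma> \<Longrightarrow> v_rate \<gamma> \<sigma> x \<le> r \<Longrightarrow> lv \<le> x \<and> x \<le> uv"
    using lb[of "Inr 1"] unfolding coef_dom_def coef_rate_def sum.case by metis
  define B where "B = \<bar>lu\<bar> + \<bar>uu\<bar> + \<bar>lv\<bar> + \<bar>uv\<bar>"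
  have B0: "0 \<le> B" by (simp add: B_def)
  have B: "\<bar>useq z k\<bar> \<le> B \<and> \<bar>vseq z k\<bar> \<le> B" if z: "z \<in> level r" for z k
  proof (cases "k = 0")
    case False
    then have I: "Inl k \<in> coef_index" "Inr k \<in> coef_index" by (auto simp: coef_index_def)
    have adm: "admissible z" using z by (simp add: level_def)
    have "lu \<le> z (Inl k) \<and> z (Inl k) \<le> uu"
      using u[of "z (Inl k)"] level_coef_le[OF z I(1)] admissible_seq(1)[OF adm, of k] False by (simp add: coef_rate_def useq_def)
    moreover have "lv \<le> z (Inr k) \<and> z (Inr k) \<le> uv"
      using v[of "z (Inr k)"] level_coef_le[OF z I(2)] admissible_seq(2)[OF adm, of k] False by (simp add: coef_rate_def vseq_def)
    ultimately show ?thesis using False by (auto simp: useq_def vseq_def B_def)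
  qed (simp add: useq_def vseq_def B0)
  define t q where "t = sqrt \<gamma>" and "q = \<gamma> * \<sigma> / (1 + \<sigma>)"
  have tq: "0 \<le> t" "0 \<le> q" using gamma sigma by (auto simp: t_def q_def)
  define R1 where "R1 = \<bar>t * ((1 - \<sigma>) / (1 + \<sigma>))\<bar> * B + q * B * (B + B) + B"
  define R2 where "R2 = 1 / (1 + \<sigma>) * B * (1 + \<sigma> * t * B) * (1 + t * B) * (1 + q * B)"
  have R: "0 \<le> R1" "0 \<le> R2" using tq B0 sigma by (auto simp: R1_def R2_def)
  have a: "\<bar>acoef \<gamma> \<sigma> (useq z) (vseq z) i\<bar> \<le> R1" if z: "z \<in> level r" for z i
  proof -
    have "\<bar>acoef \<gamma> \<sigma> (useq z) (vseq z) i\<bar> \<le> \<bar>t * ((1 - \<sigma>) / (1 + \<sigma>)) * vseq z (i - 1)\<bar>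
        + \<bar>q * vseq z (i - 1) * (useq z (i - 1) + useq z i)\<bar> + \<bar>useq z i\<bar>"
    proof -
      have "\<bar>x - y + w\<bar> \<le> \<bar>x\<bar> + \<bar>y\<bar> + \<bar>w\<bar>" for x y w :: real by linarith
      then show ?thesis unfolding acoef_def t_def[symmetric] q_def[symmetric] .
    qed
    also have "\<dots> \<le> \<bar>t * ((1 - \<sigma>) / (1 + \<sigma>))\<bar> * B + q * B * (B + B) + B"
    proof (intro add_mono)
      show "\<bar>t * ((1 - \<sigma>) / (1 + \<sigma>)) * vseq z (i - 1)\<bar> \<le> \<bar>t * ((1 - \<sigma>) / (1 + \<sigma>))\<bar> * B"
        unfolding abs_mult[of _ "vseq z (i - 1)"] using B[OF z] by (intro mult_left_mono) auto
      have "\<bar>useq z (i - 1) + useq z i\<bar> \<le> B + B" using B[OF z, of "i - 1"] B[OF z, of i] by linarith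
      then show "\<bar>q * vseq z (i - 1) * (useq z (i - 1) + useq z i)\<bar> \<le> q * B * (B + B)"
        unfolding abs_mult using B[OF z, of "i - 1"] tq B0 by (intro mult_mono) auto
    qed (use B[OF z] in auto)
    finally show ?thesis by (simp add: R1_def)
  qed
  have b: "b2coef \<gamma> \<sigma> (useq z) (vseq z) i \<le> R2" if z: "z \<in> level r" for z i
  proof -
    have adm: "admissible z" using z by (simp add: level_def)
    note A = admissible_seq[OF adm, folded t_def q_def]
    have m1: "\<bar>\<sigma> * t * useq z i\<bar> \<le> \<sigma> * t * B" "\<bar>t * useq z i\<bar> \<le> t * B" "\<bar>q * vseq z (i - 1)\<bar> \<le> q * B"
      unfolding abs_mult using tq sigma B[OF z, of i] B[OF z, of "i - 1"] by (auto intro!: mult_mono)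
    have "1 - \<sigma> * t * useq z i \<le> 1 + \<sigma> * t * B" "1 + t * useq z i \<le> 1 + t * B" "1 - q * vseq z (i - 1) \<le> 1 + q * B"
      using m1 by linarith+
    then show ?thesis
      unfolding b2coef_def R2_def t_def[symmetric] q_def[symmetric]
      using A(3)[of i] A(4)[of i] A(5)[of i] A(6)[of "i - 1"] sigma B[OF z, of i] B0 tq
      by (intro mult_mono mult_nonneg_nonneg) auto
  qed
  \<comment> \<open>\<open>R2\<close> bounds the square of \<open>b\<close>, so its root is added to
    \<open>R1\<close> to obtain one constant for both families.\<close>
  have "R2 \<le> (R1 + sqrt R2)\<^sup>2"
    using R power_mono[of "sqrt R2" "R1 + sqrt R2" 2] by simp
  moreover have "R1 \<le> R1 + sqrt R2" "0 \<le> R1 + sqrt R2" using R by auto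
  ultimately show thesis using order_trans[OF a] order_trans[OF b] by (intro that[of "R1 + sqrt R2"]) blast+
qed

text \<open>Finite endpoints of the limit interval come from the exact factorizations; infinite ones
  are replaced by the crude bound from \<open>R\<close>. Either way the measure has bounded support,
  which yields determinacy also when the interval is unbounded.\<close>

lemma level_measure:
  assumes z: "z \<in> level r"
  shows "\<exists>\<mu>\<in>moment_space (limit_interval \<gamma> \<sigma>). (\<forall>k. moment \<mu> k = coef_moment \<gamma> \<sigma> z k) \<and>
     decomposition \<gamma> \<sigma> \<mu> (useq z) (vseq z)"
proof -
  have adm: "admissible z" using z by (simp add: level_def)
  define a b where "a = acoef \<gamma> \<sigma> (useq z) (vseq z)" and "b = (\<lambda>i. sqrt (b2coef \<gamma> \<sigma> (useq z) (vseq z) i))"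
  obtain R where R: "0 \<le> R" "\<And>i. 1 \<le> i \<Longrightarrow> \<bar>a i\<bar> \<le> R" "\<And>i. 1 \<le> i \<Longrightarrow> b2coef \<gamma> \<sigma> (useq z) (vseq z) i \<le> R\<^sup>2"
    using level_bounded[of r] z unfolding a_def by metis
  have b2: "(b i)\<^sup>2 = b2coef \<gamma> \<sigma> (useq z) (vseq z) i" if "1 \<le> i" for i
    using b2coef_pos[OF adm that] by (simp add: b_def)
  have bR: "(b i)\<^sup>2 \<le> R\<^sup>2" if "1 \<le> i" for i using R(3)[OF that] b2[OF that] by simp
  have bpos: "0 < b i" if "1 \<le> i" for i using b2coef_pos[OF adm that] by (simp add: b_def)
  define lo where "lo = (if \<gamma> = 0 then - (3 * R + 1) else - 1 / sqrt \<gamma>)"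
  define hi where "hi = (if \<gamma> * \<sigma> = 0 then 3 * R + 1 else 1 / (sqrt \<gamma> * \<sigma>))"
  have lohi: "lo < 0" "0 < hi" using R(1) gamma sigma by (auto simp: lo_def hi_def divide_neg_pos)
  have "\<exists>x y. (\<forall>i. 0 \<le> x i \<and> 0 \<le> y i) \<and> (\<forall>i\<ge>1. y (i - 1) + x i \<le> a i - lo \<and> (b i)\<^sup>2 \<le> x i * y i)"
  proof (cases "\<gamma> = 0")
    case True
    show ?thesis unfolding lo_def if_P[OF True] by (rule jacobi_bound_crude(1)[OF R(2) bR R(1)])
  next
    case False
    show ?thesis using lower_edge_bound[OF adm False] b2 by (simp add: lo_def False a_def)
  qed
  then obtain x y where xy: "\<And>i. 0 \<le> x i" "\<And>i. 0 \<le> y i" "\<And>i. 1 \<le> i \<Longrightarrow> y (i - 1) + x i \<le> a i - lo"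
    "\<And>i. 1 \<le> i \<Longrightarrow> (b i)\<^sup>2 \<le> x i * y i" by metis
  have "\<exists>x y. (\<forall>i. 0 \<le> x i \<and> 0 \<le> y i) \<and> (\<forall>i\<ge>1. y (i - 1) + x i \<le> hi - a i \<and> (b i)\<^sup>2 \<le> x i * y i)"
  proof (cases "\<gamma> * \<sigma> = 0")
    case True
    show ?thesis unfolding hi_def if_P[OF True] by (rule jacobi_bound_crude(2)[OF R(2) bR R(1)])
  next
    case False
    show ?thesis using upper_edge_bound[OF adm False] b2 unfolding hi_def if_not_P[OF False] by (simp add: a_def)
  qed
  then obtain x' y' where xy': "\<And>i. 0 \<le> x' i" "\<And>i. 0 \<le> y' i" "\<And>i. 1 \<le> i \<Longrightarrow> y' (i - 1) + x' i \<le> hi - a i"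
    "\<And>i. 1 \<le> i \<Longrightarrow> (b i)\<^sup>2 \<le> x' i * y' i" by metis
  obtain \<mu> :: "real measure" where \<mu>: "real_distribution \<mu>" "AE x in \<mu>. lo \<le> x \<and> x \<le> hi"
    "\<And>k. moment \<mu> k = jacobi_pow a b k 1 1"
    using jacobi_moment_measure[of lo hi x y a b x' y', OF less_trans[OF lohi] xy xy'] by blast
  have bd: "AE x in \<mu>. \<bar>x\<bar> \<le> \<bar>lo\<bar> + \<bar>hi\<bar>" using \<mu>(2) by eventually_elim auto
  have "AE x in \<mu>. x \<in> limit_interval \<gamma> \<sigma>"
    using \<mu>(2) by eventually_elim (auto simp: limit_interval_def lo_def hi_def split: if_splits)
  then have ms: "\<mu> \<in> moment_space (limit_interval \<gamma> \<sigma>)" by (rule moment_space_bounded[OF \<mu>(1) bd])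
  have J: "jacobi_coefficients \<mu> a b"
    by (rule jacobi_coefficients_of_moments[OF borel_prob_finite_moments_bounded[OF \<mu>(1) bd] bpos \<mu>(3)])
  have "decomposition \<gamma> \<sigma> \<mu> (useq z) (vseq z)"
    unfolding decomposition_iff
  proof (intro conjI allI impI)
    show "useq z 0 = 0" "vseq z 0 = 0" by (simp_all add: useq_def vseq_def)
    show "\<exists>a b. jacobi_coefficients \<mu> a b \<and> (\<forall>k\<ge>1. a k = acoef \<gamma> \<sigma> (useq z) (vseq z) k \<and> (b k)\<^sup>2 = b2coef \<gamma> \<sigma> (useq z) (vseq z) k)"
      by (rule exI[of _ a], rule exI[of _ b]) (use J b2 in \<open>simp add: a_def\<close>)
  qed (use admissible_seq(1,2)[OF adm] in auto)
  with ms \<mu>(3) show ?thesis by (auto simp: coef_moment_def a_def b_def)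
qed

lemma rate_function_decomposition:
  assumes "\<mu> \<in> moment_space (limit_interval \<gamma> \<sigma>)" "decomposition \<gamma> \<sigma> \<mu> u v"
  shows "rate_function \<gamma> \<sigma> \<mu> = rate_sum \<gamma> \<sigma> u v"
proof -
  have m: "borel_prob_finite_moments \<mu>" using assms(1) by (simp add: moment_space_def)
  have "(THE (u, v). decomposition \<gamma> \<sigma> \<mu> u v) = (u, v)"
  proof (rule the_equality)
    fix p assume p: "case p of (u, v) \<Rightarrow> decomposition \<gamma> \<sigma> \<mu> u v"
    obtain u' v' where uv: "p = (u', v')" by (cases p)
    have "decomposition \<gamma> \<sigma> \<mu> u' v'" using p by (simp add: uv)
    from decomposition_unique[OF m this assms(2)] show "p = (u, v)" by (simp add: uv)
  qed (simp add: assms(2))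
  then show ?thesis using assms by (auto simp: rate_function_def)
qed

lemma rate_function_level:
  assumes "\<mu> \<in> moment_space (limit_interval \<gamma> \<sigma>)" "z \<in> level r" "decomposition \<gamma> \<sigma> \<mu> (useq z) (vseq z)"
  shows "rate_function \<gamma> \<sigma> \<mu> \<le> ereal r"
  using assms rate_sum_le_iff[of z r] by (simp add: rate_function_decomposition level_def)

text \<open>With \<open>level_measure\<close> this identifies the sublevel sets of the rate function
  with the sets \<open>level r\<close>. Positivity of \<open>b\<close> selects the root in the
  formula for its square.\<close>

lemma rate_function_le:
  assumes "rate_function \<gamma> \<sigma> \<nu> \<le> ereal r"
  shows "\<nu> \<in> moment_space (limit_interval \<gamma> \<sigma>) \<and> (\<exists>z\<in>level r. (\<forall>k. moment \<nu> k = coef_moment \<gamma> \<sigma> z k) \<and>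
     decomposition \<gamma> \<sigma> \<nu> (useq z) (vseq z))"
proof -
  have ms: "\<nu> \<in> moment_space (limit_interval \<gamma> \<sigma>)" and "\<exists>u v. decomposition \<gamma> \<sigma> \<nu> u v"
    using assms by (auto simp: rate_function_def split: if_splits)
  then obtain u v where d: "decomposition \<gamma> \<sigma> \<nu> u v" by blast
  define z where "z i = (case i of Inl k \<Rightarrow> u k | Inr k \<Rightarrow> v k)" for i :: "nat + nat"
  have uv: "u 0 = 0" "v 0 = 0" "\<And>k. k \<ge> 1 \<Longrightarrow> u k \<in> u_range \<gamma> \<sigma> \<and> v k \<in> v_range \<gamma> \<sigma>" using d by (auto simp: decomposition_iff)
  have seq: "useq z = u" "vseq z = v" using uv by (auto simp: useq_def vseq_def z_def fun_eq_iff)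
  have adm: "admissible z" using uv by (auto simp: admissible_def z_def coef_index_def coef_dom_def)
  have "rate_sum \<gamma> \<sigma> (useq z) (vseq z) \<le> ereal r" using assms rate_function_decomposition[OF ms d] seq by simp
  then have lev: "z \<in> level r" using adm rate_sum_le_iff[OF adm] by (simp add: level_def)
  obtain a b where ab: "jacobi_coefficients \<nu> a b" "\<And>k. k \<ge> 1 \<Longrightarrow> a k = acoef \<gamma> \<sigma> u v k" "\<And>k. k \<ge> 1 \<Longrightarrow> (b k)\<^sup>2 = b2coef \<gamma> \<sigma> u v k"
    using d unfolding decomposition_iff by blast
  have "b k = sqrt (b2coef \<gamma> \<sigma> u v k)" if "k \<ge> 1" for k
    using ab(1,3) that by (metis jacobi_coefficients_def less_eq_real_def real_sqrt_unique)
  then have "jacobi_pow a b k 1 = jacobi_pow (acoef \<gamma> \<sigma> u v) (\<lambda>i. sqrt (b2coef \<gamma> \<sigma> u v i)) k 1" for k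
    using ab(2) by (intro jacobi_pow_cong[of k]) auto
  moreover have "borel_prob_finite_moments \<nu>" using ms by (simp add: moment_space_def)
  ultimately have "moment \<nu> k = coef_moment \<gamma> \<sigma> z k" for k
    using jacobi_coefficients_moment[OF _ ab(1)] by (simp add: coef_moment_def seq)
  with ms lev d seq show ?thesis by auto
qed

lemma rate_function_nonneg: "0 \<le> rate_function \<gamma> \<sigma> \<nu>"
proof (rule ccontr)
  assume "\<not> ?thesis"
  then have "rate_function \<gamma> \<sigma> \<nu> < 0" by simp
  then obtain r where r: "rate_function \<gamma> \<sigma> \<nu> < ereal r" "ereal r < 0" using ereal_dense2 by blast
  then obtain z where "z \<in> level r" using rate_function_le[of \<nu> r] by (auto simp: less_imp_le)
  then have "partial_rate 0 z \<le> r" by (simp add: level_def)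
  then show False using r(2) by (simp add: partial_rate_def)
qed

section \<open>Compactness of the level sets\<close>

lemma compact_PiE_UNIV:
  fixes K :: "'i \<Rightarrow> real set"
  assumes "\<And>i. compact (K i)" shows "compact (Pi\<^sub>E UNIV K)"
  using compactin_PiE[of "\<lambda>_. euclidean" UNIV K] assms
  by (simp add: euclidean_product_topology)

text \<open>Each coordinate of a point of \<open>level r\<close> stays in a compact interval inside
  its open domain. On the product of these intervals, compact by Tychonoff's theorem, the partial
  sums are continuous, so \<open>level r\<close> is a closed part of a compact set.\<close>

lemma compact_level: "compact (level r)"
proof -
  have "\<exists>l u. {l..u} \<subseteq> coef_dom i \<and> (\<forall>z\<in>coef_dom i. coef_rate i z \<le> r \<longrightarrow> z \<in> {l..u})" for i
    using coef_level_bound[of i r] by (metis atLeastAtMost_iff)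
  then obtain l u where lu: "\<And>i. {l i..u i} \<subseteq> coef_dom i"
    "\<And>i z. z \<in> coef_dom i \<Longrightarrow> coef_rate i z \<le> r \<Longrightarrow> z \<in> {l i..u i}" by metis
  define K where "K i = (if i \<in> coef_index then {l i..u i} else {0})" for i
  have comp: "compact (Pi\<^sub>E UNIV K)" by (rule compact_PiE_UNIV) (simp add: K_def)
  have coef_index: "i \<in> coef_index \<longleftrightarrow> i \<noteq> Inl 0 \<and> i \<noteq> Inr 0" for i
    by (cases i) (auto simp: coef_index_def image_iff)
  have cont: "continuous_on (Pi\<^sub>E UNIV K) (partial_rate N)" for N
    unfolding partial_rate_def
  proof (intro continuous_on_sum continuous_on_add)
    fix j
    have *: "continuous_on (Pi\<^sub>E UNIV K) (\<lambda>z. coef_rate i (z i))" if "i \<in> coef_index" for i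
    proof (rule continuous_on_compose2[OF coef_rate_basic(5)[of i]])
      show "continuous_on (Pi\<^sub>E UNIV K) (\<lambda>z. z i)" by (rule continuous_on_subset[OF continuous_on_product_coordinates]) simp
      show "(\<lambda>z. z i) ` Pi\<^sub>E UNIV K \<subseteq> coef_dom i"
      proof safe
        fix z assume "z \<in> Pi\<^sub>E UNIV K"
        then have "z i \<in> K i" by auto
        then show "z i \<in> coef_dom i" using lu(1)[of i] that by (auto simp: K_def)
      qed
    qed
    show "continuous_on (Pi\<^sub>E UNIV K) (\<lambda>z. coef_rate (Inl (Suc j)) (z (Inl (Suc j))))"
      "continuous_on (Pi\<^sub>E UNIV K) (\<lambda>z. coef_rate (Inr (Suc j)) (z (Inr (Suc j))))"
      by (rule *, simp add: coef_index)+
  qed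
  have adm: "admissible z" if "z \<in> Pi\<^sub>E UNIV K" for z
    unfolding admissible_def
  proof (intro conjI ballI)
    have zK: "z i \<in> K i" for i using that by auto
    show "z (Inl 0) = 0" "z (Inr 0) = 0" using zK[of "Inl 0"] zK[of "Inr 0"] by (auto simp: K_def coef_index)
    show "z i \<in> coef_dom i" if "i \<in> coef_index" for i using zK[of i] that lu(1)[of i] by (auto simp: K_def)
  qed
  have lev: "level r = Pi\<^sub>E UNIV K \<inter> (\<Inter>N. Pi\<^sub>E UNIV K \<inter> partial_rate N -` {..r})"
  proof (intro subset_antisym subsetI)
    fix z assume z: "z \<in> level r"
    then have "admissible z" by (simp add: level_def)
    then have "z i \<in> K i" for i
      using level_coef_le[OF z, of i] lu(2)[of "z i" i] by (cases "i \<in> coef_index") (auto simp: K_def coef_index admissible_def)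
    with z show "z \<in> Pi\<^sub>E UNIV K \<inter> (\<Inter>N. Pi\<^sub>E UNIV K \<inter> partial_rate N -` {..r})" by (auto simp: level_def)
  qed (auto simp: level_def adm)
  have "closed (\<Inter>N. Pi\<^sub>E UNIV K \<inter> partial_rate N -` {..r})"
    by (intro closed_INT ballI continuous_closed_preimage cont compact_imp_closed comp closed_atMost)
  then show ?thesis unfolding lev by (rule compact_Int_closed[OF comp])
qed

text \<open>The measures of rate at most \<open>r\<close> form the continuous image of
  \<open>level r\<close>: the topology sees only moments, and these are continuous in the
  coefficients. Determinacy shows that no measure of that rate is missed.\<close>

lemma compactin_rate_level: "compactin (moment_topology UNIV) {\<nu> \<in> moment_space UNIV. rate_function \<gamma> \<sigma> \<nu> \<le> ereal r}"
proof -
  have "\<forall>z\<in>level r. \<exists>\<mu>. \<mu> \<in> moment_space (limit_interval \<gamma> \<sigma>) \<and> (\<forall>k. moment \<mu> k = coef_moment \<gamma> \<sigma> z k) \<and>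
     decomposition \<gamma> \<sigma> \<mu> (useq z) (vseq z)" using level_measure by blast
  then obtain m where m: "\<And>z. z \<in> level r \<Longrightarrow> m z \<in> moment_space (limit_interval \<gamma> \<sigma>)"
    "\<And>z k. z \<in> level r \<Longrightarrow> moment (m z) k = coef_moment \<gamma> \<sigma> z k"
    "\<And>z. z \<in> level r \<Longrightarrow> decomposition \<gamma> \<sigma> (m z) (useq z) (vseq z)" by metis
  have s: "1 + \<sigma> \<noteq> 0" using sigma by simp
  have "continuous_on UNIV (coef_moment \<gamma> \<sigma>)"
  proof (intro continuous_on_coordinatewise_then_product)
    fix k show "continuous_on UNIV (\<lambda>z. coef_moment \<gamma> \<sigma> z k)"
      unfolding continuous_on_def
    proof
      fix z0 :: "nat + nat \<Rightarrow> real"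
      have "((\<lambda>z. z i) \<longlongrightarrow> z0 i) (at z0)" for i
        using continuous_on_product_coordinates[of i] unfolding continuous_on_def by auto
      then show "((\<lambda>z. coef_moment \<gamma> \<sigma> z k) \<longlongrightarrow> coef_moment \<gamma> \<sigma> z0 k) (at z0 within UNIV)"
        by (intro tendsto_coef_moment tendsto_const s) simp
    qed
  qed
  then have cont: "continuous_on (level r) (coef_moment \<gamma> \<sigma>)" by (rule continuous_on_subset) simp
  have "continuous_map (top_of_set (level r)) (moment_topology UNIV) m"
    unfolding continuous_map_def
  proof (intro conjI allI impI)
    show "m \<in> topspace (top_of_set (level r)) \<rightarrow> topspace (moment_topology UNIV)"
      using m(1) moment_space_UNIV by auto
    fix U assume "openin (moment_topology UNIV) U"
    then obtain W :: "(nat \<Rightarrow> real) set" where W: "open W" "U = {\<nu> \<in> moment_space UNIV. moment \<nu> \<in> W}"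
      by (rule openin_moment_vimage)
    have "{z \<in> topspace (top_of_set (level r)). m z \<in> U} = level r \<inter> coef_moment \<gamma> \<sigma> -` W"
    proof -
      have "moment (m z) = coef_moment \<gamma> \<sigma> z" if "z \<in> level r" for z using m(2)[OF that] by auto
      then show ?thesis using W(2) m(1) moment_space_UNIV by auto
    qed
    then show "openin (top_of_set (level r)) {z \<in> topspace (top_of_set (level r)). m z \<in> U}"
      using continuous_openin_preimage_gen[OF cont W(1)] by simp
  qed
  moreover have "compactin (top_of_set (level r)) (level r)"
    using compact_level[of r] by (simp add: compactin_subtopology)
  ultimately have "compactin (moment_topology UNIV) (m ` level r)" by (rule image_compactin[rotated])
  moreover have "m ` level r = {\<nu> \<in> moment_space UNIV. rate_function \<gamma> \<sigma> \<nu> \<le> ereal r}"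
  proof (intro subset_antisym subsetI)
    fix \<nu> assume "\<nu> \<in> m ` level r"
    then show "\<nu> \<in> {\<nu> \<in> moment_space UNIV. rate_function \<gamma> \<sigma> \<nu> \<le> ereal r}"
      using m(1,3) moment_space_UNIV rate_function_level by blast
  next
    fix \<nu> assume "\<nu> \<in> {\<nu> \<in> moment_space UNIV. rate_function \<gamma> \<sigma> \<nu> \<le> ereal r}"
    then obtain z where z: "z \<in> level r" "\<And>k. moment \<nu> k = coef_moment \<gamma> \<sigma> z k" "\<nu> \<in> moment_space UNIV"
      using rate_function_le[of \<nu> r] by auto
    then have "\<nu> = m z" using m(1,2)[OF z(1)] by (intro moment_space_eqI[OF z(3)]) auto
    with z show "\<nu> \<in> m ` level r" by blast
  qed
  ultimately show ?thesis by simp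
qed

lemma good_rate: "good_rate_function (moment_topology UNIV) (rate_function \<gamma> \<sigma>)"
  unfolding good_rate_function_def topspace_moment_topology
  using compactin_rate_level compactin_imp_closedin[OF Hausdorff_moment_topology] rate_function_nonneg by blast

lemma good_rate_interval: "good_rate_function (moment_topology (limit_interval \<gamma> \<sigma>)) (rate_function \<gamma> \<sigma>)"
proof -
  let ?I = "limit_interval \<gamma> \<sigma>"
  have "compactin (moment_topology ?I) {\<nu> \<in> moment_space ?I. rate_function \<gamma> \<sigma> \<nu> \<le> ereal r}" for r
  proof -
    have "{\<nu> \<in> moment_space ?I. rate_function \<gamma> \<sigma> \<nu> \<le> ereal r} = {\<nu> \<in> moment_space UNIV. rate_function \<gamma> \<sigma> \<nu> \<le> ereal r}"
      using rate_function_le moment_space_UNIV by blast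
    then show ?thesis
      using compactin_rate_level[of r] unfolding moment_topology_subtopology[of ?I] compactin_subtopology by auto
  qed
  then show ?thesis
    unfolding good_rate_function_def topspace_moment_topology
    using compactin_imp_closedin[OF Hausdorff_moment_topology] rate_function_nonneg by blast
qed

end

section \<open>Large deviation bounds\<close>

lemma limsup_log_prob_le:
  assumes speed: "filterlim speed at_top sequentially"
    and p: "\<forall>\<^sub>F n in sequentially. p n \<le> C * exp (- speed n * \<alpha>)"
  shows "limsup (\<lambda>n. ereal (1 / speed n) * log_prob (p n)) \<le> ereal (- \<alpha>)"
proof -
  \<comment> \<open>A positive constant, so that its logarithm exists and vanishes after division by
    the speed.\<close>
  define C' where "C' = max C 1"
  have C': "C \<le> C'" "1 \<le> C'" by (auto simp: C'_def)
  have "\<forall>\<^sub>F n in sequentially. ereal (1 / speed n) * log_prob (p n) \<le> ereal (ln C' * (1 / speed n) - \<alpha>)"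
    using p filterlim_at_top[THEN iffD1, OF speed, rule_format, of 1]
  proof eventually_elim
    case (elim n)
    show ?case
    proof (cases "0 < p n")
      case True
      have "p n \<le> C' * exp (- speed n * \<alpha>)" using elim C' by (meson exp_ge_zero mult_right_mono order_trans)
      then have "ln (p n) \<le> ln (C' * exp (- speed n * \<alpha>))" using True C' by (subst ln_le_cancel_iff) auto
      also have "\<dots> = ln C' - speed n * \<alpha>" using C' by (simp add: ln_mult)
      finally have "1 / speed n * ln (p n) \<le> 1 / speed n * (ln C' - speed n * \<alpha>)"
        using elim by (intro mult_left_mono) auto
      also have "\<dots> = ln C' * (1 / speed n) - \<alpha>" using elim by (simp add: field_simps)
      finally show ?thesis using True by (simp add: log_prob_def)
    next
      case False
      then show ?thesis using elim by (simp add: log_prob_def)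
    qed
  qed
  then have "limsup (\<lambda>n. ereal (1 / speed n) * log_prob (p n)) \<le> limsup (\<lambda>n. ereal (ln C' * (1 / speed n) - \<alpha>))"
    by (rule Limsup_mono)
  also have "(\<lambda>n. ln C' * (1 / speed n) - \<alpha>) \<longlonglongrightarrow> ln C' * 0 - \<alpha>"
    by (intro tendsto_intros tendsto_divide_0[OF tendsto_const filterlim_at_top_imp_at_infinity[OF speed]])
  then have "limsup (\<lambda>n. ereal (ln C' * (1 / speed n) - \<alpha>)) = ereal (ln C' * 0 - \<alpha>)"
    by (intro lim_imp_Limsup tendsto_ereal) auto
  finally show ?thesis by simp
qed

lemma liminf_log_prob_ge:
  assumes speed: "filterlim speed at_top sequentially"
    and p: "\<forall>\<^sub>F n in sequentially. exp (- speed n * \<alpha>) \<le> p n"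
  shows "ereal (- \<alpha>) \<le> liminf (\<lambda>n. ereal (1 / speed n) * log_prob (p n))"
proof (rule Liminf_bounded)
  show "\<forall>\<^sub>F n in sequentially. ereal (- \<alpha>) \<le> ereal (1 / speed n) * log_prob (p n)"
    using p filterlim_at_top[THEN iffD1, OF speed, rule_format, of 1]
  proof eventually_elim
    case (elim n)
    have pos: "0 < p n" using elim exp_gt_zero[of "- speed n * \<alpha>"] by linarith
    have "- speed n * \<alpha> \<le> ln (p n)" using elim pos by (metis ln_exp ln_le_cancel_iff exp_gt_zero)
    then have "1 / speed n * (- speed n * \<alpha>) \<le> 1 / speed n * ln (p n)" using elim by (intro mult_left_mono) auto
    then show ?case using pos elim by (simp add: log_prob_def)
  qed
qed

text \<open>The logarithmic statements in extended reals follow from exponential bounds between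
  reals. Arbitrary real \<alpha> below the rate on \<open>F\<close> cover an infinite infimum, and
  the slack \<epsilon> is removed by choosing a second number between the rate and the
  bound.\<close>

lemma ldp_boundsI:
  assumes speed: "filterlim speed at_top sequentially"
    and upper: "\<And>F \<alpha>. closedin X F \<Longrightarrow> (\<And>\<nu>. \<nu> \<in> F \<Longrightarrow> ereal \<alpha> < I \<nu>) \<Longrightarrow>
       \<exists>C. \<forall>\<^sub>F n in sequentially. P n F \<le> C * exp (- speed n * \<alpha>)"
    and lower: "\<And>U \<nu> r \<epsilon>. openin X U \<Longrightarrow> \<nu> \<in> U \<Longrightarrow> I \<nu> \<le> ereal r \<Longrightarrow> 0 < \<epsilon> \<Longrightarrow>
       \<forall>\<^sub>F n in sequentially. exp (- speed n * (r + \<epsilon>)) \<le> P n U"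
  shows "ldp_bounds X P speed I"
  unfolding ldp_bounds_def
proof (intro conjI allI impI)
  fix F assume F: "closedin X F"
  show "limsup (\<lambda>n. ereal (1 / speed n) * log_prob (P n F)) \<le> - (INF x\<in>F. I x)"
  proof (rule ccontr)
    assume "\<not> ?thesis"
    then have "- (INF x\<in>F. I x) < limsup (\<lambda>n. ereal (1 / speed n) * log_prob (P n F))" by simp
    then obtain q where q: "- (INF x\<in>F. I x) < ereal q" "ereal q < limsup (\<lambda>n. ereal (1 / speed n) * log_prob (P n F))"
      using ereal_dense2 by blast
    have "ereal (- q) < (INF x\<in>F. I x)" using q(1) by (simp add: ereal_uminus_less_reorder)
    then have "\<And>\<nu>. \<nu> \<in> F \<Longrightarrow> ereal (- q) < I \<nu>" by (meson INF_lower less_le_trans)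
    then obtain C where "\<forall>\<^sub>F n in sequentially. P n F \<le> C * exp (- speed n * (- q))" using upper[OF F, of "- q"] by blast
    from limsup_log_prob_le[OF speed this] q(2) show False by simp
  qed
next
  fix U assume U: "openin X U"
  have "- liminf (\<lambda>n. ereal (1 / speed n) * log_prob (P n U)) \<le> (INF x\<in>U. I x)"
  proof (rule INF_greatest)
    fix \<nu> assume \<nu>: "\<nu> \<in> U"
    show "- liminf (\<lambda>n. ereal (1 / speed n) * log_prob (P n U)) \<le> I \<nu>"
    proof (rule ccontr)
      assume "\<not> ?thesis"
      then have "I \<nu> < - liminf (\<lambda>n. ereal (1 / speed n) * log_prob (P n U))" by simp
      then obtain q where q: "I \<nu> < ereal q" "ereal q < - liminf (\<lambda>n. ereal (1 / speed n) * log_prob (P n U))"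
        using ereal_dense2 by blast
      obtain q' where q': "I \<nu> < ereal q'" "ereal q' < ereal q" using ereal_dense2[OF q(1)] by blast
      have "\<forall>\<^sub>F n in sequentially. exp (- speed n * (q' + (q - q'))) \<le> P n U"
        using lower[OF U \<nu>, of q' "q - q'"] q' by (auto simp: less_imp_le)
      then have "ereal (- q) \<le> liminf (\<lambda>n. ereal (1 / speed n) * log_prob (P n U))"
        using liminf_log_prob_ge[OF speed, of q] by simp
      then have "- liminf (\<lambda>n. ereal (1 / speed n) * log_prob (P n U)) \<le> ereal q"
        by (simp add: ereal_uminus_le_reorder)
      with q(2) show False by simp
    qed
  qed
  then show "- (INF x\<in>U. I x) \<le> liminf (\<lambda>n. ereal (1 / speed n) * log_prob (P n U))"
    by (simp add: ereal_uminus_le_reorder)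
qed

lemma measurable_jacobi_pow:
  assumes "\<And>i. (\<lambda>\<omega>. a \<omega> i) \<in> borel_measurable M" "\<And>i. (\<lambda>\<omega>. b \<omega> i) \<in> borel_measurable M"
  shows "(\<lambda>\<omega>. jacobi_pow (a \<omega>) (b \<omega>) k j i) \<in> borel_measurable M"
proof (induction k arbitrary: i)
  case (Suc k)
  have [measurable]: "(\<lambda>\<omega>. a \<omega> i) \<in> borel_measurable M" "(\<lambda>\<omega>. b \<omega> i) \<in> borel_measurable M"
    "(\<lambda>\<omega>. jacobi_pow (a \<omega>) (b \<omega>) k j i) \<in> borel_measurable M" for i by (rule assms Suc)+
  show ?case unfolding jacobi_pow_Suc jacobi_op_def by (cases "i = 0") simp_all
qed simp

context limit_params
begin

lemma partial_rate_eq: "partial_rate N z = (\<Sum>i\<in>Inl ` {1..N} \<union> Inr ` {1..N}. coef_rate i (z i))"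
proof -
  have "(\<Sum>i\<in>Inl ` {1..N} \<union> Inr ` {1..N}. coef_rate i (z i))
     = (\<Sum>k=1..N. coef_rate (Inl k) (z (Inl k))) + (\<Sum>k=1..N. coef_rate (Inr k) (z (Inr k)))"
    by (subst sum.union_disjoint) (auto simp: sum.reindex)
  also have "\<dots> = (\<Sum>k=1..N. coef_rate (Inl k) (z (Inl k)) + coef_rate (Inr k) (z (Inr k)))" by (simp add: sum.distrib)
  also have "\<dots> = partial_rate N z"
    unfolding partial_rate_def by (rule sum.reindex_bij_witness[of _ Suc "\<lambda>k. k - 1"]) auto
  finally show ?thesis ..
qed

lemma level_sum_le:
  assumes z: "z \<in> level r" and J: "finite J" "J \<subseteq> coef_index"
  shows "(\<Sum>i\<in>J. coef_rate i (z i)) \<le> r"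
proof -
  define f :: "nat + nat \<Rightarrow> nat" where "f i = (case i of Inl k \<Rightarrow> k | Inr k \<Rightarrow> k)" for i
  define N where "N = Max (insert 0 (f ` J))"
  have "J \<subseteq> Inl ` {1..N} \<union> Inr ` {1..N}"
  proof
    fix i assume i: "i \<in> J"
    then have fi: "f i \<le> N" unfolding N_def using J by (intro Max_ge) auto
    have "i \<in> coef_index" using i J by auto
    then show "i \<in> Inl ` {1..N} \<union> Inr ` {1..N}" using fi by (auto simp: coef_index_def f_def)
  qed
  moreover have "0 \<le> coef_rate i (z i)" if "i \<in> Inl ` {1..N} \<union> Inr ` {1..N}" for i
    using z that by (intro coef_rate_nonneg) (auto simp: level_def admissible_def coef_index_def)
  ultimately have "(\<Sum>i\<in>J. coef_rate i (z i)) \<le> partial_rate N z"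
    unfolding partial_rate_eq by (intro sum_mono2) auto
  also have "\<dots> \<le> r" using z by (simp add: level_def)
  finally show ?thesis .
qed

end

section \<open>The random spectral measures as functions of the coefficients\<close>

context jacobi_asymptotics
begin

definition spec :: "nat \<Rightarrow> 'a \<Rightarrow> real measure" where
  "spec n \<omega> = spectral_measure (rescaled_jacobi_matrix n (p1 n) (p2 n) (\<lambda>k. c n k \<omega>) (\<lambda>k. s n k \<omega>))"

definition mat_a :: "nat \<Rightarrow> 'a \<Rightarrow> nat \<Rightarrow> real" where
  "mat_a n \<omega> i = (if 1 \<le> i \<and> i \<le> n then ((p1 n + p2 n) * (s n (i - 1) \<omega> * (1 - c n (i - 1) \<omega>) + c n i \<omega> * (1 - s n (i - 1) \<omega>)) - p1 n)
     / sqrt (real n * p1 n) else 0)"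

definition mat_b :: "nat \<Rightarrow> 'a \<Rightarrow> nat \<Rightarrow> real" where
  "mat_b n \<omega> i = (if 1 \<le> i \<and> i < n then (p1 n + p2 n) * jacobi_offdiag (\<lambda>k. c n k \<omega>) (\<lambda>k. s n k \<omega>) i / sqrt (real n * p1 n) else 0)"

lemma spec_props:
  assumes "n \<ge> 1"
  shows "\<exists>R. real_distribution (spec n \<omega>) \<and> (AE x in spec n \<omega>. \<bar>x\<bar> \<le> R)
     \<and> (\<forall>k. moment (spec n \<omega>) k = jacobi_pow (mat_a n \<omega>) (mat_b n \<omega>) k 1 1)"
  unfolding spec_def
proof (rule spectral_measure_tridiagonal[OF _ _ _ assms])
  show "rescaled_jacobi_matrix n (p1 n) (p2 n) (\<lambda>k. c n k \<omega>) (\<lambda>k. s n k \<omega>) =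
    Matrix.mat n n (\<lambda>(i, j). if i = j then mat_a n \<omega> (Suc i) else if j = Suc i then mat_b n \<omega> (Suc i)
       else if i = Suc j then mat_b n \<omega> (Suc j) else 0)"
    by (rule eq_matI) (auto simp: rescaled_jacobi_matrix_def jacobi_matrix_def mat_a_def mat_b_def)
qed (auto simp: mat_a_def mat_b_def)

lemma spec_in_space: "n \<ge> 1 \<Longrightarrow> spec n \<omega> \<in> moment_space UNIV"
  using spec_props[of n \<omega>] moment_space_bounded[of "spec n \<omega>" _ UNIV] by auto

lemma cs_measurable:
  assumes "n \<ge> 1"
  shows "k \<le> n \<Longrightarrow> c n k \<in> borel_measurable (M n)" "k < n \<Longrightarrow> s n k \<in> borel_measurable (M n)"
proof -
  note m = model[OF assms, unfolded jacobi_model_def]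
  have 0: "c n 0 = (\<lambda>_. 0)" "s n 0 = (\<lambda>_. 0)" using m by auto
  show "c n k \<in> borel_measurable (M n)" if "k \<le> n"
    using m that 0 by (cases "k = 0") (auto simp: distributed_def)
  show "s n k \<in> borel_measurable (M n)" if "k < n"
    using m that 0 by (cases "k = 0") (auto simp: distributed_def)
qed

lemma spec_moment_measurable:
  assumes n: "n \<ge> 1" shows "(\<lambda>\<omega>. moment (spec n \<omega>) k) \<in> borel_measurable (M n)"
proof -
  have "(\<lambda>\<omega>. jacobi_pow (mat_a n \<omega>) (mat_b n \<omega>) k 1 1) \<in> borel_measurable (M n)"
  proof (rule measurable_jacobi_pow)
    fix i
    show "(\<lambda>\<omega>. mat_a n \<omega> i) \<in> borel_measurable (M n)"
    proof (cases "1 \<le> i \<and> i \<le> n")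
      case True
      have [measurable]: "c n (i - 1) \<in> borel_measurable (M n)" "c n i \<in> borel_measurable (M n)" "s n (i - 1) \<in> borel_measurable (M n)"
        using True by (auto intro!: cs_measurable[OF n])
      show ?thesis unfolding mat_a_def if_P[OF True] by measurable
    qed (auto simp: mat_a_def)
    show "(\<lambda>\<omega>. mat_b n \<omega> i) \<in> borel_measurable (M n)"
    proof (cases "1 \<le> i \<and> i < n")
      case True
      have [measurable]: "c n i \<in> borel_measurable (M n)" "s n i \<in> borel_measurable (M n)" "s n (i - 1) \<in> borel_measurable (M n)"
        using True by (auto intro!: cs_measurable[OF n])
      show ?thesis unfolding mat_b_def if_P[OF True] jacobi_offdiag_def by measurable
    qed (auto simp: mat_b_def)
  qed
  moreover have "moment (spec n \<omega>) k = jacobi_pow (mat_a n \<omega>) (mat_b n \<omega>) k 1 1" for \<omega>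
    using spec_props[OF n, of \<omega>] by blast
  ultimately show ?thesis by simp
qed

definition good :: "nat \<Rightarrow> 'a \<Rightarrow> bool" where
  "good n \<omega> \<longleftrightarrow> (\<forall>k\<in>{1..n}. 0 < c n k \<omega> \<and> c n k \<omega> < 1) \<and> (\<forall>k\<in>{1..<n}. 0 < s n k \<omega> \<and> s n k \<omega> < 1)"

lemma AE_beta:
  assumes "distributed N lborel X (\<lambda>x. ennreal (beta_density a b x))"
  shows "AE \<omega> in N. 0 < X \<omega> \<and> X \<omega> < 1"
proof -
  have "AE x in density lborel (\<lambda>x. ennreal (beta_density a b x)). 0 < x \<and> x < 1"
    using assms by (subst AE_density) (auto simp: distributed_def beta_density_def)
  moreover have "distr N lborel X = density lborel (\<lambda>x. ennreal (beta_density a b x))" using assms by (simp add: distributed_def)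
  ultimately have "AE x in distr N lborel X. 0 < x \<and> x < 1" by (simp only:)
  then show ?thesis using assms by (subst (asm) AE_distr_iff) (auto simp: distributed_def)
qed

lemma AE_good: "n \<ge> 1 \<Longrightarrow> AE \<omega> in M n. good n \<omega>"
proof -
  assume n: "n \<ge> 1"
  note m = model[OF n, unfolded jacobi_model_def]
  have "AE \<omega> in M n. 0 < c n k \<omega> \<and> c n k \<omega> < 1" if "k \<in> {1..n}" for k
    by (rule AE_beta) (use m that in blast)
  moreover have "AE \<omega> in M n. 0 < s n k \<omega> \<and> s n k \<omega> < 1" if "k \<in> {1..<n}" for k
    by (rule AE_beta) (use m that in blast)
  ultimately have "AE \<omega> in M n. \<forall>k\<in>{1..n}. 0 < c n k \<omega> \<and> c n k \<omega> < 1"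
    "AE \<omega> in M n. \<forall>k\<in>{1..<n}. 0 < s n k \<omega> \<and> s n k \<omega> < 1"
    by (auto intro!: AE_finite_allI)
  then show ?thesis by eventually_elim (simp add: good_def)
qed

text \<open>The decomposition formulas with \<open>n / p1\<close> and \<open>p1 / p2\<close> for
  \<gamma> and \<sigma> reproduce the rescaled matrix exactly, without any error term. Positions are
  kept below \<open>n\<close>, where all variables involved belong to the model.\<close>

lemma mat_eq_coef:
  assumes n: "n \<ge> 1" and g: "good n \<omega>" and i: "1 \<le> i" "i < n"
    and z: "\<And>j. j \<in> coef_index \<Longrightarrow> z j = coef n j \<omega>"
  shows "mat_a n \<omega> i = acoef (real n / p1 n) (p1 n / p2 n) (useq z) (vseq z) i"
    "mat_b n \<omega> i = sqrt (b2coef (real n / p1 n) (p1 n / p2 n) (useq z) (vseq z) i)"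
proof -
  note P = pos[OF n]
  define p q where "p = p1 n" and "q = p2 n"
  define w where "w = sqrt (real n * p)"
  define C S C' S' where "C = c n i \<omega>" and "S = s n i \<omega>" and "C' = c n (i - 1) \<omega>" and "S' = s n (i - 1) \<omega>"
  have pq: "p > 0" "q > 0" "real n > 0" "p + q > 0" using P n by (auto simp: p_def q_def)
  have w: "w > 0" "w * w = real n * p" using pq by (auto simp: w_def)
  have t: "sqrt (real n / p) = w / p"
  proof -
    have "sqrt (real n / p) = sqrt ((w / p)\<^sup>2)"
      by (rule arg_cong[where f=sqrt]) (use pq w in \<open>simp add: power2_eq_square\<close>)
    then show ?thesis using pq w by simp
  qed
  have s1: "1 + p / q = (p + q) / q" using pq by (simp add: field_simps)
  have q1: "real n / p * (p / q) / (1 + p / q) = real n / (p + q)" unfolding s1 using pq by simp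
  have zero: "s n 0 \<omega> = 0" using model[OF n] by (simp add: jacobi_model_def)
  have u: "useq z i = ((p + q) * C - p) / w"
    using i z[of "Inl i"] by (simp add: useq_def coef_def coef_index_def p_def q_def C_def w_def)
  have v: "vseq z i = (p + q) * S / real n"
    using i z[of "Inr i"] by (simp add: vseq_def coef_def coef_index_def p_def q_def S_def)
  have v': "vseq z (i - 1) = (p + q) * S' / real n"
    using i z[of "Inr (i - 1)"] zero by (cases "i = 1") (auto simp: vseq_def coef_def coef_index_def p_def q_def S'_def)
  \<comment> \<open>For \<open>i = 1\<close> the formula for \<open>u\<close> at
    \<open>c 0 = 0\<close> would give - p / w instead of 0, but it is multiplied by
    \<open>s 0 = 0\<close>.\<close>
  have Su': "S' * useq z (i - 1) = S' * (((p + q) * C' - p) / w)"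
    using i z[of "Inl (i - 1)"] zero by (cases "i = 1") (auto simp: useq_def coef_def coef_index_def p_def q_def S'_def C'_def w_def)
  have qv: "real n / (p + q) * vseq z (i - 1) = S'" unfolding v' using pq by simp
  have tv: "w / p * ((1 - p / q) / (1 + p / q)) * vseq z (i - 1) = (q - p) * S' / w"
  proof -
    have "(1 - p / q) / (1 + p / q) = (q - p) / (p + q)"
    proof -
      have "1 - p / q = (q - p) / q" using pq by (simp add: diff_divide_distrib)
      then show ?thesis unfolding s1 using pq by simp
    qed
    then have "w / p * ((1 - p / q) / (1 + p / q)) * vseq z (i - 1) = w / p * ((q - p) * S' / real n)"
      unfolding v' using pq by simp
    also have "\<dots> = (q - p) * S' * (w / (real n * p))" by (simp add: mult_ac)
    also have "w / (real n * p) = 1 / w" unfolding w(2)[symmetric] using w(1) by simp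
    finally show ?thesis by simp
  qed
  have "acoef (real n / p) (p / q) (useq z) (vseq z) i = (q - p) * S' / w - S' * (useq z (i - 1) + useq z i) + useq z i"
    unfolding acoef_def q1 t tv qv ..
  also have "\<dots> = (q - p) * S' / w - (S' * (((p + q) * C' - p) / w) + S' * (((p + q) * C - p) / w)) + ((p + q) * C - p) / w"
    unfolding distrib_left Su' u ..
  also have "\<dots> = ((p + q) * (S' * (1 - C') + C * (1 - S')) - p) / w"
    using w(1) by (simp add: field_simps)
  finally show "mat_a n \<omega> i = acoef (real n / p1 n) (p1 n / p2 n) (useq z) (vseq z) i"
    using i by (simp add: mat_a_def p_def q_def C_def C'_def S'_def w_def)
  have f1: "1 - p / q * (w / p) * useq z i = (p + q) * (1 - C) / q"
    unfolding u using pq w(1) by (simp add: field_simps)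
  have f2: "1 + w / p * useq z i = (p + q) * C / p"
    unfolding u using pq w(1) by (simp add: field_simps)
  have "b2coef (real n / p) (p / q) (useq z) (vseq z) i
     = 1 / ((p + q) / q) * ((p + q) * S / real n) * ((p + q) * (1 - C) / q) * ((p + q) * C / p) * (1 - S')"
    unfolding b2coef_def q1 t f1 f2 qv v unfolding s1 ..
  also have "\<dots> = (p + q)\<^sup>2 * (C * (1 - C) * S * (1 - S')) / (real n * p)"
    using pq by (simp add: power2_eq_square mult_ac)
  finally have b2: "b2coef (real n / p) (p / q) (useq z) (vseq z) i = (p + q)\<^sup>2 * (C * (1 - C) * S * (1 - S')) / (real n * p)" .
  have "sqrt (b2coef (real n / p) (p / q) (useq z) (vseq z) i) = (p + q) * sqrt (C * (1 - C) * S * (1 - S')) / w"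
    unfolding b2 real_sqrt_divide real_sqrt_mult[of "(p + q)\<^sup>2"] w_def using pq by simp
  then show "mat_b n \<omega> i = sqrt (b2coef (real n / p1 n) (p1 n / p2 n) (useq z) (vseq z) i)"
    using i by (simp add: mat_b_def jacobi_offdiag_def p_def q_def C_def S_def S'_def w_def)
qed

lemma spec_moment_eq:
  assumes n: "n \<ge> 1" and g: "good n \<omega>" and k: "k < n"
    and z: "\<And>j. j \<in> coef_index \<Longrightarrow> z j = coef n j \<omega>"
  shows "moment (spec n \<omega>) k = coef_moment (real n / p1 n) (p1 n / p2 n) z k"
proof -
  have "moment (spec n \<omega>) k = jacobi_pow (mat_a n \<omega>) (mat_b n \<omega>) k 1 1" using spec_props[OF n, of \<omega>] by blast
  also have "jacobi_pow (mat_a n \<omega>) (mat_b n \<omega>) k 1 = jacobi_pow (acoef (real n / p1 n) (p1 n / p2 n) (useq z) (vseq z))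
     (\<lambda>i. sqrt (b2coef (real n / p1 n) (p1 n / p2 n) (useq z) (vseq z) i)) k 1"
    by (rule jacobi_pow_cong[of k]) (use mat_eq_coef[OF n g _ _ z] k in auto)
  finally show ?thesis by (simp add: coef_moment_def)
qed

definition box :: "(nat + nat) set \<Rightarrow> (nat + nat \<Rightarrow> real) \<Rightarrow> (nat + nat \<Rightarrow> real) \<Rightarrow> (nat + nat \<Rightarrow> real) set" where
  "box J z \<delta> = {z'. \<forall>i\<in>J. \<bar>z' i - z i\<bar> < \<delta> i}"

lemma open_box: "finite J \<Longrightarrow> open (box J z \<delta>)"
proof -
  assume J: "finite J"
  have "box J z \<delta> = (\<Inter>i\<in>J. {z'. \<bar>z' i - z i\<bar> < \<delta> i})" by (auto simp: box_def)
  also have "open \<dots>"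
    by (intro open_INT J ballI open_Collect_less continuous_intros continuous_on_product_coordinates)
  finally show ?thesis .
qed

text \<open>The filter on pairs combines the growth of \<open>n\<close> with convergence of the
  coefficients. Near the given moments \<open>W\<close> contains a cylinder over finitely many of
  them, so a window in finitely many coordinates suffices, with one \<delta> and one threshold for
  all outcomes.\<close>

lemma spec_near:
  assumes W: "open (W :: (nat \<Rightarrow> real) set)" and z: "coef_moment \<gamma> \<sigma> z \<in> W"
  obtains J \<delta> where "finite J" "J \<subseteq> coef_index" "0 < \<delta>"
    "\<forall>\<^sub>F n in sequentially. \<forall>\<omega>. good n \<omega> \<and> (\<forall>i\<in>J. \<bar>coef n i \<omega> - z i\<bar> < \<delta>) \<longrightarrow> moment (spec n \<omega>) \<in> W"
proof -
  obtain K e where K: "finite K" "0 < e" "\<And>m'. (\<And>k. k \<in> K \<Longrightarrow> \<bar>m' k - coef_moment \<gamma> \<sigma> z k\<bar> < e) \<Longrightarrow> m' \<in> W"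
    using open_fun_basis[OF W z] by metis
  let ?F = "sequentially \<times>\<^sub>F nhds z"
  have fst: "filterlim fst sequentially ?F" and snd: "filterlim snd (nhds z) ?F"
    by (auto simp: filterlim_def filtermap_fst_prod_filter filtermap_snd_prod_filter)
  have coord: "((\<lambda>x. snd x i) \<longlongrightarrow> z i) ?F" for i
  proof -
    have "((\<lambda>z'. z' i) \<longlongrightarrow> z i) (nhds z)"
    proof (rule topological_tendstoI)
      fix S :: "real set" assume "open S" "z i \<in> S"
      moreover have "open ((\<lambda>z' :: nat + nat \<Rightarrow> real. z' i) -` S)"
        by (rule open_vimage[OF \<open>open S\<close> continuous_on_product_coordinates])
      ultimately show "\<forall>\<^sub>F z' in nhds z. z' i \<in> S"
        unfolding eventually_nhds by (intro exI[of _ "(\<lambda>z'. z' i) -` S"]) auto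
    qed
    from filterlim_compose[OF this snd] show ?thesis .
  qed
  have lim: "((\<lambda>x. coef_moment (real (fst x) / p1 (fst x)) (p1 (fst x) / p2 (fst x)) (snd x) k) \<longlongrightarrow> coef_moment \<gamma> \<sigma> z k) ?F" for k
  proof (rule tendsto_coef_moment[OF filterlim_compose[OF lim_gamma fst] filterlim_compose[OF lim_sigma fst] _ coord])
    show "1 + \<sigma> \<noteq> 0" using sigma by simp
  qed
  have "\<forall>\<^sub>F x in ?F. \<forall>k\<in>K. \<bar>coef_moment (real (fst x) / p1 (fst x)) (p1 (fst x) / p2 (fst x)) (snd x) k - coef_moment \<gamma> \<sigma> z k\<bar> < e"
    using K(1) tendstoD[OF lim K(2)] by (simp add: eventually_ball_finite_distrib dist_real_def)
  then obtain Pf Pg where Pf: "eventually Pf sequentially" and Pg: "eventually Pg (nhds z)"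
    and PQ: "\<And>n z'. Pf n \<Longrightarrow> Pg z' \<Longrightarrow> \<forall>k\<in>K. \<bar>coef_moment (real n / p1 n) (p1 n / p2 n) z' k - coef_moment \<gamma> \<sigma> z k\<bar> < e"
    unfolding eventually_prod_filter by auto
  obtain V where V: "open V" "z \<in> V" "\<And>z'. z' \<in> V \<Longrightarrow> Pg z'" using Pg by (auto simp: eventually_nhds)
  obtain J \<delta> where J: "finite J" "0 < \<delta>" "\<And>z'. (\<And>k. k \<in> J \<Longrightarrow> \<bar>z' k - z k\<bar> < \<delta>) \<Longrightarrow> z' \<in> V"
    using open_fun_basis[OF V(1,2)] by metis
  have "\<forall>\<^sub>F n in sequentially. Max (insert 0 K) < n" by (rule eventually_gt_at_top)
  then have "\<forall>\<^sub>F n in sequentially. \<forall>\<omega>. good n \<omega> \<and> (\<forall>i\<in>J \<inter> coef_index. \<bar>coef n i \<omega> - z i\<bar> < \<delta>) \<longrightarrow> moment (spec n \<omega>) \<in> W"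
    using Pf eventually_ge_at_top[of 1]
  proof eventually_elim
    case (elim n)
    show ?case
    proof (intro allI impI)
      fix \<omega> assume \<omega>: "good n \<omega> \<and> (\<forall>i\<in>J \<inter> coef_index. \<bar>coef n i \<omega> - z i\<bar> < \<delta>)"
      \<comment> \<open>Coordinates outside \<open>coef_index\<close> are not random and are taken
        from \<open>z\<close>.\<close>
      define z' where "z' i = (if i \<in> coef_index then coef n i \<omega> else z i)" for i
      have "z' \<in> V" by (rule J(3)) (use \<omega> J(2) in \<open>auto simp: z'_def\<close>)
      then have near: "\<forall>k\<in>K. \<bar>coef_moment (real n / p1 n) (p1 n / p2 n) z' k - coef_moment \<gamma> \<sigma> z k\<bar> < e"
        using PQ elim V(3) by blast
      show "moment (spec n \<omega>) \<in> W"
      proof (rule K(3))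
        fix k assume k: "k \<in> K"
        then have "k \<le> Max (insert 0 K)" using K(1) by (intro Max_ge) auto
        then have "k < n" using elim by linarith
        then have "moment (spec n \<omega>) k = coef_moment (real n / p1 n) (p1 n / p2 n) z' k"
          by (intro spec_moment_eq) (use elim \<omega> in \<open>auto simp: z'_def\<close>)
        then show "\<bar>moment (spec n \<omega>) k - coef_moment \<gamma> \<sigma> z k\<bar> < e" using near k by simp
      qed
    qed
  qed
  then show thesis using J by (intro that[of "J \<inter> coef_index" \<delta>]) auto
qed

section \<open>Exponential bounds for events of spectral measures\<close>

definition law :: "nat \<Rightarrow> real measure set \<Rightarrow> real" where
  "law n A = measure (M n) {\<omega> \<in> space (M n). spec n \<omega> \<in> A}"

lemma open_event:
  assumes "n \<ge> 1" "openin (moment_topology UNIV) U"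
  shows "{\<omega> \<in> space (M n). spec n \<omega> \<in> U} \<in> sets (M n)"
proof -
  obtain W :: "(nat \<Rightarrow> real) set" where W: "open W" "U = {\<nu> \<in> moment_space UNIV. moment \<nu> \<in> W}"
    using openin_moment_vimage[OF assms(2)] .
  have "{\<omega> \<in> space (M n). spec n \<omega> \<in> U} = {\<omega> \<in> space (M n). moment (spec n \<omega>) \<in> W}"
    using W(2) spec_in_space[OF assms(1)] by auto
  then show ?thesis using measurable_moment_vimage[OF spec_moment_measurable[OF assms(1)] W(1)] by simp
qed

lemma closed_event:
  assumes "n \<ge> 1" "closedin (moment_topology UNIV) F"
  shows "{\<omega> \<in> space (M n). spec n \<omega> \<in> F} \<in> sets (M n)"
proof -
  have "openin (moment_topology UNIV) (moment_space UNIV - F)" using assms(2) by (simp add: closedin_def)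
  from open_event[OF assms(1) this] have "space (M n) - {\<omega> \<in> space (M n). spec n \<omega> \<in> moment_space UNIV - F} \<in> sets (M n)" by auto
  also have "space (M n) - {\<omega> \<in> space (M n). spec n \<omega> \<in> moment_space UNIV - F} = {\<omega> \<in> space (M n). spec n \<omega> \<in> F}"
    using spec_in_space[OF assms(1)] by auto
  finally show ?thesis .
qed

lemma ldp_lower:
  assumes U: "openin (moment_topology UNIV) U" and \<nu>: "\<nu> \<in> U" "rate_function \<gamma> \<sigma> \<nu> \<le> ereal r" and "0 < \<epsilon>"
  shows "\<forall>\<^sub>F n in sequentially. exp (- speed n * (r + \<epsilon>)) \<le> law n U"
proof -
  obtain W :: "(nat \<Rightarrow> real) set" where W: "open W" "U = {\<nu> \<in> moment_space UNIV. moment \<nu> \<in> W}"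
    using openin_moment_vimage[OF U] .
  obtain z where z: "z \<in> level r" "\<And>k. moment \<nu> k = coef_moment \<gamma> \<sigma> z k" using rate_function_le[OF \<nu>(2)] by blast
  have "coef_moment \<gamma> \<sigma> z = moment \<nu>" using z(2) by auto
  then have zW: "coef_moment \<gamma> \<sigma> z \<in> W" using W(2) \<nu>(1) by auto
  obtain J \<delta> where J: "finite J" "J \<subseteq> coef_index" "0 < \<delta>"
    "\<forall>\<^sub>F n in sequentially. \<forall>\<omega>. good n \<omega> \<and> (\<forall>i\<in>J. \<bar>coef n i \<omega> - z i\<bar> < \<delta>) \<longrightarrow> moment (spec n \<omega>) \<in> W"
    by (rule spec_near[OF W(1) zW])
  \<comment> \<open>Equal shares of \<epsilon> for the coordinates; the + 1 covers an empty
    \<open>J\<close>.\<close>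
  define e where "e = \<epsilon> / (real (card J) + 1)"
  have e: "e > 0" using assms by (simp add: e_def)
  have "\<forall>\<^sub>F n in sequentially. exp (- speed n * (coef_rate i (z i) + e)) \<le> measure (distr (M n) borel (coef n i)) {z i - \<delta><..<z i + \<delta>}"
    if i: "i \<in> J" for i
  proof -
    have iI: "i \<in> coef_index" using i J by auto
    obtain S h N where "laplace_family speed S h N (\<lambda>n. distr (M n) borel (coef n i)) (coef_dom i) (coef_rate i) (coef_lim i)"
      using laplace_coef[OF iI] .
    from laplace_family.local_lower[OF this _ J(3) e, of "z i"] show ?thesis
      using z(1) iI by (simp add: level_def admissible_def)
  qed
  then have "\<forall>\<^sub>F n in sequentially. \<forall>i\<in>J. exp (- speed n * (coef_rate i (z i) + e)) \<le> measure (distr (M n) borel (coef n i)) {z i - \<delta><..<z i + \<delta>}"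
    using J(1) by (intro eventually_ball_finite) auto
  then show ?thesis using J(4) finite_coef_index_in_model_index[OF J(1,2)] speed_ge[of 0]
  proof eventually_elim
    case (elim n)
    then have n: "n \<ge> 1" and JI: "J \<subseteq> model_index n" by auto
    interpret prob_space "M n" by (rule prob_space_M[OF n])
    let ?B = "{\<omega> \<in> space (M n). \<forall>i\<in>J. coef n i \<omega> \<in> {z i - \<delta><..<z i + \<delta>}}"
    note B = prob_box[OF n J(1) JI, of "\<lambda>i. {z i - \<delta><..<z i + \<delta>}"]
    have "(\<Sum>i\<in>J. coef_rate i (z i) + e) \<le> r + \<epsilon>"
    proof -
      have "(\<Sum>i\<in>J. coef_rate i (z i) + e) = (\<Sum>i\<in>J. coef_rate i (z i)) + real (card J) * e" by (simp add: sum.distrib)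
      moreover have "real (card J) * e \<le> (real (card J) + 1) * e" using e by simp
      moreover have "(real (card J) + 1) * e = \<epsilon>" by (simp add: e_def)
      ultimately show ?thesis using level_sum_le[OF z(1) J(1,2)] by linarith
    qed
    then have "exp (- speed n * (r + \<epsilon>)) \<le> exp (- speed n * (\<Sum>i\<in>J. coef_rate i (z i) + e))"
      using elim by (simp add: mult_left_mono)
    also have "\<dots> = (\<Prod>i\<in>J. exp (- speed n * (coef_rate i (z i) + e)))"
      by (simp add: exp_sum[OF J(1), symmetric] sum_distrib_left)
    also have "\<dots> \<le> (\<Prod>i\<in>J. measure (distr (M n) borel (coef n i)) {z i - \<delta><..<z i + \<delta>})"
      using elim by (intro prod_mono) auto
    also have "\<dots> = prob ?B" using B(2) by simp
    also have "\<dots> \<le> law n U" unfolding law_def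
    proof (rule finite_measure_mono_AE)
      show "AE \<omega> in M n. \<omega> \<in> ?B \<longrightarrow> \<omega> \<in> {\<omega> \<in> space (M n). spec n \<omega> \<in> U}"
        using AE_good[OF n]
      proof eventually_elim
        case g: (elim \<omega>)
        show ?case
        proof
          assume "\<omega> \<in> ?B"
          then have "\<omega> \<in> space (M n)" "\<forall>i\<in>J. \<bar>coef n i \<omega> - z i\<bar> < \<delta>" by (auto simp: abs_less_iff algebra_simps)
          then show "\<omega> \<in> {\<omega> \<in> space (M n). spec n \<omega> \<in> U}" using elim g W(2) spec_in_space[OF n] by auto
        qed
      qed
    qed (rule open_event[OF n U])
    finally show ?case .
  qed
qed

text \<open>If \<open>z\<close> has rate at most \<alpha>, its measure lies outside the closed set
  \<open>F\<close>, and by continuity the event in a small window is null for large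
  \<open>n\<close>. Otherwise some partial sum of the rates exceeds \<alpha>, and independence
  multiplies finitely many local bounds to the required one.\<close>

lemma local_event_bound:
  assumes F: "closedin (moment_topology UNIV) F" and \<alpha>: "\<And>\<nu>. \<nu> \<in> F \<Longrightarrow> ereal \<alpha> < rate_function \<gamma> \<sigma> \<nu>"
    and z: "admissible z"
  shows "\<exists>J \<delta>. finite J \<and> J \<subseteq> coef_index \<and> (\<forall>i. 0 < \<delta> i) \<and>
    (\<forall>\<^sub>F n in sequentially. measure (M n) {\<omega> \<in> space (M n). spec n \<omega> \<in> F \<and> (\<forall>i\<in>J. \<bar>coef n i \<omega> - z i\<bar> < \<delta> i)} \<le> exp (- speed n * \<alpha>))"
proof (cases "z \<in> level \<alpha>")
  case True
  obtain \<mu> where \<mu>: "\<mu> \<in> moment_space (limit_interval \<gamma> \<sigma>)" "\<And>k. moment \<mu> k = coef_moment \<gamma> \<sigma> z k"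
    "decomposition \<gamma> \<sigma> \<mu> (useq z) (vseq z)" using level_measure[OF True] by blast
  have "rate_function \<gamma> \<sigma> \<mu> \<le> ereal \<alpha>" by (rule rate_function_level[OF \<mu>(1) True \<mu>(3)])
  then have nF: "\<mu> \<notin> F" using \<alpha>[of \<mu>] by auto
  have "openin (moment_topology UNIV) (moment_space UNIV - F)" using F by (simp add: closedin_def)
  then obtain W :: "(nat \<Rightarrow> real) set" where W: "open W" "moment_space UNIV - F = {\<nu> \<in> moment_space UNIV. moment \<nu> \<in> W}"
    by (rule openin_moment_vimage)
  have "moment \<mu> \<in> W" using nF moment_space_UNIV[OF \<mu>(1)] W(2) by blast
  moreover have "coef_moment \<gamma> \<sigma> z = moment \<mu>" using \<mu>(2) by auto
  ultimately have zW: "coef_moment \<gamma> \<sigma> z \<in> W" by simp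
  obtain J \<delta> where J: "finite J" "J \<subseteq> coef_index" "0 < \<delta>"
    "\<forall>\<^sub>F n in sequentially. \<forall>\<omega>. good n \<omega> \<and> (\<forall>i\<in>J. \<bar>coef n i \<omega> - z i\<bar> < \<delta>) \<longrightarrow> moment (spec n \<omega>) \<in> W"
    by (rule spec_near[OF W(1) zW])
  have "\<forall>\<^sub>F n in sequentially. measure (M n) {\<omega> \<in> space (M n). spec n \<omega> \<in> F \<and> (\<forall>i\<in>J. \<bar>coef n i \<omega> - z i\<bar> < \<delta>)} \<le> exp (- speed n * \<alpha>)"
    using J(4) eventually_ge_at_top[of 1]
  proof eventually_elim
    case (elim n)
    interpret prob_space "M n" by (rule prob_space_M[OF elim(2)])
    let ?E = "{\<omega> \<in> space (M n). spec n \<omega> \<in> F \<and> (\<forall>i\<in>J. \<bar>coef n i \<omega> - z i\<bar> < \<delta>)}"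
    have "AE \<omega> in M n. \<omega> \<in> ?E \<longrightarrow> \<omega> \<in> {}"
      using AE_good[OF elim(2)]
    proof eventually_elim
      case g: (elim \<omega>)
      show ?case
      proof
        assume \<omega>: "\<omega> \<in> ?E"
        then have "moment (spec n \<omega>) \<in> W" using elim(1) g by blast
        then have "spec n \<omega> \<in> moment_space UNIV - F" using W(2) spec_in_space[OF elim(2)] by blast
        then show "\<omega> \<in> {}" using \<omega> by blast
      qed
    qed
    from finite_measure_mono_AE[OF this] have "prob ?E \<le> 0" by simp
    also have "0 \<le> exp (- speed n * \<alpha>)" by simp
    finally show ?case .
  qed
  then show ?thesis using J by (intro exI[of _ J] exI[of _ "\<lambda>_. \<delta>"]) auto
next
  case False
  then obtain N where N: "\<alpha> < partial_rate N z" using z by (auto simp: level_def not_le)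
  define J where "J = (Inl ` {1..N} \<union> Inr ` {1..N} :: (nat + nat) set)"
  have J: "finite J" "J \<subseteq> coef_index" by (auto simp: J_def coef_index_def)
  \<comment> \<open>The excess over \<alpha> is distributed over the coordinates in
    \<open>J\<close>: each local bound may lose \<open>g\<close>.\<close>
  define g where "g = (partial_rate N z - \<alpha>) / (real (card J) + 1)"
  have g: "g > 0" using N by (simp add: g_def)
  have "\<exists>\<delta>>0. \<forall>\<^sub>F n in sequentially. measure (distr (M n) borel (coef n i)) {z i - \<delta><..<z i + \<delta>} \<le> exp (- speed n * (coef_rate i (z i) - g))"
    if i: "i \<in> J" for i
  proof -
    have iI: "i \<in> coef_index" using i J by auto
    obtain S h N where lf: "laplace_family speed S h N (\<lambda>n. distr (M n) borel (coef n i)) (coef_dom i) (coef_rate i) (coef_lim i)"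
      using laplace_coef[OF iI] .
    show ?thesis
      by (rule laplace_family.local_upper[OF lf, of "z i" "coef_rate i (z i) - g"]) (use z iI g in \<open>auto simp: admissible_def\<close>)
  qed
  then have "\<forall>i\<in>J. \<exists>\<delta>. 0 < \<delta> \<and> (\<forall>\<^sub>F n in sequentially. measure (distr (M n) borel (coef n i)) {z i - \<delta><..<z i + \<delta>} \<le> exp (- speed n * (coef_rate i (z i) - g)))"
    by blast
  from bchoice[OF this] obtain \<delta>' where
    "\<forall>i\<in>J. 0 < \<delta>' i \<and> (\<forall>\<^sub>F n in sequentially. measure (distr (M n) borel (coef n i)) {z i - \<delta>' i<..<z i + \<delta>' i} \<le> exp (- speed n * (coef_rate i (z i) - g)))" ..
  then have \<delta>': "\<And>i. i \<in> J \<Longrightarrow> 0 < \<delta>' i"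
    "\<And>i. i \<in> J \<Longrightarrow> \<forall>\<^sub>F n in sequentially. measure (distr (M n) borel (coef n i)) {z i - \<delta>' i<..<z i + \<delta>' i} \<le> exp (- speed n * (coef_rate i (z i) - g))"
    by blast+
  define \<delta> where "\<delta> i = (if i \<in> J then \<delta>' i else 1)" for i
  have \<delta>: "0 < \<delta> i" for i using \<delta>'(1) by (simp add: \<delta>_def)
  have "\<forall>\<^sub>F n in sequentially. \<forall>i\<in>J. measure (distr (M n) borel (coef n i)) {z i - \<delta> i<..<z i + \<delta> i} \<le> exp (- speed n * (coef_rate i (z i) - g))"
    using J(1) \<delta>'(2) by (intro eventually_ball_finite) (auto simp: \<delta>_def)
  then have "\<forall>\<^sub>F n in sequentially. measure (M n) {\<omega> \<in> space (M n). spec n \<omega> \<in> F \<and> (\<forall>i\<in>J. \<bar>coef n i \<omega> - z i\<bar> < \<delta> i)} \<le> exp (- speed n * \<alpha>)"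
    using finite_coef_index_in_model_index[OF J] speed_ge[of 0]
  proof eventually_elim
    case (elim n)
    then have n: "n \<ge> 1" and JI: "J \<subseteq> model_index n" by auto
    interpret prob_space "M n" by (rule prob_space_M[OF n])
    note B = prob_box[OF n J(1) JI, of "\<lambda>i. {z i - \<delta> i<..<z i + \<delta> i}"]
    have "prob {\<omega> \<in> space (M n). spec n \<omega> \<in> F \<and> (\<forall>i\<in>J. \<bar>coef n i \<omega> - z i\<bar> < \<delta> i)}
      \<le> prob {\<omega> \<in> space (M n). \<forall>i\<in>J. coef n i \<omega> \<in> {z i - \<delta> i<..<z i + \<delta> i}}"
      using B(1) by (intro finite_measure_mono) (auto simp: abs_less_iff algebra_simps)
    also have "\<dots> = (\<Prod>i\<in>J. measure (distr (M n) borel (coef n i)) {z i - \<delta> i<..<z i + \<delta> i})" using B(2) by simp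
    also have "\<dots> \<le> (\<Prod>i\<in>J. exp (- speed n * (coef_rate i (z i) - g)))" using elim by (intro prod_mono) auto
    also have "\<dots> = exp (- speed n * (\<Sum>i\<in>J. coef_rate i (z i) - g))"
      by (simp add: exp_sum[OF J(1), symmetric] sum_distrib_left)
    also have "\<dots> \<le> exp (- speed n * \<alpha>)"
    proof -
      have "(\<Sum>i\<in>J. coef_rate i (z i) - g) = partial_rate N z - real (card J) * g"
        by (simp add: sum_subtractf partial_rate_eq J_def)
      moreover have "real (card J) * g \<le> (real (card J) + 1) * g" using g by simp
      moreover have "(real (card J) + 1) * g = partial_rate N z - \<alpha>" by (simp add: g_def)
      ultimately have "\<alpha> \<le> (\<Sum>i\<in>J. coef_rate i (z i) - g)" by linarith
      then show ?thesis using elim by (simp add: mult_left_mono)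
    qed
    finally show ?case .
  qed
  then show ?thesis using J \<delta> by blast
qed

text \<open>A box with intervals in all coordinates is compact in the product, so finitely many of
  the local windows cover it. They inspect only a finite set \<open>T\<close> of coordinates; hence
  leaving the box must be excluded only on \<open>T\<close>, where the union bound over single
  coordinates applies.\<close>

lemma ldp_upper:
  assumes F: "closedin (moment_topology UNIV) F" and \<alpha>: "\<And>\<nu>. \<nu> \<in> F \<Longrightarrow> ereal \<alpha> < rate_function \<gamma> \<sigma> \<nu>"
  shows "\<exists>C. \<forall>\<^sub>F n in sequentially. law n F \<le> C * exp (- speed n * \<alpha>)"
proof -
  have "\<forall>i\<in>coef_index. \<exists>p. fst p \<in> coef_dom i \<and> snd p \<in> coef_dom i \<and> fst p < coef_lim i \<and> coef_lim i < snd p \<and>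
      (\<forall>\<^sub>F n in sequentially. measure (distr (M n) borel (coef n i)) (- {fst p..snd p}) \<le> 2 * exp (- speed n * \<alpha>))"
  proof
    fix i assume i: "i \<in> coef_index"
    obtain S h N where lf: "laplace_family speed S h N (\<lambda>n. distr (M n) borel (coef n i)) (coef_dom i) (coef_rate i) (coef_lim i)"
      using laplace_coef[OF i] .
    show "\<exists>p. fst p \<in> coef_dom i \<and> snd p \<in> coef_dom i \<and> fst p < coef_lim i \<and> coef_lim i < snd p \<and>
      (\<forall>\<^sub>F n in sequentially. measure (distr (M n) borel (coef n i)) (- {fst p..snd p}) \<le> 2 * exp (- speed n * \<alpha>))"
    proof (rule laplace_family.exponential_tightness[OF lf, of \<alpha>], goal_cases)
      case (1 l u)
      then show ?case by (intro exI[of _ "(l, u)"]) simp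
    qed
  qed
  from bchoice[OF this] obtain P where P: "\<forall>i\<in>coef_index. fst (P i) \<in> coef_dom i \<and> snd (P i) \<in> coef_dom i \<and> fst (P i) < coef_lim i \<and> coef_lim i < snd (P i) \<and>
      (\<forall>\<^sub>F n in sequentially. measure (distr (M n) borel (coef n i)) (- {fst (P i)..snd (P i)}) \<le> 2 * exp (- speed n * \<alpha>))" ..
  define l u where "l i = fst (P i)" and "u i = snd (P i)" for i
  have lu: "\<And>i. i \<in> coef_index \<Longrightarrow> l i \<in> coef_dom i" "\<And>i. i \<in> coef_index \<Longrightarrow> u i \<in> coef_dom i"
    "\<And>i. i \<in> coef_index \<Longrightarrow> l i < coef_lim i" "\<And>i. i \<in> coef_index \<Longrightarrow> coef_lim i < u i"
    "\<And>i. i \<in> coef_index \<Longrightarrow> \<forall>\<^sub>F n in sequentially. measure (distr (M n) borel (coef n i)) (- {l i..u i}) \<le> 2 * exp (- speed n * \<alpha>)"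
    unfolding l_def u_def using P by blast+
  define K where "K i = (if i \<in> coef_index then {l i..u i} else {0})" for i
  have comp: "compact (Pi\<^sub>E UNIV K)" by (rule compact_PiE_UNIV) (simp add: K_def)
  have K_dom: "K i \<subseteq> coef_dom i" if "i \<in> coef_index" for i
    using mem_is_interval_1_I[OF coef_rate_basic(2)[of i] lu(1)[OF that] lu(2)[OF that]] that by (auto simp: K_def)
  have adm: "admissible z" if z: "z \<in> Pi\<^sub>E UNIV K" for z
    unfolding admissible_def
  proof (intro conjI ballI)
    have zK: "z i \<in> K i" for i using z by auto
    have "(Inl 0 :: nat + nat) \<notin> coef_index" "(Inr 0 :: nat + nat) \<notin> coef_index" by (auto simp: coef_index_def)
    then show "z (Inl 0) = 0" "z (Inr 0) = 0" using zK[of "Inl 0"] zK[of "Inr 0"] by (auto simp: K_def)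
    show "z i \<in> coef_dom i" if "i \<in> coef_index" for i using zK[of i] K_dom[OF that] by auto
  qed
  define Q where "Q z p \<longleftrightarrow> finite (fst p) \<and> fst p \<subseteq> coef_index \<and> (\<forall>i. 0 < snd p i) \<and>
    (\<forall>\<^sub>F n in sequentially. measure (M n) {\<omega> \<in> space (M n). spec n \<omega> \<in> F \<and> (\<forall>i\<in>fst p. \<bar>coef n i \<omega> - z i\<bar> < snd p i)} \<le> exp (- speed n * \<alpha>))"
    for z and p :: "(nat + nat) set \<times> (nat + nat \<Rightarrow> real)"
  have "\<forall>z\<in>Pi\<^sub>E UNIV K. \<exists>p. Q z p"
  proof
    fix z assume "z \<in> Pi\<^sub>E UNIV K"
    from local_event_bound[OF F \<alpha> adm[OF this]] obtain J \<delta> where "finite J \<and> J \<subseteq> coef_index \<and> (\<forall>i. 0 < \<delta> i) \<and>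
    (\<forall>\<^sub>F n in sequentially. measure (M n) {\<omega> \<in> space (M n). spec n \<omega> \<in> F \<and> (\<forall>i\<in>J. \<bar>coef n i \<omega> - z i\<bar> < \<delta> i)} \<le> exp (- speed n * \<alpha>))" by blast
    then have "Q z (J, \<delta>)" by (simp add: Q_def)
    then show "\<exists>p. Q z p" ..
  qed
  from bchoice[OF this] obtain R where R: "\<forall>z\<in>Pi\<^sub>E UNIV K. Q z (R z)" ..
  define J \<delta> where "J z = fst (R z)" and "\<delta> z = snd (R z)" for z
  have J: "\<And>z. z \<in> Pi\<^sub>E UNIV K \<Longrightarrow> finite (J z)" "\<And>z. z \<in> Pi\<^sub>E UNIV K \<Longrightarrow> J z \<subseteq> coef_index"
    "\<And>z i. z \<in> Pi\<^sub>E UNIV K \<Longrightarrow> 0 < \<delta> z i"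
    "\<And>z. z \<in> Pi\<^sub>E UNIV K \<Longrightarrow> \<forall>\<^sub>F n in sequentially. measure (M n) {\<omega> \<in> space (M n). spec n \<omega> \<in> F \<and> (\<forall>i\<in>J z. \<bar>coef n i \<omega> - z i\<bar> < \<delta> z i)} \<le> exp (- speed n * \<alpha>)"
    using R unfolding Q_def J_def \<delta>_def by blast+
  have cover: "Pi\<^sub>E UNIV K \<subseteq> (\<Union>z\<in>Pi\<^sub>E UNIV K. box (J z) z (\<delta> z))"
  proof
    fix z assume z: "z \<in> Pi\<^sub>E UNIV K"
    then have "z \<in> box (J z) z (\<delta> z)" using J(3)[OF z] by (simp add: box_def)
    with z show "z \<in> (\<Union>z\<in>Pi\<^sub>E UNIV K. box (J z) z (\<delta> z))" by blast
  qed
  obtain Z where Z: "Z \<subseteq> Pi\<^sub>E UNIV K" "finite Z" "Pi\<^sub>E UNIV K \<subseteq> (\<Union>z\<in>Z. box (J z) z (\<delta> z))"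
  proof (rule compactE_image[OF comp _ cover])
    show "open (box (J z) z (\<delta> z))" if "z \<in> Pi\<^sub>E UNIV K" for z by (rule open_box[OF J(1)[OF that]])
  qed (rule that)
  define T where "T = (\<Union>z\<in>Z. J z)"
  have T1: "finite (J z)" "J z \<subseteq> coef_index" if "z \<in> Z" for z using J(1,2)[of z] Z(1) that by blast+
  have T: "finite T" "T \<subseteq> coef_index" unfolding T_def using Z(2) T1(1) UN_least[of Z J coef_index, OF T1(2)] by (simp_all add: finite_UN_I)
  have E1: "\<forall>\<^sub>F n in sequentially. \<forall>z\<in>Z. measure (M n) {\<omega> \<in> space (M n). spec n \<omega> \<in> F \<and> (\<forall>i\<in>J z. \<bar>coef n i \<omega> - z i\<bar> < \<delta> z i)} \<le> exp (- speed n * \<alpha>)"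
    using Z J(4) by (intro eventually_ball_finite) auto
  have E2: "\<forall>\<^sub>F n in sequentially. \<forall>i\<in>T. measure (distr (M n) borel (coef n i)) (- {l i..u i}) \<le> 2 * exp (- speed n * \<alpha>)"
    using T lu(5) by (intro eventually_ball_finite) auto
  have "\<forall>\<^sub>F n in sequentially. law n F \<le> (real (card Z) + 2 * real (card T)) * exp (- speed n * \<alpha>)"
    using E1 E2 finite_coef_index_in_model_index[OF T]
  proof eventually_elim
    case (elim n)
    then have n: "n \<ge> 1" and TI: "T \<subseteq> model_index n" by auto
    interpret prob_space "M n" by (rule prob_space_M[OF n])
    let ?X = "\<lambda>z. {\<omega> \<in> space (M n). spec n \<omega> \<in> F \<and> (\<forall>i\<in>J z. \<bar>coef n i \<omega> - z i\<bar> < \<delta> z i)}"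
    let ?Y = "\<lambda>i. {\<omega> \<in> space (M n). coef n i \<omega> \<in> - {l i..u i}}"
    have X: "?X z \<in> sets (M n)" if z: "z \<in> Z" for z
    proof -
      have "J z \<subseteq> model_index n" using TI z by (auto simp: T_def)
      then have "{\<omega> \<in> space (M n). \<forall>i\<in>J z. coef n i \<omega> \<in> {z i - \<delta> z i<..<z i + \<delta> z i}} \<in> sets (M n)"
        by (intro prob_box(1)[OF n]) (use J(1) Z z in auto)
      moreover have "{\<omega> \<in> space (M n). \<forall>i\<in>J z. coef n i \<omega> \<in> {z i - \<delta> z i<..<z i + \<delta> z i}} = {\<omega> \<in> space (M n). \<forall>i\<in>J z. \<bar>coef n i \<omega> - z i\<bar> < \<delta> z i}"
        by (auto simp: abs_less_iff algebra_simps)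
      ultimately have "{\<omega> \<in> space (M n). spec n \<omega> \<in> F} \<inter> {\<omega> \<in> space (M n). \<forall>i\<in>J z. \<bar>coef n i \<omega> - z i\<bar> < \<delta> z i} \<in> sets (M n)"
        using closed_event[OF n F] by auto
      moreover have "{\<omega> \<in> space (M n). spec n \<omega> \<in> F} \<inter> {\<omega> \<in> space (M n). \<forall>i\<in>J z. \<bar>coef n i \<omega> - z i\<bar> < \<delta> z i} = ?X z" by auto
      ultimately show ?thesis by simp
    qed
    have m: "coef n i \<in> borel_measurable (M n)" if "i \<in> T" for i using coef_measurable[OF n] TI that by auto
    have Y: "?Y i \<in> sets (M n)" "prob (?Y i) = measure (distr (M n) borel (coef n i)) (- {l i..u i})" if "i \<in> T" for i
    proof -
      have e: "?Y i = coef n i -` (- {l i..u i}) \<inter> space (M n)" by auto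
      show "?Y i \<in> sets (M n)" unfolding e using m[OF that] by (intro measurable_sets) auto
      show "prob (?Y i) = measure (distr (M n) borel (coef n i)) (- {l i..u i})" unfolding e using m[OF that] by (subst measure_distr) auto
    qed
    have sub: "{\<omega> \<in> space (M n). spec n \<omega> \<in> F} \<subseteq> (\<Union>z\<in>Z. ?X z) \<union> (\<Union>i\<in>T. ?Y i)"
    proof
      fix \<omega> assume \<omega>: "\<omega> \<in> {\<omega> \<in> space (M n). spec n \<omega> \<in> F}"
      show "\<omega> \<in> (\<Union>z\<in>Z. ?X z) \<union> (\<Union>i\<in>T. ?Y i)"
      proof (cases "\<exists>i\<in>T. coef n i \<omega> \<in> - {l i..u i}")
        case True
        then show ?thesis using \<omega> by blast
      next
        case False
        \<comment> \<open>Coordinates that the cover does not inspect are set to their limit values,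
          which lie in \<open>K\<close>; the modified point is then in the box and hence in a
          window.\<close>
        define z' where "z' i = (if i \<in> T then coef n i \<omega> else if i \<in> coef_index then coef_lim i else 0)" for i
        have "z' i \<in> K i" for i
          using False T(2) lu(3)[of i] lu(4)[of i] by (auto simp: z'_def K_def)
        then have "z' \<in> Pi\<^sub>E UNIV K" by auto
        then obtain z where z: "z \<in> Z" "z' \<in> box (J z) z (\<delta> z)" using Z(3) by blast
        have "\<bar>coef n i \<omega> - z i\<bar> < \<delta> z i" if "i \<in> J z" for i
        proof -
          have "i \<in> T" using that z(1) by (auto simp: T_def)
          then show ?thesis using z(2) that by (auto simp: box_def z'_def)
        qed
        then show ?thesis using \<omega> z(1) by blast
      qed
    qed
    have "law n F \<le> prob ((\<Union>z\<in>Z. ?X z) \<union> (\<Union>i\<in>T. ?Y i))"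
      unfolding law_def using sub X Y(1) Z(2) T(1) by (intro finite_measure_mono sets.Un sets.finite_UN) auto
    also have "\<dots> \<le> prob (\<Union>z\<in>Z. ?X z) + prob (\<Union>i\<in>T. ?Y i)"
      using X Y(1) Z(2) T(1) by (intro measure_Un_le sets.finite_UN) auto
    also have "\<dots> \<le> (\<Sum>z\<in>Z. prob (?X z)) + (\<Sum>i\<in>T. prob (?Y i))"
      using X Y(1) Z(2) T(1) by (intro add_mono measure_UNION_le) auto
    also have "\<dots> \<le> (\<Sum>z\<in>Z. exp (- speed n * \<alpha>)) + (\<Sum>i\<in>T. 2 * exp (- speed n * \<alpha>))"
      using elim Y(2) by (intro add_mono sum_mono) auto
    also have "\<dots> = (real (card Z) + 2 * real (card T)) * exp (- speed n * \<alpha>)" by (simp add: algebra_simps)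
    finally show ?case .
  qed
  then show ?thesis by blast
qed

theorem ldp_UNIV: "ldp_bounds (moment_topology UNIV) law speed (rate_function \<gamma> \<sigma>)"
  by (rule ldp_boundsI[OF speed_lim ldp_upper ldp_lower])

end

section \<open>The principle on the limit interval\<close>

text \<open>Expanded by the binomial theorem, so that for a random measure it is measurable as soon
  as the moments are.\<close>

definition shifted_moment :: "real measure \<Rightarrow> real \<Rightarrow> nat \<Rightarrow> real" where
  "shifted_moment \<mu> a m = (\<Sum>i\<le>m. real (m choose i) * (- a) ^ (m - i) * moment \<mu> i)"

lemma shifted_moment_eq:
  assumes "borel_prob_finite_moments \<mu>"
  shows "integrable \<mu> (\<lambda>x. (x - a) ^ m)" "(\<integral>x. (x - a) ^ m \<partial>\<mu>) = shifted_moment \<mu> a m"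
proof -
  have int: "integrable \<mu> (\<lambda>x. x ^ k)" for k using assms by (simp add: borel_prob_finite_moments_def)
  have e: "(x - a) ^ m = (\<Sum>i\<le>m. real (m choose i) * (- a) ^ (m - i) * x ^ i)" for x
    using binomial_ring[of x "- a" m] by (simp add: mult_ac)
  show "integrable \<mu> (\<lambda>x. (x - a) ^ m)" unfolding e using int by (intro Bochner_Integration.integrable_sum) auto
  show "(\<integral>x. (x - a) ^ m \<partial>\<mu>) = shifted_moment \<mu> a m"
    unfolding e shifted_moment_def moment_def using int by (subst Bochner_Integration.integral_sum) auto
qed

context limit_params
begin

definition lower_end :: "nat \<Rightarrow> real" where
  "lower_end N = (if \<gamma> = 0 then - real N else max (- real N) (- 1 / sqrt \<gamma>))"

definition upper_end :: "nat \<Rightarrow> real" where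
  "upper_end N = (if \<gamma> * \<sigma> = 0 then real N else min (real N) (1 / (sqrt \<gamma> * \<sigma>)))"

lemma ends_order: "lower_end N \<le> 0" "0 \<le> upper_end N"
  using gamma sigma by (auto simp: lower_end_def upper_end_def)

lemma in_ends_iff: "lower_end N \<le> x \<and> x \<le> upper_end N \<longleftrightarrow> \<bar>x\<bar> \<le> real N \<and> x \<in> limit_interval \<gamma> \<sigma>"
  by (auto simp: lower_end_def upper_end_def limit_interval_def)

text \<open>Even moments about the midpoint of the interval cut off at \<open>-N\<close> and \<open>N\<close> detect the support, hence
  the event of living on the limit interval is measurable.\<close>

lemma moment_space_iff_moments:
  assumes rd: "real_distribution \<mu>" and R: "AE x in \<mu>. \<bar>x\<bar> \<le> R"
  shows "\<mu> \<in> moment_space (limit_interval \<gamma> \<sigma>) \<longleftrightarrow>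
    (\<exists>N. \<forall>k. shifted_moment \<mu> ((lower_end N + upper_end N) / 2) (2 * k) \<le> ((upper_end N - lower_end N) / 2) ^ (2 * k))"
    (is "_ \<longleftrightarrow> (\<exists>N. ?C N)")
proof -
  note m = borel_prob_finite_moments_bounded[OF rd R]
  have iff: "\<bar>x - (lower_end N + upper_end N) / 2\<bar> \<le> (upper_end N - lower_end N) / 2
     \<longleftrightarrow> \<bar>x\<bar> \<le> real N \<and> x \<in> limit_interval \<gamma> \<sigma>" for x N
    unfolding in_ends_iff[symmetric] by (auto simp: abs_le_iff field_simps)
  show ?thesis
  proof
    assume "\<mu> \<in> moment_space (limit_interval \<gamma> \<sigma>)"
    then have I: "AE x in \<mu>. x \<in> limit_interval \<gamma> \<sigma>" by (simp add: moment_space_def)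
    obtain N :: nat where N: "R \<le> real N" using real_arch_simple by blast
    have "AE x in \<mu>. \<bar>x - (lower_end N + upper_end N) / 2\<bar> \<le> (upper_end N - lower_end N) / 2"
      using I R by eventually_elim (use N iff in auto)
    from even_moment_le[OF rd this] have "?C N" using shifted_moment_eq(2)[OF m] by simp
    then show "\<exists>N. ?C N" ..
  next
    assume "\<exists>N. ?C N"
    then obtain N where N: "?C N" ..
    have "AE x in \<mu>. \<bar>x - (lower_end N + upper_end N) / 2\<bar> \<le> (upper_end N - lower_end N) / 2"
      by (rule AE_bounded_of_even_moments[OF rd]) (use N shifted_moment_eq[OF m] ends_order[of N] in auto)
    then have "AE x in \<mu>. x \<in> limit_interval \<gamma> \<sigma>" by eventually_elim (use iff in blast)
    then show "\<mu> \<in> moment_space (limit_interval \<gamma> \<sigma>)" by (rule moment_space_bounded[OF rd R])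
  qed
qed

end

context jacobi_asymptotics
begin

lemma interval_event:
  assumes n: "n \<ge> 1"
  shows "{\<omega> \<in> space (M n). spec n \<omega> \<in> moment_space (limit_interval \<gamma> \<sigma>)} \<in> sets (M n)"
proof -
  have [measurable]: "(\<lambda>\<omega>. shifted_moment (spec n \<omega>) a m) \<in> borel_measurable (M n)" for a m
    unfolding shifted_moment_def by (intro borel_measurable_sum borel_measurable_times spec_moment_measurable[OF n]) auto
  have "{\<omega> \<in> space (M n). spec n \<omega> \<in> moment_space (limit_interval \<gamma> \<sigma>)}
     = {\<omega> \<in> space (M n). \<exists>N. \<forall>k. shifted_moment (spec n \<omega>) ((lower_end N + upper_end N) / 2) (2 * k) \<le> ((upper_end N - lower_end N) / 2) ^ (2 * k)}"
  proof (intro Collect_cong conj_cong refl)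
    fix \<omega>
    obtain R where R: "real_distribution (spec n \<omega>)" "AE x in spec n \<omega>. \<bar>x\<bar> \<le> R" using spec_props[OF n, of \<omega>] by blast
    show "spec n \<omega> \<in> moment_space (limit_interval \<gamma> \<sigma>) \<longleftrightarrow>
      (\<exists>N. \<forall>k. shifted_moment (spec n \<omega>) ((lower_end N + upper_end N) / 2) (2 * k) \<le> ((upper_end N - lower_end N) / 2) ^ (2 * k))"
      by (rule moment_space_iff_moments[OF R])
  qed
  also have "\<dots> \<in> sets (M n)" by measurable
  finally show ?thesis .
qed

lemma law_interval_eq:
  assumes n: "n \<ge> 1" and AE: "AE \<omega> in M n. spec n \<omega> \<in> moment_space (limit_interval \<gamma> \<sigma>)"
    and A: "{\<omega> \<in> space (M n). spec n \<omega> \<in> A} \<in> sets (M n)"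
  shows "law n (A \<inter> moment_space (limit_interval \<gamma> \<sigma>)) = law n A"
proof -
  interpret prob_space "M n" by (rule prob_space_M[OF n])
  have "{\<omega> \<in> space (M n). spec n \<omega> \<in> A \<inter> moment_space (limit_interval \<gamma> \<sigma>)}
     = {\<omega> \<in> space (M n). spec n \<omega> \<in> A} \<inter> {\<omega> \<in> space (M n). spec n \<omega> \<in> moment_space (limit_interval \<gamma> \<sigma>)}" by auto
  then have "{\<omega> \<in> space (M n). spec n \<omega> \<in> A \<inter> moment_space (limit_interval \<gamma> \<sigma>)} \<in> sets (M n)"
    using sets.Int[OF A interval_event[OF n]] by simp
  then show ?thesis unfolding law_def
    by (intro finite_measure_eq_AE) (use AE A in auto)
qed

text \<open>Open and closed sets of the interval space are traces of such sets of the large space.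
  Almost surely the trace has the same probability, and the points cut off have infinite rate, so
  both bounds descend.\<close>

theorem ldp_interval:
  assumes "\<forall>\<^sub>F n in sequentially. AE \<omega> in M n. spec n \<omega> \<in> moment_space (limit_interval \<gamma> \<sigma>)"
  shows "ldp_bounds (moment_topology (limit_interval \<gamma> \<sigma>)) law speed (rate_function \<gamma> \<sigma>)"
proof (rule ldp_boundsI[OF speed_lim])
  let ?I = "moment_space (limit_interval \<gamma> \<sigma>)"
  fix F \<alpha> assume F: "closedin (moment_topology (limit_interval \<gamma> \<sigma>)) F" and \<alpha>: "\<And>\<nu>. \<nu> \<in> F \<Longrightarrow> ereal \<alpha> < rate_function \<gamma> \<sigma> \<nu>"
  obtain F' where F': "closedin (moment_topology UNIV) F'" "F = F' \<inter> ?I"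
    using F unfolding moment_topology_subtopology[of "limit_interval \<gamma> \<sigma>"] closedin_subtopology by auto
  have "ereal \<alpha> < rate_function \<gamma> \<sigma> \<nu>" if "\<nu> \<in> F'" for \<nu>
    using \<alpha>[of \<nu>] that F'(2) by (cases "\<nu> \<in> ?I") (auto simp: rate_function_def)
  then obtain C where C: "\<forall>\<^sub>F n in sequentially. law n F' \<le> C * exp (- speed n * \<alpha>)" using ldp_upper[OF F'(1)] by blast
  have "\<forall>\<^sub>F n in sequentially. law n F \<le> C * exp (- speed n * \<alpha>)"
    using C assms eventually_ge_at_top[of 1]
  proof eventually_elim
    case (elim n)
    then show ?case unfolding F'(2) using law_interval_eq[OF _ _ closed_event[OF _ F'(1)]] by simp
  qed
  then show "\<exists>C. \<forall>\<^sub>F n in sequentially. law n F \<le> C * exp (- speed n * \<alpha>)" ..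
next
  let ?I = "moment_space (limit_interval \<gamma> \<sigma>)"
  fix U \<nu> r \<epsilon> assume U: "openin (moment_topology (limit_interval \<gamma> \<sigma>)) U" and \<nu>: "\<nu> \<in> U" "rate_function \<gamma> \<sigma> \<nu> \<le> ereal r" and e: "0 < (\<epsilon>::real)"
  obtain U' where U': "openin (moment_topology UNIV) U'" "U = U' \<inter> ?I"
    using U unfolding moment_topology_subtopology[of "limit_interval \<gamma> \<sigma>"] openin_subtopology by auto
  have "\<nu> \<in> U'" using \<nu> U' by auto
  from ldp_lower[OF U'(1) this \<nu>(2) e] assms eventually_ge_at_top[of 1]
  show "\<forall>\<^sub>F n in sequentially. exp (- speed n * (r + \<epsilon>)) \<le> law n U"
  proof eventually_elim
    case (elim n)
    then show ?case unfolding U'(2) using law_interval_eq[OF _ _ open_event[OF _ U'(1)]] by simp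
  qed
qed

end

section \<open>The limit law\<close>

text \<open>These are U_n((x - a) / (2 b)) for the Chebyshev polynomials U_n of the second kind, the
  orthonormal polynomials of the semicircle with centre \<open>a\<close> and radius
  \<open>2 * b\<close>.\<close>

fun cheb :: "real \<Rightarrow> real \<Rightarrow> nat \<Rightarrow> real \<Rightarrow> real" where
  "cheb a b 0 x = 1"
| "cheb a b (Suc 0) x = (x - a) / b"
| "cheb a b (Suc (Suc n)) x = ((x - a) * cheb a b (Suc n) x - b * cheb a b n x) / b"

definition semicircle :: "real \<Rightarrow> real \<Rightarrow> real \<Rightarrow> real" where
  "semicircle a b x = (if \<bar>x - a\<bar> \<le> 2 * b then sqrt (4 * b\<^sup>2 - (x - a)\<^sup>2) / (2 * pi * b\<^sup>2) else 0)"

lemma continuous_cheb: "b \<noteq> 0 \<Longrightarrow> continuous_on S (cheb a b n)"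
  by (induction n rule: induct_nat_012) (auto intro!: continuous_intros)

text \<open>The substitution a - 2 b cos \<theta> increases on [0, \<pi>] for b > 0, which keeps the
  orientation of the integral. It is the usual one reflected, hence the sign (-1)^n.\<close>

lemma cheb_sin:
  assumes "b \<noteq> 0"
  shows "cheb a b n (a - 2 * b * cos \<theta>) * sin \<theta> = (-1) ^ n * sin (real (Suc n) * \<theta>)"
proof (induction n rule: induct_nat_012)
  case 0 show ?case by simp
next
  case 1
  then show ?case using assms sin_double[of \<theta>] by simp
next
  case (ge2 n)
  have "cheb a b (Suc (Suc n)) (a - 2 * b * cos \<theta>) * sin \<theta>
     = - 2 * cos \<theta> * (cheb a b (Suc n) (a - 2 * b * cos \<theta>) * sin \<theta>) - cheb a b n (a - 2 * b * cos \<theta>) * sin \<theta>"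
    using assms by (simp add: field_simps)
  also have "\<dots> = (-1) ^ Suc (Suc n) * (2 * cos \<theta> * sin (real (Suc (Suc n)) * \<theta>) - sin (real (Suc n) * \<theta>))"
    unfolding ge2 by (simp add: algebra_simps)
  also have "2 * cos \<theta> * sin (real (Suc (Suc n)) * \<theta>) - sin (real (Suc n) * \<theta>) = sin (real (Suc (Suc (Suc n))) * \<theta>)"
  proof -
    define A where "A = real (Suc (Suc n)) * \<theta>"
    have "real (Suc n) * \<theta> = A - \<theta>" "real (Suc (Suc (Suc n))) * \<theta> = A + \<theta>" by (simp_all add: A_def algebra_simps)
    then show ?thesis unfolding A_def[symmetric] by (simp add: sin_add sin_diff)
  qed
  finally show ?case .
qed

lemma integral_sin_sin:
  "(LBINT \<theta>=0..pi. sin \<theta> * sin (real (Suc n) * \<theta>)) = (if n = 0 then pi / 2 else 0)"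
proof -
  define F where "F \<theta> = (if n = 0 then (\<theta> - sin \<theta> * cos \<theta>) / 2
     else (sin (real n * \<theta>) / real n - sin (real (Suc (Suc n)) * \<theta>) / real (Suc (Suc n))) / 2)" for \<theta>
  have D: "(F has_real_derivative sin \<theta> * sin (real (Suc n) * \<theta>)) (at \<theta>)" for \<theta>
  proof (cases "n = 0")
    case True
    have "((\<lambda>\<theta>. (\<theta> - sin \<theta> * cos \<theta>) / 2) has_real_derivative (1 - (cos \<theta> * cos \<theta> + sin \<theta> * (- sin \<theta>))) / 2) (at \<theta>)"
      by (auto intro!: derivative_eq_intros)
    moreover have "(1 - (cos \<theta> * cos \<theta> + sin \<theta> * (- sin \<theta>))) / 2 = sin \<theta> * sin \<theta>"
      using sin_cos_squared_add[of \<theta>] by (simp add: power2_eq_square)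
    ultimately have "((\<lambda>\<theta>. (\<theta> - sin \<theta> * cos \<theta>) / 2) has_real_derivative sin \<theta> * sin \<theta>) (at \<theta>)" by (simp only:)
    then show ?thesis using True by (simp add: F_def[abs_def])
  next
    case False
    have "((\<lambda>\<theta>. (sin (real n * \<theta>) / real n - sin (real (Suc (Suc n)) * \<theta>) / real (Suc (Suc n))) / 2) has_real_derivative
       (cos (real n * \<theta>) - cos (real (Suc (Suc n)) * \<theta>)) / 2) (at \<theta>)"
      using False by (auto intro!: derivative_eq_intros simp del: of_nat_Suc)
    moreover have "(cos (real n * \<theta>) - cos (real (Suc (Suc n)) * \<theta>)) / 2 = sin \<theta> * sin (real (Suc n) * \<theta>)"
    proof -
      define A where "A = real (Suc n) * \<theta>"
      have "real n * \<theta> = A - \<theta>" "real (Suc (Suc n)) * \<theta> = A + \<theta>" by (simp_all add: A_def algebra_simps)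
      then show ?thesis unfolding A_def[symmetric] by (simp add: cos_add cos_diff)
    qed
    ultimately show ?thesis using False by (simp add: F_def[abs_def])
  qed
  have D': "(F has_vector_derivative sin \<theta> * sin (real (Suc n) * \<theta>)) (at \<theta> within S)" for \<theta> S
    by (rule has_vector_derivative_at_within) (rule D[unfolded has_real_derivative_iff_has_vector_derivative])
  have c: "continuous_on S (\<lambda>\<theta>. sin \<theta> * sin (real (Suc n) * \<theta>))" for S
    by (intro continuous_intros)
  have "(LBINT \<theta>=0..pi. sin \<theta> * sin (real (Suc n) * \<theta>)) = F pi - F 0"
    using interval_integral_FTC_finite[of 0 pi, OF c D'] by (simp only: zero_ereal_def)
  also have "\<dots> = (if n = 0 then pi / 2 else 0)"
  proof (cases "n = 0")
    case False
    have "F pi = 0" "F 0 = 0"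
      using False unfolding F_def sin_npi by auto
    then show ?thesis using False by simp
  qed (simp add: F_def)
  finally show ?thesis .
qed

text \<open>Only integrals of single polynomials are computed, that is, orthogonality to the
  constants: with the recursion they determine all moments, see \<open>cheb_moment\<close>.\<close>

lemma semicircle_cheb:
  assumes b: "b > 0"
  shows "integrable lborel (\<lambda>x. semicircle a b x * cheb a b n x)"
    "(\<integral>x. semicircle a b x * cheb a b n x \<partial>lborel) = (if n = 0 then 1 else 0)"
proof -
  define f where "f x = cheb a b n x * (sqrt (4 * b\<^sup>2 - (x - a)\<^sup>2) / (2 * pi * b\<^sup>2))" for x
  have cf: "continuous_on S f" for S unfolding f_def using b by (intro continuous_intros continuous_cheb) auto
  have e: "semicircle a b x * cheb a b n x = indicator {a - 2 * b..a + 2 * b} x *\<^sub>R f x" for x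
    by (auto simp: semicircle_def f_def indicator_def)
  show "integrable lborel (\<lambda>x. semicircle a b x * cheb a b n x)"
    unfolding e by (intro borel_integrable_compact compact_Icc cf)
  have "(\<integral>x. semicircle a b x * cheb a b n x \<partial>lborel) = (LBINT x=a - 2 * b..a + 2 * b. f x)"
    unfolding e using b by (subst interval_integral_Icc) (auto simp: set_lebesgue_integral_def)
  also have "\<dots> = (LBINT y=(\<lambda>\<theta>. a - 2 * b * cos \<theta>) 0..(\<lambda>\<theta>. a - 2 * b * cos \<theta>) pi. f y)" by simp
  also have "\<dots> = (LBINT \<theta>=0..pi. (2 * b * sin \<theta>) *\<^sub>R f (a - 2 * b * cos \<theta>))"
    unfolding zero_ereal_def
    by (rule interval_integral_substitution_finite[symmetric])
      (auto intro!: derivative_eq_intros continuous_intros cf)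
  also have "\<dots> = (LBINT \<theta>=0..pi. (2 / pi * (-1) ^ n) * (sin \<theta> * sin (real (Suc n) * \<theta>)))"
  proof (rule interval_integral_cong)
    fix \<theta> assume "\<theta> \<in> einterval (min 0 (ereal pi)) (max 0 (ereal pi))"
    then have \<theta>: "0 < \<theta>" "\<theta> < pi" by (auto simp: einterval_def min_def max_def zero_ereal_def split: if_splits)
    have s: "sin \<theta> > 0" using \<theta> by (rule sin_gt_zero)
    have "4 * b\<^sup>2 - (a - 2 * b * cos \<theta> - a)\<^sup>2 = (2 * b * sin \<theta>)\<^sup>2"
      by (simp add: power_mult_distrib sin_squared_eq algebra_simps)
    then have "sqrt (4 * b\<^sup>2 - (a - 2 * b * cos \<theta> - a)\<^sup>2) = 2 * b * sin \<theta>"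
      using s b by (simp only: real_sqrt_abs) simp
    then have "(2 * b * sin \<theta>) *\<^sub>R f (a - 2 * b * cos \<theta>) = 2 / pi * sin \<theta> * (cheb a b n (a - 2 * b * cos \<theta>) * sin \<theta>)"
      using b by (simp add: f_def power2_eq_square)
    also have "\<dots> = (2 / pi * (-1) ^ n) * (sin \<theta> * sin (real (Suc n) * \<theta>))"
      using b by (subst cheb_sin) auto
    finally show "(2 * b * sin \<theta>) *\<^sub>R f (a - 2 * b * cos \<theta>) = (2 / pi * (-1) ^ n) * (sin \<theta> * sin (real (Suc n) * \<theta>))" .
  qed
  also have "\<dots> = (2 / pi * (-1) ^ n) * (if n = 0 then pi / 2 else 0)"
    unfolding interval_lebesgue_integral_mult_right by (simp only: integral_sin_sin)
  finally show "(\<integral>x. semicircle a b x * cheb a b n x \<partial>lborel) = (if n = 0 then 1 else 0)" by auto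
qed

text \<open>An atom has mass at most \<open>1 / (\<Sum>k\<le>N. Q\<^sub>k(x\<^sub>0)\<^sup>2)\<close> for orthonormal polynomials \<open>Q\<^sub>k\<close>. At the
  edge the recursion factorizes into \<open>b\<^sub>k Q\<^sub>k\<^sub>+\<^sub>1(x\<^sub>0) = \<plusminus> x\<^sub>k Q\<^sub>k(x\<^sub>0)\<close>, so that these values do not decay.\<close>

lemma no_edge_atom:
  assumes m: "borel_prob_finite_moments \<mu>" and b: "\<And>i. 1 \<le> i \<Longrightarrow> 0 < b i"
    and mom: "\<And>k. moment \<mu> k = jacobi_pow a b k 1 1" and e: "e * e = (1::real)" and y0: "y 0 = 0"
    and a: "\<And>k. 1 \<le> k \<Longrightarrow> a k - x0 = e * (y (k - 1) + x k)" and bxy: "\<And>k. 1 \<le> k \<Longrightarrow> (b k)\<^sup>2 = x k * y k"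
    and yx: "\<And>k. 1 \<le> k \<Longrightarrow> 0 < y k \<and> y k \<le> x k"
  shows "measure \<mu> {x0} = 0"
proof -
  interpret real_distribution \<mu> using m by (simp add: borel_prob_finite_moments_iff)
  define Q where "Q k = poly (jacobi_poly a b k)" for k
  have Q01: "Q 0 x = 0" "Q 1 x = 1" for x by (auto simp: Q_def)
  have rec: "x * Q k x = b k * Q (Suc k) x + a k * Q k x + b (k - 1) * Q (k - 1) x" if "1 \<le> k" for k x
    unfolding Q_def using poly_jacobi_poly_rec[of k b x a] b[OF that] that by simp
  have fact: "b (Suc k) * Q (Suc (Suc k)) x0 = - e * x (Suc k) * Q (Suc k) x0" for k
  proof (induction k)
    case 0
    have "x0 * Q 1 x0 = b 1 * Q 2 x0 + a 1 * Q 1 x0 + b 0 * Q 0 x0" using rec[of 1 x0] by (simp add: numeral_2_eq_2)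
    then have "b 1 * Q 2 x0 = (x0 - a 1) * Q 1 x0" using Q01 by (simp add: algebra_simps)
    also have "x0 - a 1 = - e * x 1" using a[of 1] y0 by simp
    finally show ?case by (simp add: numeral_2_eq_2)
  next
    case (Suc k)
    have p: "0 < b (Suc k)" "0 < y (Suc k)" using b yx[of "Suc k"] by auto
    have "e * (b (Suc k) * Q (Suc (Suc k)) x0) = - ((e * e) * x (Suc k) * Q (Suc k) x0)" unfolding Suc by (simp add: mult_ac)
    then have h: "x (Suc k) * Q (Suc k) x0 = - e * b (Suc k) * Q (Suc (Suc k)) x0" using e by simp
    have xn: "x (Suc k) \<noteq> 0" using yx[of "Suc k"] by auto
    have "x (Suc k) * (b (Suc k) * Q (Suc k) x0) = b (Suc k) * (x (Suc k) * Q (Suc k) x0)" by (simp add: mult_ac)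
    also have "\<dots> = - e * (b (Suc k))\<^sup>2 * Q (Suc (Suc k)) x0" unfolding h by (simp add: power2_eq_square)
    also have "\<dots> = x (Suc k) * (- e * y (Suc k) * Q (Suc (Suc k)) x0)" using bxy[of "Suc k"] by simp
    finally have h2: "b (Suc k) * Q (Suc k) x0 = - e * y (Suc k) * Q (Suc (Suc k)) x0" using mult_left_cancel[OF xn] by blast
    have "b (Suc (Suc k)) * Q (Suc (Suc (Suc k))) x0 = - (a (Suc (Suc k)) - x0) * Q (Suc (Suc k)) x0 - b (Suc k) * Q (Suc k) x0"
      using rec[of "Suc (Suc k)" x0] by (simp add: algebra_simps)
    also have "a (Suc (Suc k)) - x0 = e * (y (Suc k) + x (Suc (Suc k)))" using a[of "Suc (Suc k)"] by simp
    finally show ?case unfolding h2 by (simp add: algebra_simps)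
  qed
  \<comment> \<open>By \<open>fact\<close> the squared ratio of consecutive values is x^2 / b^2 = x
    / y, which is at least 1.\<close>
  have ge1: "1 \<le> (Q (Suc k) x0)\<^sup>2" for k
  proof (induction k)
    case (Suc k)
    have p: "0 < b (Suc k)" "0 < y (Suc k)" "y (Suc k) \<le> x (Suc k)" using b yx[of "Suc k"] by auto
    have xp: "0 < x (Suc k)" using p by linarith
    have "(b (Suc k))\<^sup>2 * (Q (Suc (Suc k)) x0)\<^sup>2 = (- e * x (Suc k) * Q (Suc k) x0)\<^sup>2"
      unfolding fact[symmetric] by (simp add: power_mult_distrib)
    also have "\<dots> = (x (Suc k))\<^sup>2 * (Q (Suc k) x0)\<^sup>2" using e by (simp add: power_mult_distrib power2_eq_square)
    also have "\<dots> \<ge> (x (Suc k) * y (Suc k)) * 1"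
      unfolding power2_eq_square[of "x (Suc k)"] using xp p Suc by (intro mult_mono) auto
    finally have "(b (Suc k))\<^sup>2 * 1 \<le> (b (Suc k))\<^sup>2 * (Q (Suc (Suc k)) x0)\<^sup>2" using bxy[of "Suc k"] by simp
    then show ?case using p by simp
  qed (simp add: Q01[simplified])
  have orth: "(\<integral>x. Q i x * Q j x \<partial>\<mu>) = (if i = j then 1 else 0)" if "1 \<le> i" "1 \<le> j" for i j
    using jacobi_poly_orthonormal[OF m b mom that, of 0] by (simp add: Q_def unit_seq_def)
  have int: "integrable \<mu> (\<lambda>x. Q i x * Q j x)" for i j
    using integrable_poly[OF m, of "jacobi_poly a b i * jacobi_poly a b j"] by (simp add: Q_def)
  have bound: "measure \<mu> {x0} \<le> 1 / real N" if N: "N \<ge> 1" for N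
  proof -
    define S where "S = (\<Sum>k=1..N. (Q k x0)\<^sup>2)"
    have "(\<Sum>k=1..N. 1) \<le> S" unfolding S_def
    proof (rule sum_mono)
      fix k assume "k \<in> {1..N}"
      then show "1 \<le> (Q k x0)\<^sup>2" using ge1[of "k - 1"] by simp
    qed
    then have S: "real N \<le> S" by simp
    then have S0: "S > 0" using N by simp
    \<comment> \<open>The extremal polynomial of the Christoffel function: its value at
      \<open>x0\<close> is 1 and the integral of its square is \<open>1 / S\<close>, which therefore
      bounds the atom.\<close>
    define f where "f x = (\<Sum>k=1..N. Q k x0 * Q k x) / S" for x
    have f1: "f x0 = 1" using S0 by (simp add: f_def S_def power2_eq_square)
    have ff: "(f x)\<^sup>2 = (\<Sum>k=1..N. \<Sum>j=1..N. Q k x0 * Q j x0 / S\<^sup>2 * (Q k x * Q j x))" for x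
    proof -
      have "(f x)\<^sup>2 = (\<Sum>k=1..N. Q k x0 * Q k x) * (\<Sum>j=1..N. Q j x0 * Q j x) / S\<^sup>2"
        by (simp add: f_def power_divide power2_eq_square)
      also have "\<dots> = (\<Sum>k=1..N. \<Sum>j=1..N. (Q k x0 * Q k x) * (Q j x0 * Q j x) / S\<^sup>2)"
        unfolding sum_product sum_divide_distrib ..
      finally show ?thesis by (simp add: mult_ac)
    qed
    have "integrable \<mu> (\<lambda>x. (f x)\<^sup>2)" unfolding ff using int by (intro Bochner_Integration.integrable_sum integrable_mult_right) auto
    moreover have "(\<integral>x. (f x)\<^sup>2 \<partial>\<mu>) = 1 / S"
    proof -
      have "(\<integral>x. (f x)\<^sup>2 \<partial>\<mu>) = (\<Sum>k=1..N. \<Sum>j=1..N. Q k x0 * Q j x0 / S\<^sup>2 * (if k = j then 1 else 0))"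
        unfolding ff using int by (simp add: Bochner_Integration.integral_sum orth)
      also have "\<dots> = (\<Sum>k=1..N. (Q k x0)\<^sup>2 / S\<^sup>2)"
      proof (rule sum.cong[OF refl])
        fix k assume "k \<in> {1..N}"
        then have "(\<Sum>j=1..N. if j = k then (Q k x0)\<^sup>2 / S\<^sup>2 else 0) = (Q k x0)\<^sup>2 / S\<^sup>2" by (subst sum.delta) auto
        moreover have "(\<Sum>j=1..N. Q k x0 * Q j x0 / S\<^sup>2 * (if k = j then 1 else 0)) = (\<Sum>j=1..N. if j = k then (Q k x0)\<^sup>2 / S\<^sup>2 else 0)"
          by (intro sum.cong) (auto simp: power2_eq_square)
        ultimately show "(\<Sum>j=1..N. Q k x0 * Q j x0 / S\<^sup>2 * (if k = j then 1 else 0)) = (Q k x0)\<^sup>2 / S\<^sup>2" by simp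
      qed
      also have "\<dots> = S / S\<^sup>2" by (simp add: S_def sum_divide_distrib)
      finally show ?thesis using S0 by (simp add: power2_eq_square)
    qed
    moreover have "(\<integral>x. indicator {x0} x \<partial>\<mu>) \<le> (\<integral>x. (f x)\<^sup>2 \<partial>\<mu>)"
    proof (rule integral_mono)
      show "indicator {x0} x \<le> (f x)\<^sup>2" for x using f1 by (auto simp: indicator_def)
    qed (use \<open>integrable \<mu> (\<lambda>x. (f x)\<^sup>2)\<close> in \<open>auto simp: emeasure_eq_measure\<close>)
    ultimately have "measure \<mu> {x0} \<le> 1 / S" by simp
    also have "\<dots> \<le> 1 / real N" using S N by (intro divide_left_mono) auto
    finally show ?thesis .
  qed
  have "measure \<mu> {x0} \<le> 0"
  proof (rule tendsto_lowerbound[OF lim_const_over_n[of 1]])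
    show "\<forall>\<^sub>F n in sequentially. measure \<mu> {x0} \<le> 1 / real n"
      using eventually_ge_at_top[of 1] by eventually_elim (rule bound)
  qed simp
  then show ?thesis by (simp add: measure_le_0_iff)
qed

section \<open>The zero of the rate and its recursion coefficients\<close>

context limit_params
begin

definition lim_q :: real where "lim_q = \<gamma> * \<sigma> / (1 + \<sigma>)"
definition lim_a :: real where "lim_a = sqrt \<gamma> * ((1 - \<sigma>) / (1 + \<sigma>))"
definition lim_b1 :: real where "lim_b1 = sqrt (1 / (1 + \<sigma>))"
definition lim_b :: real where "lim_b = sqrt ((1 - lim_q) / (1 + \<sigma>))"
text \<open>At u = 0, v = 1 the coefficients are constant except at the first position, where
  \<open>v 0 = 0\<close> enters.\<close>

definition a_seq :: "nat \<Rightarrow> real" where "a_seq k = (if k = 1 then 0 else lim_a)"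
definition b_seq :: "nat \<Rightarrow> real" where "b_seq k = (if k = 1 then lim_b1 else lim_b)"
definition edge_poly :: "real \<Rightarrow> real" where "edge_poly x = (1 + sqrt \<gamma> * x) * (1 - \<sigma> * sqrt \<gamma> * x)"
definition centre :: "nat + nat \<Rightarrow> real" where "centre i = (if i \<in> coef_index then coef_lim i else 0)"

lemma lim_q: "0 \<le> lim_q" "lim_q < 1"
  using gamma sigma gs by (auto simp: lim_q_def pos_divide_less_eq)

lemma lim_b_pos: "0 < lim_b1" "0 < lim_b" "lim_b1\<^sup>2 = 1 / (1 + \<sigma>)" "lim_b\<^sup>2 = (1 - lim_q) / (1 + \<sigma>)"
  using lim_q sigma by (auto simp: lim_b1_def lim_b_def)

lemma useq_centre: "useq centre k = 0" and vseq_centre: "vseq centre k = (if k = 0 then 0 else 1)"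
  by (auto simp: useq_def vseq_def centre_def coef_lim_def coef_index_def)

lemma centre_level: "centre \<in> level 0"
proof -
  have adm: "admissible centre"
    using coef_rate_basic(3) by (auto simp: admissible_def centre_def coef_index_def)
  have "partial_rate N centre = 0" for N
    unfolding partial_rate_def
  proof (rule sum.neutral, intro ballI)
    fix j
    have "centre (Inl (Suc j)) = coef_lim (Inl (Suc j))" "centre (Inr (Suc j)) = coef_lim (Inr (Suc j))" by (auto simp: centre_def coef_index_def)
    then show "coef_rate (Inl (Suc j)) (centre (Inl (Suc j))) + coef_rate (Inr (Suc j)) (centre (Inr (Suc j))) = 0"
      by (simp add: coef_rate_basic(4))
  qed
  with adm show ?thesis by (simp add: level_def)
qed

lemma acoef_centre: "1 \<le> k \<Longrightarrow> acoef \<gamma> \<sigma> (useq centre) (vseq centre) k = a_seq k"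
  by (auto simp: acoef_def useq_centre vseq_centre a_seq_def lim_a_def)

lemma b2coef_centre: "1 \<le> k \<Longrightarrow> sqrt (b2coef \<gamma> \<sigma> (useq centre) (vseq centre) k) = b_seq k"
  by (auto simp: b2coef_def useq_centre vseq_centre b_seq_def lim_b1_def lim_b_def lim_q_def)

lemma coef_moment_centre: "coef_moment \<gamma> \<sigma> centre k = jacobi_pow a_seq b_seq k 1 1"
  unfolding coef_moment_def by (subst jacobi_pow_cong[of k _ a_seq _ b_seq]) (auto simp: acoef_centre b2coef_centre)

text \<open>Both sides satisfy the constant recursion in \<open>n\<close>, so the work lies in n = 0
  and n = 1. For n \<ge> 1 the right side contains no \<open>Q 1\<close> and integrates to 0 against
  the measure; for n = 0 its integral is \<open>1 - lim_q\<close>. Hence \<open>edge_poly\<close>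
  times the measure has the Chebyshev integrals of a multiple of the semicircle.\<close>

lemma edge_poly_cheb:
  fixes Q :: "nat \<Rightarrow> real"
  assumes Q: "Q 0 = 0" "Q 1 = 1" "\<And>k. 1 \<le> k \<Longrightarrow> x * Q k = b_seq k * Q (Suc k) + a_seq k * Q k + b_seq (k - 1) * Q (k - 1)"
  shows "edge_poly x * cheb lim_a lim_b n x
     = (- (\<gamma> * \<sigma>) * lim_b1 * lim_b) * Q (n + 3) + (lim_b1 * (sqrt \<gamma> * (1 - \<sigma>) - \<gamma> * \<sigma> * lim_a)) * Q (n + 2) + (if n = 0 then 1 - lim_q else (1 - lim_q) * lim_b / lim_b1) * Q (n + 1)"
proof -
  define a b b1 C where "a = lim_a" and "b = lim_b" and "b1 = lim_b1" and "C = 1 - lim_q"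
  define d g where "d = sqrt \<gamma> * (1 - \<sigma>)" and "g = \<gamma> * \<sigma>"
  have b: "b > 0" "b1 > 0" using lim_b_pos by (auto simp: b_def b1_def)
  have s: "1 + \<sigma> > 0" using sigma by simp
  have B1: "b1\<^sup>2 = 1 / (1 + \<sigma>)" using lim_b_pos by (simp add: b1_def)
  have C: "C = 1 - g * b1\<^sup>2" by (simp add: C_def lim_q_def g_def B1)
  have B: "b\<^sup>2 = C * b1\<^sup>2" using lim_b_pos by (simp add: b_def C_def B1)
  have a: "a = d * b1\<^sup>2" by (simp add: a_def lim_a_def d_def B1)
  have q: "edge_poly x = 1 + d * x - g * x\<^sup>2"
  proof -
    have "sqrt \<gamma> * sqrt \<gamma> = \<gamma>" using gamma by simp
    then show ?thesis by (simp add: edge_poly_def d_def g_def power2_eq_square algebra_simps)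
  qed
  have r1: "x * Q 1 = b1 * Q 2" using Q(3)[of 1] Q(1) by (simp add: b_seq_def a_seq_def b1_def numeral_2_eq_2)
  have r2: "x * Q 2 = b * Q 3 + a * Q 2 + b1 * Q 1" using Q(3)[of 2] by (simp add: b_seq_def a_seq_def b1_def b_def a_def numeral_2_eq_2 numeral_3_eq_3)
  have rk: "x * Q (k + 3) = b * Q (k + 4) + a * Q (k + 3) + b * Q (k + 2)" for k
    using Q(3)[of "k + 3"] by (simp add: b_seq_def a_seq_def b_def a_def numeral_eq_Suc)
  have r3: "x * Q 3 = b * Q 4 + a * Q 3 + b * Q 2" using rk[of 0] by (simp add: numeral_2_eq_2)
  have xr: "x = b1 * Q 2" using r1 Q(2) by simp
  define e2 e3 where "e2 = b1 * (d - g * a)" and "e3 = - g * b1 * b"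
  define e1 where "e1 n = (if n = 0 then C else C * b / b1)" for n :: nat
  have T0: "edge_poly x * cheb a b 0 x = e3 * Q 3 + e2 * Q 2 + C * Q 1"
  proof -
    have "x\<^sup>2 = b1 * (x * Q 2)" using xr by (simp add: power2_eq_square)
    also have "\<dots> = b1 * (b * Q 3 + a * Q 2 + b1 * Q 1)" by (simp only: r2)
    finally have x2: "x\<^sup>2 = b1 * (b * Q 3 + a * Q 2 + b1)" using Q(2) by simp
    have "edge_poly x = 1 + d * (b1 * Q 2) - g * (b1 * (b * Q 3 + a * Q 2 + b1))"
      unfolding q x2 using xr by simp
    then show ?thesis using Q(2) by (simp add: C e2_def e3_def power2_eq_square algebra_simps)
  qed
  have bb: "b * (C * b / b1) = C * C * b1"
  proof -
    have "b * (C * b / b1) = C * b\<^sup>2 / b1" by (simp add: power2_eq_square)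
    also have "\<dots> = C * (C * b1\<^sup>2) / b1" unfolding B ..
    finally show ?thesis using b by (simp add: power2_eq_square)
  qed
  have T1: "edge_poly x * cheb a b 1 x = e3 * Q 4 + e2 * Q 3 + (C * b / b1) * Q 2"
  proof -
    have "b * (edge_poly x * cheb a b 1 x) = (x - a) * (edge_poly x * cheb a b 0 x)" using b by simp
    also have "\<dots> = e3 * (x * Q 3 - a * Q 3) + e2 * (x * Q 2 - a * Q 2) + C * (x * Q 1 - a * Q 1)"
      unfolding T0 by (simp add: algebra_simps)
    also have "\<dots> = e3 * (b * Q 4 + b * Q 2) + e2 * (b * Q 3 + b1 * Q 1) + C * (b1 * Q 2 - a * Q 1)"
      unfolding r1 r2 r3 by simp
    also have "\<dots> = e3 * b * Q 4 + e2 * b * Q 3 + (e3 * b + C * b1) * Q 2 + (e2 * b1 - C * a) * Q 1"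
      by (simp add: algebra_simps)
    \<comment> \<open>The coefficient of \<open>Q 1\<close> vanishes: after normalization the
      weighted measure has mean \<open>lim_a\<close>.\<close>
    also have "e2 * b1 - C * a = 0" unfolding e2_def C a by (simp add: power2_eq_square algebra_simps)
    also have "e3 * b + C * b1 = b * (C * b / b1)"
    proof -
      have "e3 * b + C * b1 = b1 * (C - g * b\<^sup>2)" by (simp add: e3_def power2_eq_square algebra_simps)
      also have "C - g * b\<^sup>2 = C * (1 - g * b1\<^sup>2)" unfolding B by (simp add: algebra_simps)
      also have "\<dots> = C * C" by (simp only: C[symmetric])
      finally show ?thesis unfolding bb by (simp add: mult_ac)
    qed
    finally have "b * (edge_poly x * cheb a b 1 x) = b * (e3 * Q 4 + e2 * Q 3 + (C * b / b1) * Q 2)"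
      by (simp add: algebra_simps)
    then show ?thesis using b by (simp add: mult_left_cancel)
  qed
  have "edge_poly x * cheb a b n x = e3 * Q (n + 3) + e2 * Q (n + 2) + e1 n * Q (n + 1)" for n
  proof (induction n rule: induct_nat_012)
    case 0 show ?case using T0 by (simp add: e1_def numeral_2_eq_2 numeral_3_eq_3)
  next
    case 1 show ?case using T1 by (simp add: e1_def numeral_eq_Suc)
  next
    case (ge2 n)
    have "b * (edge_poly x * cheb a b (Suc (Suc n)) x)
       = edge_poly x * ((x - a) * cheb a b (Suc n) x - b * cheb a b n x)"
      using b by simp
    also have "\<dots> = (x - a) * (edge_poly x * cheb a b (Suc n) x) - b * (edge_poly x * cheb a b n x)"
      by (simp add: algebra_simps)
    also have "\<dots> = e3 * (x * Q (n + 4) - a * Q (n + 4)) + e2 * (x * Q (n + 3) - a * Q (n + 3)) + (C * b / b1) * (x * Q (n + 2) - a * Q (n + 2))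
       - b * (e3 * Q (n + 3) + e2 * Q (n + 2) + e1 n * Q (n + 1))"
      unfolding ge2 by (simp add: e1_def numeral_eq_Suc algebra_simps diff_divide_distrib)
    also have "x * Q (n + 4) - a * Q (n + 4) = b * Q (n + 5) + b * Q (n + 3)"
      using rk[of "n + 1"] by (simp add: numeral_eq_Suc)
    also have "x * Q (n + 3) - a * Q (n + 3) = b * Q (n + 4) + b * Q (n + 2)" using rk[of n] by simp
    \<comment> \<open>The case n = 0 is special because \<open>Q 1\<close> is linked to
      \<open>Q 2\<close> by \<open>lim_b1\<close> instead of \<open>lim_b\<close>; the factor
      \<open>b / b1\<close> in \<open>e1\<close> makes up for it.\<close>
    also have "(C * b / b1) * (x * Q (n + 2) - a * Q (n + 2)) = (C * b / b1) * (b * Q (n + 3)) + b * (e1 n * Q (n + 1))"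
    proof (cases n)
      case 0
      have "x * Q 2 - a * Q 2 = b * Q 3 + b1 * Q 1" using r2 by simp
      then have "(C * b / b1) * (x * Q 2 - a * Q 2) = (C * b / b1) * (b * Q 3) + (C * b / b1) * b1 * Q 1"
        by (simp only: distrib_left mult.assoc)
      also have "(C * b / b1) * b1 = b * C" using b by simp
      finally show ?thesis using 0 by (simp add: e1_def numeral_eq_Suc mult.assoc)
    next
      case (Suc j)
      have "x * Q (n + 2) - a * Q (n + 2) = b * Q (n + 3) + b * Q (n + 1)" using rk[of j] Suc by (simp add: numeral_eq_Suc)
      moreover have "e1 n = C * b / b1" using Suc by (simp add: e1_def)
      ultimately show ?thesis by (simp only: distrib_left mult_ac)
    qed
    finally have "b * (edge_poly x * cheb a b (Suc (Suc n)) x) = b * (e3 * Q (n + 5) + e2 * Q (n + 4) + (C * b / b1) * Q (n + 3))"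
      by (simp add: algebra_simps)
    then have "edge_poly x * cheb a b (Suc (Suc n)) x = e3 * Q (n + 5) + e2 * Q (n + 4) + (C * b / b1) * Q (n + 3)"
      using b by (simp add: mult_left_cancel)
    then show ?case by (simp add: e1_def numeral_eq_Suc)
  qed
  from this[of n] show ?thesis unfolding e1_def e2_def e3_def d_def g_def C_def a_def b_def b1_def by simp
qed

end

section \<open>Moments of weighted measures\<close>

lemma density_finite_moments:
  fixes g :: "real \<Rightarrow> real"
  assumes M: "sets M = sets borel" and g: "g \<in> borel_measurable M" "AE x in M. 0 \<le> g x"
    and int: "\<And>k. integrable M (\<lambda>x. g x * x ^ k)" and one: "(\<integral>x. g x \<partial>M) = 1"
  shows "borel_prob_finite_moments (density M (\<lambda>x. ennreal (g x)))"
    "moment (density M (\<lambda>x. ennreal (g x))) k = (\<integral>x. g x * x ^ k \<partial>M)"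
proof -
  have [measurable_cong]: "sets M = sets borel" by (rule M)
  have pm: "(\<lambda>x. x ^ k) \<in> borel_measurable M" for k :: nat by measurable
  have "prob_space (density M (\<lambda>x. ennreal (g x)))"
  proof (rule prob_spaceI)
    have "emeasure (density M (\<lambda>x. ennreal (g x))) (space (density M (\<lambda>x. ennreal (g x)))) = (\<integral>\<^sup>+x. ennreal (g x) \<partial>M)"
      using g(1) by (simp add: emeasure_density cong: nn_integral_cong)
    also have "\<dots> = ennreal (\<integral>x. g x \<partial>M)"
      using int[of 0] g(2) by (intro nn_integral_eq_integral) auto
    finally show "emeasure (density M (\<lambda>x. ennreal (g x))) (space (density M (\<lambda>x. ennreal (g x)))) = 1" using one by simp
  qed
  moreover have "integrable (density M (\<lambda>x. ennreal (g x))) (\<lambda>x. x ^ k)" for k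
    using int[of k] by (subst integrable_density[OF pm g]) simp
  ultimately show "borel_prob_finite_moments (density M (\<lambda>x. ennreal (g x)))"
    using M by (simp add: borel_prob_finite_moments_def)
  show "moment (density M (\<lambda>x. ennreal (g x))) k = (\<integral>x. g x * x ^ k \<partial>M)"
    unfolding moment_def by (subst integral_density[OF pm g]) simp
qed

text \<open>Powers are expanded in Chebyshev polynomials; the vanishing integrals leave the first
  coefficient, an entry of a power of a constant Jacobi matrix. Applied to the semicircle and to the
  weighted measure, whose moments thereby coincide.\<close>

lemma cheb_moment:
  assumes b: "b > 0" and int: "\<And>n. integrable M (\<lambda>x. g x * cheb a b n x)"
    and eq: "\<And>n. (\<integral>x. g x * cheb a b n x \<partial>M) = (if n = 0 then 1 else 0)"
  shows "integrable M (\<lambda>x. g x * x ^ m)"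
    "(\<integral>x. g x * x ^ m \<partial>M) = jacobi_pow (\<lambda>_. a) (\<lambda>_. b) m 1 1"
proof -
  define G where "G i x = (if i = 0 then 0 else cheb a b (i - 1) x)" for i x
  have rec: "x * G i x = b * G (Suc i) x + a * G i x + b * G (i - 1) x" if "1 \<le> i" for i x
  proof -
    obtain j where j: "i = Suc j" using \<open>1 \<le> i\<close> by (cases i) auto
    show ?thesis
    proof (cases j)
      case 0 then show ?thesis using b j by (simp add: G_def)
    next
      case (Suc l)
      have "b * cheb a b (Suc (Suc l)) x = (x - a) * cheb a b (Suc l) x - b * cheb a b l x" using b by simp
      then show ?thesis unfolding j Suc G_def by (simp add: left_diff_distrib del: cheb.simps)
    qed
  qed
  have pw: "g x * x ^ m = (\<Sum>i=1..m + 1. jacobi_pow (\<lambda>_. a) (\<lambda>_. b) m 1 i * (g x * cheb a b (i - 1) x))" for x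
  proof -
    have "x ^ m = (\<Sum>i=1..m + 1. jacobi_pow (\<lambda>_. a) (\<lambda>_. b) m 1 i * G i x)"
      by (rule power_eq_jacobi_sum[of "\<lambda>i. G i x"]) (use rec in \<open>auto simp: G_def\<close>)
    also have "\<dots> = (\<Sum>i=1..m + 1. jacobi_pow (\<lambda>_. a) (\<lambda>_. b) m 1 i * cheb a b (i - 1) x)"
      by (intro sum.cong) (auto simp: G_def)
    finally have "g x * x ^ m = (\<Sum>i=1..m + 1. g x * (jacobi_pow (\<lambda>_. a) (\<lambda>_. b) m 1 i * cheb a b (i - 1) x))"
      by (simp only: sum_distrib_left)
    then show ?thesis by (simp only: mult.left_commute)
  qed
  show "integrable M (\<lambda>x. g x * x ^ m)"
    unfolding pw by (intro Bochner_Integration.integrable_sum integrable_mult_right int)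
  have "(\<integral>x. g x * x ^ m \<partial>M) = (\<Sum>i=1..m + 1. jacobi_pow (\<lambda>_. a) (\<lambda>_. b) m 1 i * (if i - 1 = 0 then 1 else 0))"
    unfolding pw by (subst Bochner_Integration.integral_sum) (auto simp only: integral_mult_right_zero eq intro!: integrable_mult_right int)
  also have "\<dots> = (\<Sum>i=1..m + 1. if i = 1 then jacobi_pow (\<lambda>_. a) (\<lambda>_. b) m 1 1 else 0)"
    by (intro sum.cong) auto
  also have "\<dots> = jacobi_pow (\<lambda>_. a) (\<lambda>_. b) m 1 1" by (subst sum.delta) auto
  finally show "(\<integral>x. g x * x ^ m \<partial>M) = jacobi_pow (\<lambda>_. a) (\<lambda>_. b) m 1 1" .
qed

lemma semicircle_nonneg: "b > 0 \<Longrightarrow> 0 \<le> semicircle a b x"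
proof -
  assume b: "b > 0"
  have "\<bar>x - a\<bar> \<le> 2 * b \<Longrightarrow> (x - a)\<^sup>2 \<le> (2 * b)\<^sup>2" using b by (metis abs_le_square_iff abs_of_pos mult_pos_pos zero_less_numeral)
  then show ?thesis by (auto simp: semicircle_def power_mult_distrib)
qed

lemma semicircle_measurable [measurable]: "semicircle a b \<in> borel_measurable borel"
  unfolding semicircle_def[abs_def] by measurable

context limit_params
begin

lemma edge_poly_nonneg: "x \<in> limit_interval \<gamma> \<sigma> \<Longrightarrow> 0 \<le> edge_poly x"
proof -
  assume x: "x \<in> limit_interval \<gamma> \<sigma>"
  have "0 \<le> 1 + sqrt \<gamma> * x"
  proof (cases "\<gamma> = 0")
    case False
    then have t: "sqrt \<gamma> > 0" using gamma by simp
    have "- 1 / sqrt \<gamma> \<le> x" using x False by (simp add: limit_interval_def)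
    then have "sqrt \<gamma> * (- 1 / sqrt \<gamma>) \<le> sqrt \<gamma> * x" using t by (intro mult_left_mono) auto
    then show ?thesis using t by simp
  qed simp
  moreover have "0 \<le> 1 - \<sigma> * sqrt \<gamma> * x"
  proof (cases "\<gamma> * \<sigma> = 0")
    case False
    then have t: "\<sigma> * sqrt \<gamma> > 0" using gamma sigma by simp
    have "x \<le> 1 / (sqrt \<gamma> * \<sigma>)" using x False by (simp add: limit_interval_def)
    then have "\<sigma> * sqrt \<gamma> * x \<le> \<sigma> * sqrt \<gamma> * (1 / (\<sigma> * sqrt \<gamma>))" using t by (intro mult_left_mono) (auto simp: mult.commute)
    also have "\<dots> = 1" using t by (metis less_numeral_extra(3) mult.right_neutral nonzero_mult_div_cancel_left times_divide_eq_right)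
    finally show ?thesis by simp
  qed auto
  ultimately show ?thesis by (simp add: edge_poly_def)
qed

text \<open>The three densities of the definition are one formula, the semicircle divided by
  \<open>edge_poly\<close>: in each case an affine change of variable carries the edges of the
  support to \<open>lim_a\<close> \<plusminus> 2 \<open>lim_b\<close>.\<close>

lemma limit_density_eq:
  "limit_density \<gamma> \<sigma> x = (1 - lim_q) / edge_poly x * semicircle lim_a lim_b x"
proof -
  define t where "t = sqrt \<gamma>"
  have t: "t \<ge> 0" "\<gamma> = t\<^sup>2" using gamma by (auto simp: t_def)
  have s: "1 + \<sigma> > 0" using sigma by simp
  have b: "lim_b > 0" "lim_b\<^sup>2 = (1 - lim_q) / (1 + \<sigma>)" using lim_b_pos by auto
  have q: "1 - lim_q > 0" using lim_q by simp
  define S where "S = (if \<bar>x - lim_a\<bar> \<le> 2 * lim_b then sqrt (4 * lim_b\<^sup>2 - (x - lim_a)\<^sup>2) else 0)"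
  have "(1 - lim_q) / edge_poly x * semicircle lim_a lim_b x = (1 - lim_q) / edge_poly x * (S / (2 * pi * lim_b\<^sup>2))"
    by (simp add: semicircle_def S_def)
  also have "\<dots> = (1 + \<sigma>) / (2 * pi) * S / edge_poly x"
  proof -
    have "C / E * (S / (2 * pi * (C / (1 + \<sigma>)))) = (1 + \<sigma>) / (2 * pi) * S / E" if "C > 0" for C E
      using that s by (cases "E = 0") (simp_all add: field_simps)
    from this[OF q] show ?thesis unfolding b(2) .
  qed
  finally have R: "(1 - lim_q) / edge_poly x * semicircle lim_a lim_b x = (1 + \<sigma>) / (2 * pi) * S / edge_poly x" .
  \<comment> \<open>\<open>y\<close> is the variable of the original density with support from
    \<open>l\<close> to \<open>u\<close>, and \<open>k\<close> the scaling factor; root and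
    indicator transform together.\<close>
  have S2: "sqrt (k * (x - lim_a + 2 * lim_b) * (k * (2 * lim_b - (x - lim_a)))) * indicator {l..u} y = k * S"
    if k: "k > 0" and l: "y - l = k * (x - lim_a + 2 * lim_b)" and u: "u - y = k * (2 * lim_b - (x - lim_a))" for k l u y
  proof -
    have "y \<in> {l..u} \<longleftrightarrow> 0 \<le> y - l \<and> 0 \<le> u - y" by auto
    also have "\<dots> \<longleftrightarrow> 0 \<le> x - lim_a + 2 * lim_b \<and> 0 \<le> 2 * lim_b - (x - lim_a)"
      unfolding l u using k by (simp add: zero_le_mult_iff)
    also have "\<dots> \<longleftrightarrow> \<bar>x - lim_a\<bar> \<le> 2 * lim_b" by auto
    finally have I: "y \<in> {l..u} \<longleftrightarrow> \<bar>x - lim_a\<bar> \<le> 2 * lim_b" .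
    have "k * (x - lim_a + 2 * lim_b) * (k * (2 * lim_b - (x - lim_a))) = k\<^sup>2 * (4 * lim_b\<^sup>2 - (x - lim_a)\<^sup>2)"
      by (simp add: power2_eq_square algebra_simps)
    then have "sqrt (k * (x - lim_a + 2 * lim_b) * (k * (2 * lim_b - (x - lim_a)))) = k * sqrt (4 * lim_b\<^sup>2 - (x - lim_a)\<^sup>2)"
      using k by (simp add: real_sqrt_mult)
    then show ?thesis using I by (simp add: S_def indicator_def)
  qed
  consider "\<gamma> = 0" | "\<gamma> \<noteq> 0" "\<sigma> = 0" | "\<gamma> \<noteq> 0" "\<sigma> \<noteq> 0" by blast
  then show ?thesis
  proof cases
    case 1
    have v: "lim_a = 0" "lim_q = 0" "edge_poly x = 1" unfolding lim_a_def lim_q_def edge_poly_def using 1 by auto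
    have "x\<^sup>2 \<le> 4 / (1 + \<sigma>) \<longleftrightarrow> \<bar>x\<bar> \<le> 2 * lim_b"
    proof -
      have "4 / (1 + \<sigma>) = (2 * lim_b)\<^sup>2" using b(2) v by (simp add: power_mult_distrib)
      then show ?thesis using b(1) abs_le_square_iff[of x "2 * lim_b"] by simp
    qed
    then show ?thesis unfolding R using 1 sigma v b(2) by (simp add: limit_density_def S_def)
  next
    case 2
    then have t0: "t > 0" using t by (cases "t = 0") auto
    have v: "lim_a = t" "lim_q = 0" "lim_b = 1" "edge_poly x = 1 + t * x"
      unfolding lim_a_def lim_q_def lim_b_def edge_poly_def t_def using 2 by auto
    have l: "(1 + t * x) - (t - 1)\<^sup>2 = t * (x - lim_a + 2 * lim_b)" and u: "(t + 1)\<^sup>2 - (1 + t * x) = t * (2 * lim_b - (x - lim_a))"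
      unfolding v by (simp_all add: power2_eq_square algebra_simps)
    have "limit_density \<gamma> \<sigma> x = t * h_laguerre \<gamma> (1 + t * x)"
      using 2 gamma by (simp add: limit_density_def t_def)
    also have "h_laguerre \<gamma> (1 + t * x) = 1 / (2 * pi * \<gamma> * (1 + t * x)) * (sqrt (((1 + t * x) - (t - 1)\<^sup>2) * ((t + 1)\<^sup>2 - (1 + t * x))) * indicator {(t - 1)\<^sup>2..(t + 1)\<^sup>2} (1 + t * x))"
      by (simp add: h_laguerre_def t_def Let_def)
    also have "\<dots> = 1 / (2 * pi * \<gamma> * (1 + t * x)) * (t * S)" using S2[OF t0 l u] unfolding l u by simp
    also have "t * \<dots> = (1 + \<sigma>) / (2 * pi) * S / edge_poly x"
      unfolding v unfolding t(2) using t0 2 by (simp add: power2_eq_square)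
    finally show ?thesis unfolding R .
  next
    case 3
    then have t0: "t > 0" using t by (cases "t = 0") auto
    have \<sigma>: "\<sigma> > 0" using 3 sigma by simp
    define \<kappa> where "\<kappa> = \<sigma> / (1 + \<sigma>)"
    have \<kappa>: "\<kappa> > 0" using \<sigma> by (simp add: \<kappa>_def)
    define r w where "r = sqrt (1 - lim_q)" and "w = t / sqrt (1 + \<sigma>)"
    have r2: "r\<^sup>2 = 1 - lim_q" using q by (simp add: r_def)
    have w2: "w\<^sup>2 = \<gamma> / (1 + \<sigma>)" using s t by (simp add: w_def power_divide)
    have rw: "r * w = t * lim_b" using s by (simp add: r_def w_def lim_b_def real_sqrt_divide)
    have rs: "sqrt (1 - \<sigma> * \<gamma> / (1 + \<sigma>)) = r" by (simp add: r_def lim_q_def mult.commute)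
    have ws: "sqrt (\<gamma> / (1 + \<sigma>)) = w" by (simp add: w_def t_def real_sqrt_divide)
    have qa: "lim_q - \<gamma> / (1 + \<sigma>) = - t * lim_a"
    proof -
      have "- t * lim_a = - (t * t) * ((1 - \<sigma>) / (1 + \<sigma>))" by (simp add: lim_a_def t_def[symmetric])
      also have "t * t = \<gamma>" using t by (simp add: power2_eq_square)
      also have "- \<gamma> * ((1 - \<sigma>) / (1 + \<sigma>)) = (\<gamma> * \<sigma> - \<gamma>) / (1 + \<sigma>)" by (simp add: algebra_simps)
      finally show ?thesis by (simp only: lim_q_def diff_divide_distrib)
    qed
    define y where "y = \<kappa> * (t * x + 1)"
    have l: "y - \<kappa> * (r - w)\<^sup>2 = (\<kappa> * t) * (x - lim_a + 2 * lim_b)"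
    proof -
      have "y - \<kappa> * (r - w)\<^sup>2 = \<kappa> * (t * x + 1 - r\<^sup>2 - w\<^sup>2 + 2 * (r * w))" by (simp add: y_def power2_eq_square algebra_simps)
      also have "\<dots> = \<kappa> * (t * x + (lim_q - \<gamma> / (1 + \<sigma>)) + 2 * (t * lim_b))" unfolding r2 w2 rw by simp
      also have "\<dots> = (\<kappa> * t) * (x - lim_a + 2 * lim_b)" unfolding qa by (simp add: algebra_simps)
      finally show ?thesis .
    qed
    have u: "\<kappa> * (r + w)\<^sup>2 - y = (\<kappa> * t) * (2 * lim_b - (x - lim_a))"
    proof -
      have "\<kappa> * (r + w)\<^sup>2 - y = \<kappa> * (r\<^sup>2 + w\<^sup>2 - 1 - t * x + 2 * (r * w))" by (simp add: y_def power2_eq_square algebra_simps)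
      also have "\<dots> = \<kappa> * (- (lim_q - \<gamma> / (1 + \<sigma>)) - t * x + 2 * (t * lim_b))" unfolding r2 w2 rw by simp
      also have "\<dots> = (\<kappa> * t) * (2 * lim_b - (x - lim_a))" unfolding qa by (simp add: algebra_simps)
      finally show ?thesis .
    qed
    have y1: "y * (1 - y) = \<kappa> * edge_poly x / (1 + \<sigma>)"
    proof -
      have "1 - y = (1 - \<sigma> * t * x) / (1 + \<sigma>)" using s by (simp add: y_def \<kappa>_def field_simps)
      then show ?thesis by (simp add: y_def edge_poly_def t_def add.commute mult.assoc)
    qed
    have sg: "0 < \<sigma> * \<gamma>" "\<sigma> * \<gamma> \<le> 1" using \<sigma> 3 gamma gs by (auto simp: mult.commute)
    have "limit_density \<gamma> \<sigma> x = \<sigma> * sqrt \<gamma> / (1 + \<sigma>) * h_jacobi \<gamma> \<sigma> (\<sigma> / (1 + \<sigma>) * (sqrt \<gamma> * x + 1))"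
      unfolding limit_density_def using sg by (simp only: simp_thms if_True)
    also have "\<dots> = \<kappa> * t * h_jacobi \<gamma> \<sigma> y" by (simp add: \<kappa>_def y_def t_def)
    also have "h_jacobi \<gamma> \<sigma> y = (1 + \<sigma>) / (2 * pi * \<sigma> * \<gamma>) * ((sqrt ((y - \<kappa> * (r - w)\<^sup>2) * (\<kappa> * (r + w)\<^sup>2 - y)) * indicator {\<kappa> * (r - w)\<^sup>2..\<kappa> * (r + w)\<^sup>2} y) / (y * (1 - y)))"
      unfolding h_jacobi_def rs ws Let_def \<kappa>_def[symmetric] by simp
    also have "\<dots> = (1 + \<sigma>) / (2 * pi * \<sigma> * \<gamma>) * (\<kappa> * t * S / (\<kappa> * edge_poly x / (1 + \<sigma>)))"
      using S2[OF _ l u] \<kappa> t0 unfolding l u y1 by simp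
    also have "\<kappa> * t * \<dots> = (\<kappa> * (1 + \<sigma>)) * (t\<^sup>2 * \<kappa> * (1 + \<sigma>)) / (2 * pi * \<sigma> * \<gamma> * \<kappa>) * S / edge_poly x"
      using \<kappa> by (simp add: power2_eq_square mult_ac)
    also have "\<dots> = (1 + \<sigma>) / (2 * pi) * S / edge_poly x"
    proof -
      have "\<kappa> * (1 + \<sigma>) = \<sigma>" using s by (simp add: \<kappa>_def)
      then have "(\<kappa> * (1 + \<sigma>)) * (t\<^sup>2 * \<kappa> * (1 + \<sigma>)) / (2 * pi * \<sigma> * \<gamma> * \<kappa>) = \<sigma> * (\<gamma> * \<kappa> * (1 + \<sigma>)) / (2 * pi * \<sigma> * \<gamma> * \<kappa>)"
        by (simp only: t(2))
      also have "\<dots> = (1 + \<sigma>) / (2 * pi)" using \<sigma> \<kappa> 3 by simp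
      finally show ?thesis by simp
    qed
    finally show ?thesis unfolding R .
  qed
qed

text \<open>On the limit interval the polynomial is nonnegative, so it remains to exclude atoms at
  its zeros. The inequality \<open>y \<le> x\<close> demanded by \<open>no_edge_atom\<close> amounts
  to \<gamma> \<le> 1 at the lower edge and to \<gamma>\<sigma> \<le> 1 at the upper one.\<close>

lemma edge_poly_pos_AE:
  assumes \<mu>: "\<mu> \<in> moment_space (limit_interval \<gamma> \<sigma>)" and mom: "\<And>k. moment \<mu> k = jacobi_pow a_seq b_seq k 1 1"
  shows "AE x in \<mu>. 0 < edge_poly x"
proof -
  have m: "borel_prob_finite_moments \<mu>" and sup: "AE x in \<mu>. x \<in> limit_interval \<gamma> \<sigma>"
    using \<mu> by (auto simp: moment_space_def)
  interpret real_distribution \<mu> using m by (simp add: borel_prob_finite_moments_iff)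
  have s: "1 + \<sigma> > 0" using sigma by simp
  have bp: "0 < b_seq k" for k using lim_b_pos by (simp add: b_seq_def)
  have b1: "(b_seq 1)\<^sup>2 = 1 / (1 + \<sigma>)" and bk: "k \<noteq> 1 \<Longrightarrow> (b_seq k)\<^sup>2 = (1 - lim_q) / (1 + \<sigma>)" for k
    using lim_b_pos by (auto simp: b_seq_def)
  have null: "AE x in \<mu>. x \<noteq> x0" if "measure \<mu> {x0} = 0" for x0
    by (rule AE_I[of _ _ "{x0}"]) (use that in \<open>auto simp: emeasure_eq_measure\<close>)
  have "AE x in \<mu>. 1 + sqrt \<gamma> * x \<noteq> 0"
  proof (cases "\<gamma> = 0")
    case False
    define t where "t = sqrt \<gamma>"
    have t: "t > 0" "t * t = \<gamma>" using gamma False by (auto simp: t_def)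
    \<comment> \<open>The factorization from \<open>lower_edge_bound\<close> at u = 0, v = 1;
      \<open>Y 0 = 0\<close> reflects \<open>v 0 = 0\<close>.\<close>
    define X where "X k = (if k = 1 then 1 / t else (1 - lim_q) / t)" for k :: nat
    define Y where "Y k = (if k = 0 then 0 else t / (1 + \<sigma>))" for k :: nat
    have lq: "lim_q = t * t * \<sigma> / (1 + \<sigma>)" by (simp add: lim_q_def t(2))
    have qt: "(1 - lim_q) / t = 1 / t - t * \<sigma> / (1 + \<sigma>)"
      unfolding lq using t(1) by (simp add: diff_divide_distrib)
    have "measure \<mu> {- 1 / t} = 0"
    proof (rule no_edge_atom[OF m bp mom, where e=1 and y=Y and x=X])
      fix k :: nat assume k: "1 \<le> k"
      show "a_seq k - - 1 / t = 1 * (Y (k - 1) + X k)"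
      proof (cases "k = 1")
        case False
        have "t * ((1 - \<sigma>) / (1 + \<sigma>)) = t / (1 + \<sigma>) - t * \<sigma> / (1 + \<sigma>)" by (simp add: right_diff_distrib diff_divide_distrib)
        then show ?thesis using False k qt by (simp add: a_seq_def Y_def X_def lim_a_def t_def[symmetric])
      qed (simp add: a_seq_def X_def Y_def)
      show "(b_seq k)\<^sup>2 = X k * Y k" using b1 bk[of k] t k by (auto simp: X_def Y_def)
      have "t / (1 + \<sigma>) \<le> (1 - lim_q) / t"
      proof -
        have "t / (1 + \<sigma>) + t * \<sigma> / (1 + \<sigma>) = t * (1 + \<sigma>) / (1 + \<sigma>)" by (simp only: add_divide_distrib[symmetric]) (simp add: algebra_simps)
        also have "\<dots> = t" using s by simp
        finally have "t / (1 + \<sigma>) + t * \<sigma> / (1 + \<sigma>) = t" .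
        moreover have "t \<le> 1 / t" using t gamma by (simp add: pos_le_divide_eq)
        ultimately show ?thesis unfolding qt by linarith
      qed
      moreover have "(1 - lim_q) / t \<le> 1 / t" using t lim_q by (simp add: divide_right_mono)
      ultimately show "0 < Y k \<and> Y k \<le> X k" using k t s by (auto simp: X_def Y_def)
    qed (simp_all add: Y_def)
    from null[OF this] show ?thesis
    proof eventually_elim
      case (elim x)
      then show ?case using t(1) unfolding t_def[symmetric] by (auto simp: field_simps)
    qed
  qed simp
  moreover have "AE x in \<mu>. 1 - \<sigma> * sqrt \<gamma> * x \<noteq> 0"
  proof (cases "\<gamma> * \<sigma> = 0")
    case False
    define t where "t = sqrt \<gamma>"
    have t: "t > 0" "t * t = \<gamma>" using gamma False by (auto simp: t_def)
    have \<sigma>: "\<sigma> > 0" using sigma False by auto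
    define X where "X k = (if k = 1 then 1 / (\<sigma> * t) else (1 - lim_q) / (\<sigma> * t))" for k :: nat
    define Y where "Y k = (if k = 0 then 0 else \<sigma> * t / (1 + \<sigma>))" for k :: nat
    have lq: "lim_q = t * t * \<sigma> / (1 + \<sigma>)" by (simp add: lim_q_def t(2))
    have qt: "(1 - lim_q) / (\<sigma> * t) = 1 / (\<sigma> * t) - t / (1 + \<sigma>)"
      unfolding lq using t(1) \<sigma> by (simp add: diff_divide_distrib)
    \<comment> \<open>The sign \<open>e = - 1\<close> appears because this point bounds the interval
      from above; \<open>X\<close> and \<open>Y\<close> come from
      \<open>upper_edge_bound\<close>.\<close>
    have "measure \<mu> {1 / (\<sigma> * t)} = 0"
    proof (rule no_edge_atom[OF m bp mom, where e="- 1" and y=Y and x=X])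
      fix k :: nat assume k: "1 \<le> k"
      show "a_seq k - 1 / (\<sigma> * t) = - 1 * (Y (k - 1) + X k)"
      proof (cases "k = 1")
        case False
        have "t * ((1 - \<sigma>) / (1 + \<sigma>)) = t / (1 + \<sigma>) - \<sigma> * t / (1 + \<sigma>)" by (simp add: right_diff_distrib diff_divide_distrib)
        then show ?thesis using False k qt by (simp add: a_seq_def Y_def X_def lim_a_def t_def[symmetric])
      qed (simp add: a_seq_def X_def Y_def)
      show "(b_seq k)\<^sup>2 = X k * Y k" using b1 bk[of k] t \<sigma> k by (auto simp: X_def Y_def)
      have "\<sigma> * t / (1 + \<sigma>) \<le> (1 - lim_q) / (\<sigma> * t)"
      proof -
        have "\<sigma> * t / (1 + \<sigma>) + t / (1 + \<sigma>) = t * (1 + \<sigma>) / (1 + \<sigma>)" by (simp only: add_divide_distrib[symmetric]) (simp add: algebra_simps)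
        also have "\<dots> = t" using s by simp
        finally have "\<sigma> * t / (1 + \<sigma>) + t / (1 + \<sigma>) = t" .
        moreover have "t \<le> 1 / (\<sigma> * t)"
        proof -
          have "t * (\<sigma> * t) = \<gamma> * \<sigma>" using t(2) by simp
          then have "t * (\<sigma> * t) \<le> 1" using gs by linarith
          then show ?thesis using t(1) \<sigma> by (simp only: pos_le_divide_eq mult_pos_pos)
        qed
        ultimately show ?thesis unfolding qt by linarith
      qed
      moreover have "(1 - lim_q) / (\<sigma> * t) \<le> 1 / (\<sigma> * t)" using t \<sigma> lim_q by (simp add: divide_right_mono)
      ultimately show "0 < Y k \<and> Y k \<le> X k" using k t s \<sigma> by (auto simp: X_def Y_def)
    qed (simp_all add: Y_def)
    from null[OF this] show ?thesis
    proof eventually_elim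
      case (elim x)
      then show ?case using t(1) \<sigma> unfolding t_def[symmetric] by (auto simp: field_simps)
    qed
  qed auto
  ultimately show ?thesis
    using sup
  proof eventually_elim
    case (elim x)
    then have "edge_poly x \<noteq> 0" by (simp add: edge_poly_def)
    then show ?case using edge_poly_nonneg[OF elim(3)] by simp
  qed
qed

text \<open>The measure with density \<open>g\<close> with respect to \<mu> has the Chebyshev
  integrals of the semicircle, so the two agree by determinacy. Since \<open>g\<close> is positive
  almost everywhere, multiplication by its inverse \<open>h\<close> recovers \<mu> on one side and
  the limit law on the other.\<close>

lemma limit_law_eq_spectral:
  assumes \<mu>: "\<mu> \<in> moment_space (limit_interval \<gamma> \<sigma>)" and mom: "\<And>k. moment \<mu> k = jacobi_pow a_seq b_seq k 1 1"
  shows "limit_law \<gamma> \<sigma> = \<mu>"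
proof -
  have m: "borel_prob_finite_moments \<mu>" using \<mu> by (auto simp: moment_space_def)
  interpret real_distribution \<mu> using m by (simp add: borel_prob_finite_moments_iff)
  have bp: "0 < b_seq k" for k using lim_b_pos by (simp add: b_seq_def)
  have q: "1 - lim_q > 0" using lim_q by simp
  have b: "lim_b > 0" by (rule lim_b_pos)
  define Q where "Q k = poly (jacobi_poly a_seq b_seq k)" for k
  have Q01: "Q 0 x = 0" "Q 1 x = 1" for x by (auto simp: Q_def)
  have rec: "x * Q k x = b_seq k * Q (Suc k) x + a_seq k * Q k x + b_seq (k - 1) * Q (k - 1) x" if "1 \<le> k" for k x
    unfolding Q_def using poly_jacobi_poly_rec[of k b_seq x a_seq] bp[of k] that by simp
  have Qint: "integrable \<mu> (Q k)" for k unfolding Q_def by (rule integrable_poly[OF m])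
  have Qval: "(\<integral>x. Q k x \<partial>\<mu>) = (if k = 1 then 1 else 0)" if "1 \<le> k" for k
    using jacobi_poly_orthonormal[OF m bp mom that order_refl, of 0] Q01(2) by (auto simp: Q_def unit_seq_def)
  define g where "g x = edge_poly x / (1 - lim_q)" for x
  have ge: "g x * cheb lim_a lim_b n x = (1 / (1 - lim_q)) * ((- (\<gamma> * \<sigma>) * lim_b1 * lim_b) * Q (n + 3) x
     + (lim_b1 * (sqrt \<gamma> * (1 - \<sigma>) - \<gamma> * \<sigma> * lim_a)) * Q (n + 2) x
     + (if n = 0 then 1 - lim_q else (1 - lim_q) * lim_b / lim_b1) * Q (n + 1) x)" for n x
  proof -
    have "edge_poly x * cheb lim_a lim_b n x = (- (\<gamma> * \<sigma>) * lim_b1 * lim_b) * Q (n + 3) x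
     + (lim_b1 * (sqrt \<gamma> * (1 - \<sigma>) - \<gamma> * \<sigma> * lim_a)) * Q (n + 2) x
     + (if n = 0 then 1 - lim_q else (1 - lim_q) * lim_b / lim_b1) * Q (n + 1) x"
      by (rule edge_poly_cheb[of "\<lambda>k. Q k x"]) (use Q01 rec in auto)
    then show ?thesis unfolding g_def by (simp only: times_divide_eq_left mult_1_left)
  qed
  have gint: "integrable \<mu> (\<lambda>x. g x * cheb lim_a lim_b n x)" for n
    unfolding ge by (intro integrable_mult_right Bochner_Integration.integrable_add Qint)
  have gval: "(\<integral>x. g x * cheb lim_a lim_b n x \<partial>\<mu>) = (if n = 0 then 1 else 0)" for n
    unfolding ge using q by (simp add: Qint Qval)
  note gm = cheb_moment[OF b gint gval]
  note sm = cheb_moment[OF b semicircle_cheb[OF b]]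
  have gb: "g \<in> borel_measurable borel" unfolding g_def[abs_def] edge_poly_def[abs_def] by measurable
  then have gM: "g \<in> borel_measurable \<mu>" by simp
  have g0: "AE x in \<mu>. 0 \<le> g x"
    using edge_poly_pos_AE[OF \<mu> mom] by eventually_elim (use q in \<open>simp add: g_def\<close>)
  define \<nu> where "\<nu> = density \<mu> (\<lambda>x. ennreal (g x))"
  define sc where "sc = density lborel (\<lambda>x. ennreal (semicircle lim_a lim_b x))"
  have g1: "(\<integral>x. g x \<partial>\<mu>) = 1" and s1: "(\<integral>x. semicircle lim_a lim_b x \<partial>lborel) = 1"
    using gval[of 0] semicircle_cheb(2)[OF b, of lim_a 0] by simp_all
  have \<nu>m: "borel_prob_finite_moments \<nu>" "\<And>k. moment \<nu> k = (\<integral>x. g x * x ^ k \<partial>\<mu>)"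
    unfolding \<nu>_def by (rule density_finite_moments; use gM g0 gm(1) g1 in auto)+
  have scm: "borel_prob_finite_moments sc" "\<And>k. moment sc k = (\<integral>x. semicircle lim_a lim_b x * x ^ k \<partial>lborel)"
    unfolding sc_def by (rule density_finite_moments; use sm(1) s1 semicircle_nonneg[OF b] in auto)+
  have eq: "\<nu> = sc"
  proof (rule moment_determinate[OF scm(1) \<nu>m(1)])
    show "moment \<nu> k = moment sc k" for k unfolding \<nu>m(2) scm(2) gm(2) sm(2) ..
    \<comment> \<open>The semicircle lives within distance \<open>2 * lim_b\<close> of
      \<open>lim_a\<close>, hence inside the ball of this radius around 0.\<close>
    show "moment sc (2 * k) \<le> (\<bar>lim_a\<bar> + 2 * lim_b) ^ (2 * k)" for k
    proof -
      let ?R = "\<bar>lim_a\<bar> + 2 * lim_b"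
      have "moment sc (2 * k) \<le> (\<integral>x. semicircle lim_a lim_b x * ?R ^ (2 * k) \<partial>lborel)"
        unfolding scm(2)
      proof (rule integral_mono[OF sm(1)])
        show "integrable lborel (\<lambda>x. semicircle lim_a lim_b x * ?R ^ (2 * k))"
          using sm(1)[of lim_a 0] by simp
        fix x :: real
        show "semicircle lim_a lim_b x * x ^ (2 * k) \<le> semicircle lim_a lim_b x * ?R ^ (2 * k)"
        proof (cases "\<bar>x - lim_a\<bar> \<le> 2 * lim_b")
          case True
          then have "\<bar>x\<bar> \<le> ?R" by linarith
          then have "\<bar>x\<bar> ^ (2 * k) \<le> ?R ^ (2 * k)" by (intro power_mono) auto
          then show ?thesis using semicircle_nonneg[OF b] by (intro mult_left_mono) (auto simp: power_mult)
        qed (simp add: semicircle_def)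
      qed
      then show ?thesis using s1 by simp
    qed
  qed
  define h where "h x = (1 - lim_q) / edge_poly x" for x
  have hb: "h \<in> borel_measurable borel" unfolding h_def[abs_def] edge_poly_def[abs_def] by measurable
  have "limit_law \<gamma> \<sigma> = density lborel (\<lambda>x. ennreal (semicircle lim_a lim_b x) * ennreal (h x))"
    unfolding limit_law_def limit_density_eq h_def
    by (intro arg_cong[where f="density lborel"] ext) (metis ennreal_mult' semicircle_nonneg[OF b] mult.commute)
  also have "\<dots> = density sc (\<lambda>x. ennreal (h x))"
    unfolding sc_def by (rule density_density_eq[symmetric]) (use hb in measurable)
  also have "\<dots> = density \<mu> (\<lambda>x. ennreal (g x) * ennreal (h x))"
    unfolding eq[symmetric] \<nu>_def by (rule density_density_eq) (use hb gb in measurable)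
  also have "\<dots> = density \<mu> (\<lambda>_. 1)"
  proof (rule density_cong)
    show "AE x in \<mu>. ennreal (g x) * ennreal (h x) = 1"
      using edge_poly_pos_AE[OF \<mu> mom]
    proof eventually_elim
      case (elim x)
      then have "ennreal (g x) * ennreal (h x) = ennreal (g x * h x)"
        using q by (intro ennreal_mult[symmetric]) (auto simp: g_def h_def)
      also have "g x * h x = 1" using elim q by (simp add: g_def h_def)
      finally show ?case by simp
    qed
  qed (use hb gb in measurable)
  finally show ?thesis by (simp add: density_1)
qed

lemma limit_law_facts:
  "limit_law \<gamma> \<sigma> \<in> moment_space (limit_interval \<gamma> \<sigma>)"
  "moment (limit_law \<gamma> \<sigma>) k = coef_moment \<gamma> \<sigma> centre k"
  "rate_function \<gamma> \<sigma> (limit_law \<gamma> \<sigma>) \<le> 0"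
proof -
  obtain \<mu> where \<mu>: "\<mu> \<in> moment_space (limit_interval \<gamma> \<sigma>)" "\<And>k. moment \<mu> k = coef_moment \<gamma> \<sigma> centre k"
    "decomposition \<gamma> \<sigma> \<mu> (useq centre) (vseq centre)"
    using level_measure[OF centre_level] by blast
  have "limit_law \<gamma> \<sigma> = \<mu>" using \<mu>(1,2) by (intro limit_law_eq_spectral) (auto simp: coef_moment_centre)
  then show "limit_law \<gamma> \<sigma> \<in> moment_space (limit_interval \<gamma> \<sigma>)" "moment (limit_law \<gamma> \<sigma>) k = coef_moment \<gamma> \<sigma> centre k"
    "rate_function \<gamma> \<sigma> (limit_law \<gamma> \<sigma>) \<le> 0"
    using \<mu> rate_function_level[OF \<mu>(1) centre_level \<mu>(3)] by (auto simp: zero_ereal_def)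
qed

text \<open>Rate 0 forces every single rate to vanish, and each of them has exactly one zero; the
  coefficients are thus those of \<open>centre\<close>, and equal moments identify the
  measure.\<close>

lemma rate_function_zero_unique:
  assumes "rate_function \<gamma> \<sigma> \<nu> \<le> 0"
  shows "\<nu> = limit_law \<gamma> \<sigma>"
proof -
  obtain z where \<nu>: "\<nu> \<in> moment_space (limit_interval \<gamma> \<sigma>)" and z: "z \<in> level 0" "\<And>k. moment \<nu> k = coef_moment \<gamma> \<sigma> z k"
    using rate_function_le[of \<nu> 0] assms by (auto simp: zero_ereal_def)
  have zi: "z i = centre i" if "i \<in> coef_index" for i
  proof (rule ccontr)
    assume "z i \<noteq> centre i"
    then have "z i \<noteq> coef_lim i" using that by (simp add: centre_def)
    moreover have "z i \<in> coef_dom i" using z(1) that by (auto simp: level_def admissible_def)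
    ultimately have "0 < coef_rate i (z i)" by (intro coef_rate_basic(7))
    then show False using level_coef_le[OF z(1) that] by simp
  qed
  have "useq z = useq centre" "vseq z = vseq centre"
    by (auto simp: useq_def vseq_def fun_eq_iff coef_index_def intro!: zi)
  then have "coef_moment \<gamma> \<sigma> z k = coef_moment \<gamma> \<sigma> centre k" for k by (simp add: coef_moment_def)
  then show ?thesis using z(2) limit_law_facts(2) by (intro moment_space_eqI[OF \<nu> limit_law_facts(1)]) simp
qed

lemma minimizers_rate_function:
  "{\<nu> \<in> moment_space (limit_interval \<gamma> \<sigma>). \<forall>\<nu>' \<in> moment_space (limit_interval \<gamma> \<sigma>).
      rate_function \<gamma> \<sigma> \<nu> \<le> rate_function \<gamma> \<sigma> \<nu>'} = {limit_law \<gamma> \<sigma>}"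
proof (rule equalityI; rule subsetI)
  fix \<nu> assume "\<nu> \<in> {\<nu> \<in> moment_space (limit_interval \<gamma> \<sigma>). \<forall>\<nu>' \<in> moment_space (limit_interval \<gamma> \<sigma>).
      rate_function \<gamma> \<sigma> \<nu> \<le> rate_function \<gamma> \<sigma> \<nu>'}"
  then have "rate_function \<gamma> \<sigma> \<nu> \<le> rate_function \<gamma> \<sigma> (limit_law \<gamma> \<sigma>)" using limit_law_facts(1) by blast
  then have "rate_function \<gamma> \<sigma> \<nu> \<le> 0" using limit_law_facts(3) by (rule order_trans)
  then show "\<nu> \<in> {limit_law \<gamma> \<sigma>}" by (simp add: rate_function_zero_unique)
next
  fix \<nu> assume "\<nu> \<in> {limit_law \<gamma> \<sigma>}"
  moreover have "rate_function \<gamma> \<sigma> (limit_law \<gamma> \<sigma>) \<le> rate_function \<gamma> \<sigma> \<nu>'" for \<nu>'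
    using limit_law_facts(3) rate_function_nonneg by (rule order_trans)
  ultimately show "\<nu> \<in> {\<nu> \<in> moment_space (limit_interval \<gamma> \<sigma>). \<forall>\<nu>' \<in> moment_space (limit_interval \<gamma> \<sigma>).
      rate_function \<gamma> \<sigma> \<nu> \<le> rate_function \<gamma> \<sigma> \<nu>'}"
    using limit_law_facts(1) by blast
qed

end

theorem theorem10:
  fixes M :: "nat \<Rightarrow> 'a measure"
    and c s :: "nat \<Rightarrow> nat \<Rightarrow> 'a \<Rightarrow> real"
    and \<beta> p1 p2 :: "nat \<Rightarrow> real"
    and \<gamma> \<sigma> :: real
    and \<mu> :: "nat \<Rightarrow> 'a \<Rightarrow> real measure"
    and P :: "nat \<Rightarrow> real measure set \<Rightarrow> real"
    and I :: "real set"
  assumes "\<And>n. n \<ge> 1 \<Longrightarrow> \<beta> n > 0"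
    and "\<And>n. n \<ge> 1 \<Longrightarrow> p1 n \<ge> real n"
    and "\<And>n. n \<ge> 1 \<Longrightarrow> p2 n \<ge> real n"
    and "\<And>n. n \<ge> 1 \<Longrightarrow> jacobi_model (M n) n (\<beta> n / 2) (p1 n) (p2 n) (c n) (s n)"
    and "(\<lambda>n. real n / p1 n) \<longlonglongrightarrow> \<gamma>"
    and "(\<lambda>n. p1 n / p2 n) \<longlonglongrightarrow> \<sigma>"
    and "filterlim (\<lambda>n. \<beta> n * real n) at_top sequentially"
    and "0 \<le> \<gamma>" "\<gamma> \<le> 1"
    and "0 \<le> \<sigma>" "\<gamma> \<noteq> 0 \<Longrightarrow> \<sigma> < 1 / \<gamma>"
  defines "\<mu> \<equiv> \<lambda>n \<omega>. spectral_measure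
      (rescaled_jacobi_matrix n (p1 n) (p2 n) (\<lambda>k. c n k \<omega>) (\<lambda>k. s n k \<omega>))"
    and "P \<equiv> \<lambda>n A. measure (M n) {\<omega> \<in> space (M n). \<mu> n \<omega> \<in> A}"
    and "I \<equiv> limit_interval \<gamma> \<sigma>"
  shows
    "good_ldp (moment_topology UNIV) P (\<lambda>n. \<beta> n / 2 * real n) (rate_function \<gamma> \<sigma>) \<and>
     ((\<forall>\<^sub>F n in sequentially. AE \<omega> in M n. \<mu> n \<omega> \<in> moment_space I) \<longrightarrow>
        good_ldp (moment_topology I) P (\<lambda>n. \<beta> n / 2 * real n) (rate_function \<gamma> \<sigma>)) \<and>
     {\<nu> \<in> moment_space I. \<forall>\<nu>' \<in> moment_space I. rate_function \<gamma> \<sigma> \<nu> \<le> rate_function \<gamma> \<sigma> \<nu>'}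
       = {limit_law \<gamma> \<sigma>}"
proof -
  interpret jacobi_asymptotics \<gamma> \<sigma> M c s \<beta> p1 p2
  proof
    \<comment> \<open>The product form of \<sigma> < 1 / \<gamma> includes the case \<gamma> = 0,
      where the bound on \<sigma> is infinite.\<close>
    show "\<gamma> * \<sigma> < 1"
    proof (cases "\<gamma> = 0")
      case False
      then show ?thesis using assms(8) assms(11)[OF False] by (simp add: pos_less_divide_eq mult.commute)
    qed simp
  qed (use assms in auto)
  have \<mu>: "\<mu> = spec" by (simp add: \<mu>_def spec_def[abs_def])
  have P: "P = law" by (simp add: P_def law_def[abs_def] \<mu>)
  have speed: "(\<lambda>n. \<beta> n / 2 * real n) = speed" by (simp add: speed_def[abs_def])
  show ?thesis
    unfolding I_def \<mu> P speed good_ldp_def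
    using good_rate ldp_UNIV good_rate_interval ldp_interval minimizers_rate_function by blast
qed

end
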